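(* Let $1<\alpha\le 2$, let $T\ge 1$ and $N\ge 0$ be integers, and let $\vec{\xi}(j)=\{\xi_k(j)\}_{k=1}^{T}$ and $\vec{\eta}(j)=\{\eta_k(j)\}_{k=1}^{T}$, $j\in\mathbb Z$, be mutually independent vector-valued harmonizable symmetric $\alpha$-stable ($HS\alpha S$) sequences with absolutely continuous spectral measures and spectral densities $f(\theta)$ and $g(\theta)$ satisfying the minimality condition $$\int_{-\pi}^{\pi}\operatorname{Tr}\left[(f(\theta)+g(\theta))^{-1/(\alpha-1)}\right]d\theta<\infty .$$ Let $\vec a(0),\dots,\vec a(N)\in\mathbb C^T$, $A_N(e^{i\theta})=\sum_{j=0}^{N}\vec a(j)e^{ij\theta}$, and let $A_N\vec\xi=\sum_{j=0}^{N}(\vec a(j))^{\top}\vec\xi(j)$. Then the optimal linear estimate $\hat A_N\vec\xi$ of $A_N\vec\xi$ from observations of $\vec\xi(j)+\vec\eta(j)$ at the points $j\in\mathbb Z\setminus\{0,1,\dots,N\}$ is $$\hat A_N\vec\xi=\int_{-\pi}^{\pi}(h(\theta))^{\top}\left(d\vec Z^{\xi}(\theta)+d\vec Z^{\eta}(\theta)\right),$$ where the spectral characteristic $h(\theta)=\{h_k(\theta)\}_{k=1}^{T}$ is determined by the equation $$f(\theta)\left(A_N(e^{i\theta})-h(\theta)\right)^{<\alpha-1>}-g(\theta)\left(h(\theta)\right)^{<\alpha-1>}=\sum_{j=0}^{N}\vec c(j)e^{-ij\theta},$$ in which the unknown coefficients $\vec c(j)\in\mathbb C^T$, $j=0,\dots,N$,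 are determined from the system of equations $$\int_{-\pi}^{\pi}e^{-ik\theta}h(\theta)\,d\theta=0,\qquad k=0,1,\dots,N.$$ The error of the optimal estimate is $$\left\|A_N\vec\xi-\hat A_N\vec\xi\right\|_\alpha^\alpha=\int_{-\pi}^{\pi}\left(A_N(e^{i\theta})-h(\theta)\right)^{\top}f(\theta)\left(A_N(e^{i\theta})-h(\theta)\right)^{<\alpha-1>}d\theta+\int_{-\pi}^{\pi}(h(\theta))^{\top}g(\theta)(h(\theta))^{<\alpha-1>}d\theta,$$ and in the case $T=1$ this equals $\int_{-\pi}^{\pi}|A_N(e^{i\theta})-h(\theta)|^{\alpha}f(\theta)\,d\theta+\int_{-\pi}^{\pi}|h(\theta)|^{\alpha}g(\theta)\,d\theta$.
   Context: For complex $z$ and $\beta>0$, $z^{<\beta>}=|z|^{\beta-1}\bar z$ (and $0^{<\beta>}=0$); for vectors the operation is applied componentwise. A real random variable is symmetric $\alpha$-stable ($S\alpha S$) if its characteristic function is $\exp(-c|t|^\alpha)$ with $c\ge0$; random variables are jointly $S\alpha S$ if all real linear combinations of their (real and imaginary) components are $S\alpha S$. For jointly $S\alpha S$ complex variables $\xi=\xi_1+i\xi_2,\eta=\eta_1+i\eta_2$ with $1<\alpha\le2$, the covariation is $[\xi,\eta]_\alpha=\int_{S_4}(x_1+ix_2)(y_1+iy_2)^{<\alpha-1>}d\Gamma(x_1,x_2,y_1,y_2)$, where $\Gamma$ is the (symmetric) spectral measure on the unit sphere $S_4$ of $\mathbb R^4$ of the vector $(\xi_1,\xi_2,\eta_1,\eta_2)$,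 i.e. its characteristic function is $\exp\{-\int_{S_4}|\langle t,x\rangle|^\alpha d\Gamma(x)\}$. The norm is $\|\xi\|_\alpha=[\xi,\xi]_\alpha^{1/\alpha}$. A vector-valued $S\alpha S$ sequence $\vec\xi(n)$ (with $T$ components) is $HS\alpha S$ if $\vec\xi(n)=\int_{-\pi}^{\pi}e^{in\theta}d\vec Z^{\xi}(\theta)$, where $\vec Z^{\xi}$ is a vector-valued $S\alpha S$ process with independent increments and finite matrix-valued spectral measure $\mu$; the matrix-valued spectral measure corresponding to $\vec Z^\xi$ satisfies $\left[\int(\vec a)^{\top}d\vec Z^{\xi},\int(\vec b)^{\top}d\vec Z^{\xi}\right]_\alpha=\int(\vec a(\theta))^{\top}d\mu(\theta)(\vec b(\theta))^{<\alpha-1>}$ for vector functions with components in $L^\alpha(\mu)$ (for $T=1$, $\mu((s,t])=\|Z(t)-Z(s)\|_\alpha^\alpha$). If $d\mu(\theta)=f(\theta)d\theta$, $f$ is called the spectral density (matrix-valued when $T>1$; fractional powers are matrix powers). $H(\xi+\eta)$ is the $\|\cdot\|_\alpha$-closed linear span of all components of $\vec\xi(j)+\vec\eta(j)$, $j\in\mathbb Z$; it is isomorphic to the space $L^\alpha(f+g)$ via $e^{ij\theta}\delta_k\leftrightarrow \xi_k(j)+\eta_k(j)$, where $\delta_k$ is the $k$-th standard basis vector. $H^N(\xi+\eta)$ is the closed span of the components with $j\in\mathbb Z\setminus\{0,\dots,N\}$, corresponding to $L^\alpha_N(f+g)$, the closed subspace of $L^\alpha(f+g)$ generated by $e^{ij\theta}\delta_k$,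 $k=1,\dots,T$, $j\in\mathbb Z\setminus\{0,\dots,N\}$. The optimal linear estimate $\hat A_N\vec\xi$ is the element of $H^N(\xi+\eta)$ minimizing $\|A_N\vec\xi-\cdot\|_\alpha$, equivalently determined by $[\zeta,A_N\vec\xi-\hat A_N\vec\xi]_\alpha=0$ for all $\zeta\in H^N(\xi+\eta)$. The function $h\in L_N^\alpha(f+g)$ representing it is its spectral characteristic. *)

theory Defs
  imports "HOL-Probability.Probability"
begin

text \<open>Since \<^term>\<open>0 powr x = (0::real)\<close>, the value at \<open>0\<close> is \<open>0\<close> for every exponent.\<close>

definition spow :: "real \<Rightarrow> complex \<Rightarrow> complex" where
  "spow b z = of_real (norm z powr (b - 1)) * cnj z"

definition spow_vec :: "real \<Rightarrow> complex^'n \<Rightarrow> complex^'n" where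
  "spow_vec b v = (\<chi> k. spow b (v $ k))"

text \<open>The product of the transpose of \<open>v\<close> with \<open>w\<close>: bilinear, no conjugation.\<close>

definition tdot :: "complex^'n \<Rightarrow> complex^'n \<Rightarrow> complex" where
  "tdot v w = (\<Sum>k\<in>UNIV. v $ k * w $ k)"

definition conj_transpose :: "complex^'n^'n \<Rightarrow> complex^'n^'n" where
  "conj_transpose A = (\<chi> i j. cnj (A $ j $ i))"

definition diag_mat :: "('n \<Rightarrow> real) \<Rightarrow> complex^'n^'n" where
  "diag_mat d = (\<chi> i j. if i = j then of_real (d i) else 0)"

text \<open>\<open>B\<close> is the \<open>p\<close>-th power of the positive definite Hermitian matrix \<open>A\<close>. The eigenvalues
  are required to be positive, so a singular matrix has no power in this sense; without this
  requirement the convention \<^term>\<open>0 powr p = (0::real)\<close> would turn a negative power into a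
  pseudo-inverse.\<close>

definition has_matrix_powr :: "complex^'n^'n \<Rightarrow> real \<Rightarrow> complex^'n^'n \<Rightarrow> bool" where
  "has_matrix_powr A p B \<longleftrightarrow>
     (\<exists>U d. U ** conj_transpose U = mat 1 \<and> (\<forall>i. 0 < d i) \<and>
        A = U ** diag_mat d ** conj_transpose U \<and>
        B = U ** diag_mat (\<lambda>i. d i powr p) ** conj_transpose U)"

definition sas_rv :: "'a measure \<Rightarrow> real \<Rightarrow> ('a \<Rightarrow> real) \<Rightarrow> bool" where
  "sas_rv M \<alpha> X \<longleftrightarrow> X \<in> borel_measurable M \<and>
     (\<exists>c\<ge>0. \<forall>t. char (distr M borel X) t = of_real (exp (- c * \<bar>t\<bar> powr \<alpha>)))"

definition jointly_sas :: "'a measure \<Rightarrow> real \<Rightarrow> ('a \<Rightarrow> complex) set \<Rightarrow> bool" where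
  "jointly_sas M \<alpha> S \<longleftrightarrow>
     (\<forall>F u v. finite F \<longrightarrow> F \<subseteq> S \<longrightarrow>
        sas_rv M \<alpha> (\<lambda>\<omega>. \<Sum>X\<in>F. u X * Re (X \<omega>) + v X * Im (X \<omega>)))"

text \<open>The Euclidean space \<^typ>\<open>complex \<times> complex\<close> plays the role of four-dimensional real space,
  a point \<open>(x1 + i x2, y1 + i y2)\<close> standing for \<open>(x1, x2, y1, y2)\<close>; its inner product and its
  norm are the Euclidean ones.\<close>

definition is_spectral_measure ::
    "'a measure \<Rightarrow> real \<Rightarrow> ('a \<Rightarrow> complex) \<Rightarrow> ('a \<Rightarrow> complex) \<Rightarrow> (complex \<times> complex) measure \<Rightarrow> bool"
  where
  "is_spectral_measure M \<alpha> X Y \<Gamma> \<longleftrightarrow>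
     finite_measure \<Gamma> \<and> sets \<Gamma> = sets borel \<and> (AE x in \<Gamma>. x \<in> sphere 0 1) \<and>
     distr \<Gamma> borel uminus = \<Gamma> \<and>
     (\<forall>t. (LINT \<omega>|M. cis (t \<bullet> (X \<omega>, Y \<omega>)))
          = of_real (exp (- (LINT x|\<Gamma>. \<bar>t \<bullet> x\<bar> powr \<alpha>))))"

text \<open>For \<open>\<alpha> = 2\<close> the spectral measure is not unique, but the value of the covariation is.
  The relation below also asserts that a spectral measure of the pair exists.\<close>

definition has_covariation ::
    "'a measure \<Rightarrow> real \<Rightarrow> ('a \<Rightarrow> complex) \<Rightarrow> ('a \<Rightarrow> complex) \<Rightarrow> complex \<Rightarrow> bool" where
  "has_covariation M \<alpha> X Y c \<longleftrightarrow>
     X \<in> borel_measurable M \<and> Y \<in> borel_measurable M \<and>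
     (\<exists>\<Gamma>. is_spectral_measure M \<alpha> X Y \<Gamma> \<and> c = (LINT x|\<Gamma>. fst x * spow (\<alpha> - 1) (snd x)))"

definition covariation :: "'a measure \<Rightarrow> real \<Rightarrow> ('a \<Rightarrow> complex) \<Rightarrow> ('a \<Rightarrow> complex) \<Rightarrow> complex" where
  "covariation M \<alpha> X Y = (THE c. has_covariation M \<alpha> X Y c)"

definition sas_norm :: "'a measure \<Rightarrow> real \<Rightarrow> ('a \<Rightarrow> complex) \<Rightarrow> real" where
  "sas_norm M \<alpha> X = Re (covariation M \<alpha> X X) powr (1 / \<alpha>)"

text \<open>The first conjunct says that the norms in the second one are meaningful.\<close>

definition sas_tendsto ::
    "'a measure \<Rightarrow> real \<Rightarrow> (nat \<Rightarrow> 'a \<Rightarrow> complex) \<Rightarrow> ('a \<Rightarrow> complex) \<Rightarrow> bool" where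
  "sas_tendsto M \<alpha> Y X \<longleftrightarrow>
     (\<forall>n. \<exists>c. has_covariation M \<alpha> (\<lambda>\<omega>. Y n \<omega> - X \<omega>) (\<lambda>\<omega>. Y n \<omega> - X \<omega>) c) \<and>
     (\<lambda>n. sas_norm M \<alpha> (\<lambda>\<omega>. Y n \<omega> - X \<omega>)) \<longlonglongrightarrow> 0"

abbreviation circ :: "real measure" where
  "circ \<equiv> lebesgue_on {-pi..pi}"

definition wform :: "real \<Rightarrow> (real \<Rightarrow> complex^'n^'n) \<Rightarrow> (real \<Rightarrow> complex^'n) \<Rightarrow> (real \<Rightarrow> complex^'n)
    \<Rightarrow> real \<Rightarrow> complex" where
  "wform \<alpha> f a b \<theta> = tdot (a \<theta>) (f \<theta> *v spow_vec (\<alpha> - 1) (b \<theta>))"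

text \<open>The \<open>\<alpha>\<close>-th power of the norm of \<open>a\<close> is the integral of \<^term>\<open>wform \<alpha> f a a\<close>.\<close>

definition L_alpha :: "real \<Rightarrow> (real \<Rightarrow> complex^'n^'n) \<Rightarrow> (real \<Rightarrow> complex^'n) set" where
  "L_alpha \<alpha> f = {a \<in> borel_measurable circ. integrable circ (wform \<alpha> f a a)}"

definition L_alpha_tendsto ::
    "real \<Rightarrow> (real \<Rightarrow> complex^'n^'n) \<Rightarrow> (nat \<Rightarrow> real \<Rightarrow> complex^'n) \<Rightarrow> (real \<Rightarrow> complex^'n) \<Rightarrow> bool"
  where
  "L_alpha_tendsto \<alpha> f p a \<longleftrightarrow>
     (\<forall>n. (\<lambda>\<theta>. p n \<theta> - a \<theta>) \<in> L_alpha \<alpha> f) \<and>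
     (\<lambda>n. LINT \<theta>|circ. wform \<alpha> f (\<lambda>\<theta>. p n \<theta> - a \<theta>) (\<lambda>\<theta>. p n \<theta> - a \<theta>) \<theta>) \<longlonglongrightarrow> 0"

definition trig_span :: "nat \<Rightarrow> (real \<Rightarrow> complex^'n) set" where
  "trig_span N = {\<lambda>\<theta>. \<Sum>j\<in>F. cis (of_int j * \<theta>) *s v j | F v. finite F \<and> F \<subseteq> - {0..int N}}"

definition L_alpha_N :: "real \<Rightarrow> (real \<Rightarrow> complex^'n^'n) \<Rightarrow> nat \<Rightarrow> (real \<Rightarrow> complex^'n) set" where
  "L_alpha_N \<alpha> f N =
     {a \<in> L_alpha \<alpha> f. \<exists>p. (\<forall>n. p n \<in> trig_span N) \<and> L_alpha_tendsto \<alpha> f p a}"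

definition sas_process :: "'a measure \<Rightarrow> real \<Rightarrow> (real \<Rightarrow> 'a \<Rightarrow> complex^'n) \<Rightarrow> bool" where
  "sas_process M \<alpha> Z \<longleftrightarrow> jointly_sas M \<alpha> {\<lambda>\<omega>. Z t \<omega> $ k | t k. t \<in> {-pi..pi}}"

definition independent_increments :: "'a measure \<Rightarrow> (real \<Rightarrow> 'a \<Rightarrow> complex^'n) \<Rightarrow> bool" where
  "independent_increments M Z \<longleftrightarrow>
     (\<forall>(t :: nat \<Rightarrow> real) m. (\<forall>i\<le>m. t i \<in> {-pi..pi}) \<longrightarrow> strict_mono_on {..m} t \<longrightarrow>
        prob_space.indep_vars M (\<lambda>_. borel) (\<lambda>i \<omega>. Z (t (Suc i)) \<omega> - Z (t i) \<omega>) {..<m})"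

definition step_fun :: "nat \<Rightarrow> (nat \<Rightarrow> real) \<Rightarrow> (nat \<Rightarrow> complex^'n) \<Rightarrow> real \<Rightarrow> complex^'n" where
  "step_fun m t v \<theta> = (\<Sum>i<m. indicator {t i<..t (Suc i)} \<theta> *\<^sub>R v i)"

definition step_integral ::
    "(real \<Rightarrow> 'a \<Rightarrow> complex^'n) \<Rightarrow> nat \<Rightarrow> (nat \<Rightarrow> real) \<Rightarrow> (nat \<Rightarrow> complex^'n) \<Rightarrow> 'a \<Rightarrow> complex" where
  "step_integral Z m t v \<omega> = (\<Sum>i<m. tdot (v i) (Z (t (Suc i)) \<omega> - Z (t i) \<omega>))"

definition tendsto_prob :: "'a measure \<Rightarrow> (nat \<Rightarrow> 'a \<Rightarrow> complex) \<Rightarrow> ('a \<Rightarrow> complex) \<Rightarrow> bool" where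
  "tendsto_prob M Y X \<longleftrightarrow>
     (\<forall>e>0. (\<lambda>n. measure M {\<omega> \<in> space M. e \<le> norm (Y n \<omega> - X \<omega>)}) \<longlonglongrightarrow> 0)"

text \<open>\<open>X\<close> is a version of the integral of the transpose of \<open>a\<close> against \<open>dZ\<close>, where \<open>f\<close> is the
  density of the spectral measure of \<open>Z\<close>: the limit in probability of the integrals of step
  functions that converge to \<open>a\<close> in the space with weight \<open>f\<close>.\<close>

definition has_stoch_integral ::
    "'a measure \<Rightarrow> real \<Rightarrow> (real \<Rightarrow> complex^'n^'n) \<Rightarrow> (real \<Rightarrow> 'a \<Rightarrow> complex^'n) \<Rightarrow>
     (real \<Rightarrow> complex^'n) \<Rightarrow> ('a \<Rightarrow> complex) \<Rightarrow> bool" where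
  "has_stoch_integral M \<alpha> f Z a X \<longleftrightarrow>
     a \<in> L_alpha \<alpha> f \<and> X \<in> borel_measurable M \<and>
     (\<exists>m t v.
        (\<forall>n. (\<forall>i\<le>m n. t n i \<in> {-pi..pi}) \<and> mono_on {..m n} (t n)) \<and>
        L_alpha_tendsto \<alpha> f (\<lambda>n. step_fun (m n) (t n) (v n)) a \<and>
        tendsto_prob M (\<lambda>n. step_integral Z (m n) (t n) (v n)) X)"

text \<open>The spectral measure is \<open>f(\<theta>) d\<theta>\<close>, and integrability of \<open>f\<close> is its finiteness. That \<open>f\<close> is
  Hermitian and nonnegative almost everywhere is not assumed: it follows from the covariation
  identity.\<close>

definition has_spectral_density ::
    "'a measure \<Rightarrow> real \<Rightarrow> (real \<Rightarrow> 'a \<Rightarrow> complex^'n) \<Rightarrow> (real \<Rightarrow> complex^'n^'n) \<Rightarrow> bool" where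
  "has_spectral_density M \<alpha> Z f \<longleftrightarrow>
     integrable circ f \<and>
     (\<forall>a b I J. has_stoch_integral M \<alpha> f Z a I \<longrightarrow> has_stoch_integral M \<alpha> f Z b J \<longrightarrow>
        has_covariation M \<alpha> I J (LINT \<theta>|circ. wform \<alpha> f a b \<theta>))"

definition hsas_sequence ::
    "'a measure \<Rightarrow> real \<Rightarrow> (int \<Rightarrow> 'a \<Rightarrow> complex^'n) \<Rightarrow> (real \<Rightarrow> 'a \<Rightarrow> complex^'n) \<Rightarrow>
     (real \<Rightarrow> complex^'n^'n) \<Rightarrow> bool" where
  "hsas_sequence M \<alpha> \<xi> Z f \<longleftrightarrow>
     jointly_sas M \<alpha> {\<lambda>\<omega>. \<xi> j \<omega> $ k | j k. True} \<and>
     sas_process M \<alpha> Z \<and> independent_increments M Z \<and> has_spectral_density M \<alpha> Z f \<and>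
     (\<forall>j k. has_stoch_integral M \<alpha> f Z (\<lambda>\<theta>. cis (of_int j * \<theta>) *s axis k 1) (\<lambda>\<omega>. \<xi> j \<omega> $ k))"

definition independent_sequences ::
    "'a measure \<Rightarrow> (int \<Rightarrow> 'a \<Rightarrow> complex^'n) \<Rightarrow> (int \<Rightarrow> 'a \<Rightarrow> complex^'n) \<Rightarrow> bool" where
  "independent_sequences M \<xi> \<eta> \<longleftrightarrow>
     prob_space.indep_var M (PiM UNIV (\<lambda>_. borel)) (\<lambda>\<omega> j. \<xi> j \<omega>) (PiM UNIV (\<lambda>_. borel)) (\<lambda>\<omega> j. \<eta> j \<omega>)"

text \<open>Minimality of a matrix weight \<open>F\<close>; the matrix \<open>P(\<theta>)\<close> is the power of \<open>F(\<theta>)\<close> with exponent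
  \<open>-1/(\<alpha>-1)\<close>, which has to exist for almost every \<open>\<theta>\<close>.\<close>

definition minimality :: "real \<Rightarrow> (real \<Rightarrow> complex^'n^'n) \<Rightarrow> bool" where
  "minimality \<alpha> F \<longleftrightarrow>
     (\<exists>P. (AE \<theta> in circ. has_matrix_powr (F \<theta>) (- 1 / (\<alpha> - 1)) (P \<theta>)) \<and>
          integrable circ (\<lambda>\<theta>. trace (P \<theta>)))"

definition obs_space ::
    "'a measure \<Rightarrow> real \<Rightarrow> (int \<Rightarrow> 'a \<Rightarrow> complex^'n) \<Rightarrow> nat \<Rightarrow> ('a \<Rightarrow> complex) set" where
  "obs_space M \<alpha> \<zeta> N =
     {X. \<exists>Y. (\<forall>n. Y n \<in> {\<lambda>\<omega>. \<Sum>j\<in>F. tdot (v j) (\<zeta> j \<omega>) | F v. finite F \<and> F \<subseteq> - {0..int N}}) \<and>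
             sas_tendsto M \<alpha> Y X}"

definition optimal_estimate ::
    "'a measure \<Rightarrow> real \<Rightarrow> ('a \<Rightarrow> complex) set \<Rightarrow> ('a \<Rightarrow> complex) \<Rightarrow> ('a \<Rightarrow> complex) \<Rightarrow> bool" where
  "optimal_estimate M \<alpha> H X E \<longleftrightarrow>
     E \<in> H \<and> (\<forall>Y\<in>H. sas_norm M \<alpha> (\<lambda>\<omega>. X \<omega> - E \<omega>) \<le> sas_norm M \<alpha> (\<lambda>\<omega>. X \<omega> - Y \<omega>))"

definition A_fun :: "nat \<Rightarrow> (nat \<Rightarrow> complex^'n) \<Rightarrow> real \<Rightarrow> complex^'n" where
  "A_fun N a \<theta> = (\<Sum>j\<le>N. cis (real j * \<theta>) *s a j)"

definition A_func :: "nat \<Rightarrow> (nat \<Rightarrow> complex^'n) \<Rightarrow> (int \<Rightarrow> 'a \<Rightarrow> complex^'n) \<Rightarrow> 'a \<Rightarrow> complex" where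
  "A_func N a \<xi> \<omega> = (\<Sum>j\<le>N. tdot (a j) (\<xi> (int j) \<omega>))"

text \<open>\<open>has_bochner_integral\<close> also asserts that \<open>h\<close> is integrable.\<close>

definition interpolation_system ::
    "real \<Rightarrow> (real \<Rightarrow> complex^'n^'n) \<Rightarrow> (real \<Rightarrow> complex^'n^'n) \<Rightarrow> nat \<Rightarrow> (nat \<Rightarrow> complex^'n) \<Rightarrow>
     (real \<Rightarrow> complex^'n) \<Rightarrow> (nat \<Rightarrow> complex^'n) \<Rightarrow> bool" where
  "interpolation_system \<alpha> f g N a h c \<longleftrightarrow>
     (AE \<theta> in circ. f \<theta> *v spow_vec (\<alpha> - 1) (A_fun N a \<theta> - h \<theta>) - g \<theta> *v spow_vec (\<alpha> - 1) (h \<theta>)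
        = (\<Sum>j\<le>N. cis (- (real j * \<theta>)) *s c j)) \<and>
     (\<forall>k\<le>N. has_bochner_integral circ (\<lambda>\<theta>. cis (- (real k * \<theta>)) *s h \<theta>) 0)"

end

theory Submission
  imports Defs
begin

text \<open>The covariation identity, applied to increments over short intervals, shows that a spectral
  density is Hermitian and nonnegative if \<open>\<alpha> = 2\<close> and diagonal and nonnegative if \<open>\<alpha> < 2\<close>. In both cases
  the integral of \<open>a\<^sup>T f a\<close> with the signed power on the last factor is a uniformly convex functional
  of \<open>a\<close>, and integration against the process identifies it with the \<open>\<alpha>\<close>-th power of the norm.
  The minimality condition embeds \<open>L\<^sup>\<alpha>(f + g)\<close> continuously into \<open>L\<^sup>1\<close>, so that this space is complete
  and a minimizing sequence of trigonometric polynomials converges to a minimizer \<open>h\<close> of the error.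
  The first order condition at \<open>h\<close> says that \<open>f (A - h)\<^bsup><\<alpha>-1>\<^esup> - g h\<^bsup><\<alpha>-1>\<^esup>\<close> has no Fourier
  coefficients other than those in the equation for \<open>h\<close>, and strict convexity makes the solution of the
  system unique. On the probabilistic side, smallness of the norm and smallness in probability
  are equivalent, so every element of the observation space is the integral of some element of
  \<open>L\<^sup>\<alpha>\<^sub>N(f + g)\<close>.\<close>

section \<open>Forms of the covariation type\<close>

text \<open>Hoelder and Minkowski are replaced by one pointwise inequality, the supporting
  hyperplane of \<open>qform\<close>. It integrates to bounds with a free parameter \<tau> and
  yields a triangle inequality with factor 2, so the estimates on functions are made for
  \<open>energy\<close>, the \<alpha>-th power of the norm. Uniform convexity is stated as a small
  multiple of the data plus a constant times the midpoint gap, because this form is linear in the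
  matrix and survives integration. On the side of the variables the obstacle is the observation
  space: an element is only known to have a stable difference from each approximating combination,
  not to be jointly stable with the observations. Norms of such differences cannot be combined, so
  limits are taken in probability, where a triangle inequality is free. Going back requires a norm
  that depends on the distribution alone, whence the average of the logarithm of the characteristic
  function over rotations. Independence is given for the sequences but needed for limits of their
  combinations; a product formula for characteristic functions survives the limit and is enough to
  add spectral measures.\<close>

lemma spow_zero [simp]: "spow b 0 = 0"
  by (simp add: spow_def)

lemma norm_spow: "norm (spow b z) = norm z powr b"
proof (cases "z = 0")
  case False
  have "norm z powr (b - 1) * norm z = norm z powr b"
    using False by (simp add: powr_mult_base mult.commute)
  then show ?thesis by (simp add: spow_def norm_mult)
qed simp

lemma mult_spow: "z * spow (\<alpha> - 1) z = of_real (norm z powr \<alpha>)"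
proof (cases "z = 0")
  case False
  have "z * spow (\<alpha> - 1) z = of_real (norm z powr (\<alpha> - 2)) * (z * cnj z)"
    by (simp add: spow_def)
  also have "\<dots> = of_real (norm z powr (\<alpha> - 2) * (norm z)\<^sup>2)"
    by (simp only: of_real_mult complex_norm_square)
  also have "norm z powr (\<alpha> - 2) * (norm z)\<^sup>2 = norm z powr \<alpha>"
    using False by (simp add: powr_diff flip: powr_numeral)
  finally show ?thesis .
qed simp

lemma spow_mult: "spow b (z * w) = spow b z * spow b w"
  by (simp add: spow_def norm_mult powr_mult)

lemma mult_cnj_eq_norm: "z * cnj z = (of_real (norm z))\<^sup>2"
  by (metis complex_norm_square of_real_power)

lemma spow_1: "spow 1 z = cnj z"
  by (cases "z = 0") (simp_all add: spow_def)

lemma spow_one [simp]: "spow b 1 = 1"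
  by (simp add: spow_def)

lemma spow_measurable [measurable]: "spow b \<in> borel_measurable borel"
proof -
  have "cnj \<in> borel_measurable borel" by (intro borel_measurable_continuous_onI continuous_intros)
  then show ?thesis unfolding spow_def by measurable
qed

lemma continuous_spow:
  assumes "0 < b"
  shows "continuous_on UNIV (spow b)"
proof -
  have "isCont (spow b) z" for z
  proof (cases "z = 0")
    case True
    have "((\<lambda>z::complex. norm z powr b) \<longlongrightarrow> 0) (at 0)"
      using assms by (intro tendsto_zero_powrI[of _ _ _ b] tendsto_norm_zero tendsto_ident_at tendsto_const) auto
    then have "((\<lambda>z. norm (spow b z)) \<longlongrightarrow> 0) (at 0)"
      by (simp add: norm_spow)
    then show ?thesis
      using True by (simp add: isCont_def tendsto_norm_zero_iff)
  next
    case False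
    then show ?thesis
      unfolding spow_def by (intro continuous_intros) auto
  qed
  then show ?thesis by (simp add: continuous_on_eq_continuous_at)
qed

text \<open>Young's inequality gives the weak form \<open>B\<close>. Strictness comes from the
  square of the difference of \<open>x powr (\<alpha> / 2)\<close> and
  \<open>x powr (1 / 2)\<close>: it bounds \<open>x powr \<alpha>\<close> below through the
  intermediate exponent \<open>(\<alpha> + 1) / 2\<close>, to which the weak form applies.\<close>

lemma powr_strict_Bernoulli:
  fixes x :: real
  assumes "1 < \<alpha>" "0 \<le> x" "x \<noteq> 1"
  shows "1 + \<alpha> * (x - 1) < x powr \<alpha>"
proof (cases "x = 0")
  case True
  then show ?thesis using assms by simp
next
  case False
  then have x: "0 < x" using assms by simp
  have B: "1 + b * (x - 1) \<le> x powr b" if "1 < b" for b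
  proof -
    have "x * 1 \<le> x powr b / b + 1 powr (b / (b - 1)) / (b / (b - 1))"
      using that x by (intro Youngs_inequality) (auto simp: field_simps)
    then have "b * x \<le> b * (x powr b / b + (b - 1) / b)" using that by (intro mult_left_mono) auto
    also have "\<dots> = x powr b + (b - 1)" using that by (simp add: distrib_left)
    finally show ?thesis by (simp add: algebra_simps)
  qed
  have "x powr (\<alpha> / 2) \<noteq> x powr (1 / 2)"
    using assms x by (simp add: powr_inj)
  then have "0 < (x powr (\<alpha> / 2) - x powr (1 / 2))\<^sup>2" by simp
  also have "\<dots> = x powr \<alpha> + x - 2 * x powr ((\<alpha> + 1) / 2)"
    using x by (simp add: power2_eq_square algebra_simps add_divide_distrib flip: powr_add)
  finally have "2 * x powr ((\<alpha> + 1) / 2) - x < x powr \<alpha>" by simp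
  moreover have "1 + (\<alpha> + 1) / 2 * (x - 1) \<le> x powr ((\<alpha> + 1) / 2)"
    using assms by (intro B) auto
  ultimately show ?thesis by (simp add: field_simps)
qed

text \<open>The real gradient of \<open>norm v powr \<alpha>\<close> pairs with \<open>w\<close> as
  \<open>\<alpha> * Re (w * spow (\<alpha> - 1) v)\<close>, so this is strict convexity in the form
  of a supporting hyperplane. If the moduli differ, the Bernoulli inequality for their ratio
  \<open>x\<close> is strict; if they agree, strictness lies in the angle and comes from
  \<open>norm (u - v)\<close>.\<close>

lemma norm_powr_gradient_strict:
  fixes u v :: complex
  assumes "1 < \<alpha>" "u \<noteq> v"
  shows "norm v powr \<alpha> + \<alpha> * Re ((u - v) * spow (\<alpha> - 1) v) < norm u powr \<alpha>"
proof (cases "v = 0")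
  case True
  then show ?thesis using assms by simp
next
  case False
  define r where "r = Re (u * spow (\<alpha> - 1) v)"
  define x where "x = norm u / norm v"
  have eq: "Re ((u - v) * spow (\<alpha> - 1) v) = r - norm v powr \<alpha>"
    by (simp add: r_def left_diff_distrib mult_spow)
  have u: "norm u powr \<alpha> = x powr \<alpha> * norm v powr \<alpha>"
    using False by (simp add: x_def powr_divide)
  have n: "norm (u * spow (\<alpha> - 1) v) = x * norm v powr \<alpha>"
    using False by (simp add: norm_mult norm_spow x_def powr_diff)
  have r: "r \<le> x * norm v powr \<alpha>"
    unfolding r_def using complex_Re_le_cmod[of "u * spow (\<alpha> - 1) v"] n by simp
  have p: "0 < norm v powr \<alpha>" using False by simp
  show ?thesis
  proof (cases "x = 1")
    case True
    then have uv: "norm u = norm v" using False by (simp add: x_def)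
    have "0 < (norm (u - v))\<^sup>2" using assms by simp
    also have "(norm (u - v))\<^sup>2 = (norm u)\<^sup>2 + (norm v)\<^sup>2 - 2 * Re (u * cnj v)"
      unfolding cmod_power2 by (simp add: power2_eq_square algebra_simps)
    finally have "Re (u * cnj v) < (norm v)\<^sup>2" using uv by simp
    then have "norm v powr (\<alpha> - 2) * Re (u * cnj v) < norm v powr (\<alpha> - 2) * (norm v)\<^sup>2"
      using False by simp
    moreover have "r = norm v powr (\<alpha> - 2) * Re (u * cnj v)"
      by (simp add: r_def spow_def algebra_simps)
    moreover have "norm v powr (\<alpha> - 2) * (norm v)\<^sup>2 = norm v powr \<alpha>"
      using False by (simp add: powr_diff flip: powr_numeral)
    ultimately have "r < norm v powr \<alpha>" by simp
    then have "\<alpha> * (r - norm v powr \<alpha>) < 0" using assms by (simp add: mult_pos_neg)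
    then show ?thesis unfolding eq using uv by simp
  next
    case False
    have "1 + \<alpha> * (x - 1) < x powr \<alpha>"
      using assms False by (intro powr_strict_Bernoulli) (auto simp: x_def)
    then have "(1 + \<alpha> * (x - 1)) * norm v powr \<alpha> < x powr \<alpha> * norm v powr \<alpha>"
      using p by simp
    moreover have "\<alpha> * r \<le> \<alpha> * (x * norm v powr \<alpha>)" using r assms by simp
    ultimately show ?thesis unfolding eq u by (simp add: algebra_simps)
  qed
qed

lemma norm_powr_gradient:
  fixes u v :: complex
  assumes "1 < \<alpha>"
  shows "norm v powr \<alpha> + \<alpha> * Re ((u - v) * spow (\<alpha> - 1) v) \<le> norm u powr \<alpha>"
  using norm_powr_gradient_strict[OF assms, of u v] by (cases "u = v") auto

text \<open>The supporting hyperplane at the midpoint is compared with both ends; the two linear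
  terms cancel.\<close>

lemma norm_powr_midpoint_strict:
  fixes u v :: complex
  assumes "1 < \<alpha>" "u \<noteq> v"
  shows "norm ((u + v) / 2) powr \<alpha> < (norm u powr \<alpha> + norm v powr \<alpha>) / 2"
proof -
  let ?m = "(u + v) / 2"
  have "u \<noteq> ?m" "v \<noteq> ?m" using assms(2) by (auto simp: field_simps)
  from norm_powr_gradient_strict[OF assms(1) this(1)] norm_powr_gradient_strict[OF assms(1) this(2)]
  have "2 * norm ?m powr \<alpha> + \<alpha> * (Re ((u - ?m) * spow (\<alpha> - 1) ?m) + Re ((v - ?m) * spow (\<alpha> - 1) ?m))
      < norm u powr \<alpha> + norm v powr \<alpha>"
    by (simp only: distrib_left)
  moreover have "Re ((u - ?m) * spow (\<alpha> - 1) ?m) + Re ((v - ?m) * spow (\<alpha> - 1) ?m) = 0"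
  proof -
    have "(u - ?m) + (v - ?m) = 0" by (simp add: field_simps)
    then have "((u - ?m) + (v - ?m)) * spow (\<alpha> - 1) ?m = 0" by simp
    then show ?thesis by (metis distrib_right plus_complex.sel(1) zero_complex.sel(1))
  qed
  ultimately show ?thesis by simp
qed

text \<open>By strict convexity and compactness of the unit sphere.\<close>

lemma norm_powr_uniformly_convex:
  assumes "1 < \<alpha>" "0 < \<epsilon>"
  obtains C where "0 \<le> C"
    "\<And>u v :: complex. norm (u - v) powr \<alpha> \<le> \<epsilon> * (norm u powr \<alpha> + norm v powr \<alpha>)
       + C * ((norm u powr \<alpha> + norm v powr \<alpha>) / 2 - norm ((u + v) / 2) powr \<alpha>)"
proof -
  \<comment> \<open>All terms of the claim are homogeneous of degree \<alpha> in the pair, so it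
    suffices to argue on this level set. The subset \<open>S'\<close> is where the left side is not
    already covered by the \<epsilon> term.\<close>
  define S where "S = {p :: complex \<times> complex. norm (fst p) powr \<alpha> + norm (snd p) powr \<alpha> = 1}"
  define D where "D = (\<lambda>p :: complex \<times> complex. (norm (fst p) powr \<alpha> + norm (snd p) powr \<alpha>) / 2
     - norm ((fst p + snd p) / 2) powr \<alpha>)"
  define S' where "S' = {p \<in> S. \<epsilon> \<le> norm (fst p - snd p) powr \<alpha>}"
  have D0: "0 \<le> D p" for p
    using norm_powr_midpoint_strict[OF assms(1), of "fst p" "snd p"]
    by (cases "fst p = snd p") (auto simp: D_def)
  have cont: "continuous_on UNIV D" "continuous_on UNIV (\<lambda>p :: complex \<times> complex. norm (fst p - snd p) powr \<alpha>)"
    "continuous_on UNIV (\<lambda>p :: complex \<times> complex. norm (fst p) powr \<alpha> + norm (snd p) powr \<alpha>)"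
    unfolding D_def using assms(1) by (auto intro!: continuous_intros continuous_on_powr')
  have "closed S" unfolding S_def
    by (intro closed_Collect_eq cont continuous_on_const)
  then have cl: "closed S'" unfolding S'_def
    using closed_Collect_le[OF continuous_on_const cont(2), of \<epsilon>]
    by (simp add: Collect_conj_eq closed_Int)
  have "bounded S"
  proof -
    have "norm p \<le> 2" if "p \<in> S" for p
    proof -
      have "norm (fst p) powr \<alpha> \<le> 1" "norm (snd p) powr \<alpha> \<le> 1"
        using that powr_ge_zero[of "norm (fst p)" \<alpha>] powr_ge_zero[of "norm (snd p)" \<alpha>]
        unfolding S_def mem_Collect_eq by linarith+
      then have "norm (fst p) \<le> 1" "norm (snd p) \<le> 1"
        using assms(1) powr_less_mono2[of \<alpha> 1 "norm (fst p)"] powr_less_mono2[of \<alpha> 1 "norm (snd p)"]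
        by (auto simp: not_less[symmetric])
      then show ?thesis using norm_Pair_le[of "fst p" "snd p"] by simp
    qed
    then show ?thesis by (meson boundedI)
  qed
  then have comp: "compact S'"
    using cl by (intro compact_eq_bounded_closed[THEN iffD2] conjI bounded_subset[of S S']) (auto simp: S'_def)
  have bd: "norm (u - v) powr \<alpha> \<le> 2 powr \<alpha> * (norm u powr \<alpha> + norm v powr \<alpha>)" for u v :: complex
  proof -
    have "norm (u - v) \<le> 2 * max (norm u) (norm v)"
      using norm_triangle_ineq4[of u v] by simp
    then have "norm (u - v) powr \<alpha> \<le> (2 * max (norm u) (norm v)) powr \<alpha>"
      using assms by (intro powr_mono2) auto
    also have "\<dots> = 2 powr \<alpha> * max (norm u) (norm v) powr \<alpha>" by (simp add: powr_mult max_def)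
    also have "\<dots> \<le> 2 powr \<alpha> * (norm u powr \<alpha> + norm v powr \<alpha>)"
      by (intro mult_left_mono) (auto simp: max_def)
    finally show ?thesis .
  qed
  obtain m where m: "0 < m" "\<And>p. p \<in> S' \<Longrightarrow> m \<le> D p"
  proof (cases "S' = {}")
    case True
    then show ?thesis using that[of 1] by auto
  next
    case False
    obtain p where p: "p \<in> S'" "\<And>q. q \<in> S' \<Longrightarrow> D p \<le> D q"
      using continuous_attains_inf[OF comp False continuous_on_subset[OF cont(1) subset_UNIV]] by auto
    have "fst p \<noteq> snd p" using p(1) assms by (auto simp: S'_def)
    then have "0 < D p"
      using norm_powr_midpoint_strict[OF assms(1), of "fst p" "snd p"] by (simp add: D_def)
    then show ?thesis using p that by blast
  qed
  \<comment> \<open>On \<open>S'\<close> the gap \<open>D\<close> is at least \<open>m\<close>, and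
    the left side is at most \<open>2 powr \<alpha>\<close> on all of \<open>S\<close>;
    \<open>C\<close> is the ratio of these bounds.\<close>
  define C where "C = 2 powr \<alpha> / m"
  have C: "0 \<le> C" using m by (simp add: C_def)
  have unit: "norm (fst p - snd p) powr \<alpha> \<le> \<epsilon> + C * D p" if "p \<in> S" for p
  proof (cases "p \<in> S'")
    case True
    have "norm (fst p - snd p) powr \<alpha> \<le> 2 powr \<alpha>"
      using bd[of "fst p" "snd p"] that by (simp add: S_def)
    also have "\<dots> = C * m" using m by (simp add: C_def)
    also have "\<dots> \<le> C * D p" using m(2)[OF True] C by (intro mult_left_mono)
    finally show ?thesis using assms by simp
  next
    case False
    then show ?thesis using that C D0[of p] by (auto simp: S'_def add_increasing2)
  qed
  have "norm (u - v) powr \<alpha> \<le> \<epsilon> * (norm u powr \<alpha> + norm v powr \<alpha>)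
       + C * ((norm u powr \<alpha> + norm v powr \<alpha>) / 2 - norm ((u + v) / 2) powr \<alpha>)" for u v :: complex
  proof (cases "u = 0 \<and> v = 0")
    case False
    define s where "s = norm u powr \<alpha> + norm v powr \<alpha>"
    have s: "0 < s" using False by (auto simp: s_def add_pos_nonneg add_nonneg_pos)
    define t where "t = s powr (- (1 / \<alpha>))"
    have "t powr \<alpha> = s powr (-1)" using assms(1) by (simp only: t_def powr_powr) simp
    then have t: "0 < t" "t powr \<alpha> = 1 / s" using s by (auto simp: t_def powr_minus_divide)
    have sc: "norm (of_real t * z) powr \<alpha> = norm z powr \<alpha> / s" for z :: complex
      using t by (simp add: norm_mult powr_mult)
    have "(of_real t * u, of_real t * v) \<in> S"
      using s unfolding S_def by (simp add: sc s_def[symmetric] flip: add_divide_distrib)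
    from unit[OF this]
    have "norm (of_real t * (u - v)) powr \<alpha> \<le> \<epsilon> + C * (1 / 2 - norm (of_real t * ((u + v) / 2)) powr \<alpha>)"
      using s by (simp add: D_def sc s_def[symmetric] right_diff_distrib distrib_left flip: add_divide_distrib)
    then have "norm (u - v) powr \<alpha> / s \<le> \<epsilon> + C * (1 / 2 - norm ((u + v) / 2) powr \<alpha> / s)"
      by (simp only: sc)
    then have "norm (u - v) powr \<alpha> / s * s \<le> (\<epsilon> + C * (1 / 2 - norm ((u + v) / 2) powr \<alpha> / s)) * s"
      using s by (intro mult_right_mono) auto
    then show ?thesis using s by (simp add: s_def[symmetric] algebra_simps)
  qed simp
  then show ?thesis using that C by blast
qed


section \<open>The form of a single matrix and its convexity\<close>

definition bform :: "real \<Rightarrow> complex^'n^'n \<Rightarrow> complex^'n \<Rightarrow> complex^'n \<Rightarrow> complex" where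
  "bform \<alpha> A u v = tdot u (A *v spow_vec (\<alpha> - 1) v)"

definition qform :: "real \<Rightarrow> complex^'n^'n \<Rightarrow> complex^'n \<Rightarrow> real" where
  "qform \<alpha> A v = Re (bform \<alpha> A v v)"

text \<open>The structure that the covariation identity forces on a matrix spectral density: for
  \<open>\<alpha> < 2\<close> nothing but a diagonal matrix is compatible with it.\<close>

definition covariation_matrix :: "real \<Rightarrow> complex^'n^'n \<Rightarrow> bool" where
  "covariation_matrix \<alpha> A \<longleftrightarrow> (\<forall>v. bform \<alpha> A v v \<in> \<real>\<^sub>\<ge>\<^sub>0) \<and>
     (\<alpha> \<noteq> 2 \<longrightarrow> (\<forall>i j. i \<noteq> j \<longrightarrow> A $ i $ j = 0))"

lemma wform_eq_bform: "wform \<alpha> f a b \<theta> = bform \<alpha> (f \<theta>) (a \<theta>) (b \<theta>)"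
  by (simp add: wform_def bform_def)

lemma bform_eq_sum:
  "bform \<alpha> A u v = (\<Sum>i\<in>UNIV. \<Sum>j\<in>UNIV. u $ i * A $ i $ j * spow (\<alpha> - 1) (v $ j))"
  by (simp add: bform_def tdot_def matrix_vector_mult_def spow_vec_def sum_distrib_left mult.assoc)

lemma bform_add_left: "bform \<alpha> A (u + w) v = bform \<alpha> A u v + bform \<alpha> A w v"
  by (simp add: bform_eq_sum distrib_right sum.distrib)

lemma bform_diff_left: "bform \<alpha> A (u - w) v = bform \<alpha> A u v - bform \<alpha> A w v"
  by (simp add: bform_eq_sum left_diff_distrib sum_subtractf)

lemma bform_scale_left: "bform \<alpha> A (z *s u) v = z * bform \<alpha> A u v"
  by (simp add: bform_eq_sum sum_distrib_left mult.assoc)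

lemma bform_scale_right: "bform \<alpha> A u (z *s v) = spow (\<alpha> - 1) z * bform \<alpha> A u v"
  by (simp add: bform_eq_sum sum_distrib_left spow_mult mult_ac)

lemma bform_add_matrix: "bform \<alpha> (A + B) u v = bform \<alpha> A u v + bform \<alpha> B u v"
  by (simp add: bform_eq_sum algebra_simps sum.distrib)

lemma bform_zero_left [simp]: "bform \<alpha> A 0 v = 0" and bform_zero_right [simp]: "bform \<alpha> A u 0 = 0"
  by (simp_all add: bform_eq_sum)

lemma qform_zero [simp]: "qform \<alpha> A 0 = 0"
  by (simp add: qform_def)

lemma qform_scale: "qform \<alpha> A (z *s v) = norm z powr \<alpha> * qform \<alpha> A v"
proof -
  have "bform \<alpha> A (z *s v) (z *s v) = (z * spow (\<alpha> - 1) z) * bform \<alpha> A v v"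
    by (simp add: bform_scale_left bform_scale_right)
  then show ?thesis by (simp add: qform_def mult_spow)
qed

lemma qform_uminus: "qform \<alpha> A (- v) = qform \<alpha> A v"
proof -
  have "(-1) *s v = - v" by (simp add: vec_eq_iff)
  then show ?thesis using qform_scale[of \<alpha> A "-1" v] by simp
qed

lemma qform_half: "qform \<alpha> A ((1/2) *s v) = qform \<alpha> A v / 2 powr \<alpha>"
  by (subst qform_scale) (simp add: norm_divide powr_divide)

lemma qform_minus_commute: "qform \<alpha> A (u - v) = qform \<alpha> A (v - u)"
  using qform_uminus[of \<alpha> A "u - v"] by simp

lemma qform_add_matrix: "qform \<alpha> (A + B) v = qform \<alpha> A v + qform \<alpha> B v"
  by (simp add: qform_def bform_add_matrix)

lemma bform_axis [simp]: "bform \<alpha> A (axis k 1) (axis l 1) = A $ k $ l"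
proof -
  have s: "spow (\<alpha> - 1) (axis l 1 $ j) = (if j = l then 1 else 0)" for j
    by (simp add: axis_def)
  have "bform \<alpha> A (axis k 1) (axis l 1)
      = (\<Sum>i\<in>UNIV. if i = k then \<Sum>j\<in>UNIV. if j = l then A $ i $ j else 0 else 0)"
    unfolding bform_eq_sum by (intro sum.cong refl) (simp add: s, simp add: axis_def if_distrib[of "(*) _"] cong: if_cong)
  then show ?thesis by simp
qed

lemma continuous_bform:
  assumes "1 < \<alpha>"
  shows "continuous_on UNIV (\<lambda>p. bform \<alpha> A (fst p) (snd p))"
  unfolding bform_eq_sum
  by (intro continuous_intros continuous_on_compose2[OF continuous_spow]) (use assms in auto)

context
  fixes \<alpha> :: real and A :: "complex^'n^'n"
  assumes \<alpha>: "1 < \<alpha>" "\<alpha> \<le> 2" and A: "covariation_matrix \<alpha> A"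
begin

lemma bform_self: "bform \<alpha> A v v = of_real (qform \<alpha> A v)"
  and qform_nonneg: "0 \<le> qform \<alpha> A v"
proof -
  have "bform \<alpha> A v v \<in> \<real>\<^sub>\<ge>\<^sub>0" using A by (simp add: covariation_matrix_def)
  then show "bform \<alpha> A v v = of_real (qform \<alpha> A v)" "0 \<le> qform \<alpha> A v"
    by (auto simp: qform_def nonneg_Reals_def)
qed

lemma covariation_matrix_diag: "A $ k $ k = of_real (Re (A $ k $ k))" "0 \<le> Re (A $ k $ k)"
  using bform_self[of "axis k 1"] qform_nonneg[of "axis k 1"] by (auto simp: qform_def)

lemma bform_diag:
  assumes "\<alpha> \<noteq> 2"
  shows "bform \<alpha> A u v = (\<Sum>k\<in>UNIV. of_real (Re (A $ k $ k)) * (u $ k * spow (\<alpha> - 1) (v $ k)))"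
proof -
  have "(\<Sum>j\<in>UNIV. u $ i * A $ i $ j * spow (\<alpha> - 1) (v $ j)) = A $ i $ i * (u $ i * spow (\<alpha> - 1) (v $ i))" for i
  proof -
    have "(\<Sum>j\<in>UNIV. u $ i * A $ i $ j * spow (\<alpha> - 1) (v $ j))
        = (\<Sum>j\<in>{i}. u $ i * A $ i $ j * spow (\<alpha> - 1) (v $ j))"
      using A assms by (intro sum.mono_neutral_right) (auto simp: covariation_matrix_def)
    then show ?thesis by simp
  qed
  then show ?thesis
    unfolding bform_eq_sum using covariation_matrix_diag(1) by simp
qed

lemma qform_diag:
  assumes "\<alpha> \<noteq> 2"
  shows "qform \<alpha> A v = (\<Sum>k\<in>UNIV. Re (A $ k $ k) * norm (v $ k) powr \<alpha>)"
  unfolding qform_def bform_diag[OF assms] mult_spow by simp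

lemma bform_2_add_right:
  assumes "\<alpha> = 2"
  shows "bform \<alpha> A u (v + w) = bform \<alpha> A u v + bform \<alpha> A u w"
  using assms by (simp add: bform_eq_sum spow_1 distrib_left sum.distrib)

text \<open>For \<alpha> = 2 the form is sesquilinear. Being real on the diagonal, it has a
  symmetric real part, as its value at \<open>u + \<i> *s v\<close> shows. This is how the Hermitian
  property follows from \<open>covariation_matrix\<close>.\<close>

lemma Re_bform_2_commute:
  assumes "\<alpha> = 2"
  shows "Re (bform \<alpha> A u v) = Re (bform \<alpha> A v u)"
proof -
  have i: "bform \<alpha> A w (\<i> *s v) = - \<i> * bform \<alpha> A w v" for w
    using assms by (simp add: bform_scale_right spow_1)
  have "bform \<alpha> A (u + \<i> *s v) (u + \<i> *s v)
      = bform \<alpha> A u u + bform \<alpha> A v v + \<i> * (bform \<alpha> A v u - bform \<alpha> A u v)"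
    by (simp add: bform_2_add_right[OF assms] bform_add_left bform_scale_left i algebra_simps)
  then have "Im (\<i> * (bform \<alpha> A v u - bform \<alpha> A u v)) = 0"
    by (simp only: bform_self plus_complex.sel Im_complex_of_real) (metis Im_complex_of_real add.left_neutral bform_self plus_complex.sel(2))
  then show ?thesis by simp
qed

lemma qform_2_add:
  assumes "\<alpha> = 2"
  shows "qform \<alpha> A (u + v) = qform \<alpha> A u + qform \<alpha> A v + 2 * Re (bform \<alpha> A u v)"
  unfolding qform_def
  by (simp add: bform_2_add_right[OF assms] bform_add_left Re_bform_2_commute[OF assms, of v u])

text \<open>For \<alpha> = 2 the gap between the two sides is
  \<open>qform \<alpha> A (u - v)\<close>; for \<alpha> < 2 the matrix is diagonal and the scalar
  inequality is summed with nonnegative weights. The bound on \<open>bform\<close>, the midpoint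
  inequality and the triangle inequality below all come from it.\<close>

lemma qform_gradient: "qform \<alpha> A v + \<alpha> * Re (bform \<alpha> A (u - v) v) \<le> qform \<alpha> A u"
proof (cases "\<alpha> = 2")
  case True
  have "qform \<alpha> A u = qform \<alpha> A (u - v) + qform \<alpha> A v + 2 * Re (bform \<alpha> A (u - v) v)"
    using qform_2_add[OF True, of "u - v" v] by simp
  then show ?thesis using qform_nonneg[of "u - v"] True by simp
next
  case False
  have "Re (A $ k $ k) * (norm (v $ k) powr \<alpha> + \<alpha> * Re ((u $ k - v $ k) * spow (\<alpha> - 1) (v $ k)))
      \<le> Re (A $ k $ k) * norm (u $ k) powr \<alpha>" for k
    using norm_powr_gradient[OF \<alpha>(1)] covariation_matrix_diag(2) by (intro mult_left_mono) auto
  then have "(\<Sum>k\<in>UNIV. Re (A $ k $ k) * (norm (v $ k) powr \<alpha> + \<alpha> * Re ((u $ k - v $ k) * spow (\<alpha> - 1) (v $ k))))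
     \<le> (\<Sum>k\<in>UNIV. Re (A $ k $ k) * norm (u $ k) powr \<alpha>)"
    by (rule sum_mono)
  then show ?thesis
    unfolding qform_diag[OF False] bform_diag[OF False]
    by (simp add: distrib_left right_diff_distrib sum.distrib sum_distrib_left mult.left_commute flip: sum.distrib)
qed

text \<open>A Young inequality obtained from convexity: the phase \<open>z\<close> rotates
  \<open>u\<close> so that the form becomes positive, and the gradient inequality bounds it. The
  condition \<alpha> \<le> 2 brings the factor \<open>\<alpha> - 1\<close> below 1.\<close>

lemma norm_bform_le: "norm (bform \<alpha> A u v) \<le> qform \<alpha> A u + qform \<alpha> A v"
proof (cases "bform \<alpha> A u v = 0")
  case True
  then show ?thesis by (simp add: qform_nonneg)
next
  case False
  define z where "z = cnj (bform \<alpha> A u v) / norm (bform \<alpha> A u v)"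
  have z: "norm z = 1" using False by (simp add: z_def norm_divide)
  have "z * bform \<alpha> A u v = of_real (norm (bform \<alpha> A u v))"
    using False by (simp add: z_def complex_norm_square[symmetric] mult.commute power2_eq_square)
  then have "bform \<alpha> A (z *s u - v) v = of_real (norm (bform \<alpha> A u v) - qform \<alpha> A v)"
    by (simp add: bform_diff_left bform_scale_left bform_self)
  then have "qform \<alpha> A v + \<alpha> * (norm (bform \<alpha> A u v) - qform \<alpha> A v) \<le> qform \<alpha> A u"
    using qform_gradient[of v "z *s u"] z by (simp add: qform_scale)
  then have "\<alpha> * norm (bform \<alpha> A u v) \<le> qform \<alpha> A u + (\<alpha> - 1) * qform \<alpha> A v"
    by (simp add: algebra_simps)
  also have "\<dots> \<le> qform \<alpha> A u + qform \<alpha> A v"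
    using \<alpha> qform_nonneg[of v] mult_right_mono[of "\<alpha> - 1" 1 "qform \<alpha> A v"] by simp
  finally show ?thesis
    using \<alpha> mult_right_mono[of 1 \<alpha> "norm (bform \<alpha> A u v)"] by simp
qed

text \<open>The form is linear in \<open>u\<close> while \<open>qform\<close> has degree \<alpha>,
  so replacing \<open>u\<close> by a multiple trades one term against the other. Continuity
  arguments take \<tau> small: the second term is then harmless and the first one carries a quantity
  that tends to 0.\<close>

lemma norm_bform_le_scaled:
  assumes "0 < \<tau>"
  shows "norm (bform \<alpha> A u v) \<le> \<tau> powr (1 - \<alpha>) * qform \<alpha> A u + \<tau> * qform \<alpha> A v"
proof -
  have "norm (bform \<alpha> A (of_real (1 / \<tau>) *s u) v) \<le> (1 / \<tau>) powr \<alpha> * qform \<alpha> A u + qform \<alpha> A v"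
    using norm_bform_le[of "of_real (1 / \<tau>) *s u" v] assms by (simp add: qform_scale norm_divide)
  then have "\<tau> * norm (bform \<alpha> A (of_real (1 / \<tau>) *s u) v)
      \<le> \<tau> * ((1 / \<tau>) powr \<alpha> * qform \<alpha> A u + qform \<alpha> A v)"
    using assms by (intro mult_left_mono) auto
  moreover have "\<tau> * norm (bform \<alpha> A (of_real (1 / \<tau>) *s u) v) = norm (bform \<alpha> A u v)"
    using assms by (simp add: bform_scale_left norm_mult norm_divide)
  moreover have "\<tau> * (1 / \<tau>) powr \<alpha> = \<tau> powr (1 - \<alpha>)"
    using assms by (simp add: powr_divide powr_diff)
  ultimately show ?thesis by (simp add: distrib_left mult.assoc[symmetric])
qed

lemma qform_midpoint: "qform \<alpha> A ((1/2) *s (u + v)) \<le> (qform \<alpha> A u + qform \<alpha> A v) / 2"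
proof -
  define m where "m = (1/2) *s (u + v)"
  have "u - m = (1/2) *s (u - v)" "v - m = (-1/2) *s (u - v)"
    by (simp_all add: m_def vec_eq_iff field_simps)
  then have "qform \<alpha> A m + \<alpha> / 2 * Re (bform \<alpha> A (u - v) m) \<le> qform \<alpha> A u"
    "qform \<alpha> A m - \<alpha> / 2 * Re (bform \<alpha> A (u - v) m) \<le> qform \<alpha> A v"
    using qform_gradient[of m u] qform_gradient[of m v] by (simp_all only: bform_scale_left) simp_all
  then show ?thesis unfolding m_def[symmetric] by simp
qed

text \<open>Midpoint convexity and homogeneity give the constant \<open>2 powr \<alpha> / 2\<close>,
  which is at most 2 because \<alpha> \<le> 2.\<close>

lemma qform_add_le: "qform \<alpha> A (u + v) \<le> 2 * (qform \<alpha> A u + qform \<alpha> A v)"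
proof -
  have "qform \<alpha> A (u + v) = 2 powr \<alpha> * qform \<alpha> A ((1/2) *s (u + v))"
    by (subst qform_half) simp
  also have "\<dots> \<le> 2 powr \<alpha> * ((qform \<alpha> A u + qform \<alpha> A v) / 2)"
    by (intro mult_left_mono qform_midpoint) auto
  also have "\<dots> \<le> 2 powr 2 * ((qform \<alpha> A u + qform \<alpha> A v) / 2)"
    using \<alpha> qform_nonneg by (intro mult_right_mono powr_mono) auto
  finally show ?thesis by (simp add: powr_numeral)
qed

end

lemma covariation_matrix_add:
  assumes "covariation_matrix \<alpha> A" "covariation_matrix \<alpha> B"
  shows "covariation_matrix \<alpha> (A + B)"
  using assms by (auto simp: covariation_matrix_def bform_add_matrix)

text \<open>\<open>C\<close> depends on \<alpha> and \<epsilon> but not on the matrix, so the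
  inequality can be integrated over a varying weight. For \<alpha> = 2 it is the parallelogram law
  with \<open>C = 4\<close>; otherwise the scalar inequality is summed along the diagonal.\<close>

lemma qform_uniformly_convex:
  assumes "1 < \<alpha>" "\<alpha> \<le> 2" "0 < \<epsilon>"
  obtains C where "0 \<le> C"
    "\<And>(A :: complex^'n^'n) u v. covariation_matrix \<alpha> A \<Longrightarrow>
       qform \<alpha> A (u - v) \<le> \<epsilon> * (qform \<alpha> A u + qform \<alpha> A v)
         + C * ((qform \<alpha> A u + qform \<alpha> A v) / 2 - qform \<alpha> A ((1/2) *s (u + v)))"
proof (cases "\<alpha> = 2")
  case True
  have "qform \<alpha> A (u - v) \<le> \<epsilon> * (qform \<alpha> A u + qform \<alpha> A v)
         + 4 * ((qform \<alpha> A u + qform \<alpha> A v) / 2 - qform \<alpha> A ((1/2) *s (u + v)))"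
    if A: "covariation_matrix \<alpha> A" for A :: "complex^'n^'n" and u v
  proof -
    note [simp] = qform_nonneg[OF assms(1,2) A]
    have "bform \<alpha> A u (- v) = - bform \<alpha> A u v"
      using True by (simp add: bform_eq_sum spow_1 sum_negf)
    then have "qform \<alpha> A (u - v) = qform \<alpha> A u + qform \<alpha> A v - 2 * Re (bform \<alpha> A u v)"
      using qform_2_add[OF assms(1,2) A True, of u "- v"] by (simp add: qform_uminus)
    moreover have "4 * qform \<alpha> A ((1/2) *s (u + v)) = qform \<alpha> A u + qform \<alpha> A v + 2 * Re (bform \<alpha> A u v)"
      using qform_2_add[OF assms(1,2) A True, of u v] True by (subst qform_half) simp
    moreover have "0 \<le> \<epsilon> * (qform \<alpha> A u + qform \<alpha> A v)" using assms by simp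
    ultimately show ?thesis by argo
  qed
  then show ?thesis using that[of 4] by simp
next
  case False
  obtain C where C: "0 \<le> C"
    "\<And>u v :: complex. norm (u - v) powr \<alpha> \<le> \<epsilon> * (norm u powr \<alpha> + norm v powr \<alpha>)
       + C * ((norm u powr \<alpha> + norm v powr \<alpha>) / 2 - norm ((u + v) / 2) powr \<alpha>)"
    using norm_powr_uniformly_convex[OF assms(1,3)] by blast
  have "qform \<alpha> A (u - v) \<le> \<epsilon> * (qform \<alpha> A u + qform \<alpha> A v)
         + C * ((qform \<alpha> A u + qform \<alpha> A v) / 2 - qform \<alpha> A ((1/2) *s (u + v)))"
    if A: "covariation_matrix \<alpha> A" for A :: "complex^'n^'n" and u v
  proof -
    let ?a = "\<lambda>k. Re (A $ k $ k)"
    have "(\<Sum>k\<in>UNIV. ?a k * norm (u $ k - v $ k) powr \<alpha>)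
        \<le> (\<Sum>k\<in>UNIV. ?a k * (\<epsilon> * (norm (u $ k) powr \<alpha> + norm (v $ k) powr \<alpha>)
           + C * ((norm (u $ k) powr \<alpha> + norm (v $ k) powr \<alpha>) / 2 - norm ((u $ k + v $ k) / 2) powr \<alpha>)))"
      using C covariation_matrix_diag(2)[OF assms(1,2) A] by (intro sum_mono mult_left_mono) auto
    also have "\<dots> = \<epsilon> * (qform \<alpha> A u + qform \<alpha> A v)
         + C * ((qform \<alpha> A u + qform \<alpha> A v) / 2 - qform \<alpha> A ((1/2) *s (u + v)))"
      unfolding qform_diag[OF assms(1,2) A False]
      by (simp add: algebra_simps sum.distrib sum_subtractf sum_distrib_left sum_distrib_right sum_divide_distrib add_divide_distrib)
    finally show ?thesis unfolding qform_diag[OF assms(1,2) A False] by simp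
  qed
  then show ?thesis using that C(1) by blast
qed


section \<open>Eigenvalues and the lower bound for the form\<close>

lemma trace_conjugate:
  fixes U A :: "complex^'n^'n"
  assumes "U ** conj_transpose U = mat 1"
  shows "trace (U ** A ** conj_transpose U) = trace A"
proof -
  have "trace (U ** A ** conj_transpose U) = trace (conj_transpose U ** (U ** A))"
    by (rule trace_mul_sym)
  also have "\<dots> = trace A"
    using assms matrix_left_right_inverse[of U "conj_transpose U"] by (simp add: matrix_mul_assoc)
  finally show ?thesis .
qed

text \<open>Diagonalization: the inner sums are the entries of the row vector \<open>x\<close> times
  \<open>U\<close>. For \<alpha> = 2 the left side is the value of the form at \<open>x\<close>,
  since the signed power is then conjugation.\<close>

lemma tdot_hermitian_square:
  fixes U :: "complex^'b^'b"
  shows "tdot x ((U ** diag_mat d ** conj_transpose U) *v (\<chi> j. cnj (x $ j)))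
     = of_real (\<Sum>i\<in>UNIV. d i * (norm (\<Sum>k\<in>UNIV. x $ k * U $ k $ i))\<^sup>2)"
proof -
  have D: "((diag_mat d :: complex^'b^'b) *v y) $ i = of_real (d i) * y $ i" for y :: "complex^'b" and i
    by (simp add: diag_mat_def matrix_vector_mult_def if_distrib if_distribR cong: if_cong)
  define y where "y = conj_transpose U *v (\<chi> j. cnj (x $ j))"
  have y: "y $ i = cnj (\<Sum>k\<in>UNIV. x $ k * U $ k $ i)" for i
    by (simp add: y_def matrix_vector_mult_def conj_transpose_def mult.commute)
  have "tdot x ((U ** diag_mat d ** conj_transpose U) *v (\<chi> j. cnj (x $ j)))
      = tdot x (U *v (diag_mat d *v y))"
    by (simp add: y_def matrix_vector_mul_assoc matrix_mul_assoc)
  also have "\<dots> = (\<Sum>k\<in>UNIV. \<Sum>i\<in>UNIV. of_real (d i) * (x $ k * U $ k $ i * y $ i))"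
    unfolding tdot_def by (simp add: matrix_vector_mult_def[of U] D sum_distrib_left mult_ac)
  also have "\<dots> = (\<Sum>i\<in>UNIV. of_real (d i) * ((\<Sum>k\<in>UNIV. x $ k * U $ k $ i) * y $ i))"
    by (subst sum.swap) (simp add: sum_distrib_left sum_distrib_right)
  also have "\<dots> = of_real (\<Sum>i\<in>UNIV. d i * (norm (\<Sum>k\<in>UNIV. x $ k * U $ k $ i))\<^sup>2)"
    by (simp only: y mult_cnj_eq_norm) simp
  finally show ?thesis .
qed

text \<open>The preceding identity with all eigenvalues equal to 1.\<close>

lemma sum_norm_square_unitary:
  fixes U :: "complex^'n^'n"
  assumes U: "U ** conj_transpose U = mat 1"
  shows "(\<Sum>i\<in>UNIV. (norm (\<Sum>k\<in>UNIV. x $ k * U $ k $ i))\<^sup>2) = (\<Sum>k\<in>UNIV. (norm (x $ k))\<^sup>2)"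
proof -
  have d1: "diag_mat (\<lambda>_. 1) = (mat 1 :: complex^'n^'n)"
    by (simp add: diag_mat_def mat_def vec_eq_iff)
  have "complex_of_real (\<Sum>i\<in>UNIV. 1 * (norm (\<Sum>k\<in>UNIV. x $ k * U $ k $ i))\<^sup>2)
      = tdot x (\<chi> j. cnj (x $ j))"
    unfolding tdot_hermitian_square[symmetric] d1 by (simp add: U)
  also have "\<dots> = of_real (\<Sum>k\<in>UNIV. (norm (x $ k))\<^sup>2)"
    by (simp add: tdot_def mult_cnj_eq_norm)
  finally show ?thesis by (simp only: of_real_eq_iff mult_1)
qed

text \<open>The lower bound behind the continuous embedding of the weighted space into \<open>L\<^sup>1\<close>. It is
  Young's inequality, with the smallest eigenvalue \<open>l\<close> of \<open>A\<close> bounded below by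
  \<open>l\<^bsup>-1/(\<alpha>-1)\<^esup> \<le> Re (trace P)\<close>.\<close>

lemma norm_le_qform_trace:
  fixes A P :: "complex^'n^'n"
  assumes \<alpha>: "1 < \<alpha>" "\<alpha> \<le> 2" and A: "covariation_matrix \<alpha> A"
    and P: "has_matrix_powr A (- 1 / (\<alpha> - 1)) P" and \<tau>: "0 < \<tau>"
  shows "norm v \<le> CARD('n) * (qform \<alpha> A v / \<tau> + \<tau> powr (1 / (\<alpha> - 1)) * Re (trace P))"
proof -
  obtain U d where U: "U ** conj_transpose U = mat 1" and d: "\<And>i. 0 < d i"
    and Aeq: "A = U ** diag_mat d ** conj_transpose U"
    and Peq: "P = U ** diag_mat (\<lambda>i. d i powr (- 1 / (\<alpha> - 1))) ** conj_transpose U"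
    using P unfolding has_matrix_powr_def by blast
  define l where "l = Min (range d)"
  obtain i0 where i0: "l = d i0"
    unfolding l_def using Min_in[of "range d"] by (metis UNIV_not_empty finite finite_imageI image_is_empty rangeE)
  have "l \<le> d i" for i by (simp add: l_def)
  moreover have "0 < l" using d i0 by simp
  ultimately have l: "0 < l" "\<And>i. l \<le> d i" by auto
  have low: "l * (\<Sum>k\<in>UNIV. (norm (x $ k))\<^sup>2) \<le> Re (tdot x (A *v (\<chi> j. cnj (x $ j))))" for x
    unfolding Aeq tdot_hermitian_square sum_norm_square_unitary[OF U, symmetric] sum_distrib_left Re_complex_of_real
    using l by (intro sum_mono mult_right_mono) auto
  \<comment> \<open>A diagonal entry is the value of the Hermitian form at a basis vector. For
    \<alpha> < 2 these entries are all that is left of \<open>A\<close>.\<close>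
  have diag: "l \<le> Re (A $ k $ k)" for k
  proof -
    have "(\<chi> j. cnj (axis k 1 $ j)) = (axis k 1 :: complex^'n)" by (simp add: axis_def vec_eq_iff)
    moreover have "A $ k $ k = bform 2 A (axis k 1) (axis k 1)" by simp
    moreover have "spow_vec 1 (axis k 1) = (axis k 1 :: complex^'n)" by (simp add: axis_def spow_vec_def vec_eq_iff)
    moreover have "(\<Sum>j\<in>UNIV. (norm ((axis k 1 :: complex^'n) $ j))\<^sup>2) = 1"
      by (simp add: axis_def if_distrib[of norm] if_distrib[of "\<lambda>x. x\<^sup>2"] cong: if_cong)
    ultimately show ?thesis using low[of "axis k 1"] by (simp add: bform_def)
  qed
  \<comment> \<open>The estimate is made for the largest coordinate only; passing to the norm of
    \<open>v\<close> costs the factor \<open>CARD('n)\<close>.\<close>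
  define m where "m = Max (range (\<lambda>k. norm (v $ k)))"
  obtain k0 where k0: "m = norm (v $ k0)"
    unfolding m_def using Max_in[of "range (\<lambda>k. norm (v $ k))"]
    by (metis (mono_tags, lifting) UNIV_not_empty finite finite_imageI image_is_empty imageE)
  have mk: "norm (v $ k) \<le> m" for k by (auto simp: m_def)
  have m: "0 \<le> m" by (simp add: k0)
  have "norm v \<le> (\<Sum>k\<in>UNIV. norm (v $ k))" by (simp add: norm_vec_def L2_set_le_sum)
  also have "\<dots> \<le> CARD('n) * m" using sum_bounded_above[of UNIV "\<lambda>k. norm (v $ k)" m] mk by simp
  finally have nv: "norm v \<le> CARD('n) * m" .
  have q: "l * m powr \<alpha> \<le> qform \<alpha> A v"
  proof (cases "\<alpha> = 2")
    case True
    have "l * m powr \<alpha> = l * (norm (v $ k0))\<^sup>2" using True m by (simp add: k0 powr_numeral)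
    also have "\<dots> \<le> l * (\<Sum>k\<in>UNIV. (norm (v $ k))\<^sup>2)"
      using l by (intro mult_left_mono member_le_sum) auto
    also have "\<dots> \<le> qform \<alpha> A v"
      using low[of v] True by (simp add: qform_def bform_def spow_vec_def spow_1)
    finally show ?thesis .
  next
    case False
    have "l * m powr \<alpha> \<le> Re (A $ k0 $ k0) * norm (v $ k0) powr \<alpha>"
      using diag by (simp add: k0 mult_right_mono)
    also have "\<dots> \<le> qform \<alpha> A v"
      unfolding qform_diag[OF \<alpha> A False]
      using covariation_matrix_diag(2)[OF \<alpha> A] by (intro member_le_sum) auto
    finally show ?thesis .
  qed
  have "trace P = (\<Sum>i\<in>UNIV. of_real (d i powr (- 1 / (\<alpha> - 1))))"
    unfolding Peq trace_conjugate[OF U] by (simp add: trace_def diag_mat_def)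
  then have "Re (trace P) = (\<Sum>i\<in>UNIV. d i powr (- 1 / (\<alpha> - 1)))" by simp
  then have tr: "l powr (- 1 / (\<alpha> - 1)) \<le> Re (trace P)"
    using member_le_sum[of i0 UNIV "\<lambda>i. d i powr (- 1 / (\<alpha> - 1))"] i0 by simp
  \<comment> \<open>If \<open>m powr (\<alpha> - 1)\<close> reaches the threshold
    \<open>\<tau> / l\<close>, the form dominates \<open>m\<close>; below the threshold
    \<open>m\<close> itself is bounded by a power of \<open>\<tau> / l\<close>, and the trace
    dominates the power of \<open>l\<close>.\<close>
  have "m \<le> l * m powr \<alpha> / \<tau> + \<tau> powr (1 / (\<alpha> - 1)) * l powr (- 1 / (\<alpha> - 1))"
  proof (cases "m powr (\<alpha> - 1) \<ge> \<tau> / l")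
    case True
    have "m = m powr 1" using m by simp
    also have "\<dots> \<le> l * m powr \<alpha> / \<tau>"
    proof -
      have "m powr 1 * (\<tau> / l) \<le> m powr 1 * m powr (\<alpha> - 1)" using True by (intro mult_left_mono) auto
      also have "m powr 1 * m powr (\<alpha> - 1) = m powr \<alpha>" unfolding powr_add[symmetric] by simp
      finally show ?thesis using l \<tau> by (simp add: field_simps)
    qed
    finally show ?thesis by (simp add: add_increasing2)
  next
    case False
    have "m = (m powr (\<alpha> - 1)) powr (1 / (\<alpha> - 1))" using m \<alpha> by (simp add: powr_powr)
    also have "\<dots> \<le> (\<tau> / l) powr (1 / (\<alpha> - 1))" using False \<alpha> by (intro powr_mono2) auto
    also have "\<dots> = \<tau> powr (1 / (\<alpha> - 1)) * l powr (- 1 / (\<alpha> - 1))"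
      using l \<tau> by (simp add: powr_divide powr_minus_divide minus_divide_left[symmetric])
    finally show ?thesis using l \<tau> by (simp add: add_increasing)
  qed
  also have "\<dots> \<le> qform \<alpha> A v / \<tau> + \<tau> powr (1 / (\<alpha> - 1)) * Re (trace P)"
    using q tr \<tau> by (intro add_mono divide_right_mono mult_left_mono) auto
  finally show ?thesis using nv by (meson mult_left_mono of_nat_0_le_iff order_trans)
qed

section \<open>Integrable functions on the circle\<close>

lemma borel_measurable_vec_nth [measurable (raw)]:
  fixes f :: "'a \<Rightarrow> 'b::euclidean_space^'n"
  assumes "f \<in> borel_measurable M"
  shows "(\<lambda>x. f x $ i) \<in> borel_measurable M"
  using assms by (rule borel_measurable_continuous_on[OF continuous_on_component[OF continuous_on_id]])

lemma borel_measurable_cis [measurable (raw)]: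
  assumes "f \<in> borel_measurable M"
  shows "(\<lambda>x. cis (f x)) \<in> borel_measurable M"
  using assms by (rule borel_measurable_continuous_on[OF continuous_on_cis[OF continuous_on_id]])

lemma circ_ident_measurable [measurable]: "(\<lambda>\<theta>. \<theta>) \<in> borel_measurable circ"
  using id_borel_measurable_lebesgue_on by (simp add: id_def)

lemma finite_measure_circ: "finite_measure circ"
  by (rule finite_measure_lebesgue_on) simp

lemma borel_sets_circ: "S \<in> sets borel \<Longrightarrow> S \<subseteq> {-pi..pi} \<Longrightarrow> S \<in> sets circ"
  by (auto simp: sets_restrict_space_iff)

lemma integrable_bounded_mult:
  fixes u :: "'a \<Rightarrow> 'b::{real_normed_field, banach, second_countable_topology}"
  assumes "integrable M u" "b \<in> borel_measurable M" "\<And>x. x \<in> space M \<Longrightarrow> norm (b x) \<le> B"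
  shows "integrable M (\<lambda>x. b x * u x)"
proof (rule Bochner_Integration.integrable_bound)
  show "integrable M (\<lambda>x. B * norm (u x))" using assms by auto
  show "(\<lambda>x. b x * u x) \<in> borel_measurable M" using assms by auto
  show "AE x in M. norm (b x * u x) \<le> norm (B * norm (u x))"
  proof (rule AE_I2)
    fix x assume x: "x \<in> space M"
    have "norm (b x) * norm (u x) \<le> B * norm (u x)" using assms(3)[OF x] by (simp add: mult_right_mono)
    then show "norm (b x * u x) \<le> norm (B * norm (u x))" by (simp add: norm_mult)
  qed
qed

lemma integrable_indicator_mult:
  fixes u :: "real \<Rightarrow> 'b::{real_normed_field, banach, second_countable_topology}"
  assumes "integrable circ u" "K \<in> sets borel"
  shows "integrable circ (\<lambda>\<theta>. indicator K \<theta> * u \<theta>)"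
proof (rule integrable_bounded_mult[where B = 1])
  show "(indicator K :: real \<Rightarrow> 'b) \<in> borel_measurable circ"
    using assms(2) by (rule measurable_compose[OF circ_ident_measurable borel_measurable_indicator])
qed (use assms(1) in \<open>auto simp: indicator_def\<close>)

text \<open>Inner regularity: up to a null set, the set where \<open>u\<close> is negative is a
  countable union of compact sets, and the hypothesis forces each of them to have measure
  zero.\<close>

lemma AE_nonneg_of_compact:
  fixes u :: "real \<Rightarrow> real"
  assumes u: "integrable circ u"
    and K: "\<And>K. compact K \<Longrightarrow> K \<subseteq> {-pi..pi} \<Longrightarrow> 0 \<le> (LINT \<theta>|circ. indicator K \<theta> * u \<theta>)"
  shows "AE \<theta> in circ. 0 \<le> u \<theta>"
proof -
  define S where "S = {\<theta> \<in> space circ. u \<theta> < 0}"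
  have [measurable]: "u \<in> borel_measurable circ" using u by simp
  have S: "S \<in> sets circ" unfolding S_def by measurable
  then have Sl: "S \<in> sets lebesgue" by (auto simp: sets_restrict_space_iff)
  obtain C T where CT: "fsigma C" "T \<in> null_sets lebesgue" "C \<union> T = S"
    using lebesgue_set_almost_fsigma[OF Sl] by metis
  obtain F :: "nat \<Rightarrow> real set" where F: "range F \<subseteq> Collect compact" "C = \<Union> (range F)"
    using CT(1) unfolding fsigma_Union_compact by blast
  have null: "F n \<in> null_sets circ" for n
  proof -
    have FS: "F n \<subseteq> S" using F CT by auto
    then have sub: "F n \<subseteq> {-pi..pi}" by (auto simp: S_def)
    have Fs: "F n \<in> sets circ"
      using F by (intro borel_sets_circ sub borel_compact) auto
    have int: "integrable circ (\<lambda>\<theta>. - (indicator (F n) \<theta> * u \<theta>))"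
      using F u by (intro Bochner_Integration.integrable_minus integrable_indicator_mult borel_compact) auto
    have nn: "AE \<theta> in circ. 0 \<le> - (indicator (F n) \<theta> * u \<theta>)"
      using FS by (intro AE_I2) (auto simp: S_def indicator_def)
    have "(LINT \<theta>|circ. - (indicator (F n) \<theta> * u \<theta>)) \<le> 0"
      using K[of "F n"] F sub by auto
    then have "(LINT \<theta>|circ. - (indicator (F n) \<theta> * u \<theta>)) = 0"
      using integral_nonneg_AE[OF nn] by linarith
    then have "AE \<theta> in circ. - (indicator (F n) \<theta> * u \<theta>) = 0"
      using integral_nonneg_eq_0_iff_AE[OF int nn] by simp
    then have "AE \<theta> in circ. \<theta> \<notin> F n"
    proof eventually_elim
      case (elim \<theta>)
      then show ?case using FS by (auto simp: S_def indicator_def split: if_splits)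
    qed
    then show ?thesis using Fs by (simp add: AE_iff_null_sets)
  qed
  have "T \<subseteq> {-pi..pi}" using CT by (auto simp: S_def)
  then have "T \<in> null_sets circ" using CT(2) by (simp add: null_sets_restrict_space)
  moreover have "(\<Union>n. F n) \<in> null_sets circ" using null by (rule null_sets_UN)
  ultimately have "S \<in> null_sets circ" using CT(3) F(2) by auto
  then have "AE \<theta> in circ. \<theta> \<notin> S" by (rule AE_not_in)
  then show ?thesis using AE_space by eventually_elim (auto simp: S_def)
qed

text \<open>A compact \<open>K\<close> is, up to a null set, the limit of the unions
  \<open>U m\<close> of grid cells that meet it, so the sign passes from intervals to
  \<open>K\<close> by dominated convergence.\<close>

lemma AE_nonneg_of_intervals:
  fixes u :: "real \<Rightarrow> real"
  assumes u: "integrable circ u"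
    and I: "\<And>s t. - pi \<le> s \<Longrightarrow> s \<le> t \<Longrightarrow> t \<le> pi \<Longrightarrow> 0 \<le> (LINT \<theta>|circ. indicator {s<..t} \<theta> * u \<theta>)"
  shows "AE \<theta> in circ. 0 \<le> u \<theta>"
proof (rule AE_nonneg_of_compact[OF u])
  fix K :: "real set" assume K: "compact K" "K \<subseteq> {-pi..pi}"
  have [measurable]: "u \<in> borel_measurable circ" using u by simp
  have [measurable]: "K \<in> sets borel" using K(1) by (rule borel_compact)
  define t where "t = (\<lambda>m i. - pi + 2 * pi * real i / real (Suc m))"
  \<comment> \<open>Cells are tested against \<open>K\<close> as closed intervals but united as
    half-open ones, which are disjoint. A cell that \<open>K\<close> touches only at its left end
    does no harm, since the mesh tends to 0.\<close>
  define G where "G = (\<lambda>m. {i. i < Suc m \<and> K \<inter> {t m i..t m (Suc i)} \<noteq> {}})"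
  define U where "U = (\<lambda>m. \<Union>i\<in>G m. {t m i<..t m (Suc i)})"
  have mono: "t m i \<le> t m j" if "i \<le> j" for m i j
    using that by (auto simp: t_def intro!: divide_right_mono mult_left_mono)
  have tb: "- pi \<le> t m i" "i \<le> Suc m \<Longrightarrow> t m i \<le> pi" for m i
    using mono[of 0 i m] mono[of i "Suc m" m] by (simp_all add: t_def)
  have disj: "disjoint_family_on (\<lambda>i. {t m i<..t m (Suc i)}) (G m)" for m
  proof -
    have "{t m i<..t m (Suc i)} \<inter> {t m j<..t m (Suc j)} = {}" if "i < j" for i j
      using mono[of "Suc i" j m] that by auto
    then show ?thesis unfolding disjoint_family_on_def by (metis Int_commute linorder_neqE_nat)
  qed
  have [measurable]: "U m \<in> sets borel" for m unfolding U_def G_def by (intro sets.finite_UN) auto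
  have pos: "0 \<le> (LINT \<theta>|circ. indicator (U m) \<theta> * u \<theta>)" for m
  proof -
    have fin: "finite (G m)" by (simp add: G_def)
    have "(LINT \<theta>|circ. indicator (U m) \<theta> * u \<theta>)
        = (LINT \<theta>|circ. (\<Sum>i\<in>G m. indicator {t m i<..t m (Suc i)} \<theta> * u \<theta>))"
      unfolding U_def by (simp add: indicator_UN_disjoint[OF fin disj] sum_distrib_right)
    also have "\<dots> = (\<Sum>i\<in>G m. LINT \<theta>|circ. indicator {t m i<..t m (Suc i)} \<theta> * u \<theta>)"
      using u by (intro Bochner_Integration.integral_sum integrable_indicator_mult) auto
    also have "\<dots> \<ge> 0" using mono tb by (intro sum_nonneg I) (auto simp: G_def)
    finally show ?thesis .
  qed
  have lim: "(\<lambda>m. indicator (U m) \<theta> :: real) \<longlonglongrightarrow> indicator K \<theta>" if th: "- pi < \<theta>" "\<theta> \<le> pi" for \<theta>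
  proof -
    have cell: "\<exists>i<Suc m. \<theta> \<in> {t m i<..t m (Suc i)}" for m
    proof -
      define i where "i = (LEAST i. \<theta> \<le> t m i)"
      have ex: "\<theta> \<le> t m (Suc m)" using th by (simp add: t_def)
      then have le: "\<theta> \<le> t m i" "i \<le> Suc m" unfolding i_def by (auto intro: LeastI Least_le)
      have "i \<noteq> 0" using le th by (auto simp: t_def intro: gr0I)
      then obtain k where k: "i = Suc k" by (cases i) auto
      have "\<not> \<theta> \<le> t m k" using not_less_Least[of k "\<lambda>i. \<theta> \<le> t m i"] k by (simp add: i_def)
      then show ?thesis using le k by (intro exI[of _ k]) auto
    qed
    show ?thesis
    proof (cases "\<theta> \<in> K")
      case True
      have "\<theta> \<in> U m" for m
      proof -
        obtain i where "i < Suc m" "\<theta> \<in> {t m i<..t m (Suc i)}" using cell by blast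
        then show ?thesis using True unfolding U_def G_def by (auto intro!: exI[of _ i])
      qed
      then show ?thesis using True by simp
    next
      case False
      then obtain d where d: "0 < d" "\<And>x. x \<in> K \<Longrightarrow> d \<le> dist \<theta> x"
        using separate_point_closed[OF compact_imp_closed[OF K(1)]] by blast
      have "(\<lambda>m. 2 * pi * inverse (real (Suc m))) \<longlonglongrightarrow> 2 * pi * 0"
        by (intro tendsto_intros LIMSEQ_inverse_real_of_nat)
      then have "\<forall>\<^sub>F m in sequentially. 2 * pi * inverse (real (Suc m)) < d"
        using d(1) by (intro order_tendstoD) auto
      then have "\<forall>\<^sub>F m in sequentially. indicator (U m) \<theta> = (0::real)"
      proof eventually_elim
        case (elim m)
        have "\<theta> \<notin> U m"
        proof
          assume "\<theta> \<in> U m"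
          then obtain i x where i: "\<theta> \<in> {t m i<..t m (Suc i)}" "x \<in> K" "x \<in> {t m i..t m (Suc i)}"
            unfolding U_def G_def by blast
          then have "dist \<theta> x \<le> t m (Suc i) - t m i" by (auto simp: dist_real_def)
          also have "\<dots> = 2 * pi * inverse (real (Suc m))"
            by (simp add: t_def divide_inverse algebra_simps)
          finally show False using d(2)[OF i(2)] elim by linarith
        qed
        then show ?case by simp
      qed
      then show ?thesis using False by (simp add: tendsto_eventually)
    qed
  qed
  have "(\<lambda>m. LINT \<theta>|circ. indicator (U m) \<theta> * u \<theta>) \<longlonglongrightarrow> (LINT \<theta>|circ. indicator K \<theta> * u \<theta>)"
  proof (rule integral_dominated_convergence[where w = "\<lambda>\<theta>. norm (u \<theta>)"])
    \<comment> \<open>The point \<open>- pi\<close> lies in no half-open cell and is discarded as a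
      null set.\<close>
    have "AE \<theta> in circ. \<theta> \<noteq> - pi"
      by (intro AE_not_in[of "{- pi}", simplified]) (auto simp: null_sets_restrict_space)
    then show "AE \<theta> in circ. (\<lambda>m. indicator (U m) \<theta> * u \<theta>) \<longlonglongrightarrow> indicator K \<theta> * u \<theta>"
      using AE_space by eventually_elim (auto intro!: tendsto_intros lim)
  qed (use u in \<open>auto simp: indicator_def\<close>)
  then show "0 \<le> (LINT \<theta>|circ. indicator K \<theta> * u \<theta>)"
    by (rule LIMSEQ_le_const) (use pos in auto)
qed

lemma AE_zero_of_compact:
  fixes u :: "real \<Rightarrow> complex"
  assumes u: "integrable circ u"
    and K: "\<And>K. compact K \<Longrightarrow> K \<subseteq> {-pi..pi} \<Longrightarrow> (LINT \<theta>|circ. indicator K \<theta> * u \<theta>) = 0"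
  shows "AE \<theta> in circ. u \<theta> = 0"
proof -
  have int: "integrable circ (\<lambda>\<theta>. indicator K \<theta> * u \<theta>)" if "compact K" for K
    using u borel_compact[OF that] by (rule integrable_indicator_mult)
  have Re: "(LINT \<theta>|circ. indicator K \<theta> * Re (u \<theta>)) = 0" (is ?R)
    and Im: "(LINT \<theta>|circ. indicator K \<theta> * Im (u \<theta>)) = 0" (is ?I)
    if "compact K" "K \<subseteq> {-pi..pi}" for K
  proof -
    have "(LINT \<theta>|circ. indicator K \<theta> * Re (u \<theta>)) = Re (LINT \<theta>|circ. indicator K \<theta> * u \<theta>)"
      "(LINT \<theta>|circ. indicator K \<theta> * Im (u \<theta>)) = Im (LINT \<theta>|circ. indicator K \<theta> * u \<theta>)"
      using int[OF that(1)]
      by (simp_all flip: integral_Re integral_Im) (auto intro!: Bochner_Integration.integral_cong simp: indicator_def)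
    then show ?R ?I using K[OF that] by simp_all
  qed
  have "AE \<theta> in circ. 0 \<le> Re (u \<theta>)" "AE \<theta> in circ. 0 \<le> - Re (u \<theta>)"
    "AE \<theta> in circ. 0 \<le> Im (u \<theta>)" "AE \<theta> in circ. 0 \<le> - Im (u \<theta>)"
    by (rule AE_nonneg_of_compact, use Re Im u in simp, use Re Im u in simp)+
  then show ?thesis by eventually_elim (auto simp: complex_eq_iff)
qed

lemma AE_zero_of_intervals:
  fixes u :: "real \<Rightarrow> complex"
  assumes u: "integrable circ u"
    and I: "\<And>s t. - pi \<le> s \<Longrightarrow> s \<le> t \<Longrightarrow> t \<le> pi \<Longrightarrow> (LINT \<theta>|circ. indicator {s<..t} \<theta> * u \<theta>) = 0"
  shows "AE \<theta> in circ. u \<theta> = 0"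
proof -
  have int: "integrable circ (\<lambda>\<theta>. indicator {s<..t} \<theta> * u \<theta>)" for s t
    using u by (rule integrable_indicator_mult) simp
  have Re: "(LINT \<theta>|circ. indicator {s<..t} \<theta> * Re (u \<theta>)) = 0" (is ?R)
    and Im: "(LINT \<theta>|circ. indicator {s<..t} \<theta> * Im (u \<theta>)) = 0" (is ?I)
    if "- pi \<le> s" "s \<le> t" "t \<le> pi" for s t
  proof -
    have "(LINT \<theta>|circ. indicator {s<..t} \<theta> * Re (u \<theta>)) = Re (LINT \<theta>|circ. indicator {s<..t} \<theta> * u \<theta>)"
      "(LINT \<theta>|circ. indicator {s<..t} \<theta> * Im (u \<theta>)) = Im (LINT \<theta>|circ. indicator {s<..t} \<theta> * u \<theta>)"
      using int[of s t]
      by (simp_all flip: integral_Re integral_Im) (auto intro!: Bochner_Integration.integral_cong simp: indicator_def)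
    then show ?R ?I using I[OF that] by simp_all
  qed
  have "AE \<theta> in circ. 0 \<le> Re (u \<theta>)" "AE \<theta> in circ. 0 \<le> - Re (u \<theta>)"
    "AE \<theta> in circ. 0 \<le> Im (u \<theta>)" "AE \<theta> in circ. 0 \<le> - Im (u \<theta>)"
    by (rule AE_nonneg_of_intervals, use Re Im u in simp, use Re Im u in simp)+
  then show ?thesis by eventually_elim (auto simp: complex_eq_iff)
qed

section \<open>Fourier coefficients determine an integrable function\<close>

lemma integral_cis:
  "has_bochner_integral circ (\<lambda>\<theta>. cis (of_int j * \<theta>)) (if j = 0 then of_real (2 * pi) else 0)"
proof -
  have int: "integrable circ (\<lambda>\<theta>. cis (of_int j * \<theta>))"
    by (rule finite_measure.integrable_const_bound[OF finite_measure_circ, of _ 1]) auto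
  have "(LINT \<theta>|circ. cis (of_int j * \<theta>)) = integral {-pi..pi} (\<lambda>\<theta>. cis (of_int j * \<theta>))"
    by (rule lebesgue_integral_eq_integral[OF int]) simp
  also have "\<dots> = (if j = 0 then of_real (2 * pi) else 0)"
  proof (cases "j = 0")
    case True
    then show ?thesis by (simp add: scaleR_conv_of_real)
  next
    case False
    have "((\<lambda>\<theta>. cis (of_int j * \<theta>) / (\<i> * of_int j)) has_vector_derivative cis (of_int j * \<theta>)) (at \<theta> within {-pi..pi})" for \<theta>
    proof -
      have "((\<lambda>\<theta>. exp (\<i> * of_int j * complex_of_real \<theta>) / (\<i> * of_int j)) has_vector_derivative
          exp (\<i> * of_int j * complex_of_real \<theta>)) (at \<theta> within {-pi..pi})"
        using False by (auto intro!: derivative_eq_intros has_vector_derivative_real_field simp: field_simps)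
      then show ?thesis by (simp add: cis_conv_exp mult_ac)
    qed
    then have "((\<lambda>\<theta>. cis (of_int j * \<theta>)) has_integral
        (cis (of_int j * pi) / (\<i> * of_int j) - cis (of_int j * (- pi)) / (\<i> * of_int j))) {-pi..pi}"
      by (intro fundamental_theorem_of_calculus) auto
    moreover have "cis (of_int j * pi) = cis (of_int j * (- pi))"
    proof -
      have "cis (of_int j * pi) = cis (of_int j * (- pi)) * cis (2 * pi * of_int j)"
        by (simp add: cis_mult algebra_simps)
      then show ?thesis by simp
    qed
    ultimately show ?thesis using False by (simp add: integral_unique)
  qed
  finally show ?thesis using int by (simp add: has_bochner_integral_iff)
qed

definition fourier_null :: "(real \<Rightarrow> complex) \<Rightarrow> bool" where
  "fourier_null u \<longleftrightarrow> integrable circ u \<and> (\<forall>j. (LINT \<theta>|circ. cis (of_int j * \<theta>) * u \<theta>) = 0)"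

lemma integrable_cis_mult:
  assumes "integrable circ u"
  shows "integrable circ (\<lambda>\<theta>. cis (x * \<theta>) * u \<theta>)"
  using assms by (intro integrable_bounded_mult[where B = 1]) auto

lemma fourier_null_shift: "fourier_null u \<Longrightarrow> fourier_null (\<lambda>\<theta>. cis (of_int k * \<theta>) * u \<theta>)"
proof -
  assume u: "fourier_null u"
  have "cis (of_int j * \<theta>) * (cis (of_int k * \<theta>) * u \<theta>) = cis (of_int (j + k) * \<theta>) * u \<theta>" for j \<theta>
    by (simp only: mult.assoc[symmetric] cis_mult distrib_right of_int_add)
  then have "(LINT \<theta>|circ. cis (of_int j * \<theta>) * (cis (of_int k * \<theta>) * u \<theta>))
      = (LINT \<theta>|circ. cis (of_int (j + k) * \<theta>) * u \<theta>)" for j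
    by (simp only:)
  then show ?thesis using u unfolding fourier_null_def
    by (auto intro: integrable_cis_mult simp del: of_int_add)
qed

lemma fourier_null_add: "fourier_null u \<Longrightarrow> fourier_null v \<Longrightarrow> fourier_null (\<lambda>\<theta>. u \<theta> + v \<theta>)"
  by (auto simp: fourier_null_def distrib_left integrable_cis_mult)

lemma fourier_null_scale: "fourier_null u \<Longrightarrow> fourier_null (\<lambda>\<theta>. c * u \<theta>)"
  by (auto simp: fourier_null_def mult.left_commute[of _ c])

text \<open>A real linear function of \<open>cis \<theta>\<close> is a combination of
  \<open>cis \<theta>\<close> and \<open>cis (- \<theta>)\<close>, so multiplication by it only
  shifts Fourier coefficients. Products need the claim for every \<open>u\<close>.\<close>

lemma fourier_null_polynomial:
  assumes "real_polynomial_function p"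
  shows "fourier_null u \<Longrightarrow> fourier_null (\<lambda>\<theta>. of_real (p (cis \<theta>)) * u \<theta>)"
  using assms
proof (induction p arbitrary: u rule: real_polynomial_function.induct)
  case (linear f)
  have "of_real (f (cis \<theta>)) * u \<theta> = (f 1 / 2 + f \<i> / (2 * \<i>)) * (cis (of_int 1 * \<theta>) * u \<theta>)
      + (f 1 / 2 - f \<i> / (2 * \<i>)) * (cis (of_int (-1) * \<theta>) * u \<theta>)" for \<theta>
  proof -
    interpret bounded_linear f by fact
    have "f (cis \<theta>) = f (cos \<theta> *\<^sub>R 1 + sin \<theta> *\<^sub>R \<i>)"
      by (rule arg_cong[where f = f]) (simp add: complex_eq_iff)
    then have "f (cis \<theta>) = cos \<theta> * f 1 + sin \<theta> * f \<i>" by (simp add: add scaleR)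
    then show ?thesis by (simp add: complex_eq_iff field_simps)
  qed
  then show ?case using linear(2)
    by (simp only:) (intro fourier_null_add fourier_null_scale fourier_null_shift)
qed (simp_all add: fourier_null_scale distrib_right fourier_null_add mult.assoc)

text \<open>By Stone-Weierstrass on the unit circle, \<open>u\<close> integrates to 0 against every
  continuous function of \<open>cis \<theta>\<close>, hence, in the limit, against the indicator of
  every compact set.\<close>

lemma fourier_null_imp_AE_zero:
  assumes "fourier_null u"
  shows "AE \<theta> in circ. u \<theta> = 0"
proof (rule AE_zero_of_compact)
  show u: "integrable circ u" using assms by (simp add: fourier_null_def)
  have cont0: "(LINT \<theta>|circ. of_real (G (cis \<theta>)) * u \<theta>) = 0" if G: "continuous_on UNIV G" for G
  proof -
    have Gm: "(\<lambda>\<theta>. G (cis \<theta>)) \<in> borel_measurable circ"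
      by (rule borel_measurable_continuous_on[OF G]) measurable
    have "norm (LINT \<theta>|circ. of_real (G (cis \<theta>)) * u \<theta>) \<le> e * (LINT \<theta>|circ. norm (u \<theta>))" if "0 < e" for e
    proof -
      obtain p where p: "real_polynomial_function p" "\<And>x. x \<in> sphere 0 1 \<Longrightarrow> \<bar>G x - p x\<bar> < e"
        using Stone_Weierstrass_real_polynomial_function[OF compact_sphere continuous_on_subset[OF G subset_UNIV] \<open>0 < e\<close>, of 0 1]
        by blast
      have pm: "(\<lambda>\<theta>. p (cis \<theta>)) \<in> borel_measurable circ"
        using p(1) by (intro borel_measurable_continuous_on[of p]) (auto simp: real_polynomial_function_eq continuous_on_polymonial_function)
      have fn: "fourier_null (\<lambda>\<theta>. of_real (p (cis \<theta>)) * u \<theta>)"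
        using fourier_null_polynomial[OF p(1) assms] .
      then have p0: "(LINT \<theta>|circ. of_real (p (cis \<theta>)) * u \<theta>) = 0" "integrable circ (\<lambda>\<theta>. of_real (p (cis \<theta>)) * u \<theta>)"
        unfolding fourier_null_def by (auto dest!: spec[of _ 0])
      have Gp: "integrable circ (\<lambda>\<theta>. of_real (G (cis \<theta>) - p (cis \<theta>)) * u \<theta>)"
        using u Gm pm p(2) by (intro integrable_bounded_mult[where B = e]) (auto intro!: less_imp_le simp flip: of_real_diff)
      have "(LINT \<theta>|circ. of_real (G (cis \<theta>)) * u \<theta>)
          = (LINT \<theta>|circ. of_real (G (cis \<theta>) - p (cis \<theta>)) * u \<theta> + of_real (p (cis \<theta>)) * u \<theta>)"
        by (simp add: left_diff_distrib)
      also have "\<dots> = (LINT \<theta>|circ. of_real (G (cis \<theta>) - p (cis \<theta>)) * u \<theta>)"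
        using Gp p0 by simp
      also have "norm \<dots> \<le> (LINT \<theta>|circ. norm (of_real (G (cis \<theta>) - p (cis \<theta>)) * u \<theta>))"
        by (rule integral_norm_bound)
      also have "\<dots> \<le> (LINT \<theta>|circ. e * norm (u \<theta>))"
      proof (rule integral_mono)
        show "norm (of_real (G (cis \<theta>) - p (cis \<theta>)) * u \<theta>) \<le> e * norm (u \<theta>)" for \<theta>
          using p(2)[of "cis \<theta>"] unfolding norm_mult norm_of_real by (intro mult_right_mono) auto
      qed (use Gp u in auto)
      finally show ?thesis by simp
    qed
    note bound = this
    have "((\<lambda>e. e * (LINT \<theta>|circ. norm (u \<theta>))) \<longlongrightarrow> 0 * (LINT \<theta>|circ. norm (u \<theta>))) (at_right 0)"
      by (intro tendsto_intros)
    then have "norm (LINT \<theta>|circ. of_real (G (cis \<theta>)) * u \<theta>) \<le> 0 * (LINT \<theta>|circ. norm (u \<theta>))"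
      by (rule tendsto_lowerbound) (auto simp: bound eventually_at_filter)
    then show ?thesis by simp
  qed
  fix K :: "real set" assume K: "compact K" "K \<subseteq> {-pi..pi}"
  show "(LINT \<theta>|circ. indicator K \<theta> * u \<theta>) = 0"
  proof (cases "K = {}")
    case False
    define L where "L = cis ` K"
    have L: "closed L" "L \<noteq> {}" using K False unfolding L_def
      by (auto intro!: compact_imp_closed compact_continuous_image continuous_intros)
    \<comment> \<open>Continuous functions on the plane that decrease to the indicator of the closed
      set \<open>L\<close>.\<close>
    define G where "G = (\<lambda>n z. max 0 (1 - real n * infdist z L))"
    have Gc: "continuous_on UNIV (G n)" for n unfolding G_def by (intro continuous_intros)
    have Gm: "(\<lambda>\<theta>. G n (cis \<theta>)) \<in> borel_measurable circ" for n
      by (rule borel_measurable_continuous_on[OF Gc]) measurable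
    have Km: "(indicator K :: real \<Rightarrow> complex) \<in> borel_measurable circ"
      using borel_compact[OF K(1)] by (rule measurable_compose[OF circ_ident_measurable borel_measurable_indicator])
    \<comment> \<open>\<open>cis\<close> identifies the two endpoints, so \<open>L\<close>
      determines membership in \<open>K\<close> only inside the open interval; the endpoints form a
      null set.\<close>
    have lim: "(\<lambda>n. G n (cis \<theta>)) \<longlonglongrightarrow> indicator K \<theta>" if th: "- pi < \<theta>" "\<theta> < pi" for \<theta>
    proof (cases "\<theta> \<in> K")
      case True
      then have "cis \<theta> \<in> L" by (simp add: L_def)
      then have "infdist (cis \<theta>) L = 0" by simp
      then show ?thesis using True by (simp add: G_def)
    next
      case False
      have "cis \<theta> \<notin> L"
      proof
        assume "cis \<theta> \<in> L"
        then obtain \<phi> where ph: "\<phi> \<in> K" "cis \<theta> = cis \<phi>" by (auto simp: L_def)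
        then have b: "- pi \<le> \<phi>" "\<phi> \<le> pi" "\<phi> \<noteq> \<theta>" using K(2) False by auto
        have "cis (\<theta> - \<phi>) = 1" using ph(2) by (simp flip: cis_divide)
        then have "cos (\<theta> - \<phi>) = 1" by (simp add: complex_eq_iff)
        then obtain k :: int where "\<theta> - \<phi> = of_int k * 2 * pi" using cos_one_2pi_int by blast
        then have k: "\<theta> - \<phi> = of_int k * (2 * pi)" by simp
        have "\<bar>\<theta> - \<phi>\<bar> < 2 * pi" using th b by linarith
        then have "\<bar>of_int k\<bar> * (2 * pi) < 1 * (2 * pi)" unfolding k abs_mult by simp
        then have "\<bar>of_int k :: real\<bar> < 1" using pi_gt_zero by (simp add: mult_less_cancel_right)
        then have "k = 0" by linarith
        then show False using k b by simp
      qed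
      then have pos: "0 < infdist (cis \<theta>) L"
        using L infdist_pos_not_in_closed by blast
      obtain n0 :: nat where n0: "1 / infdist (cis \<theta>) L < n0" using reals_Archimedean2 by blast
      have "\<forall>\<^sub>F n in sequentially. G n (cis \<theta>) = 0"
        using eventually_ge_at_top[of n0]
      proof eventually_elim
        case (elim n)
        have "1 < real n0 * infdist (cis \<theta>) L" using n0 pos by (simp add: field_simps)
        also have "\<dots> \<le> real n * infdist (cis \<theta>) L" using elim pos by (intro mult_right_mono) auto
        finally show ?case by (simp add: G_def)
      qed
      then show ?thesis using False by (simp add: tendsto_eventually)
    qed
    have "(\<lambda>n. LINT \<theta>|circ. of_real (G n (cis \<theta>)) * u \<theta>) \<longlonglongrightarrow> (LINT \<theta>|circ. indicator K \<theta> * u \<theta>)"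
    proof (rule integral_dominated_convergence[where w = "\<lambda>\<theta>. norm (u \<theta>)"])
      have "AE \<theta> in circ. \<theta> \<noteq> - pi" "AE \<theta> in circ. \<theta> \<noteq> pi"
        by (intro AE_not_in[of "{- pi}", simplified] AE_not_in[of "{pi}", simplified]; auto simp: null_sets_restrict_space)+
      then show "AE \<theta> in circ. (\<lambda>n. of_real (G n (cis \<theta>)) * u \<theta>) \<longlonglongrightarrow> indicator K \<theta> * u \<theta>"
        using AE_space
      proof eventually_elim
        case (elim \<theta>)
        then have "(\<lambda>n. complex_of_real (G n (cis \<theta>))) \<longlonglongrightarrow> of_real (indicator K \<theta>)"
          by (intro tendsto_of_real lim) auto
        then show ?case by (intro tendsto_intros) (cases "\<theta> \<in> K"; simp)
      qed
      show "AE \<theta> in circ. norm (of_real (G n (cis \<theta>)) * u \<theta>) \<le> norm (u \<theta>)" for n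
      proof (rule AE_I2)
        fix \<theta>
        have "\<bar>G n (cis \<theta>)\<bar> \<le> 1" by (auto simp: G_def infdist_nonneg)
        then show "norm (of_real (G n (cis \<theta>)) * u \<theta>) \<le> norm (u \<theta>)"
          unfolding norm_mult norm_of_real using mult_right_mono[of "\<bar>G n (cis \<theta>)\<bar>" 1 "norm (u \<theta>)"] by simp
      qed
    qed (use u Gm Km in auto)
    then show ?thesis using cont0[OF Gc] LIMSEQ_const_iff by (simp add: LIMSEQ_const_iff)
  qed simp
qed

section \<open>Weighted spaces\<close>

definition energy :: "real \<Rightarrow> (real \<Rightarrow> complex^'n^'n) \<Rightarrow> (real \<Rightarrow> complex^'n) \<Rightarrow> real" where
  "energy \<alpha> F a = (LINT \<theta>|circ. qform \<alpha> (F \<theta>) (a \<theta>))"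

lemma integrable_vec_nth:
  fixes f :: "'a \<Rightarrow> 'b::euclidean_space^'n"
  shows "integrable M f \<Longrightarrow> integrable M (\<lambda>x. f x $ i)"
  by (rule integrable_bounded_linear[OF bounded_linear_vec_nth])

text \<open>Minimality is kept out of this locale because it concerns the sum of the two densities,
  while each density separately has to be a weight.\<close>

locale weight =
  fixes \<alpha> :: real and F :: "real \<Rightarrow> complex^'n^'n"
  assumes \<alpha>: "1 < \<alpha>" "\<alpha> \<le> 2"
    and integrable_F: "integrable circ F"
    and cov: "AE \<theta> in circ. covariation_matrix \<alpha> (F \<theta>)"
begin

lemma F_measurable [measurable]: "F \<in> borel_measurable circ"
  using integrable_F by simp

lemma wform_measurable:
  assumes [measurable]: "a \<in> borel_measurable circ" "b \<in> borel_measurable circ"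
  shows "wform \<alpha> F a b \<in> borel_measurable circ"
proof -
  have "(\<lambda>\<theta>. bform \<alpha> (F \<theta>) (a \<theta>) (b \<theta>)) \<in> borel_measurable circ"
    unfolding bform_eq_sum by measurable
  then show ?thesis by (simp add: wform_eq_bform[abs_def])
qed

lemma qform_measurable [measurable (raw)]:
  assumes "a \<in> borel_measurable circ"
  shows "(\<lambda>\<theta>. qform \<alpha> (F \<theta>) (a \<theta>)) \<in> borel_measurable circ"
  using wform_measurable[OF assms assms] unfolding qform_def wform_eq_bform[abs_def] by measurable

lemma AE_qform_nonneg: "AE \<theta> in circ. \<forall>v. 0 \<le> qform \<alpha> (F \<theta>) v"
  using cov by eventually_elim (simp add: qform_nonneg[OF \<alpha>])

lemma L_alpha_iff:
  "a \<in> L_alpha \<alpha> F \<longleftrightarrow> a \<in> borel_measurable circ \<and> integrable circ (\<lambda>\<theta>. qform \<alpha> (F \<theta>) (a \<theta>))"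
proof -
  have "integrable circ (wform \<alpha> F a a) \<longleftrightarrow> integrable circ (\<lambda>\<theta>. qform \<alpha> (F \<theta>) (a \<theta>))"
    if a: "a \<in> borel_measurable circ"
  proof
    assume "integrable circ (wform \<alpha> F a a)"
    then have "integrable circ (\<lambda>\<theta>. Re (wform \<alpha> F a a \<theta>))" by simp
    then show "integrable circ (\<lambda>\<theta>. qform \<alpha> (F \<theta>) (a \<theta>))" by (simp add: qform_def wform_eq_bform)
  next
    assume "integrable circ (\<lambda>\<theta>. qform \<alpha> (F \<theta>) (a \<theta>))"
    then have i: "integrable circ (\<lambda>\<theta>. complex_of_real (qform \<alpha> (F \<theta>) (a \<theta>)))" by simp
    show "integrable circ (wform \<alpha> F a a)"
    proof (rule integrable_cong_AE_imp[OF i wform_measurable[OF a a]])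
      show "AE \<theta> in circ. complex_of_real (qform \<alpha> (F \<theta>) (a \<theta>)) = wform \<alpha> F a a \<theta>"
        using cov by eventually_elim (simp add: wform_eq_bform bform_self[OF \<alpha>])
    qed
  qed
  then show ?thesis by (auto simp: L_alpha_def)
qed

lemma L_alpha_measurable: "a \<in> L_alpha \<alpha> F \<Longrightarrow> a \<in> borel_measurable circ"
  and L_alpha_integrable_qform: "a \<in> L_alpha \<alpha> F \<Longrightarrow> integrable circ (\<lambda>\<theta>. qform \<alpha> (F \<theta>) (a \<theta>))"
  by (simp_all add: L_alpha_iff)

lemma LINT_wform:
  assumes "a \<in> borel_measurable circ"
  shows "(LINT \<theta>|circ. wform \<alpha> F a a \<theta>) = of_real (energy \<alpha> F a)"
proof -
  have "(LINT \<theta>|circ. wform \<alpha> F a a \<theta>) = (LINT \<theta>|circ. complex_of_real (qform \<alpha> (F \<theta>) (a \<theta>)))"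
  proof (rule integral_cong_AE)
    show "AE \<theta> in circ. wform \<alpha> F a a \<theta> = complex_of_real (qform \<alpha> (F \<theta>) (a \<theta>))"
      using cov by eventually_elim (simp add: wform_eq_bform bform_self[OF \<alpha>])
  qed (use assms wform_measurable in measurable)
  then show ?thesis by (simp add: energy_def)
qed

lemma energy_nonneg: "0 \<le> energy \<alpha> F a"
  unfolding energy_def by (rule integral_nonneg_AE) (use AE_qform_nonneg in \<open>eventually_elim, simp\<close>)

lemma bounded_in_L_alpha:
  assumes [measurable]: "a \<in> borel_measurable circ" and B: "\<And>\<theta>. norm (a \<theta>) \<le> B"
  shows "a \<in> L_alpha \<alpha> F"
proof -
  have B0: "0 \<le> B" using B[of 0] norm_ge_zero order_trans by blast
  have "integrable circ (\<lambda>\<theta>. \<Sum>i\<in>UNIV. \<Sum>j\<in>UNIV. (a \<theta> $ i * spow (\<alpha> - 1) (a \<theta> $ j)) * F \<theta> $ i $ j)"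
  proof (intro Bochner_Integration.integrable_sum integrable_bounded_mult[where B = "B * B powr (\<alpha> - 1)"])
    fix i j \<theta>
    have c: "norm (a \<theta> $ k) \<le> B" for k using B[of \<theta>] Finite_Cartesian_Product.norm_nth_le[of "a \<theta>" k] by simp
    show "norm (a \<theta> $ i * spow (\<alpha> - 1) (a \<theta> $ j)) \<le> B * B powr (\<alpha> - 1)"
      unfolding norm_mult norm_spow using c \<alpha> B0 by (intro mult_mono powr_mono2) auto
  qed (auto intro!: integrable_vec_nth integrable_F)
  then have "integrable circ (wform \<alpha> F a a)"
    by (simp add: wform_eq_bform[abs_def] bform_eq_sum mult_ac)
  then show ?thesis by (simp add: L_alpha_def)
qed

lemma L_alpha_add:
  assumes "a \<in> L_alpha \<alpha> F" "b \<in> L_alpha \<alpha> F"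
  shows "(\<lambda>\<theta>. a \<theta> + b \<theta>) \<in> L_alpha \<alpha> F"
proof -
  have [measurable]: "a \<in> borel_measurable circ" "b \<in> borel_measurable circ"
    using assms L_alpha_measurable by auto
  have "integrable circ (\<lambda>\<theta>. qform \<alpha> (F \<theta>) (a \<theta> + b \<theta>))"
  proof (rule Bochner_Integration.integrable_bound)
    show "integrable circ (\<lambda>\<theta>. 2 * (qform \<alpha> (F \<theta>) (a \<theta>) + qform \<alpha> (F \<theta>) (b \<theta>)))"
      using assms[THEN L_alpha_integrable_qform] by auto
    show "AE \<theta> in circ. norm (qform \<alpha> (F \<theta>) (a \<theta> + b \<theta>))
        \<le> norm (2 * (qform \<alpha> (F \<theta>) (a \<theta>) + qform \<alpha> (F \<theta>) (b \<theta>)))"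
      using cov by eventually_elim (use qform_add_le[OF \<alpha>] qform_nonneg[OF \<alpha>] in force)
  qed measurable
  then show ?thesis by (simp add: L_alpha_iff)
qed

lemma L_alpha_scale:
  assumes "a \<in> L_alpha \<alpha> F"
  shows "(\<lambda>\<theta>. z *s a \<theta>) \<in> L_alpha \<alpha> F"
proof -
  have [measurable]: "a \<in> borel_measurable circ" using assms L_alpha_measurable by auto
  have "(\<lambda>v :: complex^'n. z *s v) \<in> borel_measurable borel"
    by (intro borel_measurable_continuous_onI) (simp add: vector_scalar_mult_def continuous_intros continuous_on_vec_lambda)
  then have [measurable]: "(\<lambda>\<theta>. z *s a \<theta>) \<in> borel_measurable circ" by measurable
  show ?thesis using L_alpha_integrable_qform[OF assms] by (simp add: L_alpha_iff qform_scale)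
qed

lemma L_alpha_uminus: "a \<in> L_alpha \<alpha> F \<Longrightarrow> (\<lambda>\<theta>. - a \<theta>) \<in> L_alpha \<alpha> F"
  by (simp add: L_alpha_iff qform_uminus)

lemma L_alpha_diff:
  "a \<in> L_alpha \<alpha> F \<Longrightarrow> b \<in> L_alpha \<alpha> F \<Longrightarrow> (\<lambda>\<theta>. a \<theta> - b \<theta>) \<in> L_alpha \<alpha> F"
  using L_alpha_add[OF _ L_alpha_uminus, of a b] by simp

lemma energy_mono_AE:
  assumes "a \<in> L_alpha \<alpha> F" "integrable circ w" "AE \<theta> in circ. qform \<alpha> (F \<theta>) (a \<theta>) \<le> w \<theta>"
  shows "energy \<alpha> F a \<le> integral\<^sup>L circ w"
  unfolding energy_def using assms L_alpha_integrable_qform by (intro integral_mono_AE) auto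

lemma energy_add_le:
  assumes "a \<in> L_alpha \<alpha> F" "b \<in> L_alpha \<alpha> F"
  shows "energy \<alpha> F (\<lambda>\<theta>. a \<theta> + b \<theta>) \<le> 2 * (energy \<alpha> F a + energy \<alpha> F b)"
proof -
  have "energy \<alpha> F (\<lambda>\<theta>. a \<theta> + b \<theta>) \<le> (LINT \<theta>|circ. 2 * (qform \<alpha> (F \<theta>) (a \<theta>) + qform \<alpha> (F \<theta>) (b \<theta>)))"
  proof (rule energy_mono_AE[OF L_alpha_add[OF assms]])
    show "AE \<theta> in circ. qform \<alpha> (F \<theta>) (a \<theta> + b \<theta>) \<le> 2 * (qform \<alpha> (F \<theta>) (a \<theta>) + qform \<alpha> (F \<theta>) (b \<theta>))"
      using cov by eventually_elim (rule qform_add_le[OF \<alpha>])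
  qed (use assms[THEN L_alpha_integrable_qform] in auto)
  then show ?thesis
    using assms[THEN L_alpha_integrable_qform] by (simp add: energy_def)
qed

lemma energy_minus_commute: "energy \<alpha> F (\<lambda>\<theta>. a \<theta> - b \<theta>) = energy \<alpha> F (\<lambda>\<theta>. b \<theta> - a \<theta>)"
  unfolding energy_def by (subst qform_minus_commute) simp

lemma energy_triangle:
  assumes "(\<lambda>\<theta>. a \<theta> - b \<theta>) \<in> L_alpha \<alpha> F" "(\<lambda>\<theta>. b \<theta> - c \<theta>) \<in> L_alpha \<alpha> F"
  shows "energy \<alpha> F (\<lambda>\<theta>. a \<theta> - c \<theta>)
    \<le> 2 * (energy \<alpha> F (\<lambda>\<theta>. a \<theta> - b \<theta>) + energy \<alpha> F (\<lambda>\<theta>. b \<theta> - c \<theta>))"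
  using energy_add_le[OF assms] by simp

lemma L_alpha_tendsto_iff:
  "L_alpha_tendsto \<alpha> F p a \<longleftrightarrow> (\<forall>n. (\<lambda>\<theta>. p n \<theta> - a \<theta>) \<in> L_alpha \<alpha> F) \<and>
     (\<lambda>n. energy \<alpha> F (\<lambda>\<theta>. p n \<theta> - a \<theta>)) \<longlonglongrightarrow> 0"
proof -
  have "((\<lambda>n. LINT \<theta>|circ. wform \<alpha> F (\<lambda>\<theta>. p n \<theta> - a \<theta>) (\<lambda>\<theta>. p n \<theta> - a \<theta>) \<theta>) \<longlonglongrightarrow> 0) \<longleftrightarrow>
      (\<lambda>n. energy \<alpha> F (\<lambda>\<theta>. p n \<theta> - a \<theta>)) \<longlonglongrightarrow> 0"
    if "\<forall>n. (\<lambda>\<theta>. p n \<theta> - a \<theta>) \<in> L_alpha \<alpha> F"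
  proof -
    have "(LINT \<theta>|circ. wform \<alpha> F (\<lambda>\<theta>. p n \<theta> - a \<theta>) (\<lambda>\<theta>. p n \<theta> - a \<theta>) \<theta>)
        = of_real (energy \<alpha> F (\<lambda>\<theta>. p n \<theta> - a \<theta>))" for n
      using that by (intro LINT_wform L_alpha_measurable) auto
    then show ?thesis using tendsto_of_real_iff[where c = 0 and 'a = complex] by simp
  qed
  then show ?thesis unfolding L_alpha_tendsto_def by blast
qed

lemma wform_integrable:
  assumes "a \<in> L_alpha \<alpha> F" "b \<in> L_alpha \<alpha> F"
  shows "integrable circ (wform \<alpha> F a b)"
proof (rule Bochner_Integration.integrable_bound)
  show "integrable circ (\<lambda>\<theta>. qform \<alpha> (F \<theta>) (a \<theta>) + qform \<alpha> (F \<theta>) (b \<theta>))"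
    using assms[THEN L_alpha_integrable_qform] by auto
  show "AE \<theta> in circ. norm (wform \<alpha> F a b \<theta>) \<le> norm (qform \<alpha> (F \<theta>) (a \<theta>) + qform \<alpha> (F \<theta>) (b \<theta>))"
    using cov
  proof eventually_elim
    case (elim \<theta>)
    then show ?case using norm_bform_le[OF \<alpha> elim, of "a \<theta>" "b \<theta>"]
      by (simp add: wform_eq_bform)
  qed
qed (use assms L_alpha_measurable wform_measurable in auto)

lemma energy_gradient:
  assumes "a \<in> L_alpha \<alpha> F" "b \<in> L_alpha \<alpha> F"
  shows "energy \<alpha> F b + \<alpha> * Re (LINT \<theta>|circ. wform \<alpha> F (\<lambda>\<theta>. a \<theta> - b \<theta>) b \<theta>) \<le> energy \<alpha> F a"
proof -
  have i: "integrable circ (wform \<alpha> F (\<lambda>\<theta>. a \<theta> - b \<theta>) b)"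
    using assms by (intro wform_integrable L_alpha_diff)
  have "(LINT \<theta>|circ. qform \<alpha> (F \<theta>) (b \<theta>) + \<alpha> * Re (wform \<alpha> F (\<lambda>\<theta>. a \<theta> - b \<theta>) b \<theta>))
      \<le> (LINT \<theta>|circ. qform \<alpha> (F \<theta>) (a \<theta>))"
  proof (rule integral_mono_AE)
    show "AE \<theta> in circ. qform \<alpha> (F \<theta>) (b \<theta>) + \<alpha> * Re (wform \<alpha> F (\<lambda>\<theta>. a \<theta> - b \<theta>) b \<theta>)
        \<le> qform \<alpha> (F \<theta>) (a \<theta>)"
      using cov by eventually_elim (simp add: wform_eq_bform qform_gradient[OF \<alpha>])
  qed (use i assms[THEN L_alpha_integrable_qform] in auto)
  then show ?thesis
    using i assms[THEN L_alpha_integrable_qform] by (simp add: energy_def integral_Re)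
qed

lemma norm_LINT_wform_le:
  assumes "a \<in> L_alpha \<alpha> F" "b \<in> L_alpha \<alpha> F" "0 < \<tau>"
  shows "norm (LINT \<theta>|circ. wform \<alpha> F a b \<theta>) \<le> \<tau> powr (1 - \<alpha>) * energy \<alpha> F a + \<tau> * energy \<alpha> F b"
proof -
  have "norm (LINT \<theta>|circ. wform \<alpha> F a b \<theta>) \<le> (LINT \<theta>|circ. norm (wform \<alpha> F a b \<theta>))"
    by (rule integral_norm_bound)
  also have "\<dots> \<le> (LINT \<theta>|circ. \<tau> powr (1 - \<alpha>) * qform \<alpha> (F \<theta>) (a \<theta>) + \<tau> * qform \<alpha> (F \<theta>) (b \<theta>))"
  proof (rule integral_mono_AE)
    show "AE \<theta> in circ. norm (wform \<alpha> F a b \<theta>)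
        \<le> \<tau> powr (1 - \<alpha>) * qform \<alpha> (F \<theta>) (a \<theta>) + \<tau> * qform \<alpha> (F \<theta>) (b \<theta>)"
      using cov by eventually_elim (simp add: wform_eq_bform norm_bform_le_scaled[OF \<alpha>] assms(3))
  qed (use assms(1,2)[THEN L_alpha_integrable_qform] wform_integrable[OF assms(1,2)] in auto)
  finally show ?thesis
    using assms(1,2)[THEN L_alpha_integrable_qform] by (simp add: energy_def)
qed

text \<open>The gradient inequality, used in both directions, bounds the difference of two energies
  by a pairing, and the pairing is split with \<tau>: first \<tau> is fixed small against the limit
  energy, then \<open>n\<close> is taken large.\<close>

lemma energy_tendsto:
  assumes "L_alpha_tendsto \<alpha> F p a" "a \<in> L_alpha \<alpha> F"
  shows "(\<lambda>n. energy \<alpha> F (p n)) \<longlonglongrightarrow> energy \<alpha> F a"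
proof -
  let ?d = "\<lambda>n. energy \<alpha> F (\<lambda>\<theta>. p n \<theta> - a \<theta>)"
  have d: "(\<lambda>\<theta>. p n \<theta> - a \<theta>) \<in> L_alpha \<alpha> F" "?d \<longlonglongrightarrow> 0" for n
    using assms(1) by (auto simp: L_alpha_tendsto_iff)
  have p: "p n \<in> L_alpha \<alpha> F" for n using L_alpha_add[OF d(1) assms(2)] by simp
  have comp: "energy \<alpha> F b - energy \<alpha> F c \<le> \<alpha> * (\<tau> powr (1 - \<alpha>) * energy \<alpha> F (\<lambda>\<theta>. c \<theta> - b \<theta>) + \<tau> * energy \<alpha> F b)"
    if bc: "b \<in> L_alpha \<alpha> F" "c \<in> L_alpha \<alpha> F" and "0 < \<tau>" for b c \<tau>
  proof -
    have "- Re (LINT \<theta>|circ. wform \<alpha> F (\<lambda>\<theta>. c \<theta> - b \<theta>) b \<theta>)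
        \<le> \<tau> powr (1 - \<alpha>) * energy \<alpha> F (\<lambda>\<theta>. c \<theta> - b \<theta>) + \<tau> * energy \<alpha> F b"
      using norm_LINT_wform_le[OF L_alpha_diff[OF bc(2,1)] bc(1) \<open>0 < \<tau>\<close>]
        abs_Re_le_cmod[of "LINT \<theta>|circ. wform \<alpha> F (\<lambda>\<theta>. c \<theta> - b \<theta>) b \<theta>"] by linarith
    then have "\<alpha> * - Re (LINT \<theta>|circ. wform \<alpha> F (\<lambda>\<theta>. c \<theta> - b \<theta>) b \<theta>)
        \<le> \<alpha> * (\<tau> powr (1 - \<alpha>) * energy \<alpha> F (\<lambda>\<theta>. c \<theta> - b \<theta>) + \<tau> * energy \<alpha> F b)"
      using \<alpha> by (intro mult_left_mono) auto
    then show ?thesis using energy_gradient[OF bc(2,1)] by simp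
  qed
  have bound: "\<bar>energy \<alpha> F (p n) - energy \<alpha> F a\<bar>
      \<le> \<alpha> * (\<tau> powr (1 - \<alpha>) * ?d n + \<tau> * (2 * ?d n + 2 * energy \<alpha> F a))" if "0 < \<tau>" for \<tau> n
  proof -
    have b: "energy \<alpha> F (p n) \<le> 2 * ?d n + 2 * energy \<alpha> F a"
      using energy_add_le[OF d(1) assms(2)] by simp
    have 1: "energy \<alpha> F (p n) - energy \<alpha> F a \<le> \<alpha> * (\<tau> powr (1 - \<alpha>) * ?d n + \<tau> * energy \<alpha> F (p n))"
      using comp[OF p assms(2) that] by (subst (asm) energy_minus_commute)
    have 2: "energy \<alpha> F a - energy \<alpha> F (p n) \<le> \<alpha> * (\<tau> powr (1 - \<alpha>) * ?d n + \<tau> * energy \<alpha> F a)"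
      using comp[OF assms(2) p that] .
    have m: "\<alpha> * (\<tau> powr (1 - \<alpha>) * ?d n + \<tau> * x) \<le> \<alpha> * (\<tau> powr (1 - \<alpha>) * ?d n + \<tau> * y)" if "x \<le> y" for x y
      using that \<open>0 < \<tau>\<close> \<alpha> by (intro mult_left_mono add_left_mono) auto
    have "energy \<alpha> F a \<le> 2 * ?d n + 2 * energy \<alpha> F a" using energy_nonneg[of a] energy_nonneg[of "\<lambda>\<theta>. p n \<theta> - a \<theta>"] by linarith
    from m[OF this] m[OF b] 1 2 show ?thesis by linarith
  qed
  show ?thesis
  proof (rule LIMSEQ_I)
    fix r :: real assume r: "0 < r"
    define E where "E = energy \<alpha> F a"
    \<comment> \<open>The bound tends to \<open>\<alpha> * (2 * \<tau> * E)\<close>, which this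
      choice keeps at most \<open>r / 2\<close>; the summand 1 allows \<open>E = 0\<close>.\<close>
    define \<tau> where "\<tau> = r / (4 * \<alpha> * (E + 1))"
    have E: "0 \<le> E" by (simp add: E_def energy_nonneg)
    have \<tau>: "0 < \<tau>" using r \<alpha> E by (simp add: \<tau>_def)
    have "\<alpha> * (2 * \<tau> * E) < r"
    proof -
      have "\<alpha> * (2 * \<tau> * E) = r / 2 * (E / (E + 1))" using \<alpha> E by (simp add: \<tau>_def)
      also have "\<dots> \<le> r / 2 * 1" using r E by (intro mult_left_mono) auto
      finally show ?thesis using r by simp
    qed
    moreover have "(\<lambda>n. \<alpha> * (\<tau> powr (1 - \<alpha>) * ?d n + \<tau> * (2 * ?d n + 2 * E)))
        \<longlonglongrightarrow> \<alpha> * (\<tau> powr (1 - \<alpha>) * 0 + \<tau> * (2 * 0 + 2 * E))"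
      by (intro tendsto_intros d(2))
    ultimately have "\<forall>\<^sub>F n in sequentially. \<alpha> * (\<tau> powr (1 - \<alpha>) * ?d n + \<tau> * (2 * ?d n + 2 * E)) < r"
      by (intro order_tendstoD(2)[where y = "\<alpha> * (\<tau> powr (1 - \<alpha>) * 0 + \<tau> * (2 * 0 + 2 * E))"]) (auto simp: mult_ac)
    then show "\<exists>n0. \<forall>n\<ge>n0. norm (energy \<alpha> F (p n) - energy \<alpha> F a) < r"
      unfolding eventually_sequentially using bound[OF \<tau>] unfolding E_def real_norm_def
      by (meson order_le_less_trans)
  qed
qed

text \<open>Continuity of the gradient along a line through \<open>a\<close>. The form is pointwise
  jointly continuous, and \<open>norm (z n) \<le> 1\<close> provides a majorant that does not depend
  on \<open>n\<close>.\<close>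

lemma LINT_wform_tendsto:
  assumes u: "u \<in> L_alpha \<alpha> F" and a: "a \<in> L_alpha \<alpha> F" and z: "z \<longlonglongrightarrow> 0" "\<And>n. norm (z n) \<le> 1"
  shows "(\<lambda>n. LINT \<theta>|circ. wform \<alpha> F u (\<lambda>\<theta>. a \<theta> + z n *s u \<theta>) \<theta>) \<longlonglongrightarrow> (LINT \<theta>|circ. wform \<alpha> F u a \<theta>)"
proof (rule integral_dominated_convergence
    [where w = "\<lambda>\<theta>. qform \<alpha> (F \<theta>) (u \<theta>) + 2 * (qform \<alpha> (F \<theta>) (a \<theta>) + qform \<alpha> (F \<theta>) (u \<theta>))"])
  show "wform \<alpha> F u a \<in> borel_measurable circ" "\<And>n. wform \<alpha> F u (\<lambda>\<theta>. a \<theta> + z n *s u \<theta>) \<in> borel_measurable circ"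
    using u a by (auto intro!: wform_measurable L_alpha_measurable L_alpha_add L_alpha_scale)
  show "integrable circ (\<lambda>\<theta>. qform \<alpha> (F \<theta>) (u \<theta>) + 2 * (qform \<alpha> (F \<theta>) (a \<theta>) + qform \<alpha> (F \<theta>) (u \<theta>)))"
    using u a by (auto dest!: L_alpha_integrable_qform)
  show "AE \<theta> in circ. (\<lambda>n. wform \<alpha> F u (\<lambda>\<theta>. a \<theta> + z n *s u \<theta>) \<theta>) \<longlonglongrightarrow> wform \<alpha> F u a \<theta>"
  proof (rule AE_I2)
    fix \<theta>
    have "isCont (\<lambda>p. bform \<alpha> (F \<theta>) (fst p) (snd p)) (u \<theta>, a \<theta>)"
      using continuous_bform[OF \<alpha>(1), of "F \<theta>"]
      unfolding continuous_on_eq_continuous_at[OF open_UNIV] by blast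
    moreover have "(\<lambda>n. (u \<theta>, a \<theta> + z n *s u \<theta>)) \<longlonglongrightarrow> (u \<theta>, a \<theta>)"
    proof -
      have "(\<lambda>n. z n *s u \<theta>) \<longlonglongrightarrow> 0"
        unfolding vector_scalar_mult_def by (rule vec_tendstoI) (auto intro!: tendsto_mult_left_zero z)
      then show ?thesis using tendsto_Pair[OF tendsto_const tendsto_add[OF tendsto_const]] by fastforce
    qed
    ultimately show "(\<lambda>n. wform \<alpha> F u (\<lambda>\<theta>. a \<theta> + z n *s u \<theta>) \<theta>) \<longlonglongrightarrow> wform \<alpha> F u a \<theta>"
      using isCont_tendsto_compose by (fastforce simp: wform_eq_bform)
  qed
  show "AE \<theta> in circ. norm (wform \<alpha> F u (\<lambda>\<theta>. a \<theta> + z n *s u \<theta>) \<theta>)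
      \<le> qform \<alpha> (F \<theta>) (u \<theta>) + 2 * (qform \<alpha> (F \<theta>) (a \<theta>) + qform \<alpha> (F \<theta>) (u \<theta>))" for n
    using cov
  proof eventually_elim
    case (elim \<theta>)
    have "norm (z n) powr \<alpha> \<le> 1" using z(2)[of n] \<alpha> by (simp add: powr_le1)
    then have "qform \<alpha> (F \<theta>) (z n *s u \<theta>) \<le> qform \<alpha> (F \<theta>) (u \<theta>)"
      unfolding qform_scale using qform_nonneg[OF \<alpha> elim] by (simp add: mult_left_le_one_le)
    then show ?case
      using norm_bform_le[OF \<alpha> elim, of "u \<theta>" "a \<theta> + z n *s u \<theta>"] qform_add_le[OF \<alpha> elim, of "a \<theta>" "z n *s u \<theta>"]
      by (simp add: wform_eq_bform)
  qed
qed

text \<open>The pointwise inequality is a hypothesis so that one constant \<open>C\<close> can serve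
  the two weights \<open>f\<close> and \<open>g\<close> at once.\<close>

lemma energy_midpoint_gap:
  assumes ab: "a \<in> L_alpha \<alpha> F" "b \<in> L_alpha \<alpha> F"
    and C: "\<And>(A :: complex^'n^'n) u v. covariation_matrix \<alpha> A \<Longrightarrow>
       qform \<alpha> A (u - v) \<le> \<epsilon> * (qform \<alpha> A u + qform \<alpha> A v)
         + C * ((qform \<alpha> A u + qform \<alpha> A v) / 2 - qform \<alpha> A ((1/2) *s (u + v)))"
  shows "energy \<alpha> F (\<lambda>\<theta>. a \<theta> - b \<theta>) \<le> \<epsilon> * (energy \<alpha> F a + energy \<alpha> F b)
         + C * ((energy \<alpha> F a + energy \<alpha> F b) / 2 - energy \<alpha> F (\<lambda>\<theta>. (1/2) *s (a \<theta> + b \<theta>)))"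
proof -
  note int = ab[THEN L_alpha_integrable_qform] L_alpha_integrable_qform[OF L_alpha_scale[OF L_alpha_add[OF ab], of "1/2"]]
  have "energy \<alpha> F (\<lambda>\<theta>. a \<theta> - b \<theta>) \<le> (LINT \<theta>|circ. \<epsilon> * (qform \<alpha> (F \<theta>) (a \<theta>) + qform \<alpha> (F \<theta>) (b \<theta>))
         + C * ((qform \<alpha> (F \<theta>) (a \<theta>) + qform \<alpha> (F \<theta>) (b \<theta>)) / 2 - qform \<alpha> (F \<theta>) ((1/2) *s (a \<theta> + b \<theta>))))"
  proof (rule energy_mono_AE[OF L_alpha_diff[OF ab]])
    show "AE \<theta> in circ. qform \<alpha> (F \<theta>) (a \<theta> - b \<theta>) \<le> \<epsilon> * (qform \<alpha> (F \<theta>) (a \<theta>) + qform \<alpha> (F \<theta>) (b \<theta>))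
         + C * ((qform \<alpha> (F \<theta>) (a \<theta>) + qform \<alpha> (F \<theta>) (b \<theta>)) / 2 - qform \<alpha> (F \<theta>) ((1/2) *s (a \<theta> + b \<theta>)))"
      using cov by eventually_elim (rule C)
  qed (use int in \<open>simp del: vector_add_ldistrib\<close>)
  then show ?thesis using int by (simp add: energy_def del: vector_add_ldistrib)
qed

end

section \<open>Trigonometric polynomials with a gap in the frequencies\<close>

lemma trig_span_add:
  assumes "p \<in> trig_span N" "q \<in> trig_span N"
  shows "(\<lambda>\<theta>. p \<theta> + q \<theta>) \<in> trig_span N"
proof -
  obtain F v where p: "p = (\<lambda>\<theta>. \<Sum>j\<in>F. cis (of_int j * \<theta>) *s v j)" "finite F" "F \<subseteq> - {0..int N}"
    using assms(1) by (auto simp: trig_span_def)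
  obtain G w where q: "q = (\<lambda>\<theta>. \<Sum>j\<in>G. cis (of_int j * \<theta>) *s w j)" "finite G" "G \<subseteq> - {0..int N}"
    using assms(2) by (auto simp: trig_span_def)
  let ?v = "\<lambda>j. (if j \<in> F then v j else 0) + (if j \<in> G then w j else 0)"
  have "p \<theta> + q \<theta> = (\<Sum>j\<in>F \<union> G. cis (of_int j * \<theta>) *s ?v j)" for \<theta>
  proof -
    have "p \<theta> = (\<Sum>j\<in>F \<union> G. cis (of_int j * \<theta>) *s (if j \<in> F then v j else 0))"
      unfolding p(1) using p(2) q(2) by (intro sum.mono_neutral_cong_left) auto
    moreover have "q \<theta> = (\<Sum>j\<in>F \<union> G. cis (of_int j * \<theta>) *s (if j \<in> G then w j else 0))"
      unfolding q(1) using p(2) q(2) by (intro sum.mono_neutral_cong_left) auto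
    ultimately show ?thesis by (simp add: vector_add_ldistrib sum.distrib)
  qed
  then show ?thesis using p q unfolding trig_span_def
    by (intro CollectI exI[of _ "F \<union> G"] exI[of _ ?v]) auto
qed

lemma trig_span_scale:
  assumes "p \<in> trig_span N"
  shows "(\<lambda>\<theta>. z *s p \<theta>) \<in> trig_span N"
proof -
  obtain F v where p: "p = (\<lambda>\<theta>. \<Sum>j\<in>F. cis (of_int j * \<theta>) *s v j)" "finite F" "F \<subseteq> - {0..int N}"
    using assms(1) by (auto simp: trig_span_def)
  have "z *s p \<theta> = (\<Sum>j\<in>F. cis (of_int j * \<theta>) *s (z *s v j))" for \<theta>
    by (simp add: p vec_eq_iff sum_distrib_left mult_ac)
  then show ?thesis using p unfolding trig_span_def
    by (intro CollectI exI[of _ F] exI[of _ "\<lambda>j. z *s v j"]) auto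
qed

lemma trig_monomial_in_span: "j \<notin> {0..int N} \<Longrightarrow> (\<lambda>\<theta>. cis (of_int j * \<theta>) *s v) \<in> trig_span N"
  unfolding trig_span_def by (intro CollectI exI[of _ "{j}"] exI[of _ "\<lambda>_. v"]) auto

lemma trig_sum_measurable:
  "(\<lambda>\<theta>. \<Sum>j\<in>J. cis (x j * \<theta>) *s v j) \<in> borel_measurable circ"
proof -
  have "continuous_on UNIV (\<lambda>\<theta>. \<Sum>j\<in>J. cis (x j * \<theta>) *s v j)"
    unfolding vector_scalar_mult_def by (intro continuous_intros continuous_on_vec_lambda)
  then show ?thesis by (rule borel_measurable_continuous_on) measurable
qed

lemma norm_vector_scalar_mult: "norm (z *s (v :: complex^'n)) = norm z * norm v"
  by (simp add: norm_vec_def norm_mult L2_set_right_distrib)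

lemma norm_trig_sum_le: "norm (\<Sum>j\<in>J. cis (x j * \<theta>) *s v j) \<le> (\<Sum>j\<in>J. norm (v j))"
  by (rule order_trans[OF norm_sum]) (simp add: norm_vector_scalar_mult)

context weight
begin

lemma trig_sum_in_L_alpha: "(\<lambda>\<theta>. \<Sum>j\<in>J. cis (x j * \<theta>) *s v j) \<in> L_alpha \<alpha> F"
  using trig_sum_measurable norm_trig_sum_le by (rule bounded_in_L_alpha)

lemma trig_span_in_L_alpha: "p \<in> trig_span N \<Longrightarrow> p \<in> L_alpha \<alpha> F"
  by (auto simp: trig_span_def intro: trig_sum_in_L_alpha)

lemma L_alpha_tendsto_add_scale:
  assumes p: "L_alpha_tendsto \<alpha> F p a" and q: "L_alpha_tendsto \<alpha> F q b"
  shows "L_alpha_tendsto \<alpha> F (\<lambda>n \<theta>. p n \<theta> + z *s q n \<theta>) (\<lambda>\<theta>. a \<theta> + z *s b \<theta>)"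
proof -
  let ?r = "\<lambda>n \<theta>. p n \<theta> + z *s q n \<theta>"
  have eq: "?r n \<theta> - (a \<theta> + z *s b \<theta>) = (p n \<theta> - a \<theta>) + z *s (q n \<theta> - b \<theta>)" for n \<theta>
    by (simp add: vec_eq_iff algebra_simps)
  have L: "(\<lambda>\<theta>. p n \<theta> - a \<theta>) \<in> L_alpha \<alpha> F" "(\<lambda>\<theta>. z *s (q n \<theta> - b \<theta>)) \<in> L_alpha \<alpha> F" for n
    using p q L_alpha_scale[of "\<lambda>\<theta>. q n \<theta> - b \<theta>" z] unfolding L_alpha_tendsto_iff by blast+
  have "(\<lambda>n. energy \<alpha> F (\<lambda>\<theta>. ?r n \<theta> - (a \<theta> + z *s b \<theta>))) \<longlonglongrightarrow> 0"
  proof (rule tendsto_sandwich[of "\<lambda>_. 0"])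
    show "\<forall>\<^sub>F n in sequentially. energy \<alpha> F (\<lambda>\<theta>. ?r n \<theta> - (a \<theta> + z *s b \<theta>))
        \<le> 2 * (energy \<alpha> F (\<lambda>\<theta>. p n \<theta> - a \<theta>) + norm z powr \<alpha> * energy \<alpha> F (\<lambda>\<theta>. q n \<theta> - b \<theta>))"
      using energy_add_le[OF L] unfolding eq
      by (auto simp add: energy_def qform_scale simp del: vector_ssub_ldistrib)
    have "(\<lambda>n. 2 * (energy \<alpha> F (\<lambda>\<theta>. p n \<theta> - a \<theta>) + norm z powr \<alpha> * energy \<alpha> F (\<lambda>\<theta>. q n \<theta> - b \<theta>)))
        \<longlonglongrightarrow> 2 * (0 + norm z powr \<alpha> * 0)"
      using p q by (intro tendsto_intros) (auto simp: L_alpha_tendsto_iff)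
    then show "(\<lambda>n. 2 * (energy \<alpha> F (\<lambda>\<theta>. p n \<theta> - a \<theta>) + norm z powr \<alpha> * energy \<alpha> F (\<lambda>\<theta>. q n \<theta> - b \<theta>)))
        \<longlonglongrightarrow> 0" by simp
  qed (auto simp: energy_nonneg)
  then show ?thesis
    unfolding L_alpha_tendsto_iff eq using L_alpha_add[OF L] by simp
qed

lemma L_alpha_N_add_scale:
  assumes "a \<in> L_alpha_N \<alpha> F N" "b \<in> L_alpha_N \<alpha> F N"
  shows "(\<lambda>\<theta>. a \<theta> + z *s b \<theta>) \<in> L_alpha_N \<alpha> F N"
proof -
  obtain p where p: "\<And>n. p n \<in> trig_span N" "L_alpha_tendsto \<alpha> F p a" and a: "a \<in> L_alpha \<alpha> F"
    using assms(1) by (auto simp: L_alpha_N_def)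
  obtain q where q: "\<And>n. q n \<in> trig_span N" "L_alpha_tendsto \<alpha> F q b" and b: "b \<in> L_alpha \<alpha> F"
    using assms(2) by (auto simp: L_alpha_N_def)
  show ?thesis
    unfolding L_alpha_N_def using p(1) q(1) a b L_alpha_tendsto_add_scale[OF p(2) q(2), of z]
    by (auto intro!: L_alpha_add L_alpha_scale exI[of _ "\<lambda>n \<theta>. p n \<theta> + z *s q n \<theta>"] trig_span_add trig_span_scale)
qed

lemma trig_span_in_L_alpha_N: "p \<in> trig_span N \<Longrightarrow> p \<in> L_alpha_N \<alpha> F N"
proof -
  assume p: "p \<in> trig_span N"
  have "(\<lambda>\<theta>. 0 :: complex^'n) \<in> L_alpha \<alpha> F" by (rule bounded_in_L_alpha[where B = 0]) auto
  then have "L_alpha_tendsto \<alpha> F (\<lambda>n. p) p" by (simp add: L_alpha_tendsto_iff energy_def)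
  then show ?thesis using p trig_span_in_L_alpha by (auto simp: L_alpha_N_def)
qed

end

section \<open>Minimal weights\<close>

locale minimal_weight = weight +
  fixes P :: "real \<Rightarrow> complex^'n^'n"
  assumes powr: "AE \<theta> in circ. has_matrix_powr (F \<theta>) (- 1 / (\<alpha> - 1)) (P \<theta>)"
    and integrable_trace: "integrable circ (\<lambda>\<theta>. trace (P \<theta>))"
begin

lemma AE_norm_le:
  "AE \<theta> in circ. \<forall>v \<tau>. 0 < \<tau> \<longrightarrow>
     norm v \<le> CARD('n) * (qform \<alpha> (F \<theta>) v / \<tau> + \<tau> powr (1 / (\<alpha> - 1)) * Re (trace (P \<theta>)))"
  using cov powr by eventually_elim (blast intro: norm_le_qform_trace[OF \<alpha>])

lemma L_alpha_integrable:
  assumes "a \<in> L_alpha \<alpha> F"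
  shows "integrable circ a"
proof (rule Bochner_Integration.integrable_bound)
  show "integrable circ (\<lambda>\<theta>. CARD('n) * (qform \<alpha> (F \<theta>) (a \<theta>) + Re (trace (P \<theta>))))"
    using L_alpha_integrable_qform[OF assms] integrable_trace by simp
  show "AE \<theta> in circ. norm (a \<theta>) \<le> norm (CARD('n) * (qform \<alpha> (F \<theta>) (a \<theta>) + Re (trace (P \<theta>))))"
    using AE_norm_le
  proof eventually_elim
    case (elim \<theta>)
    have "norm (a \<theta>) \<le> CARD('n) * (qform \<alpha> (F \<theta>) (a \<theta>) + Re (trace (P \<theta>)))"
      using elim[rule_format, of 1 "a \<theta>"] by simp
    then show ?case by simp
  qed
qed (use assms L_alpha_measurable in auto)

lemma LINT_norm_le:
  assumes "a \<in> L_alpha \<alpha> F" "0 < \<tau>"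
  shows "(LINT \<theta>|circ. norm (a \<theta>))
    \<le> CARD('n) * (energy \<alpha> F a / \<tau> + \<tau> powr (1 / (\<alpha> - 1)) * (LINT \<theta>|circ. Re (trace (P \<theta>))))"
proof -
  note int = L_alpha_integrable_qform[OF assms(1)] integrable_trace
  have "(LINT \<theta>|circ. norm (a \<theta>)) \<le> (LINT \<theta>|circ. CARD('n) * (qform \<alpha> (F \<theta>) (a \<theta>) / \<tau>
      + \<tau> powr (1 / (\<alpha> - 1)) * Re (trace (P \<theta>))))"
    using int L_alpha_integrable[OF assms(1)] AE_norm_le assms(2)
    by (intro integral_mono_AE) (auto elim!: eventually_mono)
  then show ?thesis using int by (simp add: energy_def)
qed

text \<open>Continuity at 0 of the embedding, uniformly in \<open>a\<close>: first \<tau> is chosen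
  to make the trace term small, and then the energy has to be small compared with this fixed
  \<tau>.\<close>

lemma LINT_norm_small:
  assumes "0 < e"
  obtains d where "0 < d"
    "\<And>a. a \<in> L_alpha \<alpha> F \<Longrightarrow> energy \<alpha> F a < d \<Longrightarrow> (LINT \<theta>|circ. norm (a \<theta>)) < e"
proof -
  define R where "R = (LINT \<theta>|circ. Re (trace (P \<theta>)))"
  have "((\<lambda>\<tau>. \<tau> powr (1 / (\<alpha> - 1)) * R) \<longlongrightarrow> 0 * R) (at_right 0)"
    using \<alpha> by (intro tendsto_intros tendsto_zero_powrI[of _ _ _ "1 / (\<alpha> - 1)"])
      (auto simp: eventually_at_filter)
  then have "\<forall>\<^sub>F \<tau> in at_right 0. \<tau> powr (1 / (\<alpha> - 1)) * R < e / (2 * CARD('n))"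
    using assms by (intro order_tendstoD) auto
  then have "\<forall>\<^sub>F \<tau> in at_right 0. 0 < \<tau> \<and> \<tau> powr (1 / (\<alpha> - 1)) * R < e / (2 * CARD('n))"
    by (intro eventually_conj eventually_at_right_less)
  then obtain \<tau> where \<tau>: "0 < \<tau>" "\<tau> powr (1 / (\<alpha> - 1)) * R < e / (2 * CARD('n))"
    using eventually_happens[of _ "at_right (0::real)"] by auto
  show ?thesis
  proof (rule that[of "\<tau> * (e / (2 * CARD('n)))"])
    show "0 < \<tau> * (e / (2 * CARD('n)))" using \<tau> assms by simp
    fix a assume a: "a \<in> L_alpha \<alpha> F" "energy \<alpha> F a < \<tau> * (e / (2 * CARD('n)))"
    have "energy \<alpha> F a / \<tau> < e / (2 * CARD('n))" using a(2) \<tau>(1) by (simp add: field_simps)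
    then have "energy \<alpha> F a / \<tau> + \<tau> powr (1 / (\<alpha> - 1)) * R < e / CARD('n)" using \<tau>(2) by simp
    then have "CARD('n) * (energy \<alpha> F a / \<tau> + \<tau> powr (1 / (\<alpha> - 1)) * R) < CARD('n) * (e / CARD('n))"
      by (intro mult_strict_left_mono) auto
    then show "(LINT \<theta>|circ. norm (a \<theta>)) < e"
      using LINT_norm_le[OF a(1) \<tau>(1)] by (simp add: R_def)
  qed
qed

lemma L_alpha_tendsto_imp_L1:
  assumes "L_alpha_tendsto \<alpha> F p a"
  shows "(\<lambda>n. LINT \<theta>|circ. norm (p n \<theta> - a \<theta>)) \<longlonglongrightarrow> 0"
proof (rule LIMSEQ_I)
  fix e :: real assume "0 < e"
  then obtain d where d: "0 < d"
    "\<And>a. a \<in> L_alpha \<alpha> F \<Longrightarrow> energy \<alpha> F a < d \<Longrightarrow> (LINT \<theta>|circ. norm (a \<theta>)) < e"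
    using LINT_norm_small by metis
  have L: "(\<lambda>\<theta>. p n \<theta> - a \<theta>) \<in> L_alpha \<alpha> F" "(\<lambda>n. energy \<alpha> F (\<lambda>\<theta>. p n \<theta> - a \<theta>)) \<longlonglongrightarrow> 0" for n
    using assms by (auto simp: L_alpha_tendsto_iff)
  have "\<forall>\<^sub>F n in sequentially. energy \<alpha> F (\<lambda>\<theta>. p n \<theta> - a \<theta>) < d"
    using L(2) d(1) by (rule order_tendstoD)
  then have "\<forall>\<^sub>F n in sequentially. (LINT \<theta>|circ. norm (p n \<theta> - a \<theta>)) < e"
    by eventually_elim (rule d(2)[OF L(1)])
  then show "\<exists>n0. \<forall>n\<ge>n0. norm ((LINT \<theta>|circ. norm (p n \<theta> - a \<theta>)) - 0) < e"
    by (simp add: eventually_sequentially)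
qed

text \<open>Definiteness comes from minimality: a function of energy 0 has integral norm below every
  positive number.\<close>

lemma energy_eq_0_imp_AE_eq_0:
  assumes a: "a \<in> L_alpha \<alpha> F" and 0: "energy \<alpha> F a = 0"
  shows "AE \<theta> in circ. a \<theta> = 0"
proof -
  have "(LINT \<theta>|circ. norm (a \<theta>)) \<le> 0"
  proof (rule field_le_epsilon)
    fix e :: real assume "0 < e"
    then obtain d where "0 < d"
      "\<And>a. a \<in> L_alpha \<alpha> F \<Longrightarrow> energy \<alpha> F a < d \<Longrightarrow> (LINT \<theta>|circ. norm (a \<theta>)) < e"
      using LINT_norm_small by metis
    then show "(LINT \<theta>|circ. norm (a \<theta>)) \<le> 0 + e" using a 0 by (simp add: less_imp_le)
  qed
  moreover have "0 \<le> (LINT \<theta>|circ. norm (a \<theta>))" by simp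
  ultimately have "(LINT \<theta>|circ. norm (a \<theta>)) = 0" by linarith
  then show ?thesis
    using integral_nonneg_eq_0_iff_AE[of circ "\<lambda>\<theta>. norm (a \<theta>)"] L_alpha_integrable[OF a] by simp
qed

text \<open>A Cauchy sequence for the energy is Cauchy in the integral norm, which supplies a
  subsequence with a pointwise limit. Fatou's lemma carries the Cauchy bound from
  \<open>p i - p j\<close> to \<open>p i - a\<close>.\<close>

lemma L_alpha_complete:
  assumes p: "\<And>n. p n \<in> L_alpha \<alpha> F"
    and cauchy: "\<And>e. 0 < e \<Longrightarrow> \<exists>n0. \<forall>i\<ge>n0. \<forall>j\<ge>n0. energy \<alpha> F (\<lambda>\<theta>. p i \<theta> - p j \<theta>) < e"
  obtains a where "a \<in> L_alpha \<alpha> F" "L_alpha_tendsto \<alpha> F p a"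
proof -
  have [measurable]: "p n \<in> borel_measurable circ" for n using p L_alpha_measurable by auto
  obtain r where r: "strict_mono r" "AE \<theta> in circ. Cauchy (\<lambda>i. p (r i) \<theta>)"
  proof (rule cauchy_L1_AE_cauchy_subseq[of circ p])
    fix e :: real assume "0 < e"
    then obtain d where d: "0 < d"
      "\<And>a. a \<in> L_alpha \<alpha> F \<Longrightarrow> energy \<alpha> F a < d \<Longrightarrow> (LINT \<theta>|circ. norm (a \<theta>)) < e"
      using LINT_norm_small by metis
    from cauchy[OF d(1)]
    show "\<exists>N. \<forall>i\<ge>N. \<forall>j\<ge>N. (LINT \<theta>|circ. norm (p i \<theta> - p j \<theta>)) < e"
      using d(2) L_alpha_diff[OF p p] by blast
  qed (use L_alpha_integrable[OF p] in auto)
  define a where "a = (\<lambda>\<theta>. lim (\<lambda>i. p (r i) \<theta>))"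
  have [measurable]: "a \<in> borel_measurable circ"
    unfolding a_def by (rule borel_measurable_lim_metric) simp
  have lim: "AE \<theta> in circ. (\<lambda>i. p (r i) \<theta>) \<longlonglongrightarrow> a \<theta>"
    using r(2) by eventually_elim (auto simp: a_def Cauchy_convergent_iff convergent_LIMSEQ_iff)
  have fatou: "(\<integral>\<^sup>+\<theta>. ennreal (qform \<alpha> (F \<theta>) (p i \<theta> - a \<theta>)) \<partial>circ) \<le> ennreal e"
    if "0 < e" and i: "\<And>j. n0 \<le> j \<Longrightarrow> energy \<alpha> F (\<lambda>\<theta>. p i \<theta> - p j \<theta>) < e" for i e n0
  proof -
    let ?q = "\<lambda>k \<theta>. ennreal (qform \<alpha> (F \<theta>) (p i \<theta> - p (r k) \<theta>))"
    have "(\<integral>\<^sup>+\<theta>. ennreal (qform \<alpha> (F \<theta>) (p i \<theta> - a \<theta>)) \<partial>circ) = (\<integral>\<^sup>+\<theta>. liminf (\<lambda>k. ?q k \<theta>) \<partial>circ)"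
    proof (rule nn_integral_cong_AE)
      show "AE \<theta> in circ. ennreal (qform \<alpha> (F \<theta>) (p i \<theta> - a \<theta>)) = liminf (\<lambda>k. ?q k \<theta>)"
        using lim
      proof eventually_elim
        case (elim \<theta>)
        have "isCont (\<lambda>x. bform \<alpha> (F \<theta>) (fst x) (snd x)) (p i \<theta> - a \<theta>, p i \<theta> - a \<theta>)"
          using continuous_bform[OF \<alpha>(1), of "F \<theta>"]
          unfolding continuous_on_eq_continuous_at[OF open_UNIV] by blast
        then have "(\<lambda>k. bform \<alpha> (F \<theta>) (p i \<theta> - p (r k) \<theta>) (p i \<theta> - p (r k) \<theta>))
            \<longlonglongrightarrow> bform \<alpha> (F \<theta>) (p i \<theta> - a \<theta>) (p i \<theta> - a \<theta>)"
          using isCont_tendsto_compose[OF _ tendsto_Pair[OF tendsto_diff[OF tendsto_const elim] tendsto_diff[OF tendsto_const elim]]]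
          by fastforce
        then have "(\<lambda>k. ?q k \<theta>) \<longlonglongrightarrow> ennreal (qform \<alpha> (F \<theta>) (p i \<theta> - a \<theta>))"
          unfolding qform_def by (intro tendsto_intros)
        then show ?case using lim_imp_Liminf by (metis sequentially_bot)
      qed
    qed
    also have "\<dots> \<le> liminf (\<lambda>k. \<integral>\<^sup>+\<theta>. ?q k \<theta> \<partial>circ)"
      by (rule nn_integral_liminf) measurable
    also have "\<dots> \<le> limsup (\<lambda>k. \<integral>\<^sup>+\<theta>. ?q k \<theta> \<partial>circ)"
      by (rule Liminf_le_Limsup) simp
    also have "\<dots> \<le> ennreal e"
    proof (rule Limsup_bounded)
      have "(\<integral>\<^sup>+\<theta>. ?q k \<theta> \<partial>circ) \<le> ennreal e" if "n0 \<le> k" for k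
      proof -
        have "n0 \<le> r k" using that seq_suble[OF r(1), of k] by simp
        then have "energy \<alpha> F (\<lambda>\<theta>. p i \<theta> - p (r k) \<theta>) < e" by (rule i)
        moreover have "(\<integral>\<^sup>+\<theta>. ?q k \<theta> \<partial>circ) = ennreal (energy \<alpha> F (\<lambda>\<theta>. p i \<theta> - p (r k) \<theta>))"
          unfolding energy_def using AE_qform_nonneg
          by (intro nn_integral_eq_integral L_alpha_integrable_qform L_alpha_diff p) (auto elim!: eventually_mono)
        ultimately show ?thesis by (simp add: ennreal_leI)
      qed
      then show "\<forall>\<^sub>F k in sequentially. (\<integral>\<^sup>+\<theta>. ?q k \<theta> \<partial>circ) \<le> ennreal e"
        by (auto simp: eventually_sequentially)
    qed
    finally show ?thesis .
  qed
  have fin: "(\<lambda>\<theta>. p i \<theta> - a \<theta>) \<in> L_alpha \<alpha> F \<and> energy \<alpha> F (\<lambda>\<theta>. p i \<theta> - a \<theta>) \<le> e"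
    if "0 < e" and i: "\<And>j. n0 \<le> j \<Longrightarrow> energy \<alpha> F (\<lambda>\<theta>. p i \<theta> - p j \<theta>) < e" for i e n0
  proof -
    note f = fatou[OF that(1), of n0 i, OF that(2)]
    have nn: "AE \<theta> in circ. 0 \<le> qform \<alpha> (F \<theta>) (p i \<theta> - a \<theta>)"
      using AE_qform_nonneg by eventually_elim simp
    have int: "integrable circ (\<lambda>\<theta>. qform \<alpha> (F \<theta>) (p i \<theta> - a \<theta>))"
      using f by (intro integrableI_nonneg nn) (auto intro: le_less_trans)
    have "ennreal (energy \<alpha> F (\<lambda>\<theta>. p i \<theta> - a \<theta>)) \<le> ennreal e"
      using f nn_integral_eq_integral[OF int nn] by (simp add: energy_def)
    then show ?thesis using int \<open>0 < e\<close> by (simp add: L_alpha_iff)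
  qed
  obtain n1 where n1: "\<And>i j. n1 \<le> i \<Longrightarrow> n1 \<le> j \<Longrightarrow> energy \<alpha> F (\<lambda>\<theta>. p i \<theta> - p j \<theta>) < 1"
    using cauchy[of 1] by auto
  have "(\<lambda>\<theta>. p n1 \<theta> - a \<theta>) \<in> L_alpha \<alpha> F" using fin[of 1 n1 n1] n1 by simp
  then have aL: "a \<in> L_alpha \<alpha> F" using L_alpha_diff[OF p[of n1]] by fastforce
  moreover have "L_alpha_tendsto \<alpha> F p a"
    unfolding L_alpha_tendsto_iff
  proof (intro conjI allI LIMSEQ_I)
    show "(\<lambda>\<theta>. p n \<theta> - a \<theta>) \<in> L_alpha \<alpha> F" for n using L_alpha_diff[OF p aL] .
    fix e :: real assume "0 < e"
    then obtain n0 where n0: "\<And>i j. n0 \<le> i \<Longrightarrow> n0 \<le> j \<Longrightarrow> energy \<alpha> F (\<lambda>\<theta>. p i \<theta> - p j \<theta>) < e / 2"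
      using cauchy[of "e / 2"] by auto
    have "energy \<alpha> F (\<lambda>\<theta>. p i \<theta> - a \<theta>) \<le> e / 2" if "n0 \<le> i" for i
      using fin[of "e / 2" n0 i] n0 that \<open>0 < e\<close> by simp
    then show "\<exists>n0. \<forall>n\<ge>n0. norm (energy \<alpha> F (\<lambda>\<theta>. p n \<theta> - a \<theta>) - 0) < e"
      using \<open>0 < e\<close> energy_nonneg by (intro exI[of _ n0]) fastforce
  qed
  ultimately show ?thesis using that by blast
qed

text \<open>A Fourier coefficient is continuous for the integral norm, hence for the energy, and it
  vanishes on \<open>trig_span N\<close> when its index lies in the gap. This is the source of the
  equations for the unknown coefficients.\<close>

lemma L_alpha_N_fourier:
  assumes "h \<in> L_alpha_N \<alpha> F N" "k \<le> N"
  shows "has_bochner_integral circ (\<lambda>\<theta>. cis (- (real k * \<theta>)) *s h \<theta>) 0"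
proof -
  obtain p where p: "\<And>n. p n \<in> trig_span N" "L_alpha_tendsto \<alpha> F p h" and h: "h \<in> L_alpha \<alpha> F"
    using assms(1) by (auto simp: L_alpha_N_def)
  have lin: "(\<lambda>\<theta>. cis (- (real k * \<theta>)) *s a \<theta>) \<in> borel_measurable circ"
    if a: "a \<in> borel_measurable circ" for a :: "real \<Rightarrow> complex^'n"
  proof -
    have "continuous_on UNIV (\<lambda>x :: complex \<times> (complex^'n). fst x *s snd x)"
      unfolding vector_scalar_mult_def by (intro continuous_intros continuous_on_vec_lambda)
    then show ?thesis
      using borel_measurable_continuous_Pair[OF _ a, of "\<lambda>\<theta>. cis (- (real k * \<theta>))" "\<lambda>x y. x *s y"] by simp
  qed
  have int: "integrable circ (\<lambda>\<theta>. cis (- (real k * \<theta>)) *s a \<theta>)" if a: "integrable circ a" for a :: "real \<Rightarrow> complex^'n"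
    by (rule Bochner_Integration.integrable_bound[OF a]) (use a lin in \<open>auto simp: norm_vector_scalar_mult\<close>)
  have p0: "(LINT \<theta>|circ. cis (- (real k * \<theta>)) *s p n \<theta>) = 0" for n
  proof -
    obtain J v where J: "p n = (\<lambda>\<theta>. \<Sum>j\<in>J. cis (of_int j * \<theta>) *s v j)" "finite J" "J \<subseteq> - {0..int N}"
      using p(1)[of n] by (auto simp: trig_span_def)
    have hb: "has_bochner_integral circ (\<lambda>\<theta>. cis (of_int (j - int k) * \<theta>) *s v j) 0" if "j \<in> J" for j
    proof -
      have "j - int k \<noteq> 0" using that J(3) assms(2) by auto
      then have "has_bochner_integral circ (\<lambda>\<theta>. cis (of_int (j - int k) * \<theta>)) 0"
        using integral_cis[of "j - int k"] by simp
      moreover have "bounded_linear (\<lambda>z :: complex. z *s v j)"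
        by (rule bounded_linear_intro[where K = "norm (v j)"])
          (simp_all add: vec_eq_iff distrib_right norm_vector_scalar_mult)
      from has_bochner_integral_bounded_linear[OF this] \<open>has_bochner_integral _ _ 0\<close>
      have "has_bochner_integral circ (\<lambda>\<theta>. cis (of_int (j - int k) * \<theta>) *s v j) (0 *s v j)"
        by blast
      then show ?thesis by simp
    qed
    have "cis (- (real k * \<theta>)) *s p n \<theta> = (\<Sum>j\<in>J. cis (of_int (j - int k) * \<theta>) *s v j)" for \<theta>
    proof -
      have c: "cis (- (real k * \<theta>)) * (cis (of_int j * \<theta>) * x) = cis (of_int (j - int k) * \<theta>) * x" for j x
        unfolding mult.assoc[symmetric] cis_mult by (simp add: algebra_simps)
      show ?thesis unfolding J(1) vec_eq_iff
        by (simp only: vector_smult_component sum_component sum_distrib_left c) simp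
    qed
    then have "has_bochner_integral circ (\<lambda>\<theta>. cis (- (real k * \<theta>)) *s p n \<theta>) (\<Sum>j\<in>J. 0)"
      using has_bochner_integral_sum[OF hb, of J] by simp
    then show ?thesis by (simp add: has_bochner_integral_iff)
  qed
  have ip: "integrable circ (p n)" "integrable circ h" for n
    using L_alpha_integrable trig_span_in_L_alpha p(1) h by auto
  have "norm (LINT \<theta>|circ. cis (- (real k * \<theta>)) *s h \<theta>) \<le> (LINT \<theta>|circ. norm (p n \<theta> - h \<theta>))" for n
  proof -
    have "(LINT \<theta>|circ. cis (- (real k * \<theta>)) *s (p n \<theta> - h \<theta>)) = - (LINT \<theta>|circ. cis (- (real k * \<theta>)) *s h \<theta>)"
      using int[OF ip(1)] int[OF ip(2)] p0 by (simp add: vector_ssub_ldistrib)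
    moreover have "norm (LINT \<theta>|circ. cis (- (real k * \<theta>)) *s (p n \<theta> - h \<theta>)) \<le> (LINT \<theta>|circ. norm (p n \<theta> - h \<theta>))"
      using integral_norm_bound[of circ "\<lambda>\<theta>. cis (- (real k * \<theta>)) *s (p n \<theta> - h \<theta>)"]
      by (simp add: norm_vector_scalar_mult del: vector_ssub_ldistrib)
    ultimately show ?thesis by simp
  qed
  then have "norm (LINT \<theta>|circ. cis (- (real k * \<theta>)) *s h \<theta>) \<le> 0"
    by (intro LIMSEQ_le_const[OF L_alpha_tendsto_imp_L1[OF p(2)]]) auto
  then show ?thesis using int[OF ip(2)] by (simp add: has_bochner_integral_iff)
qed

end

section \<open>The interpolation problem\<close>

lemma obtain_minimizing_sequence:
  fixes \<Phi> :: "'b \<Rightarrow> real"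
  assumes "S \<noteq> {}" "\<And>x. x \<in> S \<Longrightarrow> 0 \<le> \<Phi> x"
  obtains p where "\<And>n. p n \<in> S" "\<And>n. \<Phi> (p n) < Inf (\<Phi> ` S) + inverse (real (Suc n))"
proof -
  have "\<exists>x\<in>S. \<Phi> x < Inf (\<Phi> ` S) + inverse (real (Suc n))" for n
    using cInf_lessD[of "\<Phi> ` S" "Inf (\<Phi> ` S) + inverse (real (Suc n))"] assms(1) by auto
  then show ?thesis using that by metis
qed

locale interpolation_weights =
  f: weight \<alpha> f + g: weight \<alpha> g + s: minimal_weight \<alpha> "\<lambda>\<theta>. f \<theta> + g \<theta>" P
  for \<alpha> :: real and f g P :: "real \<Rightarrow> complex^'n^'n" +
  fixes N :: nat and A :: "real \<Rightarrow> complex^'n"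
  assumes A_in_L_alpha: "A \<in> L_alpha \<alpha> (\<lambda>\<theta>. f \<theta> + g \<theta>)"
begin

abbreviation s :: "real \<Rightarrow> complex^'n^'n" where "s \<equiv> \<lambda>\<theta>. f \<theta> + g \<theta>"

text \<open>The \<alpha>-th power of the estimation error in spectral terms: with spectral
  characteristic \<open>h\<close> the error splits into an integral of \<open>A - h\<close> against
  the signal and one of \<open>- h\<close> against the noise, and the two parts are
  independent.\<close>

definition error :: "(real \<Rightarrow> complex^'n) \<Rightarrow> real" where
  "error h = energy \<alpha> f (\<lambda>\<theta>. A \<theta> - h \<theta>) + energy \<alpha> g h"

lemmas \<alpha> = f.\<alpha>

text \<open>Both forms are nonnegative almost everywhere, so nothing can cancel in their
  sum.\<close>

lemma L_alpha_sum_iff: "a \<in> L_alpha \<alpha> s \<longleftrightarrow> a \<in> L_alpha \<alpha> f \<and> a \<in> L_alpha \<alpha> g"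
proof
  assume a: "a \<in> L_alpha \<alpha> s"
  have [measurable]: "a \<in> borel_measurable circ" using a s.L_alpha_measurable by auto
  have int: "integrable circ (\<lambda>\<theta>. qform \<alpha> (s \<theta>) (a \<theta>))" using a s.L_alpha_integrable_qform by auto
  have "AE \<theta> in circ. norm (qform \<alpha> (f \<theta>) (a \<theta>)) \<le> norm (qform \<alpha> (s \<theta>) (a \<theta>))"
    "AE \<theta> in circ. norm (qform \<alpha> (g \<theta>) (a \<theta>)) \<le> norm (qform \<alpha> (s \<theta>) (a \<theta>))"
    using f.AE_qform_nonneg g.AE_qform_nonneg by (eventually_elim, simp add: qform_add_matrix)+
  then show "a \<in> L_alpha \<alpha> f \<and> a \<in> L_alpha \<alpha> g"
    unfolding f.L_alpha_iff g.L_alpha_iff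
    by (intro conjI Bochner_Integration.integrable_bound[OF int]) auto
next
  assume "a \<in> L_alpha \<alpha> f \<and> a \<in> L_alpha \<alpha> g"
  then show "a \<in> L_alpha \<alpha> s"
    unfolding f.L_alpha_iff g.L_alpha_iff s.L_alpha_iff by (simp add: qform_add_matrix)
qed

lemma energy_sum:
  assumes "a \<in> L_alpha \<alpha> s"
  shows "energy \<alpha> s a = energy \<alpha> f a + energy \<alpha> g a"
  using assms unfolding L_alpha_sum_iff energy_def qform_add_matrix
  by (auto dest!: f.L_alpha_integrable_qform g.L_alpha_integrable_qform)

lemma L_alpha_tendsto_sum_iff:
  "L_alpha_tendsto \<alpha> s p a \<longleftrightarrow> L_alpha_tendsto \<alpha> f p a \<and> L_alpha_tendsto \<alpha> g p a"
proof -
  have "(\<lambda>n. energy \<alpha> f (\<lambda>\<theta>. p n \<theta> - a \<theta>) + energy \<alpha> g (\<lambda>\<theta>. p n \<theta> - a \<theta>)) \<longlonglongrightarrow> 0 \<longleftrightarrow>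
      (\<lambda>n. energy \<alpha> f (\<lambda>\<theta>. p n \<theta> - a \<theta>)) \<longlonglongrightarrow> 0 \<and> (\<lambda>n. energy \<alpha> g (\<lambda>\<theta>. p n \<theta> - a \<theta>)) \<longlonglongrightarrow> 0"
    (is "?s \<longlonglongrightarrow> 0 \<longleftrightarrow> ?f \<longlonglongrightarrow> 0 \<and> ?g \<longlonglongrightarrow> 0")
  proof (intro iffI conjI)
    assume s: "?s \<longlonglongrightarrow> 0"
    show "?f \<longlonglongrightarrow> 0" "?g \<longlonglongrightarrow> 0"
      by (rule tendsto_sandwich[OF _ _ tendsto_const s]; simp add: f.energy_nonneg g.energy_nonneg)+
  qed (auto intro: tendsto_add_zero)
  then show ?thesis
    unfolding s.L_alpha_tendsto_iff f.L_alpha_tendsto_iff g.L_alpha_tendsto_iff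
    by (auto simp: L_alpha_sum_iff energy_sum)
qed

lemma L_alpha_N_imp_L_alpha: "h \<in> L_alpha_N \<alpha> s N \<Longrightarrow> h \<in> L_alpha \<alpha> s"
  by (simp add: L_alpha_N_def)

lemma A_minus_in: "h \<in> L_alpha \<alpha> s \<Longrightarrow> (\<lambda>\<theta>. A \<theta> - h \<theta>) \<in> L_alpha \<alpha> s"
  by (rule s.L_alpha_diff[OF A_in_L_alpha])

lemma error_nonneg: "0 \<le> error h"
  by (simp add: error_def f.energy_nonneg g.energy_nonneg)

lemma error_tendsto:
  assumes "L_alpha_tendsto \<alpha> s p h" "h \<in> L_alpha \<alpha> s"
  shows "(\<lambda>n. error (p n)) \<longlonglongrightarrow> error h"
  unfolding error_def
proof (rule tendsto_add)
  have t: "L_alpha_tendsto \<alpha> f p h" "L_alpha_tendsto \<alpha> g p h"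
    using assms(1) by (simp_all add: L_alpha_tendsto_sum_iff)
  have L: "h \<in> L_alpha \<alpha> g" "(\<lambda>\<theta>. A \<theta> - h \<theta>) \<in> L_alpha \<alpha> f"
    using assms(2) A_minus_in[OF assms(2)] by (simp_all add: L_alpha_sum_iff)
  show "(\<lambda>n. energy \<alpha> g (p n)) \<longlonglongrightarrow> energy \<alpha> g h" using t(2) L(1) by (rule g.energy_tendsto)
  have "L_alpha_tendsto \<alpha> f (\<lambda>n \<theta>. A \<theta> - p n \<theta>) (\<lambda>\<theta>. A \<theta> - h \<theta>)"
    using t(1) f.L_alpha_uminus[of "\<lambda>\<theta>. p _ \<theta> - h \<theta>"] f.energy_minus_commute[of h]
    unfolding f.L_alpha_tendsto_iff by simp
  then show "(\<lambda>n. energy \<alpha> f (\<lambda>\<theta>. A \<theta> - p n \<theta>)) \<longlonglongrightarrow> energy \<alpha> f (\<lambda>\<theta>. A \<theta> - h \<theta>)"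
    using L(2) by (rule f.energy_tendsto)
qed

text \<open>\<open>A\<close> drops out of the difference of \<open>A - h\<close> and
  \<open>A - k\<close>, so uniform convexity of the two energies controls the distance from
  \<open>h\<close> to \<open>k\<close> in the space with weight \<open>f + g\<close>.\<close>

lemma error_midpoint_gap:
  assumes "0 < \<epsilon>"
  obtains C where "0 \<le> C"
    "\<And>h k. h \<in> L_alpha \<alpha> s \<Longrightarrow> k \<in> L_alpha \<alpha> s \<Longrightarrow> energy \<alpha> s (\<lambda>\<theta>. h \<theta> - k \<theta>)
       \<le> \<epsilon> * (error h + error k) + C * ((error h + error k) / 2 - error (\<lambda>\<theta>. (1/2) *s (h \<theta> + k \<theta>)))"
proof -
  obtain C where C: "0 \<le> C"
    "\<And>(A :: complex^'n^'n) u v. covariation_matrix \<alpha> A \<Longrightarrow>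
       qform \<alpha> A (u - v) \<le> \<epsilon> * (qform \<alpha> A u + qform \<alpha> A v)
         + C * ((qform \<alpha> A u + qform \<alpha> A v) / 2 - qform \<alpha> A ((1/2) *s (u + v)))"
    using qform_uniformly_convex[OF \<alpha> assms] by blast
  show ?thesis
  proof (rule that[OF C(1)])
    fix h k assume hk: "h \<in> L_alpha \<alpha> s" "k \<in> L_alpha \<alpha> s"
    have mid: "(1/2) *s ((A \<theta> - h \<theta>) + (A \<theta> - k \<theta>)) = A \<theta> - (1/2) *s (h \<theta> + k \<theta>)" for \<theta>
      by (simp add: vec_eq_iff field_simps)
    have "energy \<alpha> f (\<lambda>\<theta>. (A \<theta> - h \<theta>) - (A \<theta> - k \<theta>)) \<le> \<epsilon> * (energy \<alpha> f (\<lambda>\<theta>. A \<theta> - h \<theta>) + energy \<alpha> f (\<lambda>\<theta>. A \<theta> - k \<theta>))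
         + C * ((energy \<alpha> f (\<lambda>\<theta>. A \<theta> - h \<theta>) + energy \<alpha> f (\<lambda>\<theta>. A \<theta> - k \<theta>)) / 2
         - energy \<alpha> f (\<lambda>\<theta>. (1/2) *s ((A \<theta> - h \<theta>) + (A \<theta> - k \<theta>))))"
      using hk[THEN A_minus_in] by (intro f.energy_midpoint_gap C(2)) (auto simp: L_alpha_sum_iff)
    moreover have "energy \<alpha> f (\<lambda>\<theta>. (A \<theta> - h \<theta>) - (A \<theta> - k \<theta>)) = energy \<alpha> f (\<lambda>\<theta>. h \<theta> - k \<theta>)"
      using f.energy_minus_commute[of h k] by simp
    moreover have "energy \<alpha> g (\<lambda>\<theta>. h \<theta> - k \<theta>) \<le> \<epsilon> * (energy \<alpha> g h + energy \<alpha> g k)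
         + C * ((energy \<alpha> g h + energy \<alpha> g k) / 2 - energy \<alpha> g (\<lambda>\<theta>. (1/2) *s (h \<theta> + k \<theta>)))"
      using hk by (intro g.energy_midpoint_gap C(2)) (auto simp: L_alpha_sum_iff)
    ultimately show "energy \<alpha> s (\<lambda>\<theta>. h \<theta> - k \<theta>)
       \<le> \<epsilon> * (error h + error k) + C * ((error h + error k) / 2 - error (\<lambda>\<theta>. (1/2) *s (h \<theta> + k \<theta>)))"
      unfolding energy_sum[OF s.L_alpha_diff[OF hk]] error_def mid
      by (simp only: algebra_simps add_divide_distrib diff_divide_distrib)
  qed
qed

text \<open>A minimizing sequence is Cauchy because midpoints cannot fall below the infimum. The
  infimum is taken over polynomials and transferred to their closure by continuity of
  \<open>error\<close>.\<close>

lemma minimizer_exists: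
  obtains h where "h \<in> L_alpha_N \<alpha> s N" "\<And>w. w \<in> L_alpha_N \<alpha> s N \<Longrightarrow> error h \<le> error w"
proof -
  define m where "m = Inf (error ` trig_span N)"
  have ne: "trig_span N \<noteq> ({} :: (real \<Rightarrow> complex^'n) set)"
    using trig_monomial_in_span[of "-1" N] by auto
  have m0: "0 \<le> m" unfolding m_def using ne by (intro cInf_greatest) (auto simp: error_nonneg)
  have m: "m \<le> error q" if "q \<in> trig_span N" for q
    unfolding m_def using that by (intro cInf_lower) (auto intro!: bdd_belowI[of _ 0] error_nonneg)
  obtain p where p: "\<And>n. p n \<in> trig_span N" "\<And>n. error (p n) < m + inverse (real (Suc n))"
    using obtain_minimizing_sequence[OF ne, of error] error_nonneg unfolding m_def by blast
  have pL: "p n \<in> L_alpha \<alpha> s" for n using p(1) s.trig_span_in_L_alpha by blast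
  have "\<exists>n0. \<forall>i\<ge>n0. \<forall>j\<ge>n0. energy \<alpha> s (\<lambda>\<theta>. p i \<theta> - p j \<theta>) < e" if e: "0 < e" for e
  proof -
    \<comment> \<open>Late members of the sequence have error at most \<open>m + 1\<close>, so the
      \<epsilon> term contributes at most \<open>e / 2\<close>; \<open>n0\<close> is chosen to keep
      \<open>C\<close> times the midpoint gap below the other half.\<close>
    define \<epsilon> where "\<epsilon> = e / (4 * (m + 1))"
    have "0 < \<epsilon>" using e m0 by (simp add: \<epsilon>_def)
    then obtain C where C: "0 \<le> C"
      "\<And>h k. h \<in> L_alpha \<alpha> s \<Longrightarrow> k \<in> L_alpha \<alpha> s \<Longrightarrow> energy \<alpha> s (\<lambda>\<theta>. h \<theta> - k \<theta>)
       \<le> \<epsilon> * (error h + error k) + C * ((error h + error k) / 2 - error (\<lambda>\<theta>. (1/2) *s (h \<theta> + k \<theta>)))"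
      using error_midpoint_gap by blast
    have "0 < e / (2 * (C + 1))" using e C by simp
    then obtain n0 where n0: "inverse (real (Suc n0)) < e / (2 * (C + 1))" using reals_Archimedean by blast
    have "energy \<alpha> s (\<lambda>\<theta>. p i \<theta> - p j \<theta>) < e" if "n0 \<le> i" "n0 \<le> j" for i j
    proof -
      have inv: "inverse (real (Suc k)) \<le> inverse (real (Suc n0))" if "n0 \<le> k" for k
        using that by (intro le_imp_inverse_le) auto
      have le: "error (p k) \<le> m + inverse (real (Suc n0))" "error (p k) \<le> m + 1" if "n0 \<le> k" for k
      proof -
        show "error (p k) \<le> m + inverse (real (Suc n0))" using p(2)[of k] inv[OF that] by linarith
        have "inverse (real (Suc k)) \<le> 1" by (simp add: inverse_le_1_iff)
        then show "error (p k) \<le> m + 1" using p(2)[of k] by linarith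
      qed
      have "m \<le> error (\<lambda>\<theta>. (1/2) *s (p i \<theta> + p j \<theta>))"
        by (intro m trig_span_scale trig_span_add p(1))
      then have gap: "(error (p i) + error (p j)) / 2 - error (\<lambda>\<theta>. (1/2) *s (p i \<theta> + p j \<theta>)) \<le> e / (2 * (C + 1))"
        using le(1)[OF \<open>n0 \<le> i\<close>] le(1)[OF \<open>n0 \<le> j\<close>] n0 by argo
      have "energy \<alpha> s (\<lambda>\<theta>. p i \<theta> - p j \<theta>) \<le> \<epsilon> * (2 * (m + 1)) + C * (e / (2 * (C + 1)))"
        using C(2)[OF pL pL, of i j] mult_left_mono[OF gap C(1)]
          mult_left_mono[of "error (p i) + error (p j)" "2 * (m + 1)" \<epsilon>] \<open>0 < \<epsilon>\<close> le(2)[OF \<open>n0 \<le> i\<close>] le(2)[OF \<open>n0 \<le> j\<close>]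
        by argo
      also have "\<epsilon> * (2 * (m + 1)) = e / 2" using m0 by (simp add: \<epsilon>_def field_simps)
      also have "C * (e / (2 * (C + 1))) < e / 2" using C e by (simp add: field_simps)
      finally show ?thesis by simp
    qed
    then show ?thesis by blast
  qed
  from s.L_alpha_complete[OF pL this]
  obtain h where h: "h \<in> L_alpha \<alpha> s" "L_alpha_tendsto \<alpha> s p h" .
  have "(\<lambda>n. m + inverse (real (Suc n))) \<longlonglongrightarrow> m + 0"
    by (intro tendsto_intros LIMSEQ_inverse_real_of_nat)
  then have "error h \<le> m"
    using error_tendsto[OF h(2,1)] p(2) by (intro LIMSEQ_le[where Y = "\<lambda>n. m + inverse (real (Suc n))"]) (auto intro: less_imp_le)
  moreover have "m \<le> error w" if w: "w \<in> L_alpha_N \<alpha> s N" for w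
  proof -
    obtain q where "\<forall>n. q n \<in> trig_span N" "L_alpha_tendsto \<alpha> s q w" "w \<in> L_alpha \<alpha> s"
      using w by (auto simp: L_alpha_N_def)
    then show ?thesis using error_tendsto m by (intro LIMSEQ_le_const[of "\<lambda>n. error (q n)"]) auto
  qed
  moreover have "h \<in> L_alpha_N \<alpha> s N" using h p(1) by (auto simp: L_alpha_N_def)
  ultimately show ?thesis using that order_trans by blast
qed

text \<open>The hypothesis makes the convexity gap nonpositive, and letting \<epsilon> tend to 0
  then forces the distance to vanish. Uniqueness of the minimizer and of the solution of the system
  both reduce to this.\<close>

lemma midpoint_rigidity:
  assumes L: "k \<in> L_alpha \<alpha> s" "h \<in> L_alpha \<alpha> s"
    and mid: "(error k + error h) / 2 \<le> error (\<lambda>\<theta>. (1/2) *s (k \<theta> + h \<theta>))"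
  shows "AE \<theta> in circ. k \<theta> = h \<theta>"
proof -
  have "energy \<alpha> s (\<lambda>\<theta>. k \<theta> - h \<theta>) \<le> 0"
  proof (rule field_le_epsilon)
    fix e :: real assume e: "0 < e"
    define E where "E = error k + error h"
    define \<epsilon> where "\<epsilon> = e / (E + 1)"
    have E: "0 \<le> E" by (simp add: E_def error_nonneg)
    have "0 < \<epsilon>" using e E by (simp add: \<epsilon>_def)
    then obtain C where C: "0 \<le> C"
      "\<And>h k. h \<in> L_alpha \<alpha> s \<Longrightarrow> k \<in> L_alpha \<alpha> s \<Longrightarrow> energy \<alpha> s (\<lambda>\<theta>. h \<theta> - k \<theta>)
       \<le> \<epsilon> * (error h + error k) + C * ((error h + error k) / 2 - error (\<lambda>\<theta>. (1/2) *s (h \<theta> + k \<theta>)))"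
      using error_midpoint_gap by blast
    have "C * ((error k + error h) / 2 - error (\<lambda>\<theta>. (1/2) *s (k \<theta> + h \<theta>))) \<le> 0"
      using C(1) mid by (intro mult_nonneg_nonpos) auto
    then have "energy \<alpha> s (\<lambda>\<theta>. k \<theta> - h \<theta>) \<le> \<epsilon> * E"
      using C(2)[OF L] unfolding E_def by linarith
    also have "\<dots> \<le> e" using E e by (simp add: \<epsilon>_def field_simps)
    finally show "energy \<alpha> s (\<lambda>\<theta>. k \<theta> - h \<theta>) \<le> 0 + e" by simp
  qed
  then have "energy \<alpha> s (\<lambda>\<theta>. k \<theta> - h \<theta>) = 0" using s.energy_nonneg by (simp add: antisym)
  then have "AE \<theta> in circ. k \<theta> - h \<theta> = 0"
    by (intro s.energy_eq_0_imp_AE_eq_0 s.L_alpha_diff L)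
  then show ?thesis by simp
qed

lemma minimizer_unique:
  assumes h: "h \<in> L_alpha_N \<alpha> s N" "\<And>w. w \<in> L_alpha_N \<alpha> s N \<Longrightarrow> error h \<le> error w"
    and k: "k \<in> L_alpha_N \<alpha> s N" "error k \<le> error h"
  shows "AE \<theta> in circ. k \<theta> = h \<theta>"
proof (rule midpoint_rigidity)
  show "k \<in> L_alpha \<alpha> s" "h \<in> L_alpha \<alpha> s" using h k by (auto simp: L_alpha_N_def)
  \<comment> \<open>The zero polynomial serves to write the scaled midpoint as a combination of two
    elements.\<close>
  have "(\<lambda>\<theta>. 0 :: complex^'n) \<in> trig_span N"
    using trig_span_scale[OF trig_monomial_in_span[of "-1" N "0"], of 0] by simp
  then have z: "(\<lambda>\<theta>. 0 :: complex^'n) \<in> L_alpha_N \<alpha> s N" by (rule s.trig_span_in_L_alpha_N)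
  have "(\<lambda>\<theta>. (1/2) *s (k \<theta> + h \<theta>)) \<in> L_alpha_N \<alpha> s N"
    using s.L_alpha_N_add_scale[OF z s.L_alpha_N_add_scale[OF k(1) h(1), of 1], of "1/2"] by simp
  then show "(error k + error h) / 2 \<le> error (\<lambda>\<theta>. (1/2) *s (k \<theta> + h \<theta>))"
    using h(2) k(2) by fastforce
qed

section \<open>The first order condition and the system of equations\<close>

definition residual :: "(real \<Rightarrow> complex^'n) \<Rightarrow> real \<Rightarrow> complex^'n" where
  "residual h \<theta> = f \<theta> *v spow_vec (\<alpha> - 1) (A \<theta> - h \<theta>) - g \<theta> *v spow_vec (\<alpha> - 1) (h \<theta>)"

lemma tdot_residual:
  "tdot (u \<theta>) (residual h \<theta>) = wform \<alpha> f u (\<lambda>\<theta>. A \<theta> - h \<theta>) \<theta> - wform \<alpha> g u h \<theta>"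
  by (simp add: residual_def wform_def tdot_def right_diff_distrib sum_subtractf)

lemma integrable_tdot_residual:
  assumes "u \<in> L_alpha \<alpha> s" "h \<in> L_alpha \<alpha> s"
  shows "integrable circ (\<lambda>\<theta>. tdot (u \<theta>) (residual h \<theta>))"
    "(LINT \<theta>|circ. tdot (u \<theta>) (residual h \<theta>))
      = (LINT \<theta>|circ. wform \<alpha> f u (\<lambda>\<theta>. A \<theta> - h \<theta>) \<theta>) - (LINT \<theta>|circ. wform \<alpha> g u h \<theta>)"
proof -
  have "integrable circ (wform \<alpha> f u (\<lambda>\<theta>. A \<theta> - h \<theta>))" "integrable circ (wform \<alpha> g u h)"
    using assms A_minus_in[OF assms(2)]
    by (auto simp: L_alpha_sum_iff intro!: f.wform_integrable g.wform_integrable)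
  then show "integrable circ (\<lambda>\<theta>. tdot (u \<theta>) (residual h \<theta>))"
    "(LINT \<theta>|circ. tdot (u \<theta>) (residual h \<theta>))
      = (LINT \<theta>|circ. wform \<alpha> f u (\<lambda>\<theta>. A \<theta> - h \<theta>) \<theta>) - (LINT \<theta>|circ. wform \<alpha> g u h \<theta>)"
    unfolding tdot_residual by auto
qed

text \<open>Under the real part of the bilinear pairing \<open>tdot\<close>, the gradient of
  \<open>error\<close> at \<open>k\<close> is \<open>residual k\<close> times the factor
  \<open>- \<alpha>\<close>. The sign stems from \<open>A - h\<close> in the first energy.\<close>

lemma error_gradient:
  assumes "h \<in> L_alpha \<alpha> s" "k \<in> L_alpha \<alpha> s"
  shows "error k - \<alpha> * Re (LINT \<theta>|circ. tdot (h \<theta> - k \<theta>) (residual k \<theta>)) \<le> error h"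
proof -
  have 1: "energy \<alpha> f (\<lambda>\<theta>. A \<theta> - k \<theta>) + \<alpha> * Re (LINT \<theta>|circ. wform \<alpha> f (\<lambda>\<theta>. (A \<theta> - h \<theta>) - (A \<theta> - k \<theta>)) (\<lambda>\<theta>. A \<theta> - k \<theta>) \<theta>)
      \<le> energy \<alpha> f (\<lambda>\<theta>. A \<theta> - h \<theta>)"
    using assms[THEN A_minus_in] by (intro f.energy_gradient) (auto simp: L_alpha_sum_iff)
  have 2: "energy \<alpha> g k + \<alpha> * Re (LINT \<theta>|circ. wform \<alpha> g (\<lambda>\<theta>. h \<theta> - k \<theta>) k \<theta>) \<le> energy \<alpha> g h"
    using assms by (intro g.energy_gradient) (auto simp: L_alpha_sum_iff)
  have "wform \<alpha> f (\<lambda>\<theta>. (A \<theta> - h \<theta>) - (A \<theta> - k \<theta>)) (\<lambda>\<theta>. A \<theta> - k \<theta>) \<theta>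
      = - wform \<alpha> f (\<lambda>\<theta>. h \<theta> - k \<theta>) (\<lambda>\<theta>. A \<theta> - k \<theta>) \<theta>" for \<theta>
    by (simp add: wform_eq_bform bform_diff_left)
  then have "energy \<alpha> f (\<lambda>\<theta>. A \<theta> - k \<theta>) - \<alpha> * Re (LINT \<theta>|circ. wform \<alpha> f (\<lambda>\<theta>. h \<theta> - k \<theta>) (\<lambda>\<theta>. A \<theta> - k \<theta>) \<theta>)
      \<le> energy \<alpha> f (\<lambda>\<theta>. A \<theta> - h \<theta>)"
    using 1 by (simp only: Bochner_Integration.integral_minus) simp
  with 2 show ?thesis
    unfolding integrable_tdot_residual(2)[OF s.L_alpha_diff[OF assms] assms(2)] error_def
    by (simp add: right_diff_distrib)
qed

text \<open>Convexity bounds the increment of the error at \<open>h + z u\<close> by its gradient at that point, so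
  the error itself never has to be differentiated.\<close>

lemma minimizer_orthogonal:
  assumes h: "h \<in> L_alpha_N \<alpha> s N" "\<And>w. w \<in> L_alpha_N \<alpha> s N \<Longrightarrow> error h \<le> error w"
    and u: "u \<in> trig_span N"
  shows "(LINT \<theta>|circ. tdot (u \<theta>) (residual h \<theta>)) = 0"
proof -
  have hL: "h \<in> L_alpha \<alpha> s" using h by (simp add: L_alpha_N_def)
  have Re0: "0 \<le> Re (- (LINT \<theta>|circ. tdot (u \<theta>) (residual h \<theta>)))" if u: "u \<in> trig_span N" for u
  proof -
    have uL: "u \<in> L_alpha \<alpha> s" using u by (rule s.trig_span_in_L_alpha)
    define t where "t = (\<lambda>n. inverse (real (Suc n)))"
    let ?h = "\<lambda>n \<theta>. h \<theta> + complex_of_real (t n) *s u \<theta>"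
    let ?I = "\<lambda>h. LINT \<theta>|circ. tdot (u \<theta>) (residual h \<theta>)"
    have t: "0 < t n" "t n \<le> 1" for n by (auto simp: t_def inverse_le_1_iff)
    have hnN: "?h n \<in> L_alpha_N \<alpha> s N" for n
      by (intro s.L_alpha_N_add_scale h(1) s.trig_span_in_L_alpha_N u)
    have hn: "?h n \<in> L_alpha \<alpha> s" for n using hnN by (rule L_alpha_N_imp_L_alpha)
    \<comment> \<open>The hyperplane is based at the displaced point and evaluated at
      \<open>h\<close>; since \<open>h\<close> is a minimizer, only the sign of the pairing
      remains.\<close>
    have nonpos: "Re (?I (?h n)) \<le> 0" for n
    proof -
      have "tdot (h \<theta> - ?h n \<theta>) (residual (?h n) \<theta>) = - of_real (t n) * tdot (u \<theta>) (residual (?h n) \<theta>)" for \<theta>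
        by (simp add: tdot_def sum_distrib_left sum_negf mult.assoc)
      then have "error (?h n) + \<alpha> * (t n * Re (?I (?h n))) \<le> error h"
        using error_gradient[OF hL hn, of n] by simp
      then have "\<alpha> * (t n * Re (?I (?h n))) \<le> 0" using h(2)[OF hnN, of n] by linarith
      then show ?thesis using t(1)[of n] \<alpha> by (simp add: mult_le_0_iff)
    qed
    have tz: "(\<lambda>n. complex_of_real (t n)) \<longlonglongrightarrow> 0"
      unfolding t_def using tendsto_of_real[OF LIMSEQ_inverse_real_of_nat, where 'a = complex] by simp
    have "(\<lambda>n. (LINT \<theta>|circ. wform \<alpha> f u (\<lambda>\<theta>. A \<theta> - ?h n \<theta>) \<theta>) - (LINT \<theta>|circ. wform \<alpha> g u (?h n) \<theta>))
        \<longlonglongrightarrow> (LINT \<theta>|circ. wform \<alpha> f u (\<lambda>\<theta>. A \<theta> - h \<theta>) \<theta>) - (LINT \<theta>|circ. wform \<alpha> g u h \<theta>)"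
    proof (rule tendsto_diff)
      show "(\<lambda>n. LINT \<theta>|circ. wform \<alpha> g u (?h n) \<theta>) \<longlonglongrightarrow> (LINT \<theta>|circ. wform \<alpha> g u h \<theta>)"
        using uL hL t by (intro g.LINT_wform_tendsto tz) (auto simp: L_alpha_sum_iff less_imp_le)
      have "(\<lambda>n. LINT \<theta>|circ. wform \<alpha> f u (\<lambda>\<theta>. (A \<theta> - h \<theta>) + (- complex_of_real (t n)) *s u \<theta>) \<theta>)
          \<longlonglongrightarrow> (LINT \<theta>|circ. wform \<alpha> f u (\<lambda>\<theta>. A \<theta> - h \<theta>) \<theta>)"
        using uL A_minus_in[OF hL] t tendsto_minus[OF tz]
        by (intro f.LINT_wform_tendsto) (auto simp: L_alpha_sum_iff less_imp_le)
      moreover have "(A \<theta> - h \<theta>) + (- complex_of_real (t n)) *s u \<theta> = A \<theta> - ?h n \<theta>" for n \<theta>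
        by (simp add: vec_eq_iff)
      ultimately show "(\<lambda>n. LINT \<theta>|circ. wform \<alpha> f u (\<lambda>\<theta>. A \<theta> - ?h n \<theta>) \<theta>)
          \<longlonglongrightarrow> (LINT \<theta>|circ. wform \<alpha> f u (\<lambda>\<theta>. A \<theta> - h \<theta>) \<theta>)" by (simp only:)
    qed
    then have "(\<lambda>n. Re (?I (?h n))) \<longlonglongrightarrow> Re (?I h)"
      unfolding integrable_tdot_residual(2)[OF uL hn] integrable_tdot_residual(2)[OF uL hL]
      by (rule tendsto_Re)
    then have "Re (?I h) \<le> 0" using nonpos by (intro LIMSEQ_le_const2) auto
    then show ?thesis by simp
  qed
  \<comment> \<open>Multiplying \<open>u\<close> by the four units turns one inequality for real
    parts into the vanishing of the whole integral.\<close>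
  have "0 \<le> Re (- (z * (LINT \<theta>|circ. tdot (u \<theta>) (residual h \<theta>))))" for z
  proof -
    have "tdot (z *s u \<theta>) (residual h \<theta>) = z * tdot (u \<theta>) (residual h \<theta>)" for \<theta>
      by (simp add: tdot_def sum_distrib_left mult.assoc)
    then show ?thesis using Re0[OF trig_span_scale[OF u, of z]] by simp
  qed
  from this[of 1] this[of "-1"] this[of \<i>] this[of "-\<i>"] show ?thesis
    by (simp add: complex_eq_iff)
qed

text \<open>The pairing has no conjugation, so testing with \<open>cis (of_int j * \<theta>)\<close>
  reads off the Fourier coefficient of index \<open>- j\<close>. Only \<open>j\<close> in the gap
  survive, whence the negative frequencies.\<close>

lemma residual_trig_polynomial:
  assumes h: "h \<in> L_alpha \<alpha> s"
    and orth: "\<And>u. u \<in> trig_span N \<Longrightarrow> (LINT \<theta>|circ. tdot (u \<theta>) (residual h \<theta>)) = 0"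
  obtains c where "AE \<theta> in circ. residual h \<theta> = (\<Sum>j\<le>N. cis (- (real j * \<theta>)) *s c j)"
proof -
  have ax: "tdot (z *s axis k 1) v = z * v $ k" for z k and v :: "complex^'n"
  proof -
    have "(z *s axis k 1) $ i * v $ i = (if i = k then z * v $ k else 0)" for i by (simp add: axis_def)
    then show ?thesis by (simp add: tdot_def)
  qed
  \<comment> \<open>Constant vectors have finite energy, and pairing with them shows that the
    components of the residual are integrable.\<close>
  have axL: "(\<lambda>\<theta>. axis k 1 :: complex^'n) \<in> L_alpha \<alpha> s" for k
    by (rule s.bounded_in_L_alpha[where B = "norm (axis k (1::complex))"]) auto
  have int: "integrable circ (\<lambda>\<theta>. residual h \<theta> $ k)" for k
    using integrable_tdot_residual(1)[OF axL h, of k] ax[of 1 k] by simp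
  define c where "c = (\<lambda>j::nat. \<chi> k. (LINT \<theta>|circ. cis (real j * \<theta>) * residual h \<theta> $ k) / of_real (2 * pi))"
  let ?P = "\<lambda>\<theta>. \<Sum>j\<le>N. cis (- (real j * \<theta>)) *s c j"
  have "AE \<theta> in circ. residual h \<theta> $ k - ?P \<theta> $ k = 0" for k
  proof (rule fourier_null_imp_AE_zero, unfold fourier_null_def, intro conjI allI)
    have intP: "integrable circ (\<lambda>\<theta>. ?P \<theta> $ k)"
    proof (rule finite_measure.integrable_const_bound[OF finite_measure_circ, of _ "\<Sum>j\<le>N. norm (c j $ k)"])
      have "norm (?P \<theta> $ k) \<le> (\<Sum>j\<le>N. norm (c j $ k))" for \<theta>
        unfolding sum_component by (rule order_trans[OF norm_sum]) (simp add: norm_mult)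
      then show "AE \<theta> in circ. norm (?P \<theta> $ k) \<le> (\<Sum>j\<le>N. norm (c j $ k))" by simp
    qed (simp add: sum_component)
    then show "integrable circ (\<lambda>\<theta>. residual h \<theta> $ k - ?P \<theta> $ k)" using int by simp
    fix j :: int
    have hb: "has_bochner_integral circ (\<lambda>\<theta>. cis (of_int j * \<theta>) * ?P \<theta> $ k)
        (\<Sum>i\<le>N. (if j = int i then of_real (2 * pi) else 0) * c i $ k)"
    proof -
      have "has_bochner_integral circ (\<lambda>\<theta>. \<Sum>i\<le>N. cis (of_int (j - int i) * \<theta>) * c i $ k)
        (\<Sum>i\<le>N. (if j - int i = 0 then of_real (2 * pi) else 0) * c i $ k)"
        by (intro has_bochner_integral_sum has_bochner_integral_mult_left integral_cis)
      moreover have "(\<Sum>i\<le>N. cis (of_int (j - int i) * \<theta>) * c i $ k) = cis (of_int j * \<theta>) * ?P \<theta> $ k" for \<theta>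
      proof -
        have "cis (of_int j * \<theta>) * (cis (- (real i * \<theta>)) * x) = cis (of_int (j - int i) * \<theta>) * x" for i x
          unfolding mult.assoc[symmetric] cis_mult by (simp add: algebra_simps)
        then show ?thesis by (simp only: vector_smult_component sum_component sum_distrib_left)
      qed
      ultimately show ?thesis by simp
    qed
    have sumP: "(\<Sum>i\<le>N. (if j = int i then of_real (2 * pi) else 0) * c i $ k)
        = (LINT \<theta>|circ. cis (of_int j * \<theta>) * residual h \<theta> $ k)"
    proof (cases "j \<in> {0..int N}")
      case True
      then obtain n where n: "j = int n" "n \<le> N" by (metis atLeastAtMost_iff nonneg_int_cases of_nat_le_iff)
      have "(\<Sum>i\<le>N. (if j = int i then of_real (2 * pi) else 0) * c i $ k)
          = (\<Sum>i\<le>N. if i = n then of_real (2 * pi) * c n $ k else 0)"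
        by (intro sum.cong) (auto simp: n)
      also have "\<dots> = of_real (2 * pi) * c n $ k" using n by simp
      finally show ?thesis by (simp add: c_def n)
    next
      case False
      then have "(LINT \<theta>|circ. tdot (cis (of_int j * \<theta>) *s axis k 1) (residual h \<theta>)) = 0"
        by (intro orth trig_monomial_in_span)
      moreover have "(\<Sum>i\<le>N. (if j = int i then of_real (2 * pi) else 0) * c i $ k) = 0"
        using False by (intro sum.neutral) auto
      ultimately show ?thesis by (simp add: ax)
    qed
    have "integrable circ (\<lambda>\<theta>. cis (of_int j * \<theta>) * residual h \<theta> $ k)"
      by (rule integrable_cis_mult[OF int])
    then show "(LINT \<theta>|circ. cis (of_int j * \<theta>) * (residual h \<theta> $ k - ?P \<theta> $ k)) = 0"
      using hb unfolding sumP right_diff_distrib by (simp add: has_bochner_integral_iff)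
  qed
  then have "AE \<theta> in circ. \<forall>k. residual h \<theta> $ k - ?P \<theta> $ k = 0" by (simp add: AE_all_countable)
  then have "AE \<theta> in circ. residual h \<theta> = ?P \<theta>" by eventually_elim (simp add: vec_eq_iff)
  then show ?thesis using that by blast
qed

text \<open>The hyperplanes at \<open>h\<close> and at \<open>k\<close>, both evaluated at the
  midpoint, have linear terms of opposite sign; equal pairings make them cancel in the
  average.\<close>

lemma error_midpoint_ge_of_equal_residual:
  assumes h: "h \<in> L_alpha \<alpha> s" and k: "k \<in> L_alpha \<alpha> s"
    and eq: "(LINT \<theta>|circ. tdot (h \<theta> - k \<theta>) (residual h \<theta>)) = (LINT \<theta>|circ. tdot (h \<theta> - k \<theta>) (residual k \<theta>))"
  shows "(error h + error k) / 2 \<le> error (\<lambda>\<theta>. (1/2) *s (h \<theta> + k \<theta>))"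
proof -
  let ?m = "\<lambda>\<theta>. (1/2) *s (h \<theta> + k \<theta>)"
  have m: "?m \<in> L_alpha \<alpha> s" by (intro s.L_alpha_scale s.L_alpha_add h k)
  have "?m \<theta> - h \<theta> = (-1/2) *s (h \<theta> - k \<theta>)" "?m \<theta> - k \<theta> = (1/2) *s (h \<theta> - k \<theta>)" for \<theta>
    by (simp_all add: vec_eq_iff field_simps)
  moreover have "tdot (z *s u) v = z * tdot u v" for z and u v :: "complex^'n"
    by (simp add: tdot_def sum_distrib_left mult.assoc)
  ultimately have "tdot (?m \<theta> - h \<theta>) v = (-1/2) * tdot (h \<theta> - k \<theta>) v"
    "tdot (?m \<theta> - k \<theta>) v = (1/2) * tdot (h \<theta> - k \<theta>) v" for \<theta> v
    by (simp_all only:)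
  then have "error h + \<alpha> / 2 * Re (LINT \<theta>|circ. tdot (h \<theta> - k \<theta>) (residual h \<theta>)) \<le> error ?m"
    "error k - \<alpha> / 2 * Re (LINT \<theta>|circ. tdot (h \<theta> - k \<theta>) (residual k \<theta>)) \<le> error ?m"
    using error_gradient[OF m h] error_gradient[OF m k] by (simp_all only: integral_mult_right_zero) simp_all
  then show ?thesis unfolding eq by argo
qed

text \<open>A solution is only known to lie in the space with weight \<open>f + g\<close>, not to be
  a minimizer. The two residuals differ by a polynomial with exactly those frequencies at which
  \<open>h - k\<close> has vanishing coefficients, so \<open>h - k\<close> pairs equally with both
  and rigidity applies.\<close>

lemma system_unique:
  assumes h: "h \<in> L_alpha \<alpha> s" and k: "k \<in> L_alpha \<alpha> s"
    and c: "AE \<theta> in circ. residual h \<theta> = (\<Sum>j\<le>N. cis (- (real j * \<theta>)) *s c j)"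
    and d: "AE \<theta> in circ. residual k \<theta> = (\<Sum>j\<le>N. cis (- (real j * \<theta>)) *s d j)"
    and h0: "\<And>j. j \<le> N \<Longrightarrow> has_bochner_integral circ (\<lambda>\<theta>. cis (- (real j * \<theta>)) *s h \<theta>) 0"
    and k0: "\<And>j. j \<le> N \<Longrightarrow> has_bochner_integral circ (\<lambda>\<theta>. cis (- (real j * \<theta>)) *s k \<theta>) 0"
  shows "AE \<theta> in circ. h \<theta> = k \<theta>" and "j \<le> N \<Longrightarrow> c j = d j"
proof -
  note hk = s.L_alpha_diff[OF h k]
  have lin: "bounded_linear (\<lambda>u. tdot u v)" for v :: "complex^'n"
    unfolding tdot_def by (intro bounded_linear_sum bounded_linear_mult_left[THEN bounded_linear_compose] bounded_linear_vec_nth)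
  have "has_bochner_integral circ (\<lambda>\<theta>. \<Sum>j\<le>N. tdot (cis (- (real j * \<theta>)) *s h \<theta> - cis (- (real j * \<theta>)) *s k \<theta>) (c j - d j))
      (\<Sum>j\<le>N. tdot (0 - 0) (c j - d j))"
    using h0 k0 by (intro has_bochner_integral_sum has_bochner_integral_bounded_linear[OF lin] has_bochner_integral_diff) auto
  then have z: "(LINT \<theta>|circ. (\<Sum>j\<le>N. tdot (cis (- (real j * \<theta>)) *s h \<theta> - cis (- (real j * \<theta>)) *s k \<theta>) (c j - d j))) = 0"
    by (simp add: has_bochner_integral_iff tdot_def)
  have "(LINT \<theta>|circ. tdot (h \<theta> - k \<theta>) (residual h \<theta>) - tdot (h \<theta> - k \<theta>) (residual k \<theta>))
      = (LINT \<theta>|circ. (\<Sum>j\<le>N. tdot (cis (- (real j * \<theta>)) *s h \<theta> - cis (- (real j * \<theta>)) *s k \<theta>) (c j - d j)))"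
  proof (rule integral_cong_AE)
    show "AE \<theta> in circ. tdot (h \<theta> - k \<theta>) (residual h \<theta>) - tdot (h \<theta> - k \<theta>) (residual k \<theta>)
        = (\<Sum>j\<le>N. tdot (cis (- (real j * \<theta>)) *s h \<theta> - cis (- (real j * \<theta>)) *s k \<theta>) (c j - d j))"
      using c d
    proof eventually_elim
      case (elim \<theta>)
      have "tdot u (\<Sum>j\<le>N. cis (- (real j * \<theta>)) *s x j) = (\<Sum>j\<le>N. tdot (cis (- (real j * \<theta>)) *s u) (x j))"
        for u and x :: "nat \<Rightarrow> complex^'n"
        unfolding tdot_def by (subst sum.swap) (simp add: sum_component sum_distrib_left mult_ac)
      moreover have "tdot u v - tdot u w = tdot u (v - w)" for u v w :: "complex^'n"
        by (simp add: tdot_def right_diff_distrib sum_subtractf)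
      ultimately show ?case unfolding elim
        by (simp only: vector_ssub_ldistrib sum_subtractf[symmetric])
    qed
  qed (use integrable_tdot_residual(1)[OF hk h] integrable_tdot_residual(1)[OF hk k]
        has_bochner_integral_iff \<open>has_bochner_integral _ _ (\<Sum>j\<le>N. _)\<close> in auto)
  then have "(LINT \<theta>|circ. tdot (h \<theta> - k \<theta>) (residual h \<theta>)) = (LINT \<theta>|circ. tdot (h \<theta> - k \<theta>) (residual k \<theta>))"
    using z integrable_tdot_residual(1)[OF hk h] integrable_tdot_residual(1)[OF hk k] by simp
  from midpoint_rigidity[OF h k error_midpoint_ge_of_equal_residual[OF h k this]]
  show hk: "AE \<theta> in circ. h \<theta> = k \<theta>" .
  assume j: "j \<le> N"
  \<comment> \<open>Once \<open>h\<close> and \<open>k\<close> agree, so do the two polynomials;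
    multiplying by \<open>cis (real j * \<theta>)\<close> and integrating isolates the coefficient
    of index \<open>j\<close>.\<close>
  have "c j $ l = d j $ l" for l
  proof -
    have hb: "has_bochner_integral circ (\<lambda>\<theta>. \<Sum>i\<le>N. cis (of_int (int j - int i) * \<theta>) * (c i - d i) $ l)
        (\<Sum>i\<le>N. (if int j - int i = 0 then of_real (2 * pi) else 0) * (c i - d i) $ l)"
      by (intro has_bochner_integral_sum has_bochner_integral_mult_left integral_cis)
    have "AE \<theta> in circ. (\<Sum>i\<le>N. cis (of_int (int j - int i) * \<theta>) * (c i - d i) $ l) = 0"
      using c d hk
    proof eventually_elim
      case (elim \<theta>)
      have "cis (real j * \<theta>) * (cis (- (real i * \<theta>)) * x) = cis (of_int (int j - int i) * \<theta>) * x" for i x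
        unfolding mult.assoc[symmetric] cis_mult by (simp add: algebra_simps)
      then have "(\<Sum>i\<le>N. cis (of_int (int j - int i) * \<theta>) * (c i - d i) $ l)
          = cis (real j * \<theta>) * ((\<Sum>i\<le>N. cis (- (real i * \<theta>)) *s c i) $ l - (\<Sum>i\<le>N. cis (- (real i * \<theta>)) *s d i) $ l)"
        by (simp only: vector_smult_component sum_component sum_distrib_left right_diff_distrib
            vector_minus_component sum_subtractf)
      also have "\<dots> = 0" using elim by (simp add: residual_def)
      finally show ?case .
    qed
    then have "(\<Sum>i\<le>N. (if int j - int i = 0 then complex_of_real (2 * pi) else 0) * (c i - d i) $ l) = 0"
      using hb integral_cong_AE[of "\<lambda>\<theta>. \<Sum>i\<le>N. cis (of_int (int j - int i) * \<theta>) * (c i - d i) $ l" circ "\<lambda>_. 0"]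
      by (auto simp: has_bochner_integral_iff)
    moreover have "(\<Sum>i\<le>N. (if int j - int i = 0 then complex_of_real (2 * pi) else 0) * (c i - d i) $ l)
        = (\<Sum>i\<le>N. if i = j then of_real (2 * pi) * (c j - d j) $ l else 0)"
      by (intro sum.cong) auto
    ultimately show ?thesis using j by simp
  qed
  then show "c j = d j" by (simp add: vec_eq_iff)
qed

end

section \<open>The scale of a stable variable\<close>

lemma integral_circ_continuous:
  fixes G :: "real \<Rightarrow> real"
  assumes "continuous_on UNIV G"
  shows "integrable circ G" "(LINT \<phi>|circ. G \<phi>) = integral {-pi..pi} G"
proof -
  have c: "continuous_on {-pi..pi} G" using assms continuous_on_subset by blast
  show i: "integrable circ G"
    using absolutely_integrable_continuous_real[OF c] by (simp add: absolutely_integrable_on_def integrable_restrict_space set_integrable_def)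
  show "(LINT \<phi>|circ. G \<phi>) = integral {-pi..pi} G"
    using lebesgue_integral_eq_integral[OF i] by simp
qed

lemma integral_circ_shift:
  fixes G :: "real \<Rightarrow> real"
  assumes G: "continuous_on UNIV G" and per: "\<And>x. G (x + 2 * pi) = G x" and b: "0 \<le> b" "b \<le> 2 * pi"
  shows "(LINT \<phi>|circ. G (\<phi> + b)) = (LINT \<phi>|circ. G \<phi>)"
proof -
  have int: "G integrable_on {x..y}" for x y
    using G continuous_on_subset by (blast intro: integrable_continuous_real)
  have "continuous_on UNIV (\<lambda>\<phi>. G (\<phi> + b))"
    by (rule continuous_on_compose2[OF G]) (auto intro!: continuous_intros)
  then have "(LINT \<phi>|circ. G (\<phi> + b)) = integral {-pi..pi} (\<lambda>\<phi>. G (\<phi> + b))"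
    by (rule integral_circ_continuous)
  also have "\<dots> = integral {-pi + b..pi + b} G"
    using integral_shift_real_ivl[of "-pi + b" b "pi + b" G] by simp
  also have "\<dots> = integral {-pi + b..pi} G + integral {pi..pi + b} G"
    by (rule Henstock_Kurzweil_Integration.integral_combine[symmetric]) (use b int in auto)
  also have "integral {pi..pi + b} G = integral {-pi..-pi + b} (\<lambda>x. G (x + 2 * pi))"
    using integral_shift_real_ivl[of pi "2 * pi" "pi + b" G] by simp
  also have "\<dots> = integral {-pi..-pi + b} G" by (simp add: per)
  also have "integral {-pi + b..pi} G + integral {-pi..-pi + b} G = integral {-pi..pi} G"
    using b by (subst add.commute, intro Henstock_Kurzweil_Integration.integral_combine) (use int in auto)
  finally show ?thesis using integral_circ_continuous(2)[OF G] by simp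
qed

text \<open>The constant that relates the average over rotations to the modulus;
  \<open>sas_scale\<close> divides by it, so its positivity matters.\<close>

definition cos_moment :: "real \<Rightarrow> real" where
  "cos_moment \<alpha> = (LINT \<phi>|circ. \<bar>cos \<phi>\<bar> powr \<alpha>)"

lemma continuous_abs_cos_powr: "0 < \<alpha> \<Longrightarrow> continuous_on UNIV (\<lambda>\<phi>::real. \<bar>cos \<phi>\<bar> powr \<alpha>)"
  by (intro continuous_on_powr' continuous_intros) auto

lemma cos_moment_pos:
  assumes "0 < \<alpha>"
  shows "0 < cos_moment \<alpha>"
proof -
  have "cos_moment \<alpha> \<noteq> 0"
  proof
    assume "cos_moment \<alpha> = 0"
    then have "AE \<phi> in circ. \<bar>cos \<phi>\<bar> powr \<alpha> = 0"
      unfolding cos_moment_def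
      using integral_circ_continuous(1)[OF continuous_abs_cos_powr[OF assms]]
      by (subst (asm) integral_nonneg_eq_0_iff_AE) auto
    then have "AE \<phi> in circ. \<phi> \<notin> {-(pi/2)<..<pi/2}"
    proof eventually_elim
      case (elim \<phi>)
      then show ?case using cos_gt_zero_pi[of \<phi>] by auto
    qed
    then have "{-(pi/2)<..<pi/2} \<in> null_sets circ"
      by (subst AE_iff_null_sets) (auto intro!: borel_sets_circ)
    then have "{-(pi/2)<..<pi/2} \<in> null_sets lebesgue" by (simp add: null_sets_restrict_space)
    then have "emeasure lborel {-(pi/2)<..<pi/2} = 0" by (auto simp: null_sets_def)
    then show False by simp
  qed
  moreover have "0 \<le> cos_moment \<alpha>" unfolding cos_moment_def by (intro integral_nonneg_AE) auto
  ultimately show ?thesis by simp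
qed

text \<open>Turning \<open>w\<close> to the positive real axis shifts the angle by its argument, and
  an integral over a full period ignores the shift.\<close>

lemma integral_circ_abs_Re:
  assumes "0 < \<alpha>"
  shows "integrable circ (\<lambda>\<phi>. \<bar>Re (cis \<phi> * w)\<bar> powr \<alpha>)"
    and "(LINT \<phi>|circ. \<bar>Re (cis \<phi> * w)\<bar> powr \<alpha>) = norm w powr \<alpha> * cos_moment \<alpha>"
proof -
  let ?b = "Arg2pi w"
  have w: "w = of_real (norm w) * cis ?b"
    using Arg2pi_eq[of w] by (simp add: cis_conv_exp)
  have eq: "\<bar>Re (cis \<phi> * w)\<bar> powr \<alpha> = norm w powr \<alpha> * \<bar>cos (\<phi> + ?b)\<bar> powr \<alpha>" for \<phi>
  proof -
    have "cis \<phi> * w = of_real (norm w) * cis (\<phi> + ?b)"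
      by (subst w) (simp add: cis_mult[symmetric] mult_ac)
    then have "Re (cis \<phi> * w) = norm w * cos (\<phi> + ?b)" by simp
    then show ?thesis by (simp add: abs_mult powr_mult)
  qed
  have "continuous_on UNIV (\<lambda>\<phi>. \<bar>cos (\<phi> + ?b)\<bar> powr \<alpha>)"
    by (rule continuous_on_compose2[OF continuous_abs_cos_powr[OF assms]]) (auto intro!: continuous_intros)
  then show "integrable circ (\<lambda>\<phi>. \<bar>Re (cis \<phi> * w)\<bar> powr \<alpha>)"
    unfolding eq by (intro integrable_mult_right integral_circ_continuous)
  have "(LINT \<phi>|circ. \<bar>cos (\<phi> + ?b)\<bar> powr \<alpha>) = cos_moment \<alpha>"
    unfolding cos_moment_def
    using Arg2pi[of w] by (intro integral_circ_shift[of "\<lambda>\<phi>. \<bar>cos \<phi>\<bar> powr \<alpha>"] continuous_abs_cos_powr assms) auto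
  then show "(LINT \<phi>|circ. \<bar>Re (cis \<phi> * w)\<bar> powr \<alpha>) = norm w powr \<alpha> * cos_moment \<alpha>"
    unfolding eq by simp
qed

text \<open>The real part is taken to have a real logarithm; for a stable variable the
  characteristic function is already real and positive. \<open>Re (z * w)\<close> is the real inner
  product of \<open>w\<close> with \<open>cnj z\<close>.\<close>

definition log_char :: "'a measure \<Rightarrow> ('a \<Rightarrow> complex) \<Rightarrow> complex \<Rightarrow> real" where
  "log_char M W z = - ln (Re (LINT \<omega>|M. cis (Re (z * W \<omega>))))"

text \<open>A formula for the \<open>\<alpha>\<close>-th power of the norm of a jointly stable variable in terms of its
  distribution alone: averaging \<open>\<bar>Re (e\<^sup>i\<^sup>\<phi> w)\<bar>\<close> to the power \<open>\<alpha>\<close> over all rotations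
  gives a multiple of \<open>\<bar>w\<bar>\<close> to the power \<open>\<alpha>\<close>. In particular the spectral measure need not be unique.\<close>

definition sas_scale :: "'a measure \<Rightarrow> real \<Rightarrow> ('a \<Rightarrow> complex) \<Rightarrow> real" where
  "sas_scale M \<alpha> W = (LINT \<phi>|circ. log_char M W (cis \<phi>)) / cos_moment \<alpha>"

text \<open>A spectral measure of the pair \<open>(W, W)\<close>, rather than of \<open>W\<close>
  alone, is what the covariation of \<open>W\<close> with itself requires.\<close>

definition sas_var :: "'a measure \<Rightarrow> real \<Rightarrow> ('a \<Rightarrow> complex) \<Rightarrow> bool" where
  "sas_var M \<alpha> W \<longleftrightarrow> W \<in> borel_measurable M \<and> (\<exists>\<Gamma>. is_spectral_measure M \<alpha> W W \<Gamma>)"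

lemma inner_cnj: "cnj a \<bullet> b = Re (a * b)"
  by (simp add: inner_complex_def)

lemma log_char_spectral:
  assumes "is_spectral_measure M \<alpha> X Y \<Gamma>"
  shows "(LINT \<omega>|M. cis (Re (z * (s1 * X \<omega> + s2 * Y \<omega>))))
      = of_real (exp (- (LINT x|\<Gamma>. \<bar>Re (z * (s1 * fst x + s2 * snd x))\<bar> powr \<alpha>)))"
    and "log_char M (\<lambda>\<omega>. s1 * X \<omega> + s2 * Y \<omega>) z
      = (LINT x|\<Gamma>. \<bar>Re (z * (s1 * fst x + s2 * snd x))\<bar> powr \<alpha>)"
proof -
  have "(cnj (z * s1), cnj (z * s2)) \<bullet> (a, b) = Re (z * (s1 * a + s2 * b))" for a b
    unfolding inner_Pair inner_cnj by (simp add: distrib_left mult.assoc)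
  then show *: "(LINT \<omega>|M. cis (Re (z * (s1 * X \<omega> + s2 * Y \<omega>))))
      = of_real (exp (- (LINT x|\<Gamma>. \<bar>Re (z * (s1 * fst x + s2 * snd x))\<bar> powr \<alpha>)))"
    using assms unfolding is_spectral_measure_def
    by (metis (no_types, lifting) Bochner_Integration.integral_cong prod.collapse)
  show "log_char M (\<lambda>\<omega>. s1 * X \<omega> + s2 * Y \<omega>) z
      = (LINT x|\<Gamma>. \<bar>Re (z * (s1 * fst x + s2 * snd x))\<bar> powr \<alpha>)"
    by (simp only: log_char_def * Re_complex_of_real ln_exp minus_minus)
qed

lemma borel_measurable_fst_snd [measurable]:
  "(fst :: complex \<times> complex \<Rightarrow> complex) \<in> borel_measurable borel"
  "(snd :: complex \<times> complex \<Rightarrow> complex) \<in> borel_measurable borel"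
  by (auto intro!: borel_measurable_continuous_onI continuous_intros)

lemma AE_spectral_norm_le:
  assumes "is_spectral_measure M \<alpha> X Y \<Gamma>"
  shows "AE x in \<Gamma>. norm (s1 * fst x + s2 * snd x) \<le> norm s1 + norm s2"
proof -
  have "AE x in \<Gamma>. x \<in> sphere 0 1" using assms by (simp add: is_spectral_measure_def)
  then show ?thesis
  proof eventually_elim
    case (elim x)
    have "norm (fst x) \<le> 1" "norm (snd x) \<le> 1"
      using elim norm_fst_le[of "fst x" "snd x"] norm_snd_le[of "snd x" "fst x"] by auto
    then have "norm s1 * norm (fst x) \<le> norm s1" "norm s2 * norm (snd x) \<le> norm s2"
      by (auto intro!: mult_left_le)
    then show ?case using norm_triangle_ineq[of "s1 * fst x" "s2 * snd x"] by (simp add: norm_mult)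
  qed
qed

lemma spectral_integrable:
  assumes "is_spectral_measure M \<alpha> X Y \<Gamma>" "0 < \<alpha>"
  shows "integrable \<Gamma> (\<lambda>x. norm (s1 * fst x + s2 * snd x) powr \<alpha>)"
    "integrable \<Gamma> (\<lambda>x. \<bar>Re (z * (s1 * fst x + s2 * snd x))\<bar> powr \<alpha>)"
proof -
  interpret finite_measure \<Gamma> using assms by (simp add: is_spectral_measure_def)
  have [measurable_cong]: "sets \<Gamma> = sets borel" using assms by (simp add: is_spectral_measure_def)
  show i: "integrable \<Gamma> (\<lambda>x. norm (s1 * fst x + s2 * snd x) powr \<alpha>)" for s1 s2
  proof (rule integrable_const_bound)
    show "AE x in \<Gamma>. norm (norm (s1 * fst x + s2 * snd x) powr \<alpha>) \<le> (norm s1 + norm s2) powr \<alpha>"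
      using AE_spectral_norm_le[OF assms(1), of s1 s2]
      by eventually_elim (use assms(2) in \<open>auto intro!: powr_mono2\<close>)
  qed measurable
  show "integrable \<Gamma> (\<lambda>x. \<bar>Re (z * (s1 * fst x + s2 * snd x))\<bar> powr \<alpha>)"
  proof (rule Bochner_Integration.integrable_bound[OF i[of "z * s1" "z * s2"]])
    show "AE x in \<Gamma>. norm (\<bar>Re (z * (s1 * fst x + s2 * snd x))\<bar> powr \<alpha>)
        \<le> norm (norm (z * s1 * fst x + z * s2 * snd x) powr \<alpha>)"
    proof (rule AE_I2)
      fix x :: "complex \<times> complex"
      have "\<bar>Re (z * (s1 * fst x + s2 * snd x))\<bar> \<le> norm (z * s1 * fst x + z * s2 * snd x)"
        using abs_Re_le_cmod[of "z * (s1 * fst x + s2 * snd x)"] by (simp only: distrib_left mult.assoc)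
      then have "\<bar>Re (z * (s1 * fst x + s2 * snd x))\<bar> powr \<alpha> \<le> norm (z * s1 * fst x + z * s2 * snd x) powr \<alpha>"
        using assms(2) by (intro powr_mono2) auto
      then show "norm (\<bar>Re (z * (s1 * fst x + s2 * snd x))\<bar> powr \<alpha>)
        \<le> norm (norm (z * s1 * fst x + z * s2 * snd x) powr \<alpha>)" by (simp only: real_norm_def abs_of_nonneg[OF powr_ge_zero])
    qed
  qed measurable
qed

text \<open>By Tonelli the average over rotations can be taken under the integral against \<Gamma>,
  where it turns real parts into moduli. Every spectral measure of the pair therefore computes the
  scale of every combination.\<close>

lemma scale_spectral:
  assumes G: "is_spectral_measure M \<alpha> X Y \<Gamma>" and \<alpha>: "0 < \<alpha>"
  shows "sas_scale M \<alpha> (\<lambda>\<omega>. s1 * X \<omega> + s2 * Y \<omega>) = (LINT x|\<Gamma>. norm (s1 * fst x + s2 * snd x) powr \<alpha>)"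
proof -
  interpret G: finite_measure \<Gamma> using G by (simp add: is_spectral_measure_def)
  interpret C: finite_measure circ by (rule finite_measure_circ)
  interpret P: pair_sigma_finite circ \<Gamma> ..
  have [measurable_cong]: "sets \<Gamma> = sets borel" using G by (simp add: is_spectral_measure_def)
  let ?w = "\<lambda>x. s1 * fst x + s2 * snd x"
  let ?u = "\<lambda>\<phi> x. \<bar>Re (cis \<phi> * ?w x)\<bar> powr \<alpha>"
  have cm: "(\<lambda>p. cis (fst p)) \<in> borel_measurable (circ \<Otimes>\<^sub>M \<Gamma>)"
    by (rule borel_measurable_cis, rule measurable_compose[OF measurable_fst circ_ident_measurable])
  have [measurable]: "(\<lambda>(\<phi>, x). ?u \<phi> x) \<in> borel_measurable (circ \<Otimes>\<^sub>M \<Gamma>)"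
    using cm by (simp add: case_prod_beta)
  have inner: "(\<integral>\<^sup>+x. ennreal (?u \<phi> x) \<partial>\<Gamma>) = ennreal (LINT x|\<Gamma>. ?u \<phi> x)" for \<phi>
    by (intro nn_integral_eq_integral spectral_integrable[OF G \<alpha>]) auto
  have meas: "(\<lambda>\<phi>. LINT x|\<Gamma>. ?u \<phi> x) \<in> borel_measurable circ"
    by (rule G.borel_measurable_lebesgue_integral) measurable
  have "(\<integral>\<^sup>+\<phi>. ennreal (LINT x|\<Gamma>. ?u \<phi> x) \<partial>circ) = (\<integral>\<^sup>+\<phi>. (\<integral>\<^sup>+x. ennreal (?u \<phi> x) \<partial>\<Gamma>) \<partial>circ)"
    by (simp only: inner)
  also have "\<dots> = (\<integral>\<^sup>+x. (\<integral>\<^sup>+\<phi>. ennreal (?u \<phi> x) \<partial>circ) \<partial>\<Gamma>)"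
    by (rule P.Fubini'[symmetric]) (simp add: case_prod_beta cm)
  also have "\<dots> = (\<integral>\<^sup>+x. ennreal (norm (?w x) powr \<alpha> * cos_moment \<alpha>) \<partial>\<Gamma>)"
    using integral_circ_abs_Re[OF \<alpha>] by (intro nn_integral_cong) (simp add: nn_integral_eq_integral del: times_complex.sel)
  finally have "(LINT \<phi>|circ. LINT x|\<Gamma>. ?u \<phi> x) = (LINT x|\<Gamma>. norm (?w x) powr \<alpha> * cos_moment \<alpha>)"
    using cos_moment_pos[OF \<alpha>] meas by (subst (1 2) integral_eq_nn_integral) auto
  then show ?thesis
    using cos_moment_pos[OF \<alpha>] by (simp add: sas_scale_def log_char_spectral(2)[OF G])
qed

lemma norm_cis_diff_le: "norm (cis a - cis b) \<le> \<bar>a - b\<bar>"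
proof -
  have "cis a - cis b = cis b * (exp (\<i> * of_real (a - b)) - 1)"
    by (simp add: right_diff_distrib cis_conv_exp flip: exp_add)
  then have "norm (cis a - cis b) = 2 * \<bar>sin ((a - b) / 2)\<bar>"
    by (simp only: norm_mult norm_cis dist_exp_i_1 mult_1)
  also have "\<dots> \<le> 2 * \<bar>(a - b) / 2\<bar>" using abs_sin_x_le_abs_x[of "(a - b) / 2"] by linarith
  finally show ?thesis by simp
qed

locale stable_space = prob_space M for M :: "'a measure" +
  fixes \<alpha> :: real
  assumes \<alpha>: "1 < \<alpha>" "\<alpha> \<le> 2"
begin

lemma sas_varD:
  assumes "sas_var M \<alpha> W"
  shows "W \<in> borel_measurable M" "0 \<le> sas_scale M \<alpha> W"
    "(LINT \<omega>|M. cis (Re (z * W \<omega>))) = of_real (exp (- log_char M W z))"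
    "0 \<le> log_char M W z" "log_char M W z \<le> norm z powr \<alpha> * sas_scale M \<alpha> W"
    "sas_scale M \<alpha> (\<lambda>\<omega>. s * W \<omega>) = norm s powr \<alpha> * sas_scale M \<alpha> W"
proof -
  obtain \<Gamma> where W: "W \<in> borel_measurable M" and G: "is_spectral_measure M \<alpha> W W \<Gamma>"
    using assms by (auto simp: sas_var_def)
  have a0: "0 < \<alpha>" using \<alpha> by simp
  note int = spectral_integrable[OF G a0]
  have nu: "sas_scale M \<alpha> W = (LINT x|\<Gamma>. norm (snd x) powr \<alpha>)"
    using scale_spectral[OF G a0, of 0 1] by simp
  have lc: "log_char M W z = (LINT x|\<Gamma>. \<bar>Re (z * snd x)\<bar> powr \<alpha>)"
    using log_char_spectral(2)[OF G, of 0 1] by simp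
  show "W \<in> borel_measurable M" by fact
  show "0 \<le> sas_scale M \<alpha> W" unfolding nu by simp
  show "0 \<le> log_char M W z" unfolding lc by simp
  show "(LINT \<omega>|M. cis (Re (z * W \<omega>))) = of_real (exp (- log_char M W z))"
    using log_char_spectral(1)[OF G, of z 0 1] lc by simp
  have "log_char M W z \<le> (LINT x|\<Gamma>. norm z powr \<alpha> * norm (snd x) powr \<alpha>)"
    unfolding lc
  proof (rule integral_mono)
    show "integrable \<Gamma> (\<lambda>x. \<bar>Re (z * snd x)\<bar> powr \<alpha>)" using int(2)[of z 0 1] by simp
    show "integrable \<Gamma> (\<lambda>x. norm z powr \<alpha> * norm (snd x) powr \<alpha>)" using int(1)[of 0 1] by simp
    show "\<bar>Re (z * snd x)\<bar> powr \<alpha> \<le> norm z powr \<alpha> * norm (snd x) powr \<alpha>" for x :: "complex \<times> complex"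
      using abs_Re_le_cmod[of "z * snd x"] a0 by (auto simp: norm_mult simp flip: powr_mult intro!: powr_mono2)
  qed
  then show "log_char M W z \<le> norm z powr \<alpha> * sas_scale M \<alpha> W" by (simp add: nu)
  show "sas_scale M \<alpha> (\<lambda>\<omega>. s * W \<omega>) = norm s powr \<alpha> * sas_scale M \<alpha> W"
    using scale_spectral[OF G a0, of 0 s] by (simp add: nu norm_mult powr_mult)
qed

lemma sas_scale_zero: "sas_scale M \<alpha> (\<lambda>\<omega>. 0) = 0"
  by (simp add: sas_scale_def log_char_def prob_space)

text \<open>The combination \<open>W - W\<close> has scale 0, so \<Gamma> is concentrated where the
  two coordinates agree; there the integrand is a power of the modulus.\<close>

lemma covariation_self_spectral:
  assumes G: "is_spectral_measure M \<alpha> W W \<Gamma>"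
  shows "(LINT x|\<Gamma>. fst x * spow (\<alpha> - 1) (snd x)) = of_real (sas_scale M \<alpha> W)"
proof -
  have a0: "0 < \<alpha>" using \<alpha> by simp
  have [measurable_cong]: "sets \<Gamma> = sets borel" using G by (simp add: is_spectral_measure_def)
  have "(LINT x|\<Gamma>. norm (1 * fst x + (-1) * snd x) powr \<alpha>) = sas_scale M \<alpha> (\<lambda>\<omega>. 1 * W \<omega> + (-1) * W \<omega>)"
    by (rule scale_spectral[OF G a0, symmetric])
  then have "(LINT x|\<Gamma>. norm (1 * fst x + (-1) * snd x) powr \<alpha>) = 0" by (simp add: sas_scale_zero)
  then have "AE x in \<Gamma>. norm (1 * fst x + (-1) * snd x) powr \<alpha> = 0"
    using spectral_integrable(1)[OF G a0, of 1 "-1"]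
    by (subst (asm) integral_nonneg_eq_0_iff_AE) auto
  then have ae: "AE x in \<Gamma>. fst x * spow (\<alpha> - 1) (snd x) = of_real (norm (snd x) powr \<alpha>)"
    by eventually_elim (simp add: mult_spow)
  have "(LINT x|\<Gamma>. fst x * spow (\<alpha> - 1) (snd x)) = (LINT x|\<Gamma>. complex_of_real (norm (snd x) powr \<alpha>))"
    by (rule integral_cong_AE[OF _ _ ae]) measurable
  then show ?thesis using scale_spectral[OF G a0, of 0 1] by simp
qed

lemma has_covariation_self_iff:
  "has_covariation M \<alpha> W W c \<longleftrightarrow> sas_var M \<alpha> W \<and> c = of_real (sas_scale M \<alpha> W)"
  unfolding has_covariation_def sas_var_def using covariation_self_spectral by metis

lemma sas_norm_eq:
  assumes "sas_var M \<alpha> W"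
  shows "sas_norm M \<alpha> W = sas_scale M \<alpha> W powr (1 / \<alpha>)" "sas_norm M \<alpha> W powr \<alpha> = sas_scale M \<alpha> W"
proof -
  have "covariation M \<alpha> W W = of_real (sas_scale M \<alpha> W)"
    unfolding covariation_def by (rule the_equality) (use assms has_covariation_self_iff in auto)
  then show 1: "sas_norm M \<alpha> W = sas_scale M \<alpha> W powr (1 / \<alpha>)" by (simp add: sas_norm_def)
  show "sas_norm M \<alpha> W powr \<alpha> = sas_scale M \<alpha> W"
    unfolding 1 powr_powr using \<alpha> sas_varD(2)[OF assms] by simp
qed

section \<open>Smallness of the scale and smallness in probability\<close>

lemma prob_norm_triangle:
  assumes [measurable]: "X \<in> borel_measurable M" "Y \<in> borel_measurable M" "Z \<in> borel_measurable M"
  shows "prob {\<omega> \<in> space M. d + e \<le> norm (X \<omega> - Z \<omega> :: 'b::{second_countable_topology, real_normed_vector})}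
    \<le> prob {\<omega> \<in> space M. d \<le> norm (X \<omega> - Y \<omega>)} + prob {\<omega> \<in> space M. e \<le> norm (Y \<omega> - Z \<omega>)}"
proof -
  have "{\<omega> \<in> space M. d + e \<le> norm (X \<omega> - Z \<omega>)}
      \<subseteq> {\<omega> \<in> space M. d \<le> norm (X \<omega> - Y \<omega>)} \<union> {\<omega> \<in> space M. e \<le> norm (Y \<omega> - Z \<omega>)}"
  proof
    fix \<omega> assume "\<omega> \<in> {\<omega> \<in> space M. d + e \<le> norm (X \<omega> - Z \<omega>)}"
    then show "\<omega> \<in> {\<omega> \<in> space M. d \<le> norm (X \<omega> - Y \<omega>)} \<union> {\<omega> \<in> space M. e \<le> norm (Y \<omega> - Z \<omega>)}"
      using norm_triangle_ineq[of "X \<omega> - Y \<omega>" "Y \<omega> - Z \<omega>"] by auto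
  qed
  then have "prob {\<omega> \<in> space M. d + e \<le> norm (X \<omega> - Z \<omega>)}
      \<le> prob ({\<omega> \<in> space M. d \<le> norm (X \<omega> - Y \<omega>)} \<union> {\<omega> \<in> space M. e \<le> norm (Y \<omega> - Z \<omega>)})"
    by (intro finite_measure_mono) measurable
  also have "\<dots> \<le> prob {\<omega> \<in> space M. d \<le> norm (X \<omega> - Y \<omega>)} + prob {\<omega> \<in> space M. e \<le> norm (Y \<omega> - Z \<omega>)}"
    by (rule measure_Un_le) measurable
  finally show ?thesis .
qed

text \<open>On the event that the variables are at least \<open>e\<close> apart the exponentials
  differ by at most 2, elsewhere by at most \<open>norm z * e\<close>.\<close>

lemma char_diff_le:
  assumes [measurable]: "X \<in> borel_measurable M" "Y \<in> borel_measurable M" and e: "0 < e"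
  shows "norm ((LINT \<omega>|M. cis (Re (z * X \<omega>))) - (LINT \<omega>|M. cis (Re (z * Y \<omega>))))
    \<le> norm z * e + 2 * prob {\<omega> \<in> space M. e \<le> norm (X \<omega> - Y \<omega>)}"
proof -
  let ?B = "{\<omega> \<in> space M. e \<le> norm (X \<omega> - Y \<omega>)}"
  have int: "integrable M (\<lambda>\<omega>. cis (Re (z * W \<omega>)))" if "W \<in> borel_measurable M" for W
    by (rule integrable_const_bound[of _ 1]) (use that in auto)
  have ind: "integrable M (indicator ?B :: 'a \<Rightarrow> real)"
    by (rule integrable_real_indicator) (simp_all add: less_top[symmetric])
  have "norm ((LINT \<omega>|M. cis (Re (z * X \<omega>))) - (LINT \<omega>|M. cis (Re (z * Y \<omega>))))
      = norm (LINT \<omega>|M. cis (Re (z * X \<omega>)) - cis (Re (z * Y \<omega>)))"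
    using int by simp
  also have "\<dots> \<le> (LINT \<omega>|M. norm (cis (Re (z * X \<omega>)) - cis (Re (z * Y \<omega>))))"
    by (rule integral_norm_bound)
  also have "\<dots> \<le> (LINT \<omega>|M. norm z * e + 2 * indicator ?B \<omega>)"
  proof (rule integral_mono)
    show "integrable M (\<lambda>\<omega>. norm (cis (Re (z * X \<omega>)) - cis (Re (z * Y \<omega>))))" using int by auto
    show "integrable M (\<lambda>\<omega>. norm z * e + 2 * indicator ?B \<omega>)"
      using ind by simp
    fix \<omega> assume w: "\<omega> \<in> space M"
    have 2: "norm (cis (Re (z * X \<omega>)) - cis (Re (z * Y \<omega>))) \<le> 2"
      using norm_triangle_ineq4[of "cis (Re (z * X \<omega>))" "cis (Re (z * Y \<omega>))"] by simp
    have "norm (cis (Re (z * X \<omega>)) - cis (Re (z * Y \<omega>))) \<le> \<bar>Re (z * (X \<omega> - Y \<omega>))\<bar>"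
      using norm_cis_diff_le[of "Re (z * X \<omega>)" "Re (z * Y \<omega>)"] by (simp add: right_diff_distrib)
    also have "\<dots> \<le> norm z * norm (X \<omega> - Y \<omega>)"
      using abs_Re_le_cmod[of "z * (X \<omega> - Y \<omega>)"] by (simp only: norm_mult)
    finally have 1: "norm (cis (Re (z * X \<omega>)) - cis (Re (z * Y \<omega>))) \<le> norm z * norm (X \<omega> - Y \<omega>)" .
    show "norm (cis (Re (z * X \<omega>)) - cis (Re (z * Y \<omega>))) \<le> norm z * e + 2 * indicator ?B \<omega>"
    proof (cases "\<omega> \<in> ?B")
      case True
      then show ?thesis using 2 e by (simp add: add_increasing)
    next
      case False
      then have "norm z * norm (X \<omega> - Y \<omega>) \<le> norm z * e" using w by (intro mult_left_mono) auto
      then show ?thesis using 1 False by simp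
    qed
  qed
  also have "\<dots> = norm z * e + 2 * prob ?B"
    using ind by (simp add: prob_space)
  finally show ?thesis .
qed

text \<open>A variable that is small in probability has a characteristic function close to 1 on the
  unit circle, hence a small logarithm there, and the scale is the integral of that logarithm up to
  a constant. The factor \<open>2 * pi\<close> is the length of the circle.\<close>

lemma scale_le_of_prob:
  assumes W: "sas_var M \<alpha> W" and e: "0 < e" "e \<le> 1 / 6"
    and p: "prob {\<omega> \<in> space M. e \<le> norm (W \<omega>)} \<le> e"
  shows "sas_scale M \<alpha> W \<le> 2 * pi * (6 * e) / cos_moment \<alpha>"
proof -
  have lc: "log_char M W (cis \<phi>) \<le> 6 * e" for \<phi>
  proof -
    have "norm ((LINT \<omega>|M. cis (Re (cis \<phi> * W \<omega>))) - (LINT \<omega>|M. cis (Re (cis \<phi> * 0)))) \<le> 3 * e"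
      using char_diff_le[OF sas_varD(1)[OF W] borel_measurable_const e(1), of "cis \<phi>" 0] p by simp
    then have "norm (complex_of_real (exp (- log_char M W (cis \<phi>)) - 1)) \<le> 3 * e"
      using sas_varD(3)[OF W, of "cis \<phi>"] by (simp add: prob_space)
    then have "\<bar>exp (- log_char M W (cis \<phi>)) - 1\<bar> \<le> 3 * e" by (simp only: norm_of_real)
    then have x: "1 - 3 * e \<le> exp (- log_char M W (cis \<phi>))" by linarith
    \<comment> \<open>The bound \<open>e \<le> 1 / 6\<close> enters here: it makes the product of
      \<open>1 - 3 * e\<close> and \<open>1 + 6 * e\<close> at least 1.\<close>
    have "exp (- (6 * e)) \<le> 1 - 3 * e"
    proof -
      have "(1 - 3 * e) * (1 + 6 * e) = 1 + 3 * e * (1 - 6 * e)" by (simp add: algebra_simps)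
      then have "1 \<le> (1 - 3 * e) * (1 + 6 * e)" using e by simp
      also have "\<dots> \<le> (1 - 3 * e) * exp (6 * e)" using e by (intro mult_left_mono exp_ge_add_one_self) auto
      finally show ?thesis by (simp add: exp_minus field_simps)
    qed
    then have "exp (- (6 * e)) \<le> exp (- log_char M W (cis \<phi>))" using x by linarith
    then show ?thesis by simp
  qed
  have "(LINT \<phi>|circ. log_char M W (cis \<phi>)) \<le> (LINT \<phi>|circ. 6 * e)"
  proof (rule integral_mono')
    show "integrable circ (\<lambda>\<phi>. 6 * e)" using finite_measure.integrable_const[OF finite_measure_circ] by simp
  qed (use lc sas_varD(4)[OF W] e in auto)
  then have "(LINT \<phi>|circ. log_char M W (cis \<phi>)) \<le> 2 * pi * (6 * e)"
    by (simp add: measure_restrict_space)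
  then show ?thesis using cos_moment_pos[of \<alpha>] \<alpha> unfolding sas_scale_def
    by (intro divide_right_mono) auto
qed

text \<open>Levy's continuity theorem with the point mass at 0 as limit. Its distribution function
  is continuous at \<open>e / 2\<close> and at \<open>- e / 2\<close>, which controls both
  tails.\<close>

lemma real_char_tendsto_1_imp_prob:
  fixes X :: "nat \<Rightarrow> 'a \<Rightarrow> real"
  assumes [measurable]: "\<And>n. X n \<in> borel_measurable M"
    and c: "\<And>t. (\<lambda>n. LINT \<omega>|M. cis (t * X n \<omega>)) \<longlonglongrightarrow> 1" and e: "0 < e"
  shows "(\<lambda>n. prob {\<omega> \<in> space M. e \<le> \<bar>X n \<omega>\<bar>}) \<longlonglongrightarrow> 0"
proof -
  let ?D = "\<lambda>n. distr M borel (X n)"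
  have "real_distribution (return borel (0::real))"
    using prob_space_return[of 0 borel] by (simp add: real_distribution_def real_distribution_axioms_def)
  then interpret R: real_distribution "return borel (0::real)" .
  have D: "real_distribution (?D n)" for n by (rule real_distribution_distr) simp
  have "(\<lambda>n. char (?D n) t) \<longlonglongrightarrow> char (return borel 0) t" for t
  proof -
    have "char (?D n) t = (LINT \<omega>|M. cis (t * X n \<omega>))" for n
      by (simp add: char_def integral_distr cis_conv_exp)
    moreover have "char (return borel (0::real)) t = 1"
      unfolding char_def by (subst integral_return) auto
    ultimately show ?thesis using c by simp
  qed
  then have "weak_conv_m ?D (return borel 0)"
    using D R.real_distribution_axioms by (intro levy_continuity) auto
  then have conv: "(\<lambda>n. cdf (?D n) x) \<longlonglongrightarrow> cdf (return borel 0) x" if "x \<noteq> 0" for x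
  proof -
    have "isCont (cdf (return borel (0::real))) x"
      using that by (simp add: R.isCont_cdf measure_return)
    then show ?thesis using \<open>weak_conv_m _ _\<close> by (simp add: weak_conv_m_def weak_conv_def)
  qed
  have cdf: "cdf (?D n) x = prob {\<omega> \<in> space M. X n \<omega> \<le> x}" for n x
    by (simp add: cdf_def measure_distr vimage_def Int_def conj_commute)
  have "prob {\<omega> \<in> space M. e \<le> \<bar>X n \<omega>\<bar>} \<le> cdf (?D n) (- e / 2) + (1 - cdf (?D n) (e / 2))" for n
  proof -
    have "prob {\<omega> \<in> space M. e \<le> \<bar>X n \<omega>\<bar>}
        \<le> prob ({\<omega> \<in> space M. X n \<omega> \<le> - e / 2} \<union> (space M - {\<omega> \<in> space M. X n \<omega> \<le> e / 2}))"
      using e by (intro finite_measure_mono) auto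
    also have "\<dots> \<le> prob {\<omega> \<in> space M. X n \<omega> \<le> - e / 2} + prob (space M - {\<omega> \<in> space M. X n \<omega> \<le> e / 2})"
      by (rule measure_Un_le) measurable
    also have "prob (space M - {\<omega> \<in> space M. X n \<omega> \<le> e / 2}) = 1 - prob {\<omega> \<in> space M. X n \<omega> \<le> e / 2}"
      by (rule prob_compl) measurable
    finally show ?thesis unfolding cdf .
  qed
  note bound = this
  have lim: "(\<lambda>n. cdf (?D n) (- e / 2) + (1 - cdf (?D n) (e / 2))) \<longlonglongrightarrow> 0"
  proof -
    have "cdf (return borel (0::real)) (- e / 2) = 0" "cdf (return borel (0::real)) (e / 2) = 1"
      using e by (simp_all add: cdf_def measure_return)
    then show ?thesis
      using tendsto_add[OF conv[of "- e / 2"] tendsto_diff[OF tendsto_const conv[of "e / 2"], of 1]] e by simp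
  qed
  show ?thesis
    by (rule tendsto_sandwich[OF _ _ tendsto_const lim]) (use bound in auto)
qed

lemma scale_tendsto_0_imp_prob:
  assumes W: "\<And>n. sas_var M \<alpha> (W n)" and s: "(\<lambda>n. sas_scale M \<alpha> (W n)) \<longlonglongrightarrow> 0" and e: "0 < e"
  shows "(\<lambda>n. prob {\<omega> \<in> space M. e \<le> norm (W n \<omega>)}) \<longlonglongrightarrow> 0"
proof -
  have [measurable]: "W n \<in> borel_measurable M" for n using sas_varD(1)[OF W] .
  have ch: "(\<lambda>n. LINT \<omega>|M. cis (Re (z * W n \<omega>))) \<longlonglongrightarrow> 1" for z
  proof -
    have "(\<lambda>n. log_char M (W n) z) \<longlonglongrightarrow> 0"
    proof (rule tendsto_sandwich[OF _ _ tendsto_const])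
      show "(\<lambda>n. norm z powr \<alpha> * sas_scale M \<alpha> (W n)) \<longlonglongrightarrow> 0" using tendsto_mult_right_zero[OF s] .
    qed (use sas_varD(4,5)[OF W] in auto)
    then have "(\<lambda>n. complex_of_real (exp (- log_char M (W n) z))) \<longlonglongrightarrow> of_real (exp (- 0))"
      by (intro tendsto_intros)
    then show ?thesis using sas_varD(3)[OF W] by simp
  qed
  have "(\<lambda>n. prob {\<omega> \<in> space M. e / 2 \<le> \<bar>Re (W n \<omega>)\<bar>}) \<longlonglongrightarrow> 0"
    using ch[of "of_real _"] e by (intro real_char_tendsto_1_imp_prob) auto
  \<comment> \<open>For real \<open>t\<close> the real part of \<open>- \<i> * t * w\<close> is
    \<open>t * Im w\<close>, so this choice of \<open>z\<close> treats the imaginary part.\<close>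
  moreover have "(\<lambda>n. prob {\<omega> \<in> space M. e / 2 \<le> \<bar>Im (W n \<omega>)\<bar>}) \<longlonglongrightarrow> 0"
    using ch[of "- \<i> * of_real _"] e by (intro real_char_tendsto_1_imp_prob) auto
  ultimately have lim: "(\<lambda>n. prob {\<omega> \<in> space M. e / 2 \<le> \<bar>Re (W n \<omega>)\<bar>}
      + prob {\<omega> \<in> space M. e / 2 \<le> \<bar>Im (W n \<omega>)\<bar>}) \<longlonglongrightarrow> 0"
    by (rule tendsto_add_zero)
  have "prob {\<omega> \<in> space M. e \<le> norm (W n \<omega>)} \<le> prob {\<omega> \<in> space M. e / 2 \<le> \<bar>Re (W n \<omega>)\<bar>}
      + prob {\<omega> \<in> space M. e / 2 \<le> \<bar>Im (W n \<omega>)\<bar>}" for n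
  proof -
    have "{\<omega> \<in> space M. e \<le> norm (W n \<omega>)}
        \<subseteq> {\<omega> \<in> space M. e / 2 \<le> \<bar>Re (W n \<omega>)\<bar>} \<union> {\<omega> \<in> space M. e / 2 \<le> \<bar>Im (W n \<omega>)\<bar>}"
    proof
      fix \<omega> assume "\<omega> \<in> {\<omega> \<in> space M. e \<le> norm (W n \<omega>)}"
      then show "\<omega> \<in> {\<omega> \<in> space M. e / 2 \<le> \<bar>Re (W n \<omega>)\<bar>} \<union> {\<omega> \<in> space M. e / 2 \<le> \<bar>Im (W n \<omega>)\<bar>}"
        using cmod_le[of "W n \<omega>"] by auto
    qed
    then have "prob {\<omega> \<in> space M. e \<le> norm (W n \<omega>)}
        \<le> prob ({\<omega> \<in> space M. e / 2 \<le> \<bar>Re (W n \<omega>)\<bar>} \<union> {\<omega> \<in> space M. e / 2 \<le> \<bar>Im (W n \<omega>)\<bar>})"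
      by (intro finite_measure_mono) measurable
    also have "\<dots> \<le> prob {\<omega> \<in> space M. e / 2 \<le> \<bar>Re (W n \<omega>)\<bar>} + prob {\<omega> \<in> space M. e / 2 \<le> \<bar>Im (W n \<omega>)\<bar>}"
      by (rule measure_Un_le) measurable
    finally show ?thesis .
  qed
  note bound = this
  show ?thesis
    by (rule tendsto_sandwich[OF _ _ tendsto_const lim]) (use bound in auto)
qed

text \<open>The continuity theorem speaks of sequences. Variables that violate the claim with scales
  tending to 0 would contradict it, and this makes \<open>d\<close> uniform in
  \<open>W\<close>.\<close>

lemma prob_small_of_scale:
  assumes "0 < e"
  obtains d where "0 < d" "\<And>W. sas_var M \<alpha> W \<Longrightarrow> sas_scale M \<alpha> W < d \<Longrightarrow> prob {\<omega> \<in> space M. e \<le> norm (W \<omega>)} < e"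
proof (rule ccontr)
  assume neg: "\<not> thesis"
  have "\<exists>W. sas_var M \<alpha> W \<and> sas_scale M \<alpha> W < inverse (real (Suc n)) \<and> e \<le> prob {\<omega> \<in> space M. e \<le> norm (W \<omega>)}" for n
  proof (rule ccontr)
    assume "\<not> ?thesis"
    then have thesis by (intro that[of "inverse (real (Suc n))"]) (auto simp: not_le simp del: of_nat_Suc)
    then show False using neg by simp
  qed
  then obtain W where W: "\<And>n. sas_var M \<alpha> (W n)" "\<And>n. sas_scale M \<alpha> (W n) < inverse (real (Suc n))"
    "\<And>n. e \<le> prob {\<omega> \<in> space M. e \<le> norm (W n \<omega>)}" by metis
  have "(\<lambda>n. sas_scale M \<alpha> (W n)) \<longlonglongrightarrow> 0"
    using sas_varD(2)[OF W(1)]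
    by (intro tendsto_sandwich[OF _ _ tendsto_const LIMSEQ_inverse_real_of_nat] always_eventually allI
        less_imp_le[OF W(2)]) auto
  from scale_tendsto_0_imp_prob[OF W(1) this assms]
  have "e \<le> 0" by (rule LIMSEQ_le_const) (use W(3) in auto)
  then show False using assms by simp
qed

end

section \<open>Structure of a spectral density\<close>

context stable_space
begin

lemma tendsto_prob_eventually:
  assumes "tendsto_prob M Y X" "0 < e" "0 < d"
  shows "\<forall>\<^sub>F n in sequentially. prob {\<omega> \<in> space M. e \<le> norm (Y n \<omega> - X \<omega>)} < d"
  using assms by (auto simp: tendsto_prob_def intro: order_tendstoD(2))

lemma AE_tendsto_imp_tendsto_prob:
  assumes [measurable]: "\<And>n. Y n \<in> borel_measurable M" "X \<in> borel_measurable M"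
    and lim: "AE \<omega> in M. (\<lambda>n. Y n \<omega>) \<longlonglongrightarrow> X \<omega>"
  shows "tendsto_prob M Y X"
  unfolding tendsto_prob_def
proof (intro allI impI)
  fix e :: real assume e: "0 < e"
  let ?B = "\<lambda>n. {\<omega> \<in> space M. e \<le> norm (Y n \<omega> - X \<omega>)}"
  have "(\<lambda>n. LINT \<omega>|M. indicator (?B n) \<omega> :: real) \<longlonglongrightarrow> (LINT \<omega>|M. 0)"
  proof (rule integral_dominated_convergence[where w = "\<lambda>_. 1"])
    show "AE \<omega> in M. (\<lambda>n. indicator (?B n) \<omega> :: real) \<longlonglongrightarrow> 0"
      using lim
    proof eventually_elim
      case (elim \<omega>)
      have "\<forall>\<^sub>F n in sequentially. dist (Y n \<omega>) (X \<omega>) < e" using elim e by (rule tendstoD)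
      then have "\<forall>\<^sub>F n in sequentially. indicator (?B n) \<omega> = (0::real)"
        by eventually_elim (auto simp: dist_norm)
      then show ?case by (rule tendsto_eventually)
    qed
  qed auto
  then show "(\<lambda>n. prob (?B n)) \<longlonglongrightarrow> 0" by simp
qed

text \<open>A subsequence with geometric bounds for both the distance and the probability converges
  almost surely by Borel-Cantelli; the Cauchy property carries its limit to the whole
  sequence.\<close>

lemma prob_Cauchy_convergent:
  fixes Y :: "nat \<Rightarrow> 'a \<Rightarrow> complex"
  assumes Y[measurable]: "\<And>n. Y n \<in> borel_measurable M"
    and cauchy: "\<And>e. 0 < e \<Longrightarrow> \<exists>n0. \<forall>i\<ge>n0. \<forall>j\<ge>n0. prob {\<omega> \<in> space M. e \<le> norm (Y i \<omega> - Y j \<omega>)} < e"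
  obtains X where "X \<in> borel_measurable M" "tendsto_prob M Y X"
proof -
  have "\<exists>r. \<forall>k. (\<forall>i\<ge>r k. \<forall>j\<ge>r k. prob {\<omega> \<in> space M. (1/2) ^ k \<le> norm (Y i \<omega> - Y j \<omega>)} < (1/2) ^ k) \<and> r k < r (Suc k)"
  proof (rule dependent_nat_choice)
    show "\<exists>x. \<forall>i\<ge>x. \<forall>j\<ge>x. prob {\<omega> \<in> space M. (1/2) ^ 0 \<le> norm (Y i \<omega> - Y j \<omega>)} < (1/2) ^ 0"
      using cauchy[of "(1/2) ^ 0"] by simp
    fix x k
    obtain n0 where n0: "\<forall>i\<ge>n0. \<forall>j\<ge>n0. prob {\<omega> \<in> space M. (1/2) ^ Suc k \<le> norm (Y i \<omega> - Y j \<omega>)} < (1/2) ^ Suc k"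
      using cauchy[of "(1/2) ^ Suc k"] by auto
    show "\<exists>y. (\<forall>i\<ge>y. \<forall>j\<ge>y. prob {\<omega> \<in> space M. (1/2) ^ Suc k \<le> norm (Y i \<omega> - Y j \<omega>)} < (1/2) ^ Suc k) \<and> x < y"
      using n0 by (intro exI[of _ "max n0 (Suc x)"]) (simp del: power_Suc)
  qed
  then obtain r where r: "\<And>k i j. r k \<le> i \<Longrightarrow> r k \<le> j \<Longrightarrow>
      prob {\<omega> \<in> space M. (1/2) ^ k \<le> norm (Y i \<omega> - Y j \<omega>)} < (1/2) ^ k" "\<And>k. r k < r (Suc k)"
    by metis
  define B where "B = (\<lambda>k. {\<omega> \<in> space M. (1/2) ^ k \<le> norm (Y (r (Suc k)) \<omega> - Y (r k) \<omega>)})"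
  have "AE \<omega> in M. \<forall>\<^sub>F k in sequentially. \<omega> \<in> space M - B k"
  proof (rule borel_cantelli_AE1)
    show "B k \<in> sets M" for k unfolding B_def by measurable
    have "norm (prob (B k)) \<le> (1/2) ^ k" for k
      using r(1)[of k "r (Suc k)" "r k"] r(2)[of k] by (simp add: B_def)
    then show "summable (\<lambda>k. prob (B k))"
      by (intro summable_comparison_test'[OF summable_geometric[of "1/2::real"]]) auto
  qed (simp add: less_top[symmetric])
  then have conv: "AE \<omega> in M. convergent (\<lambda>k. Y (r k) \<omega>)"
  proof eventually_elim
    case (elim \<omega>)
    then have "\<forall>\<^sub>F k in sequentially. norm (Y (r (Suc k)) \<omega> - Y (r k) \<omega>) \<le> (1/2) ^ k"
      by eventually_elim (auto simp: B_def)
    then have "summable (\<lambda>k. Y (r (Suc k)) \<omega> - Y (r k) \<omega>)"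
      by (rule summable_comparison_test_ev) (simp add: summable_geometric)
    then have "convergent (\<lambda>n. \<Sum>k<n. Y (r (Suc k)) \<omega> - Y (r k) \<omega>)"
      by (simp add: summable_iff_convergent)
    then have "convergent (\<lambda>n. Y (r n) \<omega> - Y (r 0) \<omega>)"
      by (simp only: sum_lessThan_telescope[of "\<lambda>k. Y (r k) \<omega>"])
    then have "convergent (\<lambda>n. (Y (r n) \<omega> - Y (r 0) \<omega>) + Y (r 0) \<omega>)"
      by (intro convergent_add convergent_const)
    then show ?case by simp
  qed
  define X where "X = (\<lambda>\<omega>. lim (\<lambda>k. Y (r k) \<omega>))"
  have X[measurable]: "X \<in> borel_measurable M"
    unfolding X_def by (rule borel_measurable_lim_metric) simp
  have "AE \<omega> in M. (\<lambda>k. Y (r k) \<omega>) \<longlonglongrightarrow> X \<omega>"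
    using conv by eventually_elim (simp add: X_def convergent_LIMSEQ_iff)
  then have sub: "tendsto_prob M (\<lambda>k. Y (r k)) X"
    by (intro AE_tendsto_imp_tendsto_prob) auto
  have "tendsto_prob M Y X"
    unfolding tendsto_prob_def
  proof (intro allI impI LIMSEQ_I)
    fix e d :: real assume e: "0 < e" and d: "0 < d"
    \<comment> \<open>The Cauchy hypothesis has one number for distance and probability, so it must
      lie below both tolerances.\<close>
    define c where "c = min (e / 2) (d / 2)"
    have c: "0 < c" using e d by (simp add: c_def)
    obtain n0 where n0: "\<And>i j. n0 \<le> i \<Longrightarrow> n0 \<le> j \<Longrightarrow> prob {\<omega> \<in> space M. c \<le> norm (Y i \<omega> - Y j \<omega>)} < c"
      using cauchy[OF c] by blast
    have "\<forall>\<^sub>F k in sequentially. prob {\<omega> \<in> space M. e / 2 \<le> norm (Y (r k) \<omega> - X \<omega>)} < d / 2"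
      using e d by (intro tendsto_prob_eventually[OF sub]) auto
    then have "\<forall>\<^sub>F k in sequentially. prob {\<omega> \<in> space M. e / 2 \<le> norm (Y (r k) \<omega> - X \<omega>)} < d / 2 \<and> n0 \<le> k"
      by (intro eventually_conj eventually_ge_at_top)
    then obtain k where k: "prob {\<omega> \<in> space M. e / 2 \<le> norm (Y (r k) \<omega> - X \<omega>)} < d / 2" "n0 \<le> k"
      using eventually_happens'[OF sequentially_bot] by blast
    have rk: "n0 \<le> r k" using k(2) strict_mono_imp_increasing[of r k] r(2)
      by (simp add: strict_mono_Suc_iff order_trans)
    have "prob {\<omega> \<in> space M. e \<le> norm (Y n \<omega> - X \<omega>)} < d" if "n0 \<le> n" for n
    proof -
      have "prob {\<omega> \<in> space M. e / 2 \<le> norm (Y n \<omega> - Y (r k) \<omega>)} \<le> prob {\<omega> \<in> space M. c \<le> norm (Y n \<omega> - Y (r k) \<omega>)}"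
        by (intro finite_measure_mono) (auto simp: c_def)
      also have "\<dots> < c" by (rule n0[OF that rk])
      also have "c \<le> d / 2" by (simp add: c_def)
      finally show ?thesis using k(1) prob_norm_triangle[OF Y[of n] Y[of "r k"] X, of "e / 2" "e / 2"] by simp
    qed
    then show "\<exists>n0. \<forall>n\<ge>n0. norm (prob {\<omega> \<in> space M. e \<le> norm (Y n \<omega> - X \<omega>)} - 0) < d"
      by (intro exI[of _ n0]) simp
  qed
  then show ?thesis using that X by blast
qed

lemma AE_eq_of_prob:
  fixes X Y :: "'a \<Rightarrow> complex"
  assumes [measurable]: "X \<in> borel_measurable M" "Y \<in> borel_measurable M"
    and 0: "\<And>e. 0 < e \<Longrightarrow> prob {\<omega> \<in> space M. e \<le> norm (X \<omega> - Y \<omega>)} = 0"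
  shows "AE \<omega> in M. X \<omega> = Y \<omega>"
proof -
  have "AE \<omega> in M. \<not> inverse (real (Suc n)) \<le> norm (X \<omega> - Y \<omega>)" for n
    by (subst AE_iff_measurable[OF _ refl]) (use 0[of "inverse (real (Suc n))"] in \<open>auto simp: emeasure_eq_measure\<close>)
  then have "AE \<omega> in M. \<forall>n. \<not> inverse (real (Suc n)) \<le> norm (X \<omega> - Y \<omega>)"
    by (simp only: AE_all_countable) simp
  then show ?thesis
  proof eventually_elim
    case (elim \<omega>)
    show ?case
    proof (rule ccontr)
      assume "X \<omega> \<noteq> Y \<omega>"
      then obtain n where "inverse (real (Suc n)) < norm (X \<omega> - Y \<omega>)"
        using reals_Archimedean[of "norm (X \<omega> - Y \<omega>)"] by auto
      then show False using elim less_imp_le by blast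
    qed
  qed
qed

lemma tendsto_prob_unique:
  assumes [measurable]: "\<And>n. Y n \<in> borel_measurable M" "X \<in> borel_measurable M" "X' \<in> borel_measurable M"
    and t: "tendsto_prob M Y X" "tendsto_prob M Y X'"
  shows "AE \<omega> in M. X \<omega> = X' \<omega>"
proof (rule AE_eq_of_prob)
  fix e :: real assume e: "0 < e"
  let ?b = "\<lambda>n. prob {\<omega> \<in> space M. e / 2 \<le> norm (Y n \<omega> - X \<omega>)} + prob {\<omega> \<in> space M. e / 2 \<le> norm (Y n \<omega> - X' \<omega>)}"
  have "prob {\<omega> \<in> space M. e \<le> norm (X \<omega> - X' \<omega>)} \<le> ?b n" for n
    using prob_norm_triangle[of X "Y n" X' "e / 2" "e / 2"] by (simp add: norm_minus_commute[of "X _"])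
  moreover have "?b \<longlonglongrightarrow> 0"
    using tendsto_add_zero[OF t(1)[unfolded tendsto_prob_def, rule_format, of "e / 2"]
        t(2)[unfolded tendsto_prob_def, rule_format, of "e / 2"]] e by simp
  ultimately have "prob {\<omega> \<in> space M. e \<le> norm (X \<omega> - X' \<omega>)} \<le> 0"
    by (intro LIMSEQ_le_const[where X = ?b]) auto
  then show "prob {\<omega> \<in> space M. e \<le> norm (X \<omega> - X' \<omega>)} = 0" by (simp add: antisym)
qed measurable

lemma tendsto_prob_add:
  assumes [measurable]: "\<And>n. Y n \<in> borel_measurable M" "X \<in> borel_measurable M"
      "\<And>n. Y' n \<in> borel_measurable M" "X' \<in> borel_measurable M"
    and t: "tendsto_prob M Y X" "tendsto_prob M Y' X'"
  shows "tendsto_prob M (\<lambda>n \<omega>. Y n \<omega> + Y' n \<omega>) (\<lambda>\<omega>. X \<omega> + X' \<omega>)"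
  unfolding tendsto_prob_def
proof (intro allI impI)
  fix e :: real assume e: "0 < e"
  let ?b = "\<lambda>n. prob {\<omega> \<in> space M. e / 2 \<le> norm (Y n \<omega> - X \<omega>)} + prob {\<omega> \<in> space M. e / 2 \<le> norm (Y' n \<omega> - X' \<omega>)}"
  have bound: "prob {\<omega> \<in> space M. e \<le> norm (Y n \<omega> + Y' n \<omega> - (X \<omega> + X' \<omega>))} \<le> ?b n" for n
    using prob_norm_triangle[of "\<lambda>\<omega>. Y n \<omega> + Y' n \<omega>" "\<lambda>\<omega>. X \<omega> + Y' n \<omega>" "\<lambda>\<omega>. X \<omega> + X' \<omega>" "e / 2" "e / 2"] by simp
  have lim: "?b \<longlonglongrightarrow> 0"
    using tendsto_add_zero[OF t(1)[unfolded tendsto_prob_def, rule_format, of "e / 2"]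
        t(2)[unfolded tendsto_prob_def, rule_format, of "e / 2"]] e by simp
  show "(\<lambda>n. prob {\<omega> \<in> space M. e \<le> norm (Y n \<omega> + Y' n \<omega> - (X \<omega> + X' \<omega>))}) \<longlonglongrightarrow> 0"
    by (rule tendsto_sandwich[OF _ _ tendsto_const lim]) (use bound in auto)
qed

lemma tendsto_prob_scale:
  assumes "tendsto_prob M Y X"
  shows "tendsto_prob M (\<lambda>n \<omega>. z * Y n \<omega>) (\<lambda>\<omega>. z * X \<omega>)"
proof (cases "z = 0")
  case True
  then show ?thesis by (simp add: tendsto_prob_def)
next
  case False
  have "e \<le> norm (z * y - z * x) \<longleftrightarrow> e / norm z \<le> norm (y - x)" for e x y
  proof -
    have "norm (z * y - z * x) = norm (y - x) * norm z"
      unfolding right_diff_distrib[symmetric] norm_mult by (rule mult.commute)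
    then show ?thesis using False by (simp add: pos_divide_le_eq)
  qed
  then show ?thesis using assms False by (simp add: tendsto_prob_def)
qed

lemma tendsto_prob_char:
  assumes [measurable]: "\<And>n. Y n \<in> borel_measurable M" "X \<in> borel_measurable M"
    and t: "tendsto_prob M Y X"
  shows "(\<lambda>n. LINT \<omega>|M. cis (Re (z * Y n \<omega>))) \<longlonglongrightarrow> (LINT \<omega>|M. cis (Re (z * X \<omega>)))"
proof (rule LIMSEQ_I)
  fix d :: real assume d: "0 < d"
  \<comment> \<open>A positive bound for \<open>norm z\<close> that also works for
    \<open>z = 0\<close>; it makes the first term of \<open>char_diff_le\<close> at most
    \<open>d / 2\<close>.\<close>
  define c where "c = norm z + 1"
  define e where "e = d / (2 * c)"
  have z: "0 < c" by (simp add: c_def add_nonneg_pos)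
  have e: "0 < e" using d z by (simp add: e_def)
  have "norm z * e \<le> c * e" using e by (simp add: c_def)
  also have "\<dots> = d / 2" using z by (simp add: e_def)
  finally have ze: "norm z * e \<le> d / 2" .
  have "\<forall>\<^sub>F n in sequentially. prob {\<omega> \<in> space M. e \<le> norm (Y n \<omega> - X \<omega>)} < d / 4"
    using d e by (intro tendsto_prob_eventually[OF t]) auto
  then have "\<forall>\<^sub>F n in sequentially. norm ((LINT \<omega>|M. cis (Re (z * Y n \<omega>))) - (LINT \<omega>|M. cis (Re (z * X \<omega>)))) < d"
  proof eventually_elim
    case (elim n)
    then show ?case using char_diff_le[of "Y n" X e z] e ze by simp
  qed
  then show "\<exists>n0. \<forall>n\<ge>n0. norm ((LINT \<omega>|M. cis (Re (z * Y n \<omega>))) - (LINT \<omega>|M. cis (Re (z * X \<omega>)))) < d"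
    by (simp add: eventually_sequentially)
qed

end

section \<open>The density as a weight\<close>

lemma abs_norm_powr_diff_le:
  fixes u v :: complex
  assumes \<alpha>: "1 < \<alpha>" "\<alpha> \<le> 2" and uv: "norm u \<le> 2" "norm v \<le> 2"
  shows "\<bar>norm u powr \<alpha> - norm v powr \<alpha>\<bar> \<le> 2 * \<alpha> * norm (u - v)"
proof -
  \<comment> \<open>The slope of the supporting hyperplane at \<open>y\<close> is \<alpha> times
    \<open>norm y powr (\<alpha> - 1)\<close>, at most \<open>2 * \<alpha>\<close> when
    \<open>norm y \<le> 2\<close>.\<close>
  have *: "norm y powr \<alpha> - norm x powr \<alpha> \<le> 2 * \<alpha> * norm (x - y)" if y: "norm y \<le> 2" for x y :: complex
  proof -
    have "norm y powr (\<alpha> - 1) \<le> 2 powr (\<alpha> - 1)" using y \<alpha> by (intro powr_mono2) auto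
    also have "\<dots> \<le> 2 powr 1" using \<alpha> by (intro powr_mono) auto
    finally have p: "norm y powr (\<alpha> - 1) \<le> 2" by simp
    define R where "R = Re ((x - y) * spow (\<alpha> - 1) y)"
    have "- R \<le> norm (x - y) * norm y powr (\<alpha> - 1)"
      unfolding R_def using abs_Re_le_cmod[of "(x - y) * spow (\<alpha> - 1) y"] by (simp only: norm_mult norm_spow)
    also have "\<dots> \<le> norm (x - y) * 2" using p by (intro mult_left_mono) auto
    finally have "\<alpha> * (- R) \<le> \<alpha> * (norm (x - y) * 2)"
      using \<alpha> by (intro mult_left_mono) auto
    then show ?thesis using norm_powr_gradient[OF \<alpha>(1), of y x] unfolding R_def[symmetric] by simp
  qed
  from *[OF uv(1), of v] *[OF uv(2), of u] show ?thesis by (simp add: norm_minus_commute abs_le_iff)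
qed

text \<open>For \<alpha> < 2 the factor \<open>spow (\<alpha> - 1) z\<close> is the only one that is
  not Lipschitz at 0; it multiplies the entry that will turn out to vanish.\<close>

lemma bform_axis_combination:
  assumes "j \<noteq> k"
  shows "bform \<alpha> A (z *s axis j 1 + axis k 1) (z *s axis j 1 + axis k 1)
    = A $ k $ k + z * A $ j $ k + spow (\<alpha> - 1) z * A $ k $ j + of_real (norm z powr \<alpha>) * A $ j $ j"
proof -
  have sp: "spow (\<alpha> - 1) ((z *s axis j 1 + axis k 1) $ i)
      = spow (\<alpha> - 1) z * spow (\<alpha> - 1) (axis j 1 $ i) + spow (\<alpha> - 1) (axis k 1 $ i)" for i
    using assms by (auto simp: axis_def)
  have right: "bform \<alpha> A u (z *s axis j 1 + axis k 1)
      = spow (\<alpha> - 1) z * bform \<alpha> A u (axis j 1) + bform \<alpha> A u (axis k 1)" for u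
    unfolding bform_eq_sum sp by (simp add: algebra_simps sum.distrib sum_distrib_left)
  have "z * (spow (\<alpha> - 1) z * A $ j $ j) = of_real (norm z powr \<alpha>) * A $ j $ j"
    by (simp only: mult.assoc[symmetric] mult_spow)
  then show ?thesis
    unfolding right bform_add_left bform_scale_left by (simp add: algebra_simps)
qed

locale spectral_process = stable_space M \<alpha> for M :: "'a measure" and \<alpha> +
  fixes Z :: "real \<Rightarrow> 'a \<Rightarrow> complex^'n" and f :: "real \<Rightarrow> complex^'n^'n"
  assumes Z: "sas_process M \<alpha> Z" and density: "has_spectral_density M \<alpha> Z f"
begin

lemma integrable_f: "integrable circ f"
  and covariationI: "has_stoch_integral M \<alpha> f Z a I \<Longrightarrow> has_stoch_integral M \<alpha> f Z b J \<Longrightarrow>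
    has_covariation M \<alpha> I J (LINT \<theta>|circ. wform \<alpha> f a b \<theta>)"
  using density by (auto simp: has_spectral_density_def)

lemma f_measurable [measurable]: "f \<in> borel_measurable circ"
  using integrable_f by simp

lemma Z_measurable [measurable]: "t \<in> {-pi..pi} \<Longrightarrow> (\<lambda>\<omega>. Z t \<omega> $ k) \<in> borel_measurable M"
proof -
  assume t: "t \<in> {-pi..pi}"
  let ?X = "\<lambda>\<omega>. Z t \<omega> $ k"
  have "sas_rv M \<alpha> (\<lambda>\<omega>. \<Sum>X\<in>{?X}. u X * Re (X \<omega>) + v X * Im (X \<omega>))" for u v
    using Z t unfolding sas_process_def jointly_sas_def by blast
  from this[of "\<lambda>_. 1" "\<lambda>_. 0"] this[of "\<lambda>_. 0" "\<lambda>_. 1"]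
  show ?thesis by (simp add: sas_rv_def borel_measurable_complex_iff)
qed

definition increment :: "real \<Rightarrow> real \<Rightarrow> complex^'n \<Rightarrow> 'a \<Rightarrow> complex" where
  "increment s t v \<omega> = tdot v (Z t \<omega> - Z s \<omega>)"

definition interval_mass :: "real \<Rightarrow> real \<Rightarrow> complex^'n^'n" where
  "interval_mass s t = (\<chi> i j. LINT \<theta>|circ. indicator {s<..t} \<theta> * f \<theta> $ i $ j)"

lemma integrable_indicator_f: "integrable circ (\<lambda>\<theta>. indicator {s<..t} \<theta> * f \<theta> $ i $ j)"
  by (intro integrable_indicator_mult integrable_vec_nth integrable_f) auto

lemma interval_wform:
  "has_bochner_integral circ (wform \<alpha> f (\<lambda>\<theta>. indicator {s<..t} \<theta> *\<^sub>R v) (\<lambda>\<theta>. indicator {s<..t} \<theta> *\<^sub>R w))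
     (bform \<alpha> (interval_mass s t) v w)"
proof -
  have "has_bochner_integral circ (\<lambda>\<theta>. \<Sum>i\<in>UNIV. \<Sum>j\<in>UNIV. v $ i * (indicator {s<..t} \<theta> * f \<theta> $ i $ j) * spow (\<alpha> - 1) (w $ j))
      (\<Sum>i\<in>UNIV. \<Sum>j\<in>UNIV. v $ i * (LINT \<theta>|circ. indicator {s<..t} \<theta> * f \<theta> $ i $ j) * spow (\<alpha> - 1) (w $ j))"
    by (intro has_bochner_integral_sum has_bochner_integral_mult_left has_bochner_integral_mult_right
        has_bochner_integral_integrable integrable_indicator_f)
  moreover have "wform \<alpha> f (\<lambda>\<theta>. indicator {s<..t} \<theta> *\<^sub>R v) (\<lambda>\<theta>. indicator {s<..t} \<theta> *\<^sub>R w)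
      = (\<lambda>\<theta>. \<Sum>i\<in>UNIV. \<Sum>j\<in>UNIV. v $ i * (indicator {s<..t} \<theta> * f \<theta> $ i $ j) * spow (\<alpha> - 1) (w $ j))"
  proof
    fix \<theta>
    show "wform \<alpha> f (\<lambda>\<theta>. indicator {s<..t} \<theta> *\<^sub>R v) (\<lambda>\<theta>. indicator {s<..t} \<theta> *\<^sub>R w) \<theta>
      = (\<Sum>i\<in>UNIV. \<Sum>j\<in>UNIV. v $ i * (indicator {s<..t} \<theta> * f \<theta> $ i $ j) * spow (\<alpha> - 1) (w $ j))"
      by (cases "\<theta> \<in> {s<..t}") (simp_all add: wform_eq_bform bform_eq_sum)
  qed
  ultimately show ?thesis by (simp add: bform_eq_sum interval_mass_def)
qed

text \<open>The integrand is a step function with one cell, so a constant sequence is a witness.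
  This brings increments under the covariation identity before anything is known about the matrices
  \<open>f \<theta>\<close>.\<close>

lemma has_stoch_integral_increment:
  assumes "- pi \<le> s" "s \<le> t" "t \<le> pi"
  shows "has_stoch_integral M \<alpha> f Z (\<lambda>\<theta>. indicator {s<..t} \<theta> *\<^sub>R v) (increment s t v)"
proof -
  have m: "increment s t v \<in> borel_measurable M"
    unfolding increment_def[abs_def] tdot_def using assms by simp
  have "(\<lambda>\<theta>. indicator {s<..t} \<theta> *\<^sub>R v) \<in> borel_measurable circ" by simp
  then have L: "(\<lambda>\<theta>. indicator {s<..t} \<theta> *\<^sub>R v) \<in> L_alpha \<alpha> f"
    using interval_wform[of s t v v] by (simp add: L_alpha_def has_bochner_integral_iff)
  let ?t = "\<lambda>(n::nat) i. if i = (0::nat) then s else t"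
  have sf: "step_fun 1 (?t n) (\<lambda>_. v) = (\<lambda>\<theta>. indicator {s<..t} \<theta> *\<^sub>R v)" for n
    by (simp add: step_fun_def fun_eq_iff)
  have si: "step_integral Z 1 (?t n) (\<lambda>_. v) = increment s t v" for n
    by (simp add: step_integral_def increment_def fun_eq_iff)
  have "wform \<alpha> f (\<lambda>\<theta>. 0) (\<lambda>\<theta>. 0) = (\<lambda>\<theta>. 0)" by (simp add: wform_eq_bform fun_eq_iff)
  then have "L_alpha_tendsto \<alpha> f (\<lambda>n. step_fun 1 (?t n) (\<lambda>_. v)) (\<lambda>\<theta>. indicator {s<..t} \<theta> *\<^sub>R v)"
    unfolding sf by (simp add: L_alpha_tendsto_def L_alpha_def)
  moreover have "tendsto_prob M (\<lambda>n. step_integral Z 1 (?t n) (\<lambda>_. v)) (increment s t v)"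
    unfolding si tendsto_prob_def by (auto intro!: tendsto_eventually)
  moreover have "\<forall>n. (\<forall>i\<le>1. ?t n i \<in> {-pi..pi}) \<and> mono_on {..1} (?t n)"
    using assms by (auto simp: mono_on_def)
  ultimately show ?thesis
    unfolding has_stoch_integral_def using L m
    by (intro conjI exI[of _ "\<lambda>_. 1"] exI[of _ ?t] exI[of _ "\<lambda>_ _. v"]) auto
qed

lemma increment_covariation:
  assumes "- pi \<le> s" "s \<le> t" "t \<le> pi"
  shows "has_covariation M \<alpha> (increment s t v) (increment s t w) (bform \<alpha> (interval_mass s t) v w)"
proof -
  have "has_covariation M \<alpha> (increment s t v) (increment s t w)
      (LINT \<theta>|circ. wform \<alpha> f (\<lambda>\<theta>. indicator {s<..t} \<theta> *\<^sub>R v) (\<lambda>\<theta>. indicator {s<..t} \<theta> *\<^sub>R w) \<theta>)"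
    by (rule covariationI) (rule has_stoch_integral_increment[OF assms])+
  then show ?thesis using interval_wform[of s t v w] by (simp add: has_bochner_integral_iff)
qed

lemma increment_scale:
  assumes "- pi \<le> s" "s \<le> t" "t \<le> pi"
  shows "bform \<alpha> (interval_mass s t) v v = of_real (sas_scale M \<alpha> (increment s t v))"
    and "0 \<le> sas_scale M \<alpha> (increment s t v)"
  using increment_covariation[OF assms, of v v] sas_varD(2) unfolding has_covariation_self_iff by auto

text \<open>For \<open>j \<noteq> k\<close> the scale of \<open>z dZ\<^sub>j + dZ\<^sub>k\<close> is Lipschitz in \<open>z\<close>, but it contains the term
  \<open>z\<^bsup><\<alpha>-1>\<^esup> F\<^sub>k\<^sub>j\<close>.\<close>

lemma interval_mass_off_diagonal:
  assumes st: "- pi \<le> s" "s \<le> t" "t \<le> pi" and "\<alpha> \<noteq> 2" and jk: "j \<noteq> k"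
  shows "interval_mass s t $ k $ j = 0"
proof -
  let ?F = "interval_mass s t"
  \<comment> \<open>The covariation of the two coordinates supplies a joint spectral measure, which
    expresses the scale of all their combinations at once.\<close>
  obtain \<Gamma> where G: "is_spectral_measure M \<alpha> (increment s t (axis j 1)) (increment s t (axis k 1)) \<Gamma>"
    using increment_covariation[OF st, of "axis j 1" "axis k 1"] by (auto simp: has_covariation_def)
  have a0: "0 < \<alpha>" using \<alpha> by simp
  interpret G: finite_measure \<Gamma> using G by (simp add: is_spectral_measure_def)
  have [measurable_cong]: "sets \<Gamma> = sets borel" using G by (simp add: is_spectral_measure_def)
  define \<phi> where "\<phi> = (\<lambda>z. LINT x|\<Gamma>. norm (z * fst x + snd x) powr \<alpha>)"
  have \<phi>: "bform \<alpha> ?F (z *s axis j 1 + axis k 1) (z *s axis j 1 + axis k 1) = of_real (\<phi> z)" for z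
  proof -
    have "increment s t (z *s axis j 1 + axis k 1) = (\<lambda>\<omega>. z * increment s t (axis j 1) \<omega> + 1 * increment s t (axis k 1) \<omega>)"
      by (simp add: increment_def tdot_def fun_eq_iff distrib_right sum.distrib sum_distrib_left mult.assoc)
    then show ?thesis using scale_spectral[OF G a0, of z 1] increment_scale(1)[OF st] by (simp add: \<phi>_def)
  qed
  define C where "C = 2 * \<alpha> * measure \<Gamma> (space \<Gamma>)"
  \<comment> \<open>For \<open>norm z \<le> 1\<close> the two moduli to be compared are at most 2 on
    the unit sphere, the range of the scalar Lipschitz bound.\<close>
  have lip: "\<bar>\<phi> z - \<phi> 0\<bar> \<le> C * norm z" if z: "norm z \<le> 1" for z
  proof -
    have int: "integrable \<Gamma> (\<lambda>x. norm (z * fst x + snd x) powr \<alpha>)" for z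
      using spectral_integrable(1)[OF G a0, of z 1] by simp
    have "\<phi> z - \<phi> 0 = (LINT x|\<Gamma>. norm (z * fst x + snd x) powr \<alpha> - norm (0 * fst x + snd x) powr \<alpha>)"
      unfolding \<phi>_def using int[of z] int[of 0] by simp
    also have "norm \<dots> \<le> (LINT x|\<Gamma>. norm (norm (z * fst x + snd x) powr \<alpha> - norm (0 * fst x + snd x) powr \<alpha>))"
      by (rule integral_norm_bound)
    also have "\<dots> \<le> (LINT x|\<Gamma>. 2 * \<alpha> * norm z)"
    proof (rule integral_mono_AE)
      show "AE x in \<Gamma>. norm (norm (z * fst x + snd x) powr \<alpha> - norm (0 * fst x + snd x) powr \<alpha>) \<le> 2 * \<alpha> * norm z"
        using AE_spectral_norm_le[OF G, of z 1] AE_spectral_norm_le[OF G, of 0 1] AE_spectral_norm_le[OF G, of z 0]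
      proof eventually_elim
        case (elim x)
        have "\<bar>norm (z * fst x + snd x) powr \<alpha> - norm (0 * fst x + snd x) powr \<alpha>\<bar>
            \<le> 2 * \<alpha> * norm ((z * fst x + snd x) - (0 * fst x + snd x))"
          using elim z by (intro abs_norm_powr_diff_le \<alpha>) auto
        also have "\<dots> \<le> 2 * \<alpha> * norm z" using elim \<alpha> by (intro mult_left_mono) auto
        finally show ?case by simp
      qed
      have "integrable \<Gamma> (\<lambda>x. norm (z * fst x + snd x) powr \<alpha> - norm (0 * fst x + snd x) powr \<alpha>)"
        by (intro Bochner_Integration.integrable_diff int)
      then show "integrable \<Gamma> (\<lambda>x. norm (norm (z * fst x + snd x) powr \<alpha> - norm (0 * fst x + snd x) powr \<alpha>))"
        by (rule integrable_norm)
    qed simp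
    finally show ?thesis by (simp add: C_def mult_ac)
  qed
  define D where "D = C + norm (?F $ j $ k) + norm (?F $ j $ j)"
  \<comment> \<open>Every other term is of order \<open>r\<close>, while the entry comes with
    \<open>r powr (\<alpha> - 1)\<close>; dividing leaves \<open>r powr (2 - \<alpha>)\<close>,
    which tends to 0 for \<alpha> < 2.\<close>
  have bound: "norm (?F $ k $ j) \<le> D * r powr (2 - \<alpha>)" if r: "0 < r" "r \<le> 1" for r
  proof -
    define z where "z = complex_of_real r"
    have "?F $ k $ k = of_real (\<phi> 0)" using \<phi>[of 0] by (simp add: bform_axis)
    then have "spow (\<alpha> - 1) z * ?F $ k $ j = of_real (\<phi> z - \<phi> 0) - z * ?F $ j $ k - of_real (norm z powr \<alpha>) * ?F $ j $ j"
      using \<phi>[of z] unfolding bform_axis_combination[OF jk] by (simp add: algebra_simps)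
    then have "norm (spow (\<alpha> - 1) z * ?F $ k $ j)
        \<le> norm (complex_of_real (\<phi> z - \<phi> 0)) + norm (z * ?F $ j $ k) + norm (complex_of_real (norm z powr \<alpha>) * ?F $ j $ j)"
    proof -
      have "norm (a - b - c) \<le> norm a + norm b + norm c" for a b c :: complex
        using norm_triangle_ineq4[of "a - b" c] norm_triangle_ineq4[of a b] by linarith
      then show ?thesis unfolding \<open>spow (\<alpha> - 1) z * ?F $ k $ j = _\<close> .
    qed
    then have 1: "r powr (\<alpha> - 1) * norm (?F $ k $ j) \<le> \<bar>\<phi> z - \<phi> 0\<bar> + r * norm (?F $ j $ k) + r powr \<alpha> * norm (?F $ j $ j)"
      using r unfolding norm_mult norm_spow norm_of_real by (simp add: z_def)
    have "r powr \<alpha> \<le> r powr 1" using r \<alpha> by (intro powr_mono') auto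
    then have 2: "r powr \<alpha> * norm (?F $ j $ j) \<le> r * norm (?F $ j $ j)" using r by (intro mult_right_mono) auto
    have 3: "\<bar>\<phi> z - \<phi> 0\<bar> \<le> C * r" using lip[of z] r by (simp add: z_def)
    have "r powr (\<alpha> - 1) * norm (?F $ k $ j) \<le> D * r"
      using 1 2 3 by (simp add: D_def algebra_simps)
    then have "r powr (1 - \<alpha>) * (r powr (\<alpha> - 1) * norm (?F $ k $ j)) \<le> r powr (1 - \<alpha>) * (D * r)"
      by (intro mult_left_mono) auto
    moreover have "r powr (1 - \<alpha>) * r powr (\<alpha> - 1) = 1" using r by (simp flip: powr_add)
    moreover have "r powr (1 - \<alpha>) * r = r powr (2 - \<alpha>)"
      using r powr_add[of r "1 - \<alpha>" 1] by simp
    moreover have "r powr (1 - \<alpha>) * (D * r) = D * (r powr (1 - \<alpha>) * r)" by simp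
    ultimately show ?thesis by (simp only: mult.assoc[symmetric] mult_1)
  qed
  have "((\<lambda>r. D * r powr (2 - \<alpha>)) \<longlongrightarrow> D * 0) (at_right 0)"
    using \<alpha> \<open>\<alpha> \<noteq> 2\<close> by (intro tendsto_intros tendsto_zero_powrI[of _ _ _ "2 - \<alpha>"]) (auto simp: eventually_at_filter)
  then have "norm (?F $ k $ j) \<le> D * 0"
  proof (rule tendsto_lowerbound)
    show "\<forall>\<^sub>F r in at_right 0. norm (?F $ k $ j) \<le> D * r powr (2 - \<alpha>)"
      unfolding eventually_at_right_field using bound by (intro exI[of _ 1]) auto
  qed simp
  then show ?thesis by simp
qed

text \<open>The integrals of the form over all intervals are scales, so for a fixed vector the form
  is nonnegative almost everywhere, and the off-diagonal entries vanish likewise. A countable dense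
  set of vectors and continuity make the exceptional set independent of the vector.\<close>

lemma weight: "weight \<alpha> f"
proof
  show "1 < \<alpha>" "\<alpha> \<le> 2" "integrable circ f" using \<alpha> integrable_f by auto
  have off: "AE \<theta> in circ. f \<theta> $ i $ j = 0" if "\<alpha> \<noteq> 2" "i \<noteq> j" for i j
  proof (rule AE_zero_of_intervals)
    show "integrable circ (\<lambda>\<theta>. f \<theta> $ i $ j)" by (intro integrable_vec_nth integrable_f)
    show "(LINT \<theta>|circ. indicator {s<..t} \<theta> * f \<theta> $ i $ j) = 0" if "- pi \<le> s" "s \<le> t" "t \<le> pi" for s t
      using interval_mass_off_diagonal[OF that \<open>\<alpha> \<noteq> 2\<close>, of j i] \<open>i \<noteq> j\<close> by (simp add: interval_mass_def)
  qed
  have pos: "AE \<theta> in circ. bform \<alpha> (f \<theta>) v v \<in> \<real>\<^sub>\<ge>\<^sub>0" for v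
  proof -
    let ?u = "\<lambda>\<theta>. bform \<alpha> (f \<theta>) v v"
    have int: "integrable circ ?u"
      unfolding bform_eq_sum
      by (intro Bochner_Integration.integrable_sum integrable_mult_left integrable_mult_right integrable_vec_nth integrable_f)
    have I: "(LINT \<theta>|circ. indicator {s<..t} \<theta> * ?u \<theta>) = of_real (sas_scale M \<alpha> (increment s t v))"
      if "- pi \<le> s" "s \<le> t" "t \<le> pi" for s t
    proof -
      have "indicator {s<..t} \<theta> * ?u \<theta> = wform \<alpha> f (\<lambda>\<theta>. indicator {s<..t} \<theta> *\<^sub>R v) (\<lambda>\<theta>. indicator {s<..t} \<theta> *\<^sub>R v) \<theta>" for \<theta>
        by (cases "\<theta> \<in> {s<..t}") (simp_all add: wform_eq_bform)
      then show ?thesis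
        using interval_wform[of s t v v] increment_scale(1)[OF that, of v]
        by (simp only: has_bochner_integral_iff)
    qed
    have Re: "(LINT \<theta>|circ. indicator {s<..t} \<theta> * Re (?u \<theta>)) = sas_scale M \<alpha> (increment s t v)" (is ?R)
      and Im: "(LINT \<theta>|circ. indicator {s<..t} \<theta> * Im (?u \<theta>)) = 0" (is ?I)
      if "- pi \<le> s" "s \<le> t" "t \<le> pi" for s t
    proof -
      have "integrable circ (\<lambda>\<theta>. indicator {s<..t} \<theta> * ?u \<theta>)" using int by (rule integrable_indicator_mult) simp
      then have "(LINT \<theta>|circ. indicator {s<..t} \<theta> * Re (?u \<theta>)) = Re (LINT \<theta>|circ. indicator {s<..t} \<theta> * ?u \<theta>)"
        "(LINT \<theta>|circ. indicator {s<..t} \<theta> * Im (?u \<theta>)) = Im (LINT \<theta>|circ. indicator {s<..t} \<theta> * ?u \<theta>)"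
        by (simp_all flip: integral_Re integral_Im) (auto intro!: Bochner_Integration.integral_cong simp: indicator_def)
      then show ?R ?I using I[OF that] by simp_all
    qed
    have "AE \<theta> in circ. 0 \<le> Re (?u \<theta>)" "AE \<theta> in circ. 0 \<le> Im (?u \<theta>)" "AE \<theta> in circ. 0 \<le> - Im (?u \<theta>)"
      by (rule AE_nonneg_of_intervals, use Re Im int increment_scale(2) in simp, use Re Im int increment_scale(2) in simp)+
    then show ?thesis by eventually_elim (auto simp: complex_nonneg_Reals_iff)
  qed
  obtain D :: "(complex^'n) set" where D: "countable D" "closure D = UNIV"
    using separable[of "UNIV :: (complex^'n) set"] by (metis subset_UNIV top.extremum_uniqueI)
  have "AE \<theta> in circ. \<forall>v\<in>D. bform \<alpha> (f \<theta>) v v \<in> \<real>\<^sub>\<ge>\<^sub>0"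
    using pos D(1) by (simp add: AE_ball_countable)
  moreover have "AE \<theta> in circ. \<forall>i j. \<alpha> \<noteq> 2 \<longrightarrow> i \<noteq> j \<longrightarrow> f \<theta> $ i $ j = 0"
    unfolding AE_all_countable using off by (auto intro!: AE_I2)
  ultimately show "AE \<theta> in circ. covariation_matrix \<alpha> (f \<theta>)"
  proof eventually_elim
    case (elim \<theta>)
    have "continuous_on UNIV (\<lambda>v. bform \<alpha> (f \<theta>) v v)"
      using continuous_on_compose2[OF continuous_bform[OF \<alpha>(1), of "f \<theta>"], of UNIV "\<lambda>v. (v, v)"]
      by (simp add: continuous_intros)
    then have "closed {v. bform \<alpha> (f \<theta>) v v \<in> \<real>\<^sub>\<ge>\<^sub>0}"
      using closed_vimage[OF closed_nonneg_Reals_complex] by (simp add: vimage_def)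
    then have "closure D \<subseteq> {v. bform \<alpha> (f \<theta>) v v \<in> \<real>\<^sub>\<ge>\<^sub>0}"
      using elim(1) by (intro closure_minimal) auto
    then show ?case using D(2) elim(2) by (auto simp: covariation_matrix_def)
  qed
qed

end

section \<open>Stochastic integrals\<close>

definition step_sum :: "nat \<Rightarrow> (nat \<Rightarrow> real) \<Rightarrow> (nat \<Rightarrow> complex^'n) \<Rightarrow> (real \<Rightarrow> complex^'n) \<Rightarrow> complex" where
  "step_sum m t v \<Phi> = (\<Sum>i<m. tdot (v i) (\<Phi> (t (Suc i)) - \<Phi> (t i)))"

lemma step_integral_eq_step_sum: "step_integral Z m t v \<omega> = step_sum m t v (\<lambda>s. Z s \<omega>)"
  by (simp add: step_integral_def step_sum_def)

lemma tdot_add_left: "tdot (u + v) w = tdot u w + tdot v w"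
  and tdot_scale_left: "tdot (z *s u) w = z * tdot u w"
  and tdot_zero_left [simp]: "tdot 0 w = 0"
  and tdot_add_right: "tdot w (u + v) = tdot w u + tdot w v"
  and tdot_axis: "tdot u (z *s axis k 1) = z * u $ k"
proof -
  have "u $ i * (z *s axis k 1) $ i = (if i = k then z * u $ k else 0)" for i by (simp add: axis_def)
  then show "tdot u (z *s axis k 1) = z * u $ k" by (simp add: tdot_def)
qed (simp_all add: tdot_def algebra_simps sum.distrib sum_distrib_left)

lemma tdot_sum_left: "tdot (\<Sum>i\<in>I. u i) w = (\<Sum>i\<in>I. tdot (u i) w)"
  by (induction I rule: infinite_finite_induct) (simp_all add: tdot_add_left)

lemma tdot_sum_right: "tdot w (\<Sum>i\<in>I. u i) = (\<Sum>i\<in>I. tdot w (u i))"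
  by (induction I rule: infinite_finite_induct) (simp_all add: tdot_add_right, simp_all add: tdot_def)

text \<open>A step function is itself a step integral: for \<open>s \<mapsto> 1(\<theta> \<le> s)\<close> times a basis vector. So what holds for
  all step integrals holds for step functions.\<close>

lemma step_fun_eq_step_sum:
  assumes "mono_on {..m} t"
  shows "step_fun m t v \<theta> $ k = step_sum m t v (\<lambda>s. of_bool (\<theta> \<le> s) *s axis k 1)"
proof -
  have "(indicator {t i<..t (Suc i)} \<theta> *\<^sub>R v i) $ k
      = tdot (v i) (of_bool (\<theta> \<le> t (Suc i)) *s axis k 1 - of_bool (\<theta> \<le> t i) *s axis k 1)" if "i < m" for i
  proof -
    have "t i \<le> t (Suc i)" using assms that by (auto intro: mono_onD)
    then have "(indicator {t i<..t (Suc i)} \<theta> *\<^sub>R v i) $ k = (of_bool (\<theta> \<le> t (Suc i)) - of_bool (\<theta> \<le> t i)) * v i $ k"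
      by (auto simp: indicator_def)
    also have "\<dots> = tdot (v i) ((of_bool (\<theta> \<le> t (Suc i)) - of_bool (\<theta> \<le> t i)) *s axis k 1)"
      by (simp only: tdot_axis)
    finally show ?thesis by (simp only: vector_sub_rdistrib)
  qed
  then show ?thesis unfolding step_fun_def step_sum_def sum_component by (intro sum.cong) auto
qed

text \<open>Cells are open on the left and closed on the right, so on a finer grid the coefficient
  of a cell is the value of the old step function at its right end. Coefficients given by values
  rather than indices make different partitions comparable.\<close>

lemma step_sum_refine:
  assumes t: "mono_on {..m} t" "\<And>i. i \<le> m \<Longrightarrow> t i \<in> g ` {..K}" and g: "strict_mono_on {..K} g"
  shows "step_sum m t v \<Phi> = step_sum K g (\<lambda>k. step_fun m t v (g (Suc k))) \<Phi>"
proof -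
  have cell: "\<Phi> (t (Suc i)) - \<Phi> (t i)
      = (\<Sum>k<K. indicator {t i<..t (Suc i)} (g (Suc k)) *\<^sub>R (\<Phi> (g (Suc k)) - \<Phi> (g k)))" if i: "i < m" for i
  proof -
    obtain p where p: "t i = g p" "p \<le> K" using t(2)[of i] i by auto
    obtain q where q: "t (Suc i) = g q" "q \<le> K" using t(2)[of "Suc i"] i by auto
    have "t i \<le> t (Suc i)" using t(1) i by (auto intro: mono_onD)
    then have pq: "p \<le> q" using p q strict_mono_on_less_eq[OF g, of p q] by simp
    have ind: "indicator {t i<..t (Suc i)} (g (Suc k)) = (if k \<in> {p..<q} then 1 else (0::real))" if "k < K" for k
      using that p q strict_mono_on_less[OF g, of p "Suc k"] strict_mono_on_less_eq[OF g, of "Suc k" q]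
      by (auto simp: indicator_def)
    have "(\<Sum>k<K. indicator {t i<..t (Suc i)} (g (Suc k)) *\<^sub>R (\<Phi> (g (Suc k)) - \<Phi> (g k)))
        = (\<Sum>k<K. if k \<in> {p..<q} then \<Phi> (g (Suc k)) - \<Phi> (g k) else 0)"
      by (intro sum.cong) (auto simp: ind)
    also have "\<dots> = (\<Sum>k\<in>{p..<q}. \<Phi> (g (Suc k)) - \<Phi> (g k))"
      using q(2) by (subst sum.inter_restrict[symmetric]) (auto intro!: sum.cong)
    also have "\<dots> = \<Phi> (g q) - \<Phi> (g p)"
      by (rule sum_Suc_diff'[OF pq])
    finally show ?thesis using p q by simp
  qed
  have sc: "tdot u (r *\<^sub>R w) = tdot (r *\<^sub>R u) w" for r u and w :: "complex^'b"
    by (simp add: tdot_def)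
  have "step_sum m t v \<Phi> = (\<Sum>i<m. \<Sum>k<K. tdot (indicator {t i<..t (Suc i)} (g (Suc k)) *\<^sub>R v i) (\<Phi> (g (Suc k)) - \<Phi> (g k)))"
    unfolding step_sum_def by (intro sum.cong refl) (simp only: cell lessThan_iff tdot_sum_right sc)
  also have "\<dots> = step_sum K g (\<lambda>k. step_fun m t v (g (Suc k))) \<Phi>"
    unfolding step_sum_def step_fun_def tdot_sum_left by (rule sum.swap)
  finally show ?thesis .
qed

text \<open>Both sums are rewritten on the sorted union of the two sets of nodes. The identity is
  proved for every path, and the one for step functions is a special case.\<close>

lemma step_sum_combination:
  assumes "mono_on {..m1} t1" "\<And>i. i \<le> m1 \<Longrightarrow> t1 i \<in> S" "mono_on {..m2} t2" "\<And>i. i \<le> m2 \<Longrightarrow> t2 i \<in> S"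
  obtains m t v where "mono_on {..m} t" "\<And>i. i \<le> m \<Longrightarrow> t i \<in> S"
    "\<And>\<theta>. step_fun m t v \<theta> = step_fun m1 t1 v1 \<theta> + z *s step_fun m2 t2 v2 \<theta>"
    "\<And>\<Phi>. step_sum m t v \<Phi> = step_sum m1 t1 v1 \<Phi> + z * step_sum m2 t2 v2 \<Phi>"
proof -
  define G where "G = t1 ` {..m1} \<union> t2 ` {..m2}"
  define xs where "xs = sorted_list_of_set G"
  \<comment> \<open>\<open>K\<close> counts cells, one fewer than nodes; each partition has at least
    the node of index 0, so there is no truncation at 0.\<close>
  define K where "K = length xs - 1"
  define g where "g = (\<lambda>i. xs ! i)"
  have fin: "finite G" "G \<noteq> {}" by (auto simp: G_def)
  have set: "set xs = G" using fin by (simp add: xs_def)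
  have len: "length xs = Suc K" using fin set by (cases xs) (auto simp: K_def)
  have gG: "g ` {..K} = G"
    unfolding g_def set[symmetric] set_conv_nth using len by (auto simp: less_Suc_eq_le)
  have sm: "strict_mono_on {..K} g"
    unfolding g_def strict_mono_on_def
    using sorted_wrt_nth_less[OF strict_sorted_list_of_set[of G]] len by (auto simp: xs_def)
  define v where "v = (\<lambda>k. step_fun m1 t1 v1 (g (Suc k)) + z *s step_fun m2 t2 v2 (g (Suc k)))"
  have ss: "step_sum K g v \<Phi> = step_sum m1 t1 v1 \<Phi> + z * step_sum m2 t2 v2 \<Phi>" for \<Phi>
  proof -
    have "step_sum m1 t1 v1 \<Phi> = step_sum K g (\<lambda>k. step_fun m1 t1 v1 (g (Suc k))) \<Phi>"
      by (rule step_sum_refine[OF assms(1) _ sm]) (auto simp: gG G_def)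
    moreover have "step_sum m2 t2 v2 \<Phi> = step_sum K g (\<lambda>k. step_fun m2 t2 v2 (g (Suc k))) \<Phi>"
      by (rule step_sum_refine[OF assms(3) _ sm]) (auto simp: gG G_def)
    ultimately show ?thesis
      by (simp add: step_sum_def v_def tdot_add_left tdot_scale_left sum.distrib sum_distrib_left)
  qed
  have mono: "mono_on {..K} g" using sm by (rule strict_mono_on_imp_mono_on)
  show ?thesis
  proof (rule that[OF mono _ _ ss])
    have "G \<subseteq> S" using assms(2,4) by (auto simp: G_def)
    then show "g i \<in> S" if "i \<le> K" for i using gG that by auto
    show "step_fun K g v \<theta> = step_fun m1 t1 v1 \<theta> + z *s step_fun m2 t2 v2 \<theta>" for \<theta>
      by (simp add: vec_eq_iff step_fun_eq_step_sum mono assms(1,3) ss)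
  qed
qed

section \<open>The integral as a linear isometry\<close>

context spectral_process
begin

sublocale w: weight \<alpha> f by (rule weight)

lemma L_alpha_tendsto_eventually:
  "L_alpha_tendsto \<alpha> f p a \<Longrightarrow> 0 < e \<Longrightarrow> \<forall>\<^sub>F n in sequentially. energy \<alpha> f (\<lambda>\<theta>. p n \<theta> - a \<theta>) < e"
  unfolding w.L_alpha_tendsto_iff by (elim conjE) (rule order_tendstoD(2))

lemma step_fun_in_L_alpha: "step_fun m t v \<in> L_alpha \<alpha> f"
proof (rule w.bounded_in_L_alpha)
  show "step_fun m t v \<in> borel_measurable circ"
    unfolding step_fun_def[abs_def] by (intro borel_measurable_sum borel_measurable_scaleR) auto
  show "norm (step_fun m t v \<theta>) \<le> (\<Sum>i<m. norm (v i))" for \<theta>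
    unfolding step_fun_def
  proof (rule order_trans[OF norm_sum], rule sum_mono)
    show "norm (indicator {t i<..t (Suc i)} \<theta> *\<^sub>R v i) \<le> norm (v i)" for i
      by (cases "\<theta> \<in> {t i<..t (Suc i)}") auto
  qed
qed

lemma step_integral_measurable:
  assumes "\<And>i. i \<le> m \<Longrightarrow> t i \<in> {-pi..pi}"
  shows "step_integral Z m t v \<in> borel_measurable M"
  unfolding step_integral_def[abs_def] tdot_def
  by (intro borel_measurable_sum borel_measurable_times borel_measurable_const)
    (simp add: Z_measurable assms[unfolded atLeastAtMost_iff])

text \<open>The covariation identity with equal arguments turns the energy of the integrand into the
  scale of the integral.\<close>

lemma has_stoch_integralD:
  assumes "has_stoch_integral M \<alpha> f Z a X"
  shows "a \<in> L_alpha \<alpha> f" "X \<in> borel_measurable M" "sas_var M \<alpha> X" "sas_scale M \<alpha> X = energy \<alpha> f a"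
proof -
  show a: "a \<in> L_alpha \<alpha> f" "X \<in> borel_measurable M" using assms by (auto simp: has_stoch_integral_def)
  have "has_covariation M \<alpha> X X (of_real (energy \<alpha> f a))"
    using covariationI[OF assms assms] w.LINT_wform[OF w.L_alpha_measurable[OF a(1)]] by simp
  then show "sas_var M \<alpha> X" "sas_scale M \<alpha> X = energy \<alpha> f a"
    unfolding has_covariation_self_iff by (auto simp del: of_real_eq_iff simp: of_real_eq_iff[where 'a = complex])
qed

lemma has_stoch_integral_stepE:
  assumes "has_stoch_integral M \<alpha> f Z a X" "0 < e"
  obtains m t v where "mono_on {..m} t" "\<forall>i\<le>m. t i \<in> {-pi..pi}"
    "energy \<alpha> f (\<lambda>\<theta>. step_fun m t v \<theta> - a \<theta>) < e"
    "prob {\<omega> \<in> space M. e \<le> norm (step_integral Z m t v \<omega> - X \<omega>)} < e"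
proof -
  obtain m t v where s: "\<And>n. (\<forall>i\<le>m n. t n i \<in> {-pi..pi}) \<and> mono_on {..m n} (t n)"
    "L_alpha_tendsto \<alpha> f (\<lambda>n. step_fun (m n) (t n) (v n)) a"
    "tendsto_prob M (\<lambda>n. step_integral Z (m n) (t n) (v n)) X"
    using assms(1) unfolding has_stoch_integral_def by blast
  have "\<forall>\<^sub>F n in sequentially. energy \<alpha> f (\<lambda>\<theta>. step_fun (m n) (t n) (v n) \<theta> - a \<theta>) < e"
    using s(2) assms(2) by (rule L_alpha_tendsto_eventually)
  moreover have "\<forall>\<^sub>F n in sequentially. prob {\<omega> \<in> space M. e \<le> norm (step_integral Z (m n) (t n) (v n) \<omega> - X \<omega>)} < e"
    by (rule tendsto_prob_eventually[OF s(3) assms(2,2)])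
  ultimately have "\<forall>\<^sub>F n in sequentially. energy \<alpha> f (\<lambda>\<theta>. step_fun (m n) (t n) (v n) \<theta> - a \<theta>) < e \<and>
      prob {\<omega> \<in> space M. e \<le> norm (step_integral Z (m n) (t n) (v n) \<omega> - X \<omega>)} < e"
    by (rule eventually_conj)
  then obtain n where "energy \<alpha> f (\<lambda>\<theta>. step_fun (m n) (t n) (v n) \<theta> - a \<theta>) < e"
      "prob {\<omega> \<in> space M. e \<le> norm (step_integral Z (m n) (t n) (v n) \<omega> - X \<omega>)} < e"
    using eventually_happens'[OF sequentially_bot] by blast
  then show ?thesis using that[of "m n" "t n" "v n"] s(1)[of n] by blast
qed

text \<open>One step function per tolerance suffices: the tolerances
  \<open>inverse (real (Suc n))\<close> give a single sequence that converges in both senses. This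
  form absorbs diagonal arguments.\<close>

lemma has_stoch_integralI:
  assumes a: "a \<in> L_alpha \<alpha> f" and X[measurable]: "X \<in> borel_measurable M"
    and step: "\<And>e. 0 < e \<Longrightarrow> \<exists>m t v. mono_on {..m} t \<and> (\<forall>i\<le>m. t i \<in> {-pi..pi}) \<and>
      energy \<alpha> f (\<lambda>\<theta>. step_fun m t v \<theta> - a \<theta>) < e \<and>
      prob {\<omega> \<in> space M. e \<le> norm (step_integral Z m t v \<omega> - X \<omega>)} < e"
  shows "has_stoch_integral M \<alpha> f Z a X"
proof -
  have "\<forall>n. \<exists>m t v. mono_on {..m} t \<and> (\<forall>i\<le>m. t i \<in> {-pi..pi}) \<and>
      energy \<alpha> f (\<lambda>\<theta>. step_fun m t v \<theta> - a \<theta>) < inverse (real (Suc n)) \<and>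
      prob {\<omega> \<in> space M. inverse (real (Suc n)) \<le> norm (step_integral Z m t v \<omega> - X \<omega>)} < inverse (real (Suc n))"
    using step by (simp del: of_nat_Suc)
  then have "\<exists>m t v. \<forall>n. mono_on {..m n} (t n) \<and> (\<forall>i\<le>m n. t n i \<in> {-pi..pi}) \<and>
      energy \<alpha> f (\<lambda>\<theta>. step_fun (m n) (t n) (v n) \<theta> - a \<theta>) < inverse (real (Suc n)) \<and>
      prob {\<omega> \<in> space M. inverse (real (Suc n)) \<le> norm (step_integral Z (m n) (t n) (v n) \<omega> - X \<omega>)} < inverse (real (Suc n))"
    unfolding choice_iff .
  then obtain m t v where s: "\<And>n. mono_on {..m n} (t n)" "\<And>n. \<forall>i\<le>m n. t n i \<in> {-pi..pi}"
      "\<And>n. energy \<alpha> f (\<lambda>\<theta>. step_fun (m n) (t n) (v n) \<theta> - a \<theta>) < inverse (real (Suc n))"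
      "\<And>n. prob {\<omega> \<in> space M. inverse (real (Suc n)) \<le> norm (step_integral Z (m n) (t n) (v n) \<omega> - X \<omega>)} < inverse (real (Suc n))"
    by (elim exE) (simp only: all_conj_distrib, blast)
  have "L_alpha_tendsto \<alpha> f (\<lambda>n. step_fun (m n) (t n) (v n)) a"
    unfolding w.L_alpha_tendsto_iff
  proof (intro conjI allI)
    show "(\<lambda>\<theta>. step_fun (m n) (t n) (v n) \<theta> - a \<theta>) \<in> L_alpha \<alpha> f" for n
      by (intro w.L_alpha_diff step_fun_in_L_alpha a)
    show "(\<lambda>n. energy \<alpha> f (\<lambda>\<theta>. step_fun (m n) (t n) (v n) \<theta> - a \<theta>)) \<longlonglongrightarrow> 0"
      by (rule tendsto_sandwich[OF _ _ tendsto_const LIMSEQ_inverse_real_of_nat])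
        (use s(3) w.energy_nonneg in \<open>auto intro!: always_eventually less_imp_le simp del: of_nat_Suc\<close>)
  qed
  moreover have "tendsto_prob M (\<lambda>n. step_integral Z (m n) (t n) (v n)) X"
    unfolding tendsto_prob_def
  proof (intro allI impI)
    fix e :: real assume e: "0 < e"
    have meas[measurable]: "step_integral Z (m n) (t n) (v n) \<in> borel_measurable M" for n
      using s(2) by (intro step_integral_measurable) auto
    have "\<forall>\<^sub>F n in sequentially. inverse (real (Suc n)) < e"
      using order_tendstoD(2)[OF LIMSEQ_inverse_real_of_nat e] .
    then have le: "\<forall>\<^sub>F n in sequentially. prob {\<omega> \<in> space M. e \<le> norm (step_integral Z (m n) (t n) (v n) \<omega> - X \<omega>)}
        \<le> inverse (real (Suc n))"
    proof eventually_elim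
      case (elim n)
      have "prob {\<omega> \<in> space M. e \<le> norm (step_integral Z (m n) (t n) (v n) \<omega> - X \<omega>)}
          \<le> prob {\<omega> \<in> space M. inverse (real (Suc n)) \<le> norm (step_integral Z (m n) (t n) (v n) \<omega> - X \<omega>)}"
        using elim by (intro finite_measure_mono) auto
      then show ?case using s(4)[of n] by linarith
    qed
    show "(\<lambda>n. prob {\<omega> \<in> space M. e \<le> norm (step_integral Z (m n) (t n) (v n) \<omega> - X \<omega>)}) \<longlonglongrightarrow> 0"
      by (rule tendsto_sandwich[OF _ le tendsto_const LIMSEQ_inverse_real_of_nat]) simp
  qed
  ultimately show ?thesis
    unfolding has_stoch_integral_def using a X s(1,2) by blast
qed

lemma has_stoch_integral_add_scale:
  assumes X: "has_stoch_integral M \<alpha> f Z a X" and Y: "has_stoch_integral M \<alpha> f Z b Y"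
  shows "has_stoch_integral M \<alpha> f Z (\<lambda>\<theta>. a \<theta> + z *s b \<theta>) (\<lambda>\<omega>. X \<omega> + z * Y \<omega>)"
proof -
  obtain m t v where s: "\<And>n. (\<forall>i\<le>m n. t n i \<in> {-pi..pi}) \<and> mono_on {..m n} (t n)"
    "L_alpha_tendsto \<alpha> f (\<lambda>n. step_fun (m n) (t n) (v n)) a"
    "tendsto_prob M (\<lambda>n. step_integral Z (m n) (t n) (v n)) X"
    using X unfolding has_stoch_integral_def by blast
  obtain m' t' v' where s': "\<And>n. (\<forall>i\<le>m' n. t' n i \<in> {-pi..pi}) \<and> mono_on {..m' n} (t' n)"
    "L_alpha_tendsto \<alpha> f (\<lambda>n. step_fun (m' n) (t' n) (v' n)) b"
    "tendsto_prob M (\<lambda>n. step_integral Z (m' n) (t' n) (v' n)) Y"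
    using Y unfolding has_stoch_integral_def by blast
  have "\<exists>m'' t'' v''. mono_on {..m''} t'' \<and> (\<forall>i\<le>m''. t'' i \<in> {-pi..pi}) \<and>
      (\<forall>\<theta>. step_fun m'' t'' v'' \<theta> = step_fun (m n) (t n) (v n) \<theta> + z *s step_fun (m' n) (t' n) (v' n) \<theta>) \<and>
      (\<forall>\<Phi>. step_sum m'' t'' v'' \<Phi> = step_sum (m n) (t n) (v n) \<Phi> + z * step_sum (m' n) (t' n) (v' n) \<Phi>)" for n
    using step_sum_combination[of "m n" "t n" "{-pi..pi}" "m' n" "t' n" "v n" z "v' n"] s(1)[of n] s'(1)[of n]
    by metis
  then obtain m'' t'' v'' where c: "\<And>n. mono_on {..m'' n} (t'' n)" "\<And>n. \<forall>i\<le>m'' n. t'' n i \<in> {-pi..pi}"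
      "\<And>n \<theta>. step_fun (m'' n) (t'' n) (v'' n) \<theta> = step_fun (m n) (t n) (v n) \<theta> + z *s step_fun (m' n) (t' n) (v' n) \<theta>"
      "\<And>n \<Phi>. step_sum (m'' n) (t'' n) (v'' n) \<Phi> = step_sum (m n) (t n) (v n) \<Phi> + z * step_sum (m' n) (t' n) (v' n) \<Phi>"
    by metis
  have "L_alpha_tendsto \<alpha> f (\<lambda>n. step_fun (m'' n) (t'' n) (v'' n)) (\<lambda>\<theta>. a \<theta> + z *s b \<theta>)"
  proof -
    have "(\<lambda>n. step_fun (m'' n) (t'' n) (v'' n))
        = (\<lambda>n \<theta>. step_fun (m n) (t n) (v n) \<theta> + z *s step_fun (m' n) (t' n) (v' n) \<theta>)"
      by (simp add: fun_eq_iff c(3))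
    then show ?thesis using w.L_alpha_tendsto_add_scale[OF s(2) s'(2), of z] by simp
  qed
  moreover have "tendsto_prob M (\<lambda>n. step_integral Z (m'' n) (t'' n) (v'' n)) (\<lambda>\<omega>. X \<omega> + z * Y \<omega>)"
  proof -
    have "(\<lambda>n. step_integral Z (m'' n) (t'' n) (v'' n))
        = (\<lambda>n \<omega>. step_integral Z (m n) (t n) (v n) \<omega> + z * step_integral Z (m' n) (t' n) (v' n) \<omega>)"
      by (simp add: fun_eq_iff step_integral_eq_step_sum c(4))
    moreover have "step_integral Z (m n) (t n) (v n) \<in> borel_measurable M"
      "step_integral Z (m' n) (t' n) (v' n) \<in> borel_measurable M" for n
      using s(1) s'(1) by (auto intro!: step_integral_measurable)
    ultimately show ?thesis
      using has_stoch_integralD(2)[OF X] has_stoch_integralD(2)[OF Y]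
      by (simp only:) (intro tendsto_prob_add tendsto_prob_scale s(3) s'(3); simp)
  qed
  moreover have "(\<lambda>\<theta>. a \<theta> + z *s b \<theta>) \<in> L_alpha \<alpha> f"
    by (intro w.L_alpha_add w.L_alpha_scale has_stoch_integralD(1)[OF X] has_stoch_integralD(1)[OF Y])
  moreover have "(\<lambda>\<omega>. X \<omega> + z * Y \<omega>) \<in> borel_measurable M"
    using has_stoch_integralD(2)[OF X] has_stoch_integralD(2)[OF Y] by simp
  ultimately show ?thesis unfolding has_stoch_integral_def using c(1,2) by blast
qed

lemma has_stoch_integral_limit:
  assumes X: "\<And>n. has_stoch_integral M \<alpha> f Z (a n) (X n)"
    and a: "L_alpha_tendsto \<alpha> f a b" "b \<in> L_alpha \<alpha> f"
    and Y: "Y \<in> borel_measurable M" "tendsto_prob M X Y"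
  shows "has_stoch_integral M \<alpha> f Z b Y"
proof (rule has_stoch_integralI[OF a(2) Y(1)])
  fix e :: real assume e: "0 < e"
  have "\<forall>\<^sub>F n in sequentially. energy \<alpha> f (\<lambda>\<theta>. a n \<theta> - b \<theta>) < e / 4"
    using e by (intro L_alpha_tendsto_eventually a(1)) simp
  moreover have "\<forall>\<^sub>F n in sequentially. prob {\<omega> \<in> space M. e / 2 \<le> norm (X n \<omega> - Y \<omega>)} < e / 2"
    using e by (intro tendsto_prob_eventually[OF Y(2)]) auto
  ultimately have "\<forall>\<^sub>F n in sequentially. energy \<alpha> f (\<lambda>\<theta>. a n \<theta> - b \<theta>) < e / 4 \<and>
      prob {\<omega> \<in> space M. e / 2 \<le> norm (X n \<omega> - Y \<omega>)} < e / 2" by (rule eventually_conj)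
  then obtain n where n: "energy \<alpha> f (\<lambda>\<theta>. a n \<theta> - b \<theta>) < e / 4"
      "prob {\<omega> \<in> space M. e / 2 \<le> norm (X n \<omega> - Y \<omega>)} < e / 2"
    using eventually_happens'[OF sequentially_bot] by blast
  \<comment> \<open>A quarter, because the triangle inequality for the energy has the factor
    2.\<close>
  have "0 < e / 4" using e by simp
  from has_stoch_integral_stepE[OF X[of n] this]
  obtain m t v where s: "mono_on {..m} t" "\<forall>i\<le>m. t i \<in> {-pi..pi}"
    "energy \<alpha> f (\<lambda>\<theta>. step_fun m t v \<theta> - a n \<theta>) < e / 4"
    "prob {\<omega> \<in> space M. e / 4 \<le> norm (step_integral Z m t v \<omega> - X n \<omega>)} < e / 4" .
  have [measurable]: "step_integral Z m t v \<in> borel_measurable M" "X n \<in> borel_measurable M" "Y \<in> borel_measurable M"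
    using s(2) has_stoch_integralD(2)[OF X] Y by (auto intro: step_integral_measurable)
  have "energy \<alpha> f (\<lambda>\<theta>. step_fun m t v \<theta> - b \<theta>)
      \<le> 2 * (energy \<alpha> f (\<lambda>\<theta>. step_fun m t v \<theta> - a n \<theta>) + energy \<alpha> f (\<lambda>\<theta>. a n \<theta> - b \<theta>))"
    by (intro w.energy_triangle w.L_alpha_diff step_fun_in_L_alpha a(2) has_stoch_integralD(1)[OF X])
  then have 1: "energy \<alpha> f (\<lambda>\<theta>. step_fun m t v \<theta> - b \<theta>) < e" using s(3) n(1) by simp
  have "prob {\<omega> \<in> space M. e / 2 + e / 2 \<le> norm (step_integral Z m t v \<omega> - Y \<omega>)}
      \<le> prob {\<omega> \<in> space M. e / 2 \<le> norm (step_integral Z m t v \<omega> - X n \<omega>)} + prob {\<omega> \<in> space M. e / 2 \<le> norm (X n \<omega> - Y \<omega>)}"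
    by (rule prob_norm_triangle) measurable
  moreover have "prob {\<omega> \<in> space M. e / 2 \<le> norm (step_integral Z m t v \<omega> - X n \<omega>)}
      \<le> prob {\<omega> \<in> space M. e / 4 \<le> norm (step_integral Z m t v \<omega> - X n \<omega>)}"
    using e by (intro finite_measure_mono) auto
  ultimately have 2: "prob {\<omega> \<in> space M. e \<le> norm (step_integral Z m t v \<omega> - Y \<omega>)} < e"
    using n(2) s(4) e by simp
  show "\<exists>m t v. mono_on {..m} t \<and> (\<forall>i\<le>m. t i \<in> {-pi..pi}) \<and>
      energy \<alpha> f (\<lambda>\<theta>. step_fun m t v \<theta> - b \<theta>) < e \<and>
      prob {\<omega> \<in> space M. e \<le> norm (step_integral Z m t v \<omega> - Y \<omega>)} < e"
    using s(1,2) 1 2 by blast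
qed

lemma has_stoch_integral_diff:
  assumes "has_stoch_integral M \<alpha> f Z a X" "has_stoch_integral M \<alpha> f Z b Y"
  shows "has_stoch_integral M \<alpha> f Z (\<lambda>\<theta>. a \<theta> - b \<theta>) (\<lambda>\<omega>. X \<omega> - Y \<omega>)"
  using has_stoch_integral_add_scale[OF assms, of "-1"] by (simp add: vec_eq_iff)

text \<open>Differences of the \<open>X n\<close> are integrals of differences, so their scales are
  energies. Small scales give small probabilities uniformly, and hence a limit in probability
  exists.\<close>

lemma has_stoch_integral_tendsto:
  assumes X: "\<And>n. has_stoch_integral M \<alpha> f Z (a n) (X n)"
    and a: "L_alpha_tendsto \<alpha> f a b" "b \<in> L_alpha \<alpha> f"
  obtains Y where "has_stoch_integral M \<alpha> f Z b Y" "tendsto_prob M X Y"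
proof -
  have "\<exists>n0. \<forall>i\<ge>n0. \<forall>j\<ge>n0. prob {\<omega> \<in> space M. e \<le> norm (X i \<omega> - X j \<omega>)} < e" if e: "0 < e" for e
  proof -
    obtain d where d: "0 < d" "\<And>W. sas_var M \<alpha> W \<Longrightarrow> sas_scale M \<alpha> W < d \<Longrightarrow> prob {\<omega> \<in> space M. e \<le> norm (W \<omega>)} < e"
      using prob_small_of_scale[OF e] by blast
    have "\<forall>\<^sub>F n in sequentially. energy \<alpha> f (\<lambda>\<theta>. a n \<theta> - b \<theta>) < d / 4"
      using d(1) by (intro L_alpha_tendsto_eventually a(1)) simp
    then obtain n0 where n0: "\<And>n. n0 \<le> n \<Longrightarrow> energy \<alpha> f (\<lambda>\<theta>. a n \<theta> - b \<theta>) < d / 4"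
      by (auto simp: eventually_sequentially)
    have "prob {\<omega> \<in> space M. e \<le> norm (X i \<omega> - X j \<omega>)} < e" if "n0 \<le> i" "n0 \<le> j" for i j
    proof (rule d(2))
      note D = has_stoch_integral_diff[OF X X, of i j]
      show "sas_var M \<alpha> (\<lambda>\<omega>. X i \<omega> - X j \<omega>)" by (rule has_stoch_integralD(3)[OF D])
      have "energy \<alpha> f (\<lambda>\<theta>. a i \<theta> - a j \<theta>) \<le> 2 * (energy \<alpha> f (\<lambda>\<theta>. a i \<theta> - b \<theta>) + energy \<alpha> f (\<lambda>\<theta>. b \<theta> - a j \<theta>))"
        by (intro w.energy_triangle w.L_alpha_diff a(2) has_stoch_integralD(1)[OF X])
      then show "sas_scale M \<alpha> (\<lambda>\<omega>. X i \<omega> - X j \<omega>) < d"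
        using n0[OF \<open>n0 \<le> i\<close>] n0[OF \<open>n0 \<le> j\<close>] w.energy_minus_commute[of b "a j"]
        by (simp add: has_stoch_integralD(4)[OF D])
    qed
    then show ?thesis by blast
  qed
  from prob_Cauchy_convergent[OF has_stoch_integralD(2)[OF X] this]
  obtain Y where "Y \<in> borel_measurable M" "tendsto_prob M X Y" .
  then show ?thesis using that has_stoch_integral_limit[OF X a] by blast
qed

text \<open>The difference has energy 0 and hence scale 0, so the constant sequence of this
  difference tends to 0 in probability.\<close>

lemma has_stoch_integral_unique:
  assumes X: "has_stoch_integral M \<alpha> f Z a X" and Y: "has_stoch_integral M \<alpha> f Z b Y"
    and ae: "AE \<theta> in circ. a \<theta> = b \<theta>"
  shows "AE \<omega> in M. X \<omega> = Y \<omega>"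
proof (rule AE_eq_of_prob)
  show "X \<in> borel_measurable M" "Y \<in> borel_measurable M" using has_stoch_integralD(2) X Y by auto
  note D = has_stoch_integral_diff[OF X Y]
  have "energy \<alpha> f (\<lambda>\<theta>. a \<theta> - b \<theta>) = (LINT \<theta>|circ. 0)"
    unfolding energy_def
    by (rule integral_cong_AE) (use ae has_stoch_integralD(1)[OF D] w.L_alpha_measurable in \<open>auto intro!: w.qform_measurable elim!: eventually_mono\<close>)
  then have z: "sas_scale M \<alpha> (\<lambda>\<omega>. X \<omega> - Y \<omega>) = 0" by (simp add: has_stoch_integralD(4)[OF D])
  fix e :: real assume e: "0 < e"
  have "(\<lambda>n::nat. prob {\<omega> \<in> space M. e \<le> norm (X \<omega> - Y \<omega>)}) \<longlonglongrightarrow> 0"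
    by (rule scale_tendsto_0_imp_prob[OF has_stoch_integralD(3)[OF D] _ e]) (simp add: z)
  then show "prob {\<omega> \<in> space M. e \<le> norm (X \<omega> - Y \<omega>)} = 0" by (simp add: LIMSEQ_const_iff)
qed

lemma has_stoch_integral_sum:
  assumes "finite J" "\<And>j. j \<in> J \<Longrightarrow> has_stoch_integral M \<alpha> f Z (a j) (X j)"
  shows "has_stoch_integral M \<alpha> f Z (\<lambda>\<theta>. \<Sum>j\<in>J. z j *s a j \<theta>) (\<lambda>\<omega>. \<Sum>j\<in>J. z j * X j \<omega>)"
  using assms
proof (induction J rule: finite_induct)
  case empty
  \<comment> \<open>The empty sum is an increment over a degenerate interval.\<close>
  have "increment (-pi) (-pi) 0 = (\<lambda>_. 0)" by (simp add: increment_def fun_eq_iff)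
  then show ?case using has_stoch_integral_increment[of "-pi" "-pi" 0] by simp
next
  case (insert j J)
  have "has_stoch_integral M \<alpha> f Z (\<lambda>\<theta>. (\<Sum>j\<in>J. z j *s a j \<theta>) + z j *s a j \<theta>) (\<lambda>\<omega>. (\<Sum>j\<in>J. z j * X j \<omega>) + z j * X j \<omega>)"
    using insert by (intro has_stoch_integral_add_scale) auto
  then show ?case using insert by (simp add: add.commute)
qed

end

section \<open>Sums of independent stable variables\<close>

text \<open>The spectral measure of a sum of independent stable variables arises in this way from
  those of the summands.\<close>

definition measure_sum :: "'a measure \<Rightarrow> 'a measure \<Rightarrow> 'a measure" where
  "measure_sum A B = measure_of (space A) (sets A) (\<lambda>X. emeasure A X + emeasure B X)"

context
  fixes A B :: "'a measure"
  assumes sets_eq: "sets A = sets B"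
begin

lemma sets_measure_sum: "sets (measure_sum A B) = sets A"
  and space_measure_sum: "space (measure_sum A B) = space A"
  by (simp_all add: measure_sum_def sets.sets_measure_of_eq sets.space_measure_of_eq)

lemma emeasure_measure_sum:
  assumes "X \<in> sets A"
  shows "emeasure (measure_sum A B) X = emeasure A X + emeasure B X"
proof (rule emeasure_measure_of[OF measure_sum_def sets.space_closed])
  show "countably_additive (sets (measure_sum A B)) (\<lambda>X. emeasure A X + emeasure B X)"
    unfolding countably_additive_def sets_measure_sum
  proof (intro allI impI)
    fix F :: "nat \<Rightarrow> 'a set" assume F: "range F \<subseteq> sets A" "disjoint_family F"
    have "(\<Sum>i. emeasure A (F i) + emeasure B (F i)) = (\<Sum>i. emeasure A (F i)) + (\<Sum>i. emeasure B (F i))"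
      by (rule suminf_add[symmetric]) auto
    then show "(\<Sum>i. emeasure A (F i) + emeasure B (F i)) = emeasure A (\<Union> (range F)) + emeasure B (\<Union> (range F))"
      using F sets_eq by (simp add: suminf_emeasure)
  qed
qed (use assms in \<open>auto simp: positive_def sets_measure_sum\<close>)

lemma nn_integral_measure_sum:
  assumes "u \<in> borel_measurable A"
  shows "(\<integral>\<^sup>+x. u x \<partial>measure_sum A B) = (\<integral>\<^sup>+x. u x \<partial>A) + (\<integral>\<^sup>+x. u x \<partial>B)"
proof -
  have mA: "borel_measurable (measure_sum A B) = borel_measurable A"
    by (rule measurable_cong_sets) (simp_all add: sets_measure_sum)
  have mB: "borel_measurable B = borel_measurable A"
    by (rule measurable_cong_sets) (simp_all add: sets_eq)
  have sp: "space A = space B" using sets_eq by (rule sets_eq_imp_space_eq)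
  from assms show ?thesis
  proof (induction rule: borel_measurable_induct)
    case (cong f g)
    then have "(\<integral>\<^sup>+x. f x \<partial>C) = (\<integral>\<^sup>+x. g x \<partial>C)" if "space C = space A" for C
      using that by (intro nn_integral_cong) simp
    then show ?case using cong by (simp add: space_measure_sum sp)
  next
    case (set X)
    then show ?case by (simp add: sets_measure_sum emeasure_measure_sum sets_eq[symmetric])
  next
    case (mult u c)
    then show ?case by (simp add: nn_integral_cmult mA mB distrib_left)
  next
    case (add u v)
    then show ?case by (simp add: nn_integral_add mA mB ac_simps)
  next
    case (seq U)
    have sup: "(\<integral>\<^sup>+x. (SUP i. U i) x \<partial>C) = (SUP i. \<integral>\<^sup>+x. U i x \<partial>C)" if "sets C = sets A" for C :: "'a measure"
    proof -
      have "U i \<in> borel_measurable C" for i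
        using seq(1) by (simp add: measurable_cong_sets[OF that refl])
      then show ?thesis
        unfolding SUP_apply by (intro nn_integral_monotone_convergence_SUP seq)
    qed
    have "(SUP i. (\<integral>\<^sup>+x. U i x \<partial>A) + (\<integral>\<^sup>+x. U i x \<partial>B)) = (SUP i. \<integral>\<^sup>+x. U i x \<partial>A) + (SUP i. \<integral>\<^sup>+x. U i x \<partial>B)"
      using seq by (intro ennreal_SUP_add) (auto intro!: incseq_nn_integral)
    then show ?case
      using seq sup[OF refl] sup[OF sets_eq[symmetric]] sup[OF sets_measure_sum] by simp
  qed
qed

lemma integral_measure_sum:
  fixes u :: "'a \<Rightarrow> real"
  assumes "integrable A u" "integrable B u" "\<And>x. 0 \<le> u x"
  shows "(LINT x|measure_sum A B. u x) = (LINT x|A. u x) + (LINT x|B. u x)"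
proof -
  have u: "u \<in> borel_measurable A" using assms by auto
  then have m: "u \<in> borel_measurable (measure_sum A B)"
    by (subst measurable_cong_sets[OF sets_measure_sum refl])
  have "(\<integral>\<^sup>+x. ennreal (u x) \<partial>measure_sum A B) = ennreal ((LINT x|A. u x) + (LINT x|B. u x))"
    using u assms by (subst nn_integral_measure_sum) (auto simp: nn_integral_eq_integral)
  then show ?thesis
    using m assms(3) by (intro has_bochner_integral_integral_eq has_bochner_integral_nn_integral) auto
qed

end

context stable_space
begin

text \<open>Both factors are tested with the same \<open>z\<close>. This is weaker than
  independence, but it passes to limits in probability and suffices to add spectral
  measures.\<close>

definition char_indep :: "('a \<Rightarrow> complex) \<Rightarrow> ('a \<Rightarrow> complex) \<Rightarrow> bool" where
  "char_indep X Y \<longleftrightarrow> (\<forall>z. (LINT \<omega>|M. cis (Re (z * (X \<omega> + Y \<omega>))))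
     = (LINT \<omega>|M. cis (Re (z * X \<omega>))) * (LINT \<omega>|M. cis (Re (z * Y \<omega>))))"

text \<open>Logarithms of characteristic functions add, so the sum of spectral measures of
  \<open>(X, X)\<close> and \<open>(Y, Y)\<close> is a spectral measure for the sum; scales add
  because they are integrals against these measures.\<close>

lemma sas_var_add:
  assumes X: "sas_var M \<alpha> X" and Y: "sas_var M \<alpha> Y" and ind: "char_indep X Y"
  shows "sas_var M \<alpha> (\<lambda>\<omega>. X \<omega> + Y \<omega>)"
    "sas_scale M \<alpha> (\<lambda>\<omega>. X \<omega> + Y \<omega>) = sas_scale M \<alpha> X + sas_scale M \<alpha> Y"
proof -
  obtain G where G: "is_spectral_measure M \<alpha> X X G" using X by (auto simp: sas_var_def)
  obtain H where H: "is_spectral_measure M \<alpha> Y Y H" using Y by (auto simp: sas_var_def)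
  have a0: "0 < \<alpha>" using \<alpha> by simp
  have sets: "sets G = sets H" "sets G = sets borel" "sets H = sets borel"
    using G H by (auto simp: is_spectral_measure_def)
  interpret G: finite_measure G using G by (simp add: is_spectral_measure_def)
  interpret H: finite_measure H using H by (simp add: is_spectral_measure_def)
  let ?S = "measure_sum G H"
  note em = emeasure_measure_sum[OF sets(1)] and ss = sets_measure_sum[OF sets(1)] and im = integral_measure_sum[OF sets(1)]
  have int: "(LINT x|?S. \<bar>t \<bullet> x\<bar> powr \<alpha>) = (LINT x|G. \<bar>t \<bullet> x\<bar> powr \<alpha>) + (LINT x|H. \<bar>t \<bullet> x\<bar> powr \<alpha>)" for t
  proof (rule im)
    have t: "t \<bullet> x = Re (1 * (cnj (fst t) * fst x + cnj (snd t) * snd x))" for x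
      by (simp add: inner_prod_def inner_complex_def)
    show "integrable G (\<lambda>x. \<bar>t \<bullet> x\<bar> powr \<alpha>)" "integrable H (\<lambda>x. \<bar>t \<bullet> x\<bar> powr \<alpha>)"
      unfolding t by (rule spectral_integrable(2)[OF G a0], rule spectral_integrable(2)[OF H a0])
  qed simp
  have S: "is_spectral_measure M \<alpha> (\<lambda>\<omega>. X \<omega> + Y \<omega>) (\<lambda>\<omega>. X \<omega> + Y \<omega>) ?S"
    unfolding is_spectral_measure_def
  proof (intro conjI allI)
    have "emeasure ?S (space ?S) \<noteq> \<infinity>"
      unfolding space_measure_sum[OF sets(1)] by (subst em) auto
    then show "finite_measure ?S" by (rule finite_measureI)
    show sS: "sets ?S = sets borel" using ss sets by simp
    have "AE x in G. x \<in> sphere 0 1" "AE x in H. x \<in> sphere 0 1"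
      using G H by (auto simp: is_spectral_measure_def)
    then have "emeasure G (- sphere 0 1) = 0" "emeasure H (- sphere 0 1) = 0"
      using sets by (auto simp: AE_iff_measurable[OF _ refl] sets_eq_imp_space_eq[OF sets(2)] sets_eq_imp_space_eq[OF sets(3)] Compl_eq)
    then have "emeasure ?S (- sphere 0 1) = 0"
      using sets by (subst em) auto
    then show "AE x in ?S. x \<in> sphere 0 1"
      by (subst AE_iff_measurable[OF _ refl]) (use sS sets_eq_imp_space_eq[OF sS] in \<open>auto simp: Compl_eq\<close>)
    show "distr ?S borel uminus = ?S"
    proof (rule measure_eqI)
      fix C assume "C \<in> sets (distr ?S borel uminus)"
      then have C: "C \<in> sets borel" by simp
      have um: "uminus -` C \<in> sets (borel :: (complex \<times> complex) measure)"
        using measurable_sets[OF borel_measurable_continuous_onI[OF continuous_on_minus[OF continuous_on_id]] C] by simp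
      have dG: "emeasure K (uminus -` C) = emeasure K C" if "distr K borel uminus = K" "sets K = sets borel" for K
      proof -
        have "emeasure K C = emeasure (distr K borel uminus) C" using that(1) by simp
        also have "\<dots> = emeasure K (uminus -` C \<inter> space K)"
          using C that(2) by (intro emeasure_distr) auto
        finally show ?thesis using sets_eq_imp_space_eq[OF that(2)] by simp
      qed
      have "emeasure (distr ?S borel uminus) C = emeasure ?S (uminus -` C \<inter> space ?S)"
        using C sS by (intro emeasure_distr) auto
      also have "\<dots> = emeasure G (uminus -` C) + emeasure H (uminus -` C)"
        using sets_eq_imp_space_eq[OF sS] um sets by (subst em) auto
      also have "\<dots> = emeasure G C + emeasure H C"
        using G H by (intro arg_cong2[where f = "(+)"] dG) (auto simp: is_spectral_measure_def)
      also have "\<dots> = emeasure ?S C" using C sets by (subst em) auto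
      finally show "emeasure (distr ?S borel uminus) C = emeasure ?S C" .
    qed (use sS in simp)
    fix t :: "complex \<times> complex"
    \<comment> \<open>A test vector meets the diagonal only through the sum of its components, so
      the product formula with a single complex \<open>z\<close> is enough.\<close>
    have t: "t \<bullet> (w, w) = Re ((cnj (fst t) + cnj (snd t)) * w)" for w
      by (simp add: inner_prod_def inner_complex_def algebra_simps)
    have cG: "(LINT \<omega>|M. cis (t \<bullet> (X \<omega>, X \<omega>))) = of_real (exp (- (LINT x|G. \<bar>t \<bullet> x\<bar> powr \<alpha>)))"
      and cH: "(LINT \<omega>|M. cis (t \<bullet> (Y \<omega>, Y \<omega>))) = of_real (exp (- (LINT x|H. \<bar>t \<bullet> x\<bar> powr \<alpha>)))"
      using G H unfolding is_spectral_measure_def by blast+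
    have "(LINT \<omega>|M. cis (t \<bullet> (X \<omega> + Y \<omega>, X \<omega> + Y \<omega>)))
        = (LINT \<omega>|M. cis (t \<bullet> (X \<omega>, X \<omega>))) * (LINT \<omega>|M. cis (t \<bullet> (Y \<omega>, Y \<omega>)))"
      using ind unfolding char_indep_def t by blast
    then show "(LINT \<omega>|M. cis (t \<bullet> (X \<omega> + Y \<omega>, X \<omega> + Y \<omega>))) = of_real (exp (- (LINT x|?S. \<bar>t \<bullet> x\<bar> powr \<alpha>)))"
      unfolding cG cH int by (simp add: exp_add[symmetric] flip: of_real_mult)
  qed
  then show "sas_var M \<alpha> (\<lambda>\<omega>. X \<omega> + Y \<omega>)"
    using X Y by (auto simp: sas_var_def)
  show "sas_scale M \<alpha> (\<lambda>\<omega>. X \<omega> + Y \<omega>) = sas_scale M \<alpha> X + sas_scale M \<alpha> Y"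
    using scale_spectral[OF S a0, of 0 1] scale_spectral[OF G a0, of 0 1] scale_spectral[OF H a0, of 0 1]
      im[of "\<lambda>x. norm (snd x) powr \<alpha>"] spectral_integrable(1)[OF G a0, of 0 1] spectral_integrable(1)[OF H a0, of 0 1]
    by simp
qed

lemma sas_var_cong_AE:
  assumes X: "sas_var M \<alpha> X" and Y[measurable]: "Y \<in> borel_measurable M" and ae: "AE \<omega> in M. X \<omega> = Y \<omega>"
  shows "sas_var M \<alpha> Y" "sas_scale M \<alpha> Y = sas_scale M \<alpha> X"
proof -
  have [measurable]: "X \<in> borel_measurable M" using X by (rule sas_varD)
  obtain G where G: "is_spectral_measure M \<alpha> X X G" using X by (auto simp: sas_var_def)
  have "(LINT \<omega>|M. cis (t \<bullet> (Y \<omega>, Y \<omega>))) = (LINT \<omega>|M. cis (t \<bullet> (X \<omega>, X \<omega>)))" for t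
    by (rule integral_cong_AE) (use ae in \<open>auto simp: inner_prod_def elim!: eventually_mono\<close>)
  then have "is_spectral_measure M \<alpha> Y Y G" using G by (simp add: is_spectral_measure_def)
  then show "sas_var M \<alpha> Y" using Y by (auto simp: sas_var_def)
  have "(LINT \<omega>|M. cis (Re (z * Y \<omega>))) = (LINT \<omega>|M. cis (Re (z * X \<omega>)))" for z
    by (rule integral_cong_AE) (use ae in \<open>auto elim!: eventually_mono\<close>)
  then show "sas_scale M \<alpha> Y = sas_scale M \<alpha> X" by (simp only: sas_scale_def log_char_def)
qed

lemma char_indep_limit:
  assumes [measurable]: "\<And>n. X n \<in> borel_measurable M" "\<And>n. Y n \<in> borel_measurable M"
      "X' \<in> borel_measurable M" "Y' \<in> borel_measurable M"
    and t: "tendsto_prob M X X'" "tendsto_prob M Y Y'" and ind: "\<And>n. char_indep (X n) (Y n)"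
  shows "char_indep X' Y'"
  unfolding char_indep_def
proof
  fix z
  have "(\<lambda>n. LINT \<omega>|M. cis (Re (z * (X n \<omega> + Y n \<omega>)))) \<longlonglongrightarrow> (LINT \<omega>|M. cis (Re (z * (X' \<omega> + Y' \<omega>))))"
    by (intro tendsto_prob_char tendsto_prob_add t) measurable
  moreover have "(\<lambda>n. (LINT \<omega>|M. cis (Re (z * X n \<omega>))) * (LINT \<omega>|M. cis (Re (z * Y n \<omega>))))
      \<longlonglongrightarrow> (LINT \<omega>|M. cis (Re (z * X' \<omega>))) * (LINT \<omega>|M. cis (Re (z * Y' \<omega>)))"
    by (intro tendsto_mult tendsto_prob_char t) measurable
  moreover have "(\<lambda>n. LINT \<omega>|M. cis (Re (z * (X n \<omega> + Y n \<omega>))))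
      = (\<lambda>n. (LINT \<omega>|M. cis (Re (z * X n \<omega>))) * (LINT \<omega>|M. cis (Re (z * Y n \<omega>))))"
    using ind unfolding char_indep_def by blast
  ultimately show "(LINT \<omega>|M. cis (Re (z * (X' \<omega> + Y' \<omega>))))
      = (LINT \<omega>|M. cis (Re (z * X' \<omega>))) * (LINT \<omega>|M. cis (Re (z * Y' \<omega>)))"
    by (simp only: LIMSEQ_unique)
qed

lemma char_indep_of_indep_var:
  assumes "indep_var N X N' Y" "G \<in> borel_measurable N" "H \<in> borel_measurable N'"
  shows "char_indep (\<lambda>\<omega>. G (X \<omega>)) (\<lambda>\<omega>. H (Y \<omega>))"
  unfolding char_indep_def
proof
  fix z :: complex
  have "indep_var borel (\<lambda>\<omega>. cis (Re (z * G (X \<omega>)))) borel (\<lambda>\<omega>. cis (Re (z * H (Y \<omega>))))"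
    using indep_var_compose[OF assms(1), of "\<lambda>x. cis (Re (z * G x))" borel "\<lambda>x. cis (Re (z * H x))" borel] assms(2,3)
    by (simp add: comp_def)
  moreover have [measurable]: "(\<lambda>\<omega>. G (X \<omega>)) \<in> borel_measurable M" "(\<lambda>\<omega>. H (Y \<omega>)) \<in> borel_measurable M"
    using measurable_compose[OF indep_var_rv1[OF assms(1)] assms(2)] measurable_compose[OF indep_var_rv2[OF assms(1)] assms(3)]
    by auto
  moreover have "integrable M (\<lambda>\<omega>. cis (Re (z * G (X \<omega>))))" "integrable M (\<lambda>\<omega>. cis (Re (z * H (Y \<omega>))))"
    by (rule integrable_const_bound[of _ 1]; simp)+
  ultimately have "(LINT \<omega>|M. cis (Re (z * G (X \<omega>))) * cis (Re (z * H (Y \<omega>))))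
      = (LINT \<omega>|M. cis (Re (z * G (X \<omega>)))) * (LINT \<omega>|M. cis (Re (z * H (Y \<omega>))))"
    by (intro indep_var_lebesgue_integral)
  then show "(LINT \<omega>|M. cis (Re (z * (G (X \<omega>) + H (Y \<omega>)))))
      = (LINT \<omega>|M. cis (Re (z * G (X \<omega>)))) * (LINT \<omega>|M. cis (Re (z * H (Y \<omega>))))"
    by (simp only: cis_mult distrib_left plus_complex.sel)
qed

end

text \<open>A function of the whole sequence rather than of \<omega>, so that independence of the
  two sequences can be composed with it.\<close>

definition lin_comb :: "int set \<Rightarrow> (int \<Rightarrow> complex^'n) \<Rightarrow> (int \<Rightarrow> complex^'n) \<Rightarrow> complex" where
  "lin_comb J v x = (\<Sum>j\<in>J. tdot (v j) (x j))"

definition trig_poly :: "int set \<Rightarrow> (int \<Rightarrow> complex^'n) \<Rightarrow> real \<Rightarrow> complex^'n" where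
  "trig_poly J v \<theta> = (\<Sum>j\<in>J. cis (of_int j * \<theta>) *s v j)"

lemma lin_comb_measurable [measurable]: "lin_comb J v \<in> borel_measurable (PiM UNIV (\<lambda>_. borel))"
  unfolding lin_comb_def[abs_def] tdot_def
  by (intro borel_measurable_sum borel_measurable_times borel_measurable_const borel_measurable_vec_nth)
    (rule measurable_component_singleton, simp)

lemma (in spectral_process) has_stoch_integral_trig_poly:
  assumes mono: "\<And>j k. has_stoch_integral M \<alpha> f Z (\<lambda>\<theta>. cis (of_int j * \<theta>) *s axis k 1) (\<lambda>\<omega>. \<xi> j \<omega> $ k)"
    and J: "finite J"
  shows "has_stoch_integral M \<alpha> f Z (trig_poly J v) (\<lambda>\<omega>. lin_comb J v (\<lambda>j. \<xi> j \<omega>))"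
proof -
  have double_sum: "(\<Sum>p\<in>J \<times> UNIV. h (fst p) (snd p)) = (\<Sum>j\<in>J. \<Sum>k\<in>UNIV. h j k)"
    for h :: "int \<Rightarrow> 'n \<Rightarrow> 'b::comm_monoid_add"
    by (simp add: sum.cartesian_product split_beta)
  have "has_stoch_integral M \<alpha> f Z
      (\<lambda>\<theta>. \<Sum>p\<in>J \<times> UNIV. v (fst p) $ snd p *s (cis (of_int (fst p) * \<theta>) *s axis (snd p) 1))
      (\<lambda>\<omega>. \<Sum>p\<in>J \<times> UNIV. v (fst p) $ snd p * \<xi> (fst p) \<omega> $ snd p)"
    using J mono by (intro has_stoch_integral_sum) auto
  moreover have "(\<Sum>p\<in>J \<times> UNIV. v (fst p) $ snd p *s (cis (of_int (fst p) * \<theta>) *s axis (snd p) 1)) = trig_poly J v \<theta>" for \<theta>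
  proof -
    have "(\<Sum>k\<in>UNIV. u $ k *s (z *s axis k 1)) = z *s u" for z and u :: "complex^'n"
    proof -
      have "u $ k * (z * axis k 1 $ i) = (if k = i then z * u $ i else 0)" for k i by (simp add: axis_def)
      then show ?thesis unfolding vec_eq_iff sum_component vector_smult_component by simp
    qed
    then show ?thesis
      unfolding trig_poly_def double_sum[of "\<lambda>j k. v j $ k *s (cis (of_int j * \<theta>) *s axis k 1)"] by (simp only:)
  qed
  moreover have "(\<Sum>p\<in>J \<times> UNIV. v (fst p) $ snd p * \<xi> (fst p) \<omega> $ snd p) = lin_comb J v (\<lambda>j. \<xi> j \<omega>)" for \<omega>
    by (simp add: lin_comb_def tdot_def double_sum[of "\<lambda>j k. v j $ k * \<xi> j \<omega> $ k"])
  ultimately show ?thesis by (simp add: fun_eq_iff[symmetric])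
qed

section \<open>The optimal estimate\<close>

lemma lin_comb_add: "lin_comb J v (\<lambda>j. x j + y j) = lin_comb J v x + lin_comb J v y"
  by (simp add: lin_comb_def tdot_add_right sum.distrib)

lemma A_func_eq_lin_comb: "A_func N a \<xi> \<omega> = lin_comb {0..int N} (\<lambda>j. a (nat j)) (\<lambda>j. \<xi> j \<omega>)"
  unfolding A_func_def lin_comb_def
  by (rule sum.reindex_bij_witness[of _ nat int]) auto

lemma A_fun_eq_trig_poly: "A_fun N a = trig_poly {0..int N} (\<lambda>j. a (nat j))"
  unfolding A_fun_def trig_poly_def fun_eq_iff
  by (intro allI sum.reindex_bij_witness[of _ nat int]) auto

lemma trig_span_iff:
  "p \<in> trig_span N \<longleftrightarrow> (\<exists>F v. p = trig_poly F v \<and> finite F \<and> F \<subseteq> - {0..int N})"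
  by (auto simp: trig_span_def trig_poly_def[abs_def])

lemma trig_poly_in_span: "finite J \<Longrightarrow> J \<subseteq> - {0..int N} \<Longrightarrow> trig_poly J v \<in> trig_span N"
  unfolding trig_span_iff by blast

locale noisy_observation =
  stable_space M \<alpha> + \<xi>: spectral_process M \<alpha> Z\<xi> f + \<eta>: spectral_process M \<alpha> Z\<eta> g +
  interpolation_weights \<alpha> f g P N "A_fun N a"
  for M :: "'a measure" and \<alpha> and Z\<xi> Z\<eta> :: "real \<Rightarrow> 'a \<Rightarrow> complex^'n" and f g P and N and a +
  fixes \<xi> \<eta> :: "int \<Rightarrow> 'a \<Rightarrow> complex^'n"
  assumes \<xi>_integral: "\<And>j k. has_stoch_integral M \<alpha> f Z\<xi> (\<lambda>\<theta>. cis (of_int j * \<theta>) *s axis k 1) (\<lambda>\<omega>. \<xi> j \<omega> $ k)"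
    and \<eta>_integral: "\<And>j k. has_stoch_integral M \<alpha> g Z\<eta> (\<lambda>\<theta>. cis (of_int j * \<theta>) *s axis k 1) (\<lambda>\<omega>. \<eta> j \<omega> $ k)"
    and indep: "indep_var (PiM UNIV (\<lambda>_. borel)) (\<lambda>\<omega> j. \<xi> j \<omega>) (PiM UNIV (\<lambda>_. borel)) (\<lambda>\<omega> j. \<eta> j \<omega>)"
begin

abbreviation "\<xi>_comb J v \<equiv> \<lambda>\<omega>. lin_comb J v (\<lambda>j. \<xi> j \<omega>)"
abbreviation "\<eta>_comb J v \<equiv> \<lambda>\<omega>. lin_comb J v (\<lambda>j. \<eta> j \<omega>)"

lemmas \<xi>_poly = \<xi>.has_stoch_integral_trig_poly[OF \<xi>_integral]
lemmas \<eta>_poly = \<eta>.has_stoch_integral_trig_poly[OF \<eta>_integral]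

lemma A_integral: "has_stoch_integral M \<alpha> f Z\<xi> (A_fun N a) (A_func N a \<xi>)"
  unfolding A_fun_eq_trig_poly A_func_eq_lin_comb[abs_def] by (rule \<xi>_poly) simp

lemma A_func_measurable [measurable]: "A_func N a \<xi> \<in> borel_measurable M"
  using A_integral by (rule \<xi>.has_stoch_integralD(2))

lemma comb_measurable:
  "\<xi>_comb J v \<in> borel_measurable M" "\<eta>_comb J v \<in> borel_measurable M"
  using measurable_compose[OF indep_var_rv1[OF indep] lin_comb_measurable]
    measurable_compose[OF indep_var_rv2[OF indep] lin_comb_measurable] by auto

text \<open>The third conjunct is what independence of the sequences leaves in the limit.\<close>

definition pair_integral :: "(real \<Rightarrow> complex^'n) \<Rightarrow> (real \<Rightarrow> complex^'n) \<Rightarrow> ('a \<Rightarrow> complex) \<Rightarrow> ('a \<Rightarrow> complex) \<Rightarrow> bool" where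
  "pair_integral u w X Y \<longleftrightarrow> has_stoch_integral M \<alpha> f Z\<xi> u X \<and> has_stoch_integral M \<alpha> g Z\<eta> w Y \<and> char_indep X Y"

lemma pair_integral_sum:
  assumes "pair_integral u w X Y"
  shows "sas_var M \<alpha> (\<lambda>\<omega>. X \<omega> + Y \<omega>)" "sas_scale M \<alpha> (\<lambda>\<omega>. X \<omega> + Y \<omega>) = energy \<alpha> f u + energy \<alpha> g w"
proof -
  have X: "has_stoch_integral M \<alpha> f Z\<xi> u X" and Y: "has_stoch_integral M \<alpha> g Z\<eta> w Y" and ind: "char_indep X Y"
    using assms by (auto simp: pair_integral_def)
  note s = sas_var_add[OF \<xi>.has_stoch_integralD(3)[OF X] \<eta>.has_stoch_integralD(3)[OF Y] ind]
  show "sas_var M \<alpha> (\<lambda>\<omega>. X \<omega> + Y \<omega>)" by (rule s)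
  show "sas_scale M \<alpha> (\<lambda>\<omega>. X \<omega> + Y \<omega>) = energy \<alpha> f u + energy \<alpha> g w"
    unfolding s(2) \<xi>.has_stoch_integralD(4)[OF X] \<eta>.has_stoch_integralD(4)[OF Y] ..
qed

text \<open>The same coefficients approximate \<open>h\<close> in the joint space and define the
  combinations that tend to \<open>I\<close> and to \<open>J\<close>. Keeping them explicit makes
  independence of signal and noise available before the limit.\<close>

definition realizes :: "(nat \<Rightarrow> int set) \<Rightarrow> (nat \<Rightarrow> int \<Rightarrow> complex^'n) \<Rightarrow> (real \<Rightarrow> complex^'n) \<Rightarrow>
    ('a \<Rightarrow> complex) \<Rightarrow> ('a \<Rightarrow> complex) \<Rightarrow> bool" where
  "realizes F v h I J \<longleftrightarrow> (\<forall>n. finite (F n) \<and> F n \<subseteq> - {0..int N}) \<and>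
     L_alpha_tendsto \<alpha> s (\<lambda>n. trig_poly (F n) (v n)) h \<and>
     has_stoch_integral M \<alpha> f Z\<xi> h I \<and> has_stoch_integral M \<alpha> g Z\<eta> h J \<and>
     tendsto_prob M (\<lambda>n. \<xi>_comb (F n) (v n)) I \<and> tendsto_prob M (\<lambda>n. \<eta>_comb (F n) (v n)) J"

text \<open>Convergence with weight \<open>f + g\<close> implies convergence with each weight, so
  one sequence of polynomials produces both integrals.\<close>

lemma realizes_exist:
  assumes F: "\<And>n. finite (F n)" "\<And>n. F n \<subseteq> - {0..int N}"
    and h: "L_alpha_tendsto \<alpha> s (\<lambda>n. trig_poly (F n) (v n)) h" "h \<in> L_alpha \<alpha> s"
  obtains I J where "realizes F v h I J"
proof -
  have hf: "L_alpha_tendsto \<alpha> f (\<lambda>n. trig_poly (F n) (v n)) h" "h \<in> L_alpha \<alpha> f"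
    and hg: "L_alpha_tendsto \<alpha> g (\<lambda>n. trig_poly (F n) (v n)) h" "h \<in> L_alpha \<alpha> g"
    using h by (auto simp: L_alpha_tendsto_sum_iff L_alpha_sum_iff)
  obtain I where "has_stoch_integral M \<alpha> f Z\<xi> h I" "tendsto_prob M (\<lambda>n. \<xi>_comb (F n) (v n)) I"
    using \<xi>.has_stoch_integral_tendsto[OF \<xi>_poly hf, OF F(1)] .
  moreover obtain J where "has_stoch_integral M \<alpha> g Z\<eta> h J" "tendsto_prob M (\<lambda>n. \<eta>_comb (F n) (v n)) J"
    using \<eta>.has_stoch_integral_tendsto[OF \<eta>_poly hg, OF F(1)] .
  ultimately show ?thesis using that F h(1) by (simp add: realizes_def)
qed

lemma L_alpha_N_realizes:
  assumes "h \<in> L_alpha_N \<alpha> s N"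
  obtains F v I J where "realizes F v h I J"
proof -
  obtain p where p: "\<forall>n. p n \<in> trig_span N" "L_alpha_tendsto \<alpha> s p h" "h \<in> L_alpha \<alpha> s"
    using assms by (auto simp: L_alpha_N_def)
  have "\<forall>n. \<exists>F v. p n = trig_poly F v \<and> finite F \<and> F \<subseteq> - {0..int N}"
    using p(1) unfolding trig_span_iff .
  then have "\<exists>F v. \<forall>n. p n = trig_poly (F n) (v n) \<and> finite (F n) \<and> F n \<subseteq> - {0..int N}"
    unfolding choice_iff .
  then obtain F v where F: "\<And>n. p n = trig_poly (F n) (v n)" "\<And>n. finite (F n)" "\<And>n. F n \<subseteq> - {0..int N}"
    by blast
  have "p = (\<lambda>n. trig_poly (F n) (v n))" using F(1) by (rule ext)
  then have "L_alpha_tendsto \<alpha> s (\<lambda>n. trig_poly (F n) (v n)) h" using p(2) by simp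
  from realizes_exist[OF F(2,3) this p(3)] obtain I J where "realizes F v h I J" .
  then show ?thesis by (rule that)
qed

lemma realizes_in_L_alpha_N:
  assumes "realizes F v h I J"
  shows "h \<in> L_alpha_N \<alpha> s N" "h \<in> L_alpha \<alpha> s"
proof -
  show h: "h \<in> L_alpha \<alpha> s"
    using assms \<xi>.has_stoch_integralD(1) \<eta>.has_stoch_integralD(1) unfolding realizes_def L_alpha_sum_iff by blast
  have "\<forall>n. trig_poly (F n) (v n) \<in> trig_span N" using assms by (auto simp: realizes_def intro: trig_poly_in_span)
  then show "h \<in> L_alpha_N \<alpha> s N"
    using assms h unfolding L_alpha_N_def realizes_def
    by (intro CollectI conjI exI[of _ "\<lambda>n. trig_poly (F n) (v n)"]) auto
qed

text \<open>Both the error \<open>A \<xi> - (I + J)\<close> and the approximations to \<open>I + J\<close> have the form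
  \<open>(X - I) + (Y - J)\<close> for linear combinations \<open>X\<close> of the \<open>\<xi> j\<close> and \<open>Y\<close> of the \<open>\<eta> j\<close>.\<close>

lemma pair_integral_diff:
  assumes r: "realizes F v h I J"
    and G: "has_stoch_integral M \<alpha> f Z\<xi> u (\<lambda>\<omega>. G (\<lambda>j. \<xi> j \<omega>))" "G \<in> borel_measurable (PiM UNIV (\<lambda>_. borel))"
    and H: "has_stoch_integral M \<alpha> g Z\<eta> w (\<lambda>\<omega>. H (\<lambda>j. \<eta> j \<omega>))" "H \<in> borel_measurable (PiM UNIV (\<lambda>_. borel))"
  shows "pair_integral (\<lambda>\<theta>. u \<theta> - h \<theta>) (\<lambda>\<theta>. w \<theta> - h \<theta>)
     (\<lambda>\<omega>. G (\<lambda>j. \<xi> j \<omega>) - I \<omega>) (\<lambda>\<omega>. H (\<lambda>j. \<eta> j \<omega>) - J \<omega>)"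
  unfolding pair_integral_def
proof (intro conjI)
  have I: "has_stoch_integral M \<alpha> f Z\<xi> h I" "tendsto_prob M (\<lambda>n. \<xi>_comb (F n) (v n)) I"
    and J: "has_stoch_integral M \<alpha> g Z\<eta> h J" "tendsto_prob M (\<lambda>n. \<eta>_comb (F n) (v n)) J"
    using r by (auto simp: realizes_def)
  show "has_stoch_integral M \<alpha> f Z\<xi> (\<lambda>\<theta>. u \<theta> - h \<theta>) (\<lambda>\<omega>. G (\<lambda>j. \<xi> j \<omega>) - I \<omega>)"
    by (rule \<xi>.has_stoch_integral_diff[OF G(1) I(1)])
  show "has_stoch_integral M \<alpha> g Z\<eta> (\<lambda>\<theta>. w \<theta> - h \<theta>) (\<lambda>\<omega>. H (\<lambda>j. \<eta> j \<omega>) - J \<omega>)"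
    by (rule \<eta>.has_stoch_integral_diff[OF H(1) J(1)])
  note [measurable] = \<xi>.has_stoch_integralD(2)[OF G(1)] \<eta>.has_stoch_integralD(2)[OF H(1)]
    \<xi>.has_stoch_integralD(2)[OF I(1)] \<eta>.has_stoch_integralD(2)[OF J(1)] comb_measurable
  have d: "tendsto_prob M (\<lambda>n \<omega>. X \<omega> - Y n \<omega>) (\<lambda>\<omega>. X \<omega> - Z \<omega>)" if "tendsto_prob M Y Z" for X Y Z
    using that by (simp add: tendsto_prob_def norm_minus_commute)
  show "char_indep (\<lambda>\<omega>. G (\<lambda>j. \<xi> j \<omega>) - I \<omega>) (\<lambda>\<omega>. H (\<lambda>j. \<eta> j \<omega>) - J \<omega>)"
  proof (rule char_indep_limit[OF _ _ _ _ d[OF I(2)] d[OF J(2)]])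
    show "char_indep (\<lambda>\<omega>. G (\<lambda>j. \<xi> j \<omega>) - \<xi>_comb (F n) (v n) \<omega>) (\<lambda>\<omega>. H (\<lambda>j. \<eta> j \<omega>) - \<eta>_comb (F n) (v n) \<omega>)" for n
      using char_indep_of_indep_var[OF indep, of "\<lambda>x. G x - lin_comb (F n) (v n) x" "\<lambda>x. H x - lin_comb (F n) (v n) x"]
        G(2) H(2) by simp
  qed measurable
qed

text \<open>The error is the sum of \<open>A_func N a \<xi> - I\<close> and \<open>- J\<close>; on
  the side of the noise \<open>pair_integral_diff\<close> is applied to the zero
  combination.\<close>

lemma error_scale:
  assumes r: "realizes F v h I J"
  shows "sas_var M \<alpha> (\<lambda>\<omega>. A_func N a \<xi> \<omega> - (I \<omega> + J \<omega>))"
    "sas_scale M \<alpha> (\<lambda>\<omega>. A_func N a \<xi> \<omega> - (I \<omega> + J \<omega>)) = error h"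
proof -
  have A: "has_stoch_integral M \<alpha> f Z\<xi> (A_fun N a) (\<xi>_comb {0..int N} (\<lambda>j. a (nat j)))"
    using A_integral unfolding A_func_eq_lin_comb[abs_def] .
  have z: "trig_poly {} v = (\<lambda>_. 0)" "lin_comb {} v = (\<lambda>_. 0)" for v :: "int \<Rightarrow> complex^'n"
    by (simp_all add: trig_poly_def lin_comb_def fun_eq_iff)
  have 0: "has_stoch_integral M \<alpha> g Z\<eta> (\<lambda>\<theta>. 0) (\<lambda>\<omega>. 0)"
    using \<eta>_poly[of "{}"] by (simp add: z)
  note p = pair_integral_diff[OF r A lin_comb_measurable 0, simplified]
  have eq: "(\<lambda>\<omega>. A_func N a \<xi> \<omega> - (I \<omega> + J \<omega>)) = (\<lambda>\<omega>. \<xi>_comb {0..int N} (\<lambda>j. a (nat j)) \<omega> - I \<omega> + - J \<omega>)"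
    by (simp add: A_func_eq_lin_comb fun_eq_iff)
  show "sas_var M \<alpha> (\<lambda>\<omega>. A_func N a \<xi> \<omega> - (I \<omega> + J \<omega>))"
    "sas_scale M \<alpha> (\<lambda>\<omega>. A_func N a \<xi> \<omega> - (I \<omega> + J \<omega>)) = error h"
    unfolding eq using pair_integral_sum[OF p] by (simp_all add: error_def energy_def qform_uminus)
qed

abbreviation observation :: "int \<Rightarrow> 'a \<Rightarrow> complex^'n" where
  "observation \<equiv> \<lambda>j \<omega>. \<xi> j \<omega> + \<eta> j \<omega>"

lemma sas_norm_tendsto_iff:
  assumes "\<And>n. sas_var M \<alpha> (W n)"
  shows "(\<lambda>n. sas_norm M \<alpha> (W n)) \<longlonglongrightarrow> 0 \<longleftrightarrow> (\<lambda>n. sas_scale M \<alpha> (W n)) \<longlonglongrightarrow> 0"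
proof
  assume "(\<lambda>n. sas_norm M \<alpha> (W n)) \<longlonglongrightarrow> 0"
  then have "(\<lambda>n. sas_norm M \<alpha> (W n) powr \<alpha>) \<longlonglongrightarrow> 0"
    using \<alpha> by (rule_tac tendsto_zero_powrI[of _ _ _ \<alpha>]) (auto simp: sas_norm_def)
  then show "(\<lambda>n. sas_scale M \<alpha> (W n)) \<longlonglongrightarrow> 0" by (simp add: sas_norm_eq(2)[OF assms])
next
  assume "(\<lambda>n. sas_scale M \<alpha> (W n)) \<longlonglongrightarrow> 0"
  then have "(\<lambda>n. sas_scale M \<alpha> (W n) powr (1 / \<alpha>)) \<longlonglongrightarrow> 0"
    using \<alpha> sas_varD(2)[OF assms] by (rule_tac tendsto_zero_powrI[of _ _ _ "1 / \<alpha>"]) auto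
  then show "(\<lambda>n. sas_norm M \<alpha> (W n)) \<longlonglongrightarrow> 0" by (simp add: sas_norm_eq(1)[OF assms])
qed

text \<open>The isometry between the space with weight \<open>f + g\<close> and the observations:
  the scale of the signal part and the scale of the noise part add up to the energy of the
  sum.\<close>

lemma obs_comb_diff:
  assumes r: "realizes F v h I J" and K: "finite K"
  shows "sas_var M \<alpha> (\<lambda>\<omega>. lin_comb K c (\<lambda>j. observation j \<omega>) - (I \<omega> + J \<omega>))"
    "sas_scale M \<alpha> (\<lambda>\<omega>. lin_comb K c (\<lambda>j. observation j \<omega>) - (I \<omega> + J \<omega>)) = energy \<alpha> s (\<lambda>\<theta>. trig_poly K c \<theta> - h \<theta>)"
proof -
  note p = pair_integral_sum[OF pair_integral_diff[OF r \<xi>_poly[OF K, of c] lin_comb_measurable \<eta>_poly[OF K, of c] lin_comb_measurable]]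
  have eq: "(\<lambda>\<omega>. lin_comb K c (\<lambda>j. observation j \<omega>) - (I \<omega> + J \<omega>))
      = (\<lambda>\<omega>. \<xi>_comb K c \<omega> - I \<omega> + (\<eta>_comb K c \<omega> - J \<omega>))"
    by (simp add: lin_comb_add fun_eq_iff)
  show "sas_var M \<alpha> (\<lambda>\<omega>. lin_comb K c (\<lambda>j. observation j \<omega>) - (I \<omega> + J \<omega>))"
    unfolding eq by (rule p(1))
  have "trig_poly K c \<in> L_alpha \<alpha> s" unfolding trig_poly_def[abs_def] by (rule s.trig_sum_in_L_alpha)
  then show "sas_scale M \<alpha> (\<lambda>\<omega>. lin_comb K c (\<lambda>j. observation j \<omega>) - (I \<omega> + J \<omega>)) = energy \<alpha> s (\<lambda>\<theta>. trig_poly K c \<theta> - h \<theta>)"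
    unfolding eq p(2) by (intro energy_sum[symmetric] s.L_alpha_diff realizes_in_L_alpha_N(2)[OF r])
qed

lemma realizes_imp_obs_space:
  assumes r: "realizes F v h I J"
  shows "(\<lambda>\<omega>. I \<omega> + J \<omega>) \<in> obs_space M \<alpha> observation N"
proof -
  have fin: "finite (F n)" "F n \<subseteq> - {0..int N}" for n using r by (auto simp: realizes_def)
  let ?Y = "\<lambda>n \<omega>. lin_comb (F n) (v n) (\<lambda>j. observation j \<omega>)"
  note d = obs_comb_diff[OF r fin(1)]
  have "(\<lambda>n. energy \<alpha> s (\<lambda>\<theta>. trig_poly (F n) (v n) \<theta> - h \<theta>)) \<longlonglongrightarrow> 0"
    using r unfolding realizes_def s.L_alpha_tendsto_iff by blast
  then have "(\<lambda>n. sas_norm M \<alpha> (\<lambda>\<omega>. ?Y n \<omega> - (I \<omega> + J \<omega>))) \<longlonglongrightarrow> 0"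
    unfolding sas_norm_tendsto_iff[OF d(1)] d(2) .
  then have "sas_tendsto M \<alpha> ?Y (\<lambda>\<omega>. I \<omega> + J \<omega>)"
    unfolding sas_tendsto_def using d(1) has_covariation_self_iff by blast
  moreover have "\<forall>n. ?Y n \<in> {\<lambda>\<omega>. \<Sum>j\<in>F. tdot (v j) (observation j \<omega>) | F v. finite F \<and> F \<subseteq> - {0..int N}}"
    unfolding lin_comb_def using fin by blast
  ultimately show ?thesis unfolding obs_space_def by (intro CollectI exI[of _ ?Y] conjI)
qed

text \<open>\<open>Y\<close> comes only as a limit in norm, and the norms of \<open>W i - Y\<close>
  and \<open>W j - Y\<close> cannot be combined, while probabilities can. The difference of
  \<open>W i\<close> and \<open>W j\<close> is a combination of observations, so its smallness in
  probability becomes smallness of an energy, and completeness produces \<open>h\<close>.\<close>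

lemma obs_space_imp_realizes:
  assumes Y: "Y \<in> obs_space M \<alpha> observation N"
  obtains F v h I J where "realizes F v h I J" "Y \<in> borel_measurable M" "AE \<omega> in M. Y \<omega> = I \<omega> + J \<omega>"
proof -
  obtain W where W: "\<forall>n. W n \<in> {\<lambda>\<omega>. \<Sum>j\<in>F. tdot (v j) (observation j \<omega>) | F v. finite F \<and> F \<subseteq> - {0..int N}}"
    and t: "sas_tendsto M \<alpha> W Y"
    using Y unfolding obs_space_def by blast
  have "\<forall>n. \<exists>F v. W n = (\<lambda>\<omega>. lin_comb F v (\<lambda>j. observation j \<omega>)) \<and> finite F \<and> F \<subseteq> - {0..int N}"
    using W unfolding lin_comb_def by blast
  then have "\<exists>F v. \<forall>n. W n = (\<lambda>\<omega>. lin_comb (F n) (v n) (\<lambda>j. observation j \<omega>)) \<and> finite (F n) \<and> F n \<subseteq> - {0..int N}"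
    unfolding choice_iff .
  then obtain F v where Wn: "\<And>n. W n = (\<lambda>\<omega>. lin_comb (F n) (v n) (\<lambda>j. observation j \<omega>))"
    and F: "\<And>n. finite (F n)" "\<And>n. F n \<subseteq> - {0..int N}"
    by blast
  let ?p = "\<lambda>n. trig_poly (F n) (v n)"
  have D: "sas_var M \<alpha> (\<lambda>\<omega>. W n \<omega> - Y \<omega>)" for n
    using t has_covariation_self_iff unfolding sas_tendsto_def by blast
  have Wm[measurable]: "W n \<in> borel_measurable M" for n
    unfolding Wn lin_comb_add using comb_measurable by simp
  \<comment> \<open>Measurability of \<open>Y\<close> is recovered from that of \<open>W 0\<close>
    and of the difference.\<close>
  have "(\<lambda>\<omega>. W 0 \<omega> - (W 0 \<omega> - Y \<omega>)) \<in> borel_measurable M"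
    by (rule borel_measurable_diff[OF Wm[of 0] sas_varD(1)[OF D[of 0]]])
  then have Ym[measurable]: "Y \<in> borel_measurable M" by simp
  have "(\<lambda>n. sas_scale M \<alpha> (\<lambda>\<omega>. W n \<omega> - Y \<omega>)) \<longlonglongrightarrow> 0"
    using t unfolding sas_tendsto_def sas_norm_tendsto_iff[OF D] by blast
  then have tp: "tendsto_prob M W Y"
    unfolding tendsto_prob_def by (intro allI impI scale_tendsto_0_imp_prob[where W = "\<lambda>n \<omega>. W n \<omega> - Y \<omega>"] D)
  have pL: "?p n \<in> L_alpha \<alpha> s" for n
    unfolding trig_poly_def[abs_def] by (rule s.trig_sum_in_L_alpha)
  have cauchy: "\<exists>n0. \<forall>i\<ge>n0. \<forall>j\<ge>n0. energy \<alpha> s (\<lambda>\<theta>. ?p i \<theta> - ?p j \<theta>) < e" if e: "0 < e" for e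
  proof -
    have a0: "0 < cos_moment \<alpha>" using \<alpha> by (intro cos_moment_pos) simp
    \<comment> \<open>The range of \<open>scale_le_of_prob\<close> requires \<open>1 / 6\<close>;
      the denominator \<open>24 * pi\<close> makes its bound at most \<open>e / 2\<close>.\<close>
    define e' where "e' = min (1 / 6) (e * cos_moment \<alpha> / (24 * pi))"
    have e': "0 < e'" "e' \<le> 1 / 6" "e' \<le> e * cos_moment \<alpha> / (24 * pi)" using e a0 by (auto simp: e'_def)
    have "\<forall>\<^sub>F n in sequentially. prob {\<omega> \<in> space M. e' / 2 \<le> norm (W n \<omega> - Y \<omega>)} < e' / 2"
      using e' by (intro tendsto_prob_eventually[OF tp]) auto
    then obtain n0 where n0: "\<And>n. n0 \<le> n \<Longrightarrow> prob {\<omega> \<in> space M. e' / 2 \<le> norm (W n \<omega> - Y \<omega>)} < e' / 2"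
      by (auto simp: eventually_sequentially)
    have "energy \<alpha> s (\<lambda>\<theta>. ?p i \<theta> - ?p j \<theta>) < e" if "n0 \<le> i" "n0 \<le> j" for i j
    proof -
      \<comment> \<open>A single combination realizes its own polynomial through the constant
        sequence, so the isometry applies to the difference of two combinations.\<close>
      have r: "realizes (\<lambda>_. F j) (\<lambda>_. v j) (?p j) (\<xi>_comb (F j) (v j)) (\<eta>_comb (F j) (v j))"
      proof -
        have "L_alpha_tendsto \<alpha> s (\<lambda>_. ?p j) (?p j)"
          using s.bounded_in_L_alpha[of "\<lambda>_. 0" 0] by (simp add: s.L_alpha_tendsto_iff energy_def)
        then show ?thesis using F by (simp add: realizes_def \<xi>_poly \<eta>_poly tendsto_prob_def)
      qed
      have Wij: "(\<lambda>\<omega>. W i \<omega> - W j \<omega>) = (\<lambda>\<omega>. lin_comb (F i) (v i) (\<lambda>j. observation j \<omega>) - (\<xi>_comb (F j) (v j) \<omega> + \<eta>_comb (F j) (v j) \<omega>))"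
        by (simp add: Wn lin_comb_add fun_eq_iff)
      note d = obs_comb_diff[OF r F(1), of i "v i", folded Wij]
      have "prob {\<omega> \<in> space M. e' / 2 + e' / 2 \<le> norm (W i \<omega> - W j \<omega>)}
          \<le> prob {\<omega> \<in> space M. e' / 2 \<le> norm (W i \<omega> - Y \<omega>)} + prob {\<omega> \<in> space M. e' / 2 \<le> norm (Y \<omega> - W j \<omega>)}"
        by (rule prob_norm_triangle) measurable
      then have "prob {\<omega> \<in> space M. e' \<le> norm (W i \<omega> - W j \<omega>)} \<le> e'"
        using n0[OF \<open>n0 \<le> i\<close>] n0[OF \<open>n0 \<le> j\<close>] by (simp add: norm_minus_commute[of "Y _"])
      from scale_le_of_prob[OF d(1) e'(1,2) this]
      have "energy \<alpha> s (\<lambda>\<theta>. ?p i \<theta> - ?p j \<theta>) \<le> 2 * pi * (6 * e') / cos_moment \<alpha>" by (simp add: d(2))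
      also have "\<dots> \<le> e / 2" using e'(3) a0 by (simp add: field_simps)
      also have "\<dots> < e" using e by simp
      finally show ?thesis .
    qed
    then show ?thesis by blast
  qed
  obtain h where h: "h \<in> L_alpha \<alpha> s" "L_alpha_tendsto \<alpha> s ?p h"
    using s.L_alpha_complete[OF pL cauchy] .
  obtain I J where r: "realizes F v h I J" using realizes_exist[OF F h(2,1)] .
  have [measurable]: "I \<in> borel_measurable M" "J \<in> borel_measurable M"
    using r \<xi>.has_stoch_integralD(2) \<eta>.has_stoch_integralD(2) unfolding realizes_def by blast+
  have "tendsto_prob M (\<lambda>n \<omega>. \<xi>_comb (F n) (v n) \<omega> + \<eta>_comb (F n) (v n) \<omega>) (\<lambda>\<omega>. I \<omega> + J \<omega>)"
    using r by (intro tendsto_prob_add) (auto simp: realizes_def comb_measurable)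
  then have "tendsto_prob M W (\<lambda>\<omega>. I \<omega> + J \<omega>)"
    by (simp add: Wn lin_comb_add tendsto_prob_def)
  then have "AE \<omega> in M. Y \<omega> = I \<omega> + J \<omega>"
    using tp by (intro tendsto_prob_unique[of W]) auto
  then show ?thesis using that r Ym by blast
qed

lemma error_of_obs:
  assumes r: "realizes F v h I J" and Y: "Y \<in> borel_measurable M" "AE \<omega> in M. Y \<omega> = I \<omega> + J \<omega>"
  shows "sas_norm M \<alpha> (\<lambda>\<omega>. A_func N a \<xi> \<omega> - Y \<omega>) = error h powr (1 / \<alpha>)"
proof -
  have ae: "AE \<omega> in M. A_func N a \<xi> \<omega> - (I \<omega> + J \<omega>) = A_func N a \<xi> \<omega> - Y \<omega>"
    using Y(2) by eventually_elim simp
  have m: "(\<lambda>\<omega>. A_func N a \<xi> \<omega> - Y \<omega>) \<in> borel_measurable M" using Y(1) by simp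
  note c = sas_var_cong_AE[OF error_scale(1)[OF r] m ae]
  show ?thesis using sas_norm_eq(1)[OF c(1)] c(2) error_scale(2)[OF r] by simp
qed

lemma error_powr_le_iff: "error h powr (1 / \<alpha>) \<le> error k powr (1 / \<alpha>) \<longleftrightarrow> error h \<le> error k"
proof
  assume le: "error h powr (1 / \<alpha>) \<le> error k powr (1 / \<alpha>)"
  have "x = (x powr (1 / \<alpha>)) powr \<alpha>" if "0 \<le> x" for x
    using that \<alpha> by (simp add: powr_powr)
  then show "error h \<le> error k"
    using le powr_mono2[OF _ _ le, of \<alpha>] \<alpha> error_nonneg by (metis less_eq_real_def less_trans powr_ge_zero zero_less_one)
next
  assume "error h \<le> error k"
  then show "error h powr (1 / \<alpha>) \<le> error k powr (1 / \<alpha>)"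
    using \<alpha> error_nonneg by (intro powr_mono2) auto
qed

end

lemma qform_singleton:
  fixes A :: "complex^'n^'n"
  assumes "CARD('n) = 1"
  shows "qform \<alpha> A v = norm (v $ k) powr \<alpha> * Re (A $ k $ k)"
proof -
  obtain i :: 'n where "UNIV = {i}" using assms by (metis card_1_singletonE)
  then have U: "(UNIV :: 'n set) = {k}" by (metis UNIV_I singletonD)
  have "bform \<alpha> A v v = A $ k $ k * (v $ k * spow (\<alpha> - 1) (v $ k))"
    unfolding bform_eq_sum U by simp
  then show ?thesis unfolding qform_def mult_spow by simp
qed

theorem theorem1:
  fixes M :: "'a measure"
    and \<alpha> :: real
    and N :: nat
    and \<xi> \<eta> :: "int \<Rightarrow> 'a \<Rightarrow> complex^'n"
    and Z\<xi> Z\<eta> :: "real \<Rightarrow> 'a \<Rightarrow> complex^'n"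
    and f g :: "real \<Rightarrow> complex^'n^'n"
    and a :: "nat \<Rightarrow> complex^'n"
  assumes "prob_space M"
    and "1 < \<alpha>" and "\<alpha> \<le> 2"
    and "hsas_sequence M \<alpha> \<xi> Z\<xi> f"
    and "hsas_sequence M \<alpha> \<eta> Z\<eta> g"
    and "independent_sequences M \<xi> \<eta>"
    and "minimality \<alpha> (\<lambda>\<theta>. f \<theta> + g \<theta>)"
  shows "\<exists>h c I J.
    h \<in> L_alpha_N \<alpha> (\<lambda>\<theta>. f \<theta> + g \<theta>) N \<and>
    interpolation_system \<alpha> f g N a h c \<and>
    (\<forall>h' c'. h' \<in> L_alpha \<alpha> (\<lambda>\<theta>. f \<theta> + g \<theta>) \<longrightarrow> interpolation_system \<alpha> f g N a h' c' \<longrightarrow>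
       (AE \<theta> in circ. h' \<theta> = h \<theta>) \<and> (\<forall>j\<le>N. c' j = c j)) \<and>
    has_stoch_integral M \<alpha> f Z\<xi> h I \<and> has_stoch_integral M \<alpha> g Z\<eta> h J \<and>
    optimal_estimate M \<alpha> (obs_space M \<alpha> (\<lambda>j \<omega>. \<xi> j \<omega> + \<eta> j \<omega>) N) (A_func N a \<xi>) (\<lambda>\<omega>. I \<omega> + J \<omega>) \<and>
    (\<forall>X. optimal_estimate M \<alpha> (obs_space M \<alpha> (\<lambda>j \<omega>. \<xi> j \<omega> + \<eta> j \<omega>) N) (A_func N a \<xi>) X \<longrightarrow>
       (AE \<omega> in M. X \<omega> = I \<omega> + J \<omega>)) \<and>
    of_real (sas_norm M \<alpha> (\<lambda>\<omega>. A_func N a \<xi> \<omega> - (I \<omega> + J \<omega>)) powr \<alpha>)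
      = (LINT \<theta>|circ. wform \<alpha> f (\<lambda>\<theta>. A_fun N a \<theta> - h \<theta>) (\<lambda>\<theta>. A_fun N a \<theta> - h \<theta>) \<theta>)
        + (LINT \<theta>|circ. wform \<alpha> g h h \<theta>) \<and>
    (CARD('n) = 1 \<longrightarrow> (\<forall>k.
       sas_norm M \<alpha> (\<lambda>\<omega>. A_func N a \<xi> \<omega> - (I \<omega> + J \<omega>)) powr \<alpha>
         = (LINT \<theta>|circ. norm (A_fun N a \<theta> $ k - h \<theta> $ k) powr \<alpha> * Re (f \<theta> $ k $ k))
           + (LINT \<theta>|circ. norm (h \<theta> $ k) powr \<alpha> * Re (g \<theta> $ k $ k))))"
proof -
  interpret stable_space M \<alpha>
    using assms(1-3) by (simp add: stable_space_def stable_space_axioms_def)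
  interpret \<xi>: spectral_process M \<alpha> Z\<xi> f
    by unfold_locales (use assms(4) in \<open>auto simp: hsas_sequence_def\<close>)
  interpret \<eta>: spectral_process M \<alpha> Z\<eta> g
    by unfold_locales (use assms(5) in \<open>auto simp: hsas_sequence_def\<close>)
  obtain P where P: "AE \<theta> in circ. has_matrix_powr (f \<theta> + g \<theta>) (- 1 / (\<alpha> - 1)) (P \<theta>)"
    "integrable circ (\<lambda>\<theta>. trace (P \<theta>))"
    using assms(7) by (auto simp: minimality_def)
  have cov: "AE \<theta> in circ. covariation_matrix \<alpha> (f \<theta> + g \<theta>)"
    using \<xi>.w.cov \<eta>.w.cov by eventually_elim (rule covariation_matrix_add)
  interpret s: minimal_weight \<alpha> "\<lambda>\<theta>. f \<theta> + g \<theta>" P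
    by unfold_locales (use assms(2,3) \<xi>.integrable_f \<eta>.integrable_f cov P in auto)
  have A: "A_fun N a \<in> L_alpha \<alpha> (\<lambda>\<theta>. f \<theta> + g \<theta>)"
    unfolding A_fun_def[abs_def] by (rule s.trig_sum_in_L_alpha)
  interpret noisy_observation M \<alpha> Z\<xi> Z\<eta> f g P N a \<xi> \<eta>
    by unfold_locales (use A assms(4-6) in \<open>auto simp: hsas_sequence_def independent_sequences_def\<close>)
  \<comment> \<open>The system is not solved directly: its solvability is the first order condition
    at this minimizer.\<close>
  obtain h where h: "h \<in> L_alpha_N \<alpha> s N" "\<And>w. w \<in> L_alpha_N \<alpha> s N \<Longrightarrow> error h \<le> error w"
    using minimizer_exists by blast
  have hL: "h \<in> L_alpha \<alpha> s" using h(1) by (rule L_alpha_N_imp_L_alpha)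
  obtain c where c: "AE \<theta> in circ. residual h \<theta> = (\<Sum>j\<le>N. cis (- (real j * \<theta>)) *s c j)"
    using residual_trig_polynomial[OF hL minimizer_orthogonal[OF h]] by blast
  obtain F v I J where r: "realizes F v h I J" using L_alpha_N_realizes[OF h(1)] .
  have I: "has_stoch_integral M \<alpha> f Z\<xi> h I" and J: "has_stoch_integral M \<alpha> g Z\<eta> h J"
    using r by (auto simp: realizes_def)
  have sys: "interpolation_system \<alpha> f g N a h' c' \<longleftrightarrow>
      (AE \<theta> in circ. residual h' \<theta> = (\<Sum>j\<le>N. cis (- (real j * \<theta>)) *s c' j)) \<and>
      (\<forall>k\<le>N. has_bochner_integral circ (\<lambda>\<theta>. cis (- (real k * \<theta>)) *s h' \<theta>) 0)" for h' c'
    by (simp add: interpolation_system_def residual_def)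
  have system: "interpolation_system \<alpha> f g N a h c"
    unfolding sys using c s.L_alpha_N_fourier[OF h(1)] by blast
  have unique: "(AE \<theta> in circ. h' \<theta> = h \<theta>) \<and> (\<forall>j\<le>N. c' j = c j)"
    if "h' \<in> L_alpha \<alpha> s" "interpolation_system \<alpha> f g N a h' c'" for h' c'
    using system_unique[of h' h c' c] that hL system unfolding sys by blast
  have E: "(\<lambda>\<omega>. I \<omega> + J \<omega>) \<in> borel_measurable M"
    using \<xi>.has_stoch_integralD(2)[OF I] \<eta>.has_stoch_integralD(2)[OF J] by simp
  have norm_E: "sas_norm M \<alpha> (\<lambda>\<omega>. A_func N a \<xi> \<omega> - (I \<omega> + J \<omega>)) = error h powr (1 / \<alpha>)"
    using error_of_obs[OF r E] by simp
  have opt: "optimal_estimate M \<alpha> (obs_space M \<alpha> observation N) (A_func N a \<xi>) (\<lambda>\<omega>. I \<omega> + J \<omega>)"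
    unfolding optimal_estimate_def
  proof (intro conjI ballI)
    show "(\<lambda>\<omega>. I \<omega> + J \<omega>) \<in> obs_space M \<alpha> observation N" using r by (rule realizes_imp_obs_space)
    fix Y assume "Y \<in> obs_space M \<alpha> observation N"
    \<comment> \<open>Every competitor is almost everywhere the integral of some \<open>h'\<close>
      in the closed span, so comparing norms amounts to comparing values of
      \<open>error\<close>.\<close>
    then obtain F' v' h' I' J' where r': "realizes F' v' h' I' J'"
      and Y: "Y \<in> borel_measurable M" "AE \<omega> in M. Y \<omega> = I' \<omega> + J' \<omega>"
      using obs_space_imp_realizes by blast
    show "sas_norm M \<alpha> (\<lambda>\<omega>. A_func N a \<xi> \<omega> - (I \<omega> + J \<omega>)) \<le> sas_norm M \<alpha> (\<lambda>\<omega>. A_func N a \<xi> \<omega> - Y \<omega>)"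
      unfolding norm_E error_of_obs[OF r' Y] error_powr_le_iff
      by (rule h(2)[OF realizes_in_L_alpha_N(1)[OF r']])
  qed
  have opt_unique: "AE \<omega> in M. X \<omega> = I \<omega> + J \<omega>"
    if X: "optimal_estimate M \<alpha> (obs_space M \<alpha> observation N) (A_func N a \<xi>) X" for X
  proof -
    have "X \<in> obs_space M \<alpha> observation N" using X by (simp add: optimal_estimate_def)
    then obtain F' v' h' I' J' where r': "realizes F' v' h' I' J'"
      and X': "X \<in> borel_measurable M" "AE \<omega> in M. X \<omega> = I' \<omega> + J' \<omega>"
      using obs_space_imp_realizes by blast
    have "sas_norm M \<alpha> (\<lambda>\<omega>. A_func N a \<xi> \<omega> - X \<omega>) \<le> sas_norm M \<alpha> (\<lambda>\<omega>. A_func N a \<xi> \<omega> - (I \<omega> + J \<omega>))"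
      using X opt by (simp add: optimal_estimate_def)
    \<comment> \<open>A second optimum yields a second minimizer. It agrees with \<open>h\<close>
      almost everywhere, and integrals of functions that agree almost everywhere coincide almost
      surely.\<close>
    then have le: "error h' \<le> error h" unfolding norm_E error_of_obs[OF r' X'] error_powr_le_iff .
    have "AE \<theta> in circ. h' \<theta> = h \<theta>"
      by (rule minimizer_unique) (use h le realizes_in_L_alpha_N(1)[OF r'] in auto)
    then have "AE \<omega> in M. I' \<omega> = I \<omega>" "AE \<omega> in M. J' \<omega> = J \<omega>"
      using r' I J \<xi>.has_stoch_integral_unique \<eta>.has_stoch_integral_unique unfolding realizes_def by blast+
    with X'(2) show ?thesis by eventually_elim simp
  qed
  have formula: "sas_norm M \<alpha> (\<lambda>\<omega>. A_func N a \<xi> \<omega> - (I \<omega> + J \<omega>)) powr \<alpha>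
      = energy \<alpha> f (\<lambda>\<theta>. A_fun N a \<theta> - h \<theta>) + energy \<alpha> g h"
    using sas_norm_eq(2)[OF error_scale(1)[OF r]] error_scale(2)[OF r] by (simp add: error_def)
  have nonneg: "0 \<le> sas_norm M \<alpha> (\<lambda>\<omega>. A_func N a \<xi> \<omega> - (I \<omega> + J \<omega>))" by (simp add: norm_E)
  have meas: "h \<in> borel_measurable circ" "(\<lambda>\<theta>. A_fun N a \<theta> - h \<theta>) \<in> borel_measurable circ"
    using hL A_minus_in[OF hL] s.L_alpha_measurable by auto
  show ?thesis
  proof (intro exI conjI allI impI)
    show "h \<in> L_alpha_N \<alpha> s N" by (rule h)
    show "interpolation_system \<alpha> f g N a h c" by (rule system)
    show "has_stoch_integral M \<alpha> f Z\<xi> h I" "has_stoch_integral M \<alpha> g Z\<eta> h J" by (rule I, rule J)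
    show "optimal_estimate M \<alpha> (obs_space M \<alpha> observation N) (A_func N a \<xi>) (\<lambda>\<omega>. I \<omega> + J \<omega>)" by (rule opt)
    show "of_real (sas_norm M \<alpha> (\<lambda>\<omega>. A_func N a \<xi> \<omega> - (I \<omega> + J \<omega>)) powr \<alpha>)
      = (LINT \<theta>|circ. wform \<alpha> f (\<lambda>\<theta>. A_fun N a \<theta> - h \<theta>) (\<lambda>\<theta>. A_fun N a \<theta> - h \<theta>) \<theta>)
        + (LINT \<theta>|circ. wform \<alpha> g h h \<theta>)"
      unfolding \<xi>.w.LINT_wform[OF meas(2)] \<eta>.w.LINT_wform[OF meas(1)] formula by simp
    show "sas_norm M \<alpha> (\<lambda>\<omega>. A_func N a \<xi> \<omega> - (I \<omega> + J \<omega>)) powr \<alpha>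
         = (LINT \<theta>|circ. norm (A_fun N a \<theta> $ k - h \<theta> $ k) powr \<alpha> * Re (f \<theta> $ k $ k))
           + (LINT \<theta>|circ. norm (h \<theta> $ k) powr \<alpha> * Re (g \<theta> $ k $ k))" if "CARD('n) = 1" for k
      unfolding formula energy_def qform_singleton[OF that, of _ _ _ k] by simp
  qed (use unique opt_unique in blast)+
qed

end
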